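(* Let $\mathbb K\in\{\mathbb R,\mathbb C\}$. There exist compactly supported Borel probability measures $\mu^\Box_{\mathrm{CW}}(\theta)$ on $\mathbb R$, indexed by $\theta\in\Theta_{\mathrm{CW}}(p,d)$, $p,d\in\mathbb N$, such that the following hold. (1) Let $M>0$, $\gamma>0$, let $(p_d)_{d\in\mathbb N}$ be natural numbers with $p_d\ge d$ and $\sup_{d}(p_d/d)<\infty$, and let $\phi_d\in\Theta_{\mathrm{CW}}(p_d,d,M)$ for $d\in\mathbb N$. Then $\mathbb P$-almost surely \[\lim_{d\to\infty}\sup_{\theta\in\Theta_{\mathrm{CW}}(p_d,d,M)}\Big|H_\gamma\big[\mathrm{ESD}(W_{\mathrm{CW}}(\phi_d)),\mu^\Box_{\mathrm{CW}}(\theta)\big]-H_\gamma\big[\mu^\Box_{\mathrm{CW}}(\phi_d),\mu^\Box_{\mathrm{CW}}(\theta)\big]\Big|=0.\] (2) For $p,d\in\mathbb N$ define $\mathcal R:\mathbb H^-\times\mathbb R^p\to\mathbb C$ and $\mathcal G:\mathbb H^-\times\mathbb H^+\times\mathbb R^p\to\mathbb H^-$ by \[\mathcal R(b,v)=\frac1d\sum_{i=1}^p\frac{v_i}{1-v_ib},\qquad \mathcal G(b,z,v)=[z-\mathcal R(b,v)]^{-1},\] and write $\mathcal G_{z,v}(b)=\mathcal G(b,z,v)$. Let $z\in\mathbb H^+$ and $v\in\mathbb R^p$ with $\operatorname{Im}z>\max\{|v_k|:k=1,\dots,p\}$. Then for every initial point $b_0\in\mathbb H^-$, \[G_{\mu^\Box_{\mathrm{CW}}(d,\iota_p(v))}(z)=\lim_{n\to\infty}\mathcal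 G_{z,v}^{n}(b_0),\] where $\mathcal G^n_{z,v}$ is the $n$-fold composition and $\iota_p(v)\in M_p(\mathbb C)$ is the diagonal matrix with diagonal $v$. (3) $\mu^\Box_{\mathrm{CW}}(d,A)=\mu^\Box_{\mathrm{CW}}(d,U^*AU)$ for every $(d,A)\in\Theta_{\mathrm{CW}}(p,d)$ and every unitary $U\in M_p(\mathbb C)$. (4) For every $z\in\mathbb H^+$ and $p,d\in\mathbb N$, the function $\theta\mapsto G_{\mu^\Box_{\mathrm{CW}}(\theta)}(z)$ on $\Theta_{\mathrm{CW}}(p,d)$ is of class $C^\infty$. Moreover, for every $z\in\mathbb H^+$ and $v\in\mathbb R^p$, the linear map $\mathrm{id}-D_{G(z,v)}\mathcal G_{z,v}$ is invertible, where $G(z,v):=G_{\mu^\Box_{\mathrm{CW}}(d,\iota_p(v))}(z)$ and $D_{G(z,v)}\mathcal G_{z,v}$ is the derivative of $b\mapsto\mathcal G_{z,v}(b)$ at $G(z,v)$.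
   Context: $\mathbb H^+=\{z\in\mathbb C:\operatorname{Im}z>0\}$, $\mathbb H^-=-\mathbb H^+$. All random objects live on a fixed probability space $(\Omega,\mathfrak F,\mathbb P)$. A $p\times d$ Ginibre matrix over $\mathbb R$ has i.i.d. $\mathrm{Normal}(0,1/d)$ entries; over $\mathbb C$ its entries are $(f_{k\ell}+ig_{k\ell})/\sqrt2$ with all $f_{k\ell},g_{k\ell}$ independent $\mathrm{Normal}(0,1/d)$. $\Theta_{\mathrm{CW}}(p,d)=\{d\}\times M_p(\mathbb C)_{\mathrm{s.a.}}$ (self-adjoint matrices) and $\Theta_{\mathrm{CW}}(p,d,M)=\{(d,V)\in\Theta_{\mathrm{CW}}(p,d):\|V\|\le M\}$ (operator norm). The compound Wishart model is $W_{\mathrm{CW}}(d,A)=Z^*AZ$, where $Z$ is a $p\times d$ Ginibre matrix over $\mathbb K$. For a self-adjoint $d\times d$ matrix with eigenvalues $\lambda_1,\dots,\lambda_d$, its spectral distribution is $\frac1d\sum_k\delta_{\lambda_k}$; for a self-adjoint random matrix $W$, $\mathrm{ESD}(W)(\omega)$ is the spectral distribution of $W(\omega)$. For a Borel probability measure $\mu$ on $\mathbb R$, $G_\mu(z)=\int\frac{\mu(dt)}{z-t}$, $z\in\mathbb C\setminus\mathbb R$. For $\gamma>0$, $P_\gamma(x)=\frac{1}{\pi}\frac{\gamma}{x^2+\gamma^2}$ and $(P_\gamma*\nu)(x)=\int P_\gamma(x-t)\nu(dt)$. For a compactly supported Borel probability measure $\mu$ and a Borel probability measure $\nu$ with finite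 second moment, the Cauchy cross-entropy is $H_\gamma(\nu,\mu)=\int\ell_\gamma(x,\mu)(P_\gamma*\nu)(x)\,dx$ with $\ell_\gamma(x,\mu)=-\log\big[-\frac1\pi\operatorname{Im}G_\mu(x+i\gamma)\big]$. *)

theory Defs
  imports "HOL-Analysis.Analysis" "HOL-Probability.Probability"
    "Jordan_Normal_Form.Schur_Decomposition" "Jordan_Normal_Form.Char_Poly"
begin

datatype scalar_field = Reals | Complexes

definition Theta_CW :: "nat \<Rightarrow> nat \<Rightarrow> (nat \<times> complex mat) set" where
  "Theta_CW p d = {d} \<times> {A. A \<in> carrier_mat p p \<and> mat_adjoint A = A}"

definition vec_norm2 :: "complex vec \<Rightarrow> real" where
  "vec_norm2 x = sqrt (\<Sum>i<dim_vec x. (cmod (x $ i))\<^sup>2)"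

definition op_norm :: "complex mat \<Rightarrow> real" where
  "op_norm V = Sup {vec_norm2 (V *\<^sub>v x) | x. x \<in> carrier_vec (dim_col V) \<and> vec_norm2 x \<le> 1}"

definition Theta_CW_bdd :: "nat \<Rightarrow> nat \<Rightarrow> real \<Rightarrow> (nat \<times> complex mat) set" where
  "Theta_CW_bdd p d M = {\<theta> \<in> Theta_CW p d. op_norm (snd \<theta>) \<le> M}"

definition ginibre :: "'a measure \<Rightarrow> scalar_field \<Rightarrow> nat \<Rightarrow> nat \<Rightarrow> ('a \<Rightarrow> complex mat) \<Rightarrow> bool" where
  "ginibre M K p d Z \<longleftrightarrow>
     (\<forall>\<omega>\<in>space M. Z \<omega> \<in> carrier_mat p d) \<and>
     (case K of
        Reals \<Rightarrow> (\<exists>f :: nat \<times> nat \<Rightarrow> 'a \<Rightarrow> real.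
            prob_space.indep_vars M (\<lambda>_. borel) f ({..<p} \<times> {..<d}) \<and>
            (\<forall>kl \<in> {..<p} \<times> {..<d}.
               distributed M lborel (f kl) (\<lambda>x. ennreal (normal_density 0 (1 / sqrt (real d)) x))) \<and>
            (\<forall>\<omega>\<in>space M. \<forall>k<p. \<forall>l<d. Z \<omega> $$ (k, l) = complex_of_real (f (k, l) \<omega>)))
      | Complexes \<Rightarrow> (\<exists>f :: nat \<times> nat \<times> bool \<Rightarrow> 'a \<Rightarrow> real.
            prob_space.indep_vars M (\<lambda>_. borel) f ({..<p} \<times> {..<d} \<times> UNIV) \<and>
            (\<forall>klb \<in> {..<p} \<times> {..<d} \<times> UNIV.
               distributed M lborel (f klb) (\<lambda>x. ennreal (normal_density 0 (1 / sqrt (real d)) x))) \<and>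
            (\<forall>\<omega>\<in>space M. \<forall>k<p. \<forall>l<d.
               Z \<omega> $$ (k, l) = Complex (f (k, l, True) \<omega>) (f (k, l, False) \<omega>) / complex_of_real (sqrt 2))))"

definition W_CW :: "complex mat \<Rightarrow> complex mat \<Rightarrow> complex mat" where
  "W_CW Z A = mat_adjoint Z * A * Z"

text \<open>Spectral distribution (1/d) sum_k delta_{lambda_k} of a self-adjoint d x d matrix:
  uniform distribution on the multiset of eigenvalues (roots of the characteristic
  polynomial, counted with multiplicity; they are real for self-adjoint matrices).\<close>
definition spectral_distribution :: "complex mat \<Rightarrow> real measure" where
  "spectral_distribution W = measure_pmf (pmf_of_multiset (image_mset Re (proots (char_poly W))))"

definition cauchy_transform :: "real measure \<Rightarrow> complex \<Rightarrow> complex" where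
  "cauchy_transform \<mu> z = (\<integral>t. inverse (z - complex_of_real t) \<partial>\<mu>)"

definition poisson_kernel :: "real \<Rightarrow> real \<Rightarrow> real" where
  "poisson_kernel \<gamma> x = (1 / pi) * (\<gamma> / (x\<^sup>2 + \<gamma>\<^sup>2))"

definition poisson_conv :: "real \<Rightarrow> real measure \<Rightarrow> real \<Rightarrow> real" where
  "poisson_conv \<gamma> \<nu> x = (\<integral>t. poisson_kernel \<gamma> (x - t) \<partial>\<nu>)"

definition cauchy_loss :: "real \<Rightarrow> real \<Rightarrow> real measure \<Rightarrow> real" where
  "cauchy_loss \<gamma> x \<mu> = - ln (- (1 / pi) * Im (cauchy_transform \<mu> (Complex x \<gamma>)))"

definition cauchy_cross_entropy :: "real \<Rightarrow> real measure \<Rightarrow> real measure \<Rightarrow> real" where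
  "cauchy_cross_entropy \<gamma> \<nu> \<mu> = (\<integral>x. cauchy_loss \<gamma> x \<mu> * poisson_conv \<gamma> \<nu> x \<partial>lborel)"

definition compactly_supported_prob :: "real measure \<Rightarrow> bool" where
  "compactly_supported_prob \<mu> \<longleftrightarrow>
     prob_space \<mu> \<and> sets \<mu> = sets borel \<and> (\<exists>K. compact K \<and> emeasure \<mu> K = 1)"

text \<open>The maps R(b,v) and G(b,z,v); v in R^p is represented by its first p values.\<close>
definition Rcal :: "nat \<Rightarrow> nat \<Rightarrow> (nat \<Rightarrow> real) \<Rightarrow> complex \<Rightarrow> complex" where
  "Rcal d p v b = (1 / of_nat d) * (\<Sum>i<p. complex_of_real (v i) / (1 - complex_of_real (v i) * b))"

definition Gcal :: "nat \<Rightarrow> nat \<Rightarrow> complex \<Rightarrow> (nat \<Rightarrow> real) \<Rightarrow> complex \<Rightarrow> complex" where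
  "Gcal d p z v b = inverse (z - Rcal d p v b)"

definition diag_real :: "nat \<Rightarrow> (nat \<Rightarrow> real) \<Rightarrow> complex mat" where
  "diag_real p v = mat p p (\<lambda>(i, j). if i = j then complex_of_real (v i) else 0)"

definition unitary_mat :: "nat \<Rightarrow> complex mat \<Rightarrow> bool" where
  "unitary_mat p U \<longleftrightarrow> U \<in> carrier_mat p p \<and> mat_adjoint U * U = 1\<^sub>m p"

text \<open>Linear real coordinates (x_0,...,x_{p*p-1}) on the self-adjoint p x p matrices.\<close>
definition herm_of :: "nat \<Rightarrow> (nat \<Rightarrow> real) \<Rightarrow> complex mat" where
  "herm_of p x = mat p p (\<lambda>(i, j).
     if i = j then complex_of_real (x (i * p + i))
     else if i < j then Complex (x (i * p + j)) (x (j * p + i))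
     else Complex (x (j * p + i)) (- x (i * p + j)))"

definition partial_coord :: "nat \<Rightarrow> ((nat \<Rightarrow> real) \<Rightarrow> complex) \<Rightarrow> (nat \<Rightarrow> real) \<Rightarrow> complex" where
  "partial_coord k g x = vector_derivative (\<lambda>t. g (x(k := t))) (at (x k))"

fun iter_partial :: "nat list \<Rightarrow> ((nat \<Rightarrow> real) \<Rightarrow> complex) \<Rightarrow> (nat \<Rightarrow> real) \<Rightarrow> complex" where
  "iter_partial [] g = g"
| "iter_partial (k # ks) g = partial_coord k (iter_partial ks g)"

definition smooth_coords :: "nat \<Rightarrow> ((nat \<Rightarrow> real) \<Rightarrow> complex) \<Rightarrow> bool" where
  "smooth_coords N g \<longleftrightarrow>
     (\<forall>ks. set ks \<subseteq> {..<N} \<longrightarrow>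
        continuous_on UNIV (iter_partial ks g) \<and>
        (\<forall>k<N. \<forall>x. (\<lambda>t. iter_partial ks g (x(k := t))) differentiable (at (x k))))"

end

theory Submission
  imports Defs "HOL-Complex_Analysis.Complex_Analysis" "HOL-Real_Asymp.Real_Asymp"
    "Jordan_Normal_Form.Spectral_Radius"
begin

text \<open>
  Write \<open>R(b) = (1/d) \<Sum> v\<^sub>i / (1 - v\<^sub>i b)\<close> and \<open>S(b) = (1/d) \<Sum> v\<^sub>i\<^sup>2 / |1 - v\<^sub>i b|\<^sup>2 = Im R(b) / Im b\<close>. If \<open>b (z - R(b)) = 1\<close> with
  \<open>Im z > 0 > Im b\<close>, then comparing imaginary parts gives \<open>|b|\<^sup>2 S(b) < 1\<close>. As \<open>|R'| \<le> S\<close>, the derivative of the fixed point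
  map has modulus less than 1 at a fixed point, and by the Cauchy--Schwarz inequality for
  \<open>R(b) - R(c) = (b - c) K(b, c)\<close>, fixed points are unique and depend continuously on the data. The iterates converge
  since the map contracts the hyperbolic metric uniformly once \<open>Im z > max |v\<^sub>i|\<close>.

  For a Gaussian matrix \<open>Y\<close> and the resolvent trace \<open>g = (1/d) tr (z - Y\<^sup>* A Y)\<^sup>-\<^sup>1\<close>, Gaussian integration by parts bounds the
  second moment of the defect \<open>g (z - R(g)) - 1\<close> by a multiple of \<open>1 / d\<^sup>2\<close> when \<open>Im z\<close> is large. Hence the defect tends to 0
  almost surely, first on a sequence of points and then, by Vitali's theorem, on the whole half plane. Applied to
  matrices of format \<open>np \<times> nd\<close> with each \<open>v\<^sub>i\<close> repeated \<open>n\<close> times, for which \<open>R\<close> does not depend on \<open>n\<close>, this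
  also produces the limit measure by weak compactness. Its support is bounded because off a compact set the solution stays
  on the branch that behaves like \<open>1 / z\<close>.

  The loss functions are bounded by a multiple of \<open>(1 + |x|)\<^sup>1\<^sup>/\<^sup>4\<close>, uniformly over the parameter set, so the supremum
  in the first part is at most the integral of this weight against the difference of two Poisson convolutions, and the
  first moments of the spectral distributions are bounded almost surely. Smoothness is an
  implicit function argument: after multiplication with \<open>det (1 - b A)\<close> the fixed point equation becomes polynomial in \<open>b\<close> and
  the entries of \<open>A\<close>.
\<close>

section \<open>The scalar fixed point equation\<close>

text \<open>For the resolvent trace \<open>g\<close> no concentration inequality is used; everything
  rests on one exact identity. With \<open>h\<close> the defect at \<open>g\<close>,
  \<open>R\<close> the resolvent and \<open>B = A (1 - g A)^-1\<close>, integration by parts is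
  applied to \<open>tr (E R Y\<^sup>* B) * cnj h\<close> in every coordinate. Because
  \<open>B - g B A = A\<close>, the leading terms add up to \<open>d |h|\<^sup>2\<close>, and the
  rest is \<open>1 / d\<close> times an error bounded by multiples of \<open>|Y|\<^sup>2 |h|\<close>
  and \<open>|Y|\<^sup>2 / d\<close>, where \<open>|Y|\<^sup>2\<close> is of order \<open>d\<close>.
  The first kind is absorbed into the left side. The resulting rate is summable, so the matrices of
  different sizes may be coupled in any way. Two obstacles shape the rest. A complex self-adjoint
  \<open>A\<close> need not be diagonalizable by a real orthogonal matrix, so the real Ginibre law
  cannot be rotated to make \<open>A\<close> diagonal; instead the unitary is moved into the basis
  that the real Gaussian coordinates multiply. And eigenvalues are not smooth functions of the
  matrix, so every regularity statement in the parameter passes through symmetric functions of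
  them.\<close>

definition Scal :: "nat \<Rightarrow> nat \<Rightarrow> (nat \<Rightarrow> real) \<Rightarrow> complex \<Rightarrow> real" where
  "Scal d p v b = (1 / real d) * (\<Sum>i<p. (v i)\<^sup>2 / (cmod (1 - complex_of_real (v i) * b))\<^sup>2)"

definition Kcal :: "nat \<Rightarrow> nat \<Rightarrow> (nat \<Rightarrow> real) \<Rightarrow> complex \<Rightarrow> complex \<Rightarrow> complex" where
  "Kcal d p v b c = (1 / of_nat d) * (\<Sum>i<p. (complex_of_real (v i))\<^sup>2
      / ((1 - complex_of_real (v i) * b) * (1 - complex_of_real (v i) * c)))"

lemma one_minus_nz: assumes "Im b < 0" shows "1 - complex_of_real v * b \<noteq> 0"
proof
  assume *: "1 - complex_of_real v * b = 0"
  hence "Im (1 - complex_of_real v * b) = 0" by simp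
  hence "v * Im b = 0" by simp
  hence "v = 0" using assms by auto
  thus False using * by simp
qed

lemma Scal_nonneg: "0 \<le> Scal d p v b"
  unfolding Scal_def by (intro mult_nonneg_nonneg sum_nonneg) auto

lemma Im_Rcal: assumes "\<And>i. i < p \<Longrightarrow> 1 - complex_of_real (v i) * b \<noteq> 0"
  shows "Im (Rcal d p v b) = Im b * Scal d p v b"
proof -
  have 1: "Im (complex_of_real (v i) / (1 - complex_of_real (v i) * b)) =
      Im b * ((v i)\<^sup>2 / (cmod (1 - complex_of_real (v i) * b))\<^sup>2)" for i
    by (simp add: Im_divide cmod_power2) (simp add: power2_eq_square)
  have "Rcal d p v b = complex_of_real (1 / real d) * (\<Sum>i<p. complex_of_real (v i) / (1 - complex_of_real (v i) * b))"
    by (simp add: Rcal_def)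
  hence "Im (Rcal d p v b) = (1/real d) * (\<Sum>i<p. Im (complex_of_real (v i) / (1 - complex_of_real (v i) * b)))"
    by (simp only: Im_complex_of_real Re_complex_of_real times_complex.simps Im_sum mult_zero_left add_0_right)
  thus ?thesis unfolding 1 Scal_def by (simp add: sum_distrib_left mult_ac)
qed

lemma Rcal_diff:
  assumes b: "\<And>i. i < p \<Longrightarrow> 1 - complex_of_real (v i) * b \<noteq> 0" and c: "\<And>i. i < p \<Longrightarrow> 1 - complex_of_real (v i) * c \<noteq> 0"
  shows "Rcal d p v b - Rcal d p v c = (b - c) * Kcal d p v b c"
proof -
  have "complex_of_real (v i) / (1 - complex_of_real (v i) * b) - complex_of_real (v i) / (1 - complex_of_real (v i) * c)
     = (b - c) * ((complex_of_real (v i))\<^sup>2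
      / ((1 - complex_of_real (v i) * b) * (1 - complex_of_real (v i) * c)))" if "i < p" for i
    using b[OF that] c[OF that] by (simp add: field_simps power2_eq_square)
  thus ?thesis unfolding Rcal_def Kcal_def right_diff_distrib[symmetric] sum_subtractf[symmetric]
    by (simp add: sum_distrib_left mult_ac)
qed

text \<open>Cauchy-Schwarz over the index \<open>i\<close>. A quantity that couples two points is
  thereby split into one factor for each, and each factor can be controlled by what is known about
  its own point.\<close>

lemma Kcal_le: "(cmod (Kcal d p v b c))\<^sup>2 \<le> Scal d p v b * Scal d p v c"
proof -
  define f where "f = (\<lambda>b i. \<bar>v i\<bar> / cmod (1 - complex_of_real (v i) * b))"
  have "cmod (\<Sum>i<p. (complex_of_real (v i))\<^sup>2
      / ((1 - complex_of_real (v i) * b) * (1 - complex_of_real (v i) * c))) \<le> (\<Sum>i<p. f b i * f c i)"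
    by (rule sum_norm_le) (simp add: f_def norm_divide norm_mult norm_power power2_eq_square)
  hence "(cmod (\<Sum>i<p. (complex_of_real (v i))\<^sup>2
      / ((1 - complex_of_real (v i) * b) * (1 - complex_of_real (v i) * c))))\<^sup>2 \<le> (\<Sum>i<p. f b i * f c i)\<^sup>2"
    by (rule power_mono) auto
  also have "\<dots> \<le> (\<Sum>i<p. (f b i)\<^sup>2) * (\<Sum>i<p. (f c i)\<^sup>2)"
    by (rule Cauchy_Schwarz_ineq_sum)
  finally have "(1/(real d)\<^sup>2) * (cmod (\<Sum>i<p. (complex_of_real (v i))\<^sup>2
      / ((1 - complex_of_real (v i) * b) * (1 - complex_of_real (v i) * c))))\<^sup>2 \<le>
      (1/(real d)\<^sup>2) * ((\<Sum>i<p. (f b i)\<^sup>2) * (\<Sum>i<p. (f c i)\<^sup>2))"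
    by (intro mult_left_mono) auto
  moreover have "Scal d p v b = (1/real d) * (\<Sum>i<p. (f b i)\<^sup>2)" for b
    unfolding Scal_def f_def by (simp add: power_divide)
  ultimately show ?thesis unfolding Kcal_def
    by (simp add: norm_mult power_mult_distrib norm_divide power_divide power2_eq_square mult_ac)
qed

lemma Rcal_lower: assumes "Im b < 0" "0 < Im z" shows "Im z \<le> Im (z - Rcal d p v b)"
  using Im_Rcal[of p v b d] one_minus_nz[OF assms(1)] Scal_nonneg[of d p v b] assms
  by (simp add: mult_nonpos_nonneg)

lemma Gcal_nz: assumes "Im b < 0" "0 < Im z" shows "z - Rcal d p v b \<noteq> 0"
proof
  assume "z - Rcal d p v b = 0"
  hence "Im (z - Rcal d p v b) = 0" by (simp only: zero_complex.simps)
  with Rcal_lower[OF assms, of d p v] assms show False by linarith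
qed

text \<open>From \<open>- Im (1/w) = |1/w|^2 Im w\<close>. The two summands stay apart because the
  share of the second in the total is the contraction factor of \<open>Gcal_contract\<close>, and
  because at a fixed point the positive first summand makes \<open>Scal_fixpoint_less\<close>
  strict.\<close>

lemma Im_Gcal: assumes "Im b < 0" "0 < Im z"
  shows "- Im (Gcal d p z v b) = (cmod (Gcal d p z v b))\<^sup>2 * (Im z - Im b * Scal d p v b)"
proof -
  define w where "w = z - Rcal d p v b"
  have "w \<noteq> 0" unfolding w_def by (rule Gcal_nz[OF assms])
  have "Im w = Im z - Im b * Scal d p v b"
    using Im_Rcal[of p v b d] one_minus_nz[OF assms(1)] by (simp add: w_def)
  moreover have "- Im (inverse w) = (cmod (inverse w))\<^sup>2 * Im w"
    using \<open>w \<noteq> 0\<close> by (simp add: norm_inverse power_inverse cmod_power2 divide_inverse)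
  ultimately show ?thesis by (simp add: Gcal_def w_def)
qed

lemma Im_Gcal_neg: assumes "Im b < 0" "0 < Im z" shows "Im (Gcal d p z v b) < 0"
proof -
  have "0 < Im z - Im b * Scal d p v b"
    using assms Scal_nonneg[of d p v b] by (smt (verit) mult_nonpos_nonneg)
  moreover have "0 < (cmod (Gcal d p z v b))\<^sup>2" using Gcal_nz[OF assms] by (simp add: Gcal_def)
  ultimately have "0 < - Im (Gcal d p z v b)" unfolding Im_Gcal[OF assms] by simp
  thus ?thesis by simp
qed

lemma Gcal_norm_le: assumes "Im b < 0" "0 < Im z" shows "cmod (Gcal d p z v b) \<le> 1 / Im z"
proof -
  have "Im z \<le> cmod (z - Rcal d p v b)"
    using Rcal_lower[OF assms, of d p v] abs_Im_le_cmod[of "z - Rcal d p v b"] by linarith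
  thus ?thesis using assms unfolding Gcal_def norm_inverse by (simp add: divide_inverse le_imp_inverse_le)
qed

lemma Scal_fixpoint_less:
  assumes "Im g < 0" "0 < Im z" "Gcal d p z v g = g"
  shows "(cmod g)\<^sup>2 * Scal d p v g < 1"
proof -
  have "- Im g = (cmod g)\<^sup>2 * Im z + (- Im g) * ((cmod g)\<^sup>2 * Scal d p v g)"
    using Im_Gcal[OF assms(1,2), of d p v] unfolding assms(3) by (simp add: algebra_simps)
  moreover have "0 < (cmod g)\<^sup>2 * Im z" using assms by (intro mult_pos_pos zero_less_power) auto
  ultimately have "(- Im g) * ((cmod g)\<^sup>2 * Scal d p v g) < (- Im g) * 1" by linarith
  thus ?thesis using assms(1) by (subst (asm) mult_less_cancel_left_pos) auto
qed

lemma Gcal_diff: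
  assumes "Im b < 0" "Im c < 0" "0 < Im z"
  shows "Gcal d p z v b - Gcal d p z v c = Gcal d p z v b * Gcal d p z v c * ((b - c) * Kcal d p v b c)"
proof -
  have "Gcal d p z v b - Gcal d p z v c = Gcal d p z v b * Gcal d p z v c * (Rcal d p v b - Rcal d p v c)"
    using Gcal_nz[OF assms(1,3), of d p v] Gcal_nz[OF assms(2,3), of d p v]
    unfolding Gcal_def by (simp add: field_simps)
  thus ?thesis using Rcal_diff[of p v b c d] one_minus_nz assms by simp
qed

lemma Rcal_has_field_derivative:
  assumes "\<And>i. i < p \<Longrightarrow> 1 - complex_of_real (v i) * b \<noteq> 0"
  shows "(Rcal d p v has_field_derivative Kcal d p v b b) (at b)"
proof -
  have "((\<lambda>b. (1 / of_nat d) * (\<Sum>i<p. complex_of_real (v i) / (1 - complex_of_real (v i) * b))) has_field_derivative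
     (1 / of_nat d) * (\<Sum>i<p. (complex_of_real (v i))\<^sup>2
      / ((1 - complex_of_real (v i) * b) * (1 - complex_of_real (v i) * b)))) (at b)"
    by (rule derivative_eq_intros DERIV_sum | use assms in \<open>force simp: power2_eq_square\<close>)+
  thus ?thesis unfolding Rcal_def Kcal_def .
qed

lemma Gcal_deriv_fixpoint:
  assumes "Im g < 0" "0 < Im z" "Gcal d p z v g = g"
  shows "(Gcal d p z v has_field_derivative (g\<^sup>2 * Kcal d p v g g)) (at g)"
    and "cmod (g\<^sup>2 * Kcal d p v g g) < 1"
proof -
  have i: "inverse (z - Rcal d p v g) = g" using assms(3) by (simp add: Gcal_def)
  have "((\<lambda>b. inverse (z - Rcal d p v b)) has_field_derivative (g\<^sup>2 * Kcal d p v g g)) (at g)"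
    using Gcal_nz[OF assms(1,2), of d p v] i
    by (auto intro!: derivative_eq_intros Rcal_has_field_derivative one_minus_nz assms simp: power2_eq_square)
  thus "(Gcal d p z v has_field_derivative (g\<^sup>2 * Kcal d p v g g)) (at g)"
    unfolding Gcal_def .
  have "cmod (Kcal d p v g g) \<le> Scal d p v g"
    using Kcal_le[of d p v g g] by (metis Scal_nonneg power2_eq_square power2_le_imp_le)
  hence "cmod (g\<^sup>2 * Kcal d p v g g) \<le> (cmod g)\<^sup>2 * Scal d p v g"
    by (simp add: norm_mult norm_power mult_left_mono)
  thus "cmod (g\<^sup>2 * Kcal d p v g g) < 1" using Scal_fixpoint_less[OF assms] by linarith
qed

lemma bij_id_minus_Gcal_deriv:
  assumes "Im g < 0" "0 < Im z" "Gcal d p z v g = g"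
  shows "\<exists>D. (Gcal d p z v has_derivative D) (at g) \<and> bij (\<lambda>h. h - D h)"
proof -
  define k where "k = g\<^sup>2 * Kcal d p v g g"
  have k: "k \<noteq> 1" using Gcal_deriv_fixpoint(2)[OF assms] unfolding k_def[symmetric] by auto
  have "h - k * h = (1 - k) * h" for h :: complex by (simp add: algebra_simps)
  hence "bij (\<lambda>h. h - k * h)"
    using k by (intro o_bij[where g="\<lambda>h. h / (1 - k)"]) (auto simp: fun_eq_iff)
  thus ?thesis using Gcal_deriv_fixpoint(1)[OF assms] unfolding k_def has_field_derivative_def by blast
qed

text \<open>The quotient \<open>|b - c|\<^sup>2 / (Im b Im c)\<close> is a function of the hyperbolic distance.\<close>

lemma Gcal_contract:
  assumes b: "Im b < 0" and c: "Im c < 0" and z: "0 < Im z"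
    and rb: "(- Im b) * Scal d p v b \<le> \<rho> * (Im z + (- Im b) * Scal d p v b)"
    and rc: "(- Im c) * Scal d p v c \<le> \<rho> * (Im z + (- Im c) * Scal d p v c)"
    and \<rho>: "0 \<le> \<rho>"
    and D: "(cmod (b - c))\<^sup>2 \<le> D * (Im b * Im c)"
  shows "(cmod (Gcal d p z v b - Gcal d p z v c))\<^sup>2 \<le> (\<rho>\<^sup>2 * D) * (Im (Gcal d p z v b) * Im (Gcal d p z v c))"
proof -
  define B C where "B = (cmod (Gcal d p z v b))\<^sup>2" and "C = (cmod (Gcal d p z v c))\<^sup>2"
  define sb sc where "sb = Scal d p v b" and "sc = Scal d p v c"
  have nn: "0 \<le> B" "0 \<le> C" "0 \<le> sb" "0 \<le> sc" by (auto simp: B_def C_def sb_def sc_def Scal_nonneg)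
  have "0 \<le> D * (Im b * Im c)" using D by (smt (verit) zero_le_power2)
  hence D0: "0 \<le> D" using b c by (simp add: zero_le_mult_iff mult_neg_neg) (smt (verit) mult_neg_neg)
  have "(cmod (Gcal d p z v b - Gcal d p z v c))\<^sup>2 = B * C * ((cmod (b - c))\<^sup>2 * (cmod (Kcal d p v b c))\<^sup>2)"
    unfolding Gcal_diff[OF b c z] by (simp add: norm_mult power_mult_distrib B_def C_def)
  also have "\<dots> \<le> B * C * ((D * (Im b * Im c)) * (sb * sc))"
    unfolding sb_def sc_def using b c D0
    by (intro mult_left_mono[of _ _ "B * C"] mult_mono[OF D Kcal_le]) (auto simp: B_def C_def mult_nonpos_nonpos)
  \<comment> \<open>Regrouped so that each bracket carries a quantity bounded by \<open>rb\<close>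
    or \<open>rc\<close>. After the replacement, \<open>Im_Gcal\<close> turns the brackets into the
    imaginary parts of the images.\<close>
  also have "\<dots> = D * (B * ((- Im b) * sb)) * (C * ((- Im c) * sc))" by (simp add: mult_ac)
  also have "\<dots> \<le> D * (B * (\<rho> * (Im z + (- Im b) * sb))) * (C * (\<rho> * (Im z + (- Im c) * sc)))"
  proof (intro mult_mono[of "D * _" "D * _"] mult_left_mono[of _ _ D] mult_left_mono[of _ _ B] mult_left_mono[of _ _ C])
    show "- Im b * sb \<le> \<rho> * (Im z + - Im b * sb)" "- Im c * sc \<le> \<rho> * (Im z + - Im c * sc)"
      using rb rc unfolding sb_def sc_def .
    have "0 \<le> - Im b * sb" "0 \<le> - Im c * sc" using b c nn by (intro mult_nonneg_nonneg; simp)+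
    note * = this
    show "0 \<le> C * (- Im c * sc)" using *(2) by (rule mult_nonneg_nonneg[OF nn(2)])
    have "0 \<le> Im z + - Im b * sb" using *(1) z by linarith
    thus "0 \<le> D * (B * (\<rho> * (Im z + - Im b * sb)))"
      using nn D0 \<rho> by (intro mult_nonneg_nonneg)
  qed (rule D0 nn)+
  also have "\<dots> = (\<rho>\<^sup>2 * D) * ((B * (Im z + (- Im b) * sb)) * (C * (Im z + (- Im c) * sc)))"
    by (simp add: power2_eq_square mult_ac)
  also have "B * (Im z + (- Im b) * sb) = - Im (Gcal d p z v b)"
    unfolding Im_Gcal[OF b z] B_def sb_def by simp
  also have "C * (Im z + (- Im c) * sc) = - Im (Gcal d p z v c)"
    unfolding Im_Gcal[OF c z] C_def sc_def by simp
  finally show ?thesis by simp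
qed

lemma Scal_le:
  assumes "\<And>k. k < p \<Longrightarrow> \<bar>v k\<bar> \<le> V" and "V * cmod b \<le> q" "q < 1" "0 \<le> V"
  shows "Scal d p v b \<le> real p / real d * (V\<^sup>2 / (1 - q)\<^sup>2)"
proof -
  have "(v i)\<^sup>2 / (cmod (1 - complex_of_real (v i) * b))\<^sup>2 \<le> V\<^sup>2 / (1 - q)\<^sup>2" if i: "i < p" for i
  proof -
    have "\<bar>v i\<bar> * cmod b \<le> V * cmod b" using assms(1)[OF i] by (intro mult_right_mono) auto
    hence "1 - q \<le> cmod (1 - complex_of_real (v i) * b)"
      using norm_triangle_ineq2[of 1 "complex_of_real (v i) * b"] assms(2) by (simp add: norm_mult)
    hence "(1 - q)\<^sup>2 \<le> (cmod (1 - complex_of_real (v i) * b))\<^sup>2" using assms(3) by (intro power_mono) auto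
    moreover have "(v i)\<^sup>2 \<le> V\<^sup>2" using assms(1)[OF i] by (metis abs_ge_zero power2_abs power_mono)
    ultimately show ?thesis using assms(3) by (intro frac_le) auto
  qed
  hence "(\<Sum>i<p. (v i)\<^sup>2 / (cmod (1 - complex_of_real (v i) * b))\<^sup>2) \<le> real p * (V\<^sup>2 / (1 - q)\<^sup>2)"
    using sum_bounded_above[of "{..<p}" "\<lambda>i. (v i)\<^sup>2 / (cmod (1 - complex_of_real (v i) * b))\<^sup>2" "V\<^sup>2 / (1 - q)\<^sup>2"] by simp
  hence "(1 / real d) * (\<Sum>i<p. (v i)\<^sup>2 / (cmod (1 - complex_of_real (v i) * b))\<^sup>2) \<le> (1 / real d) * (real p * (V\<^sup>2 / (1 - q)\<^sup>2))"
    by (intro mult_left_mono) auto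
  thus ?thesis unfolding Scal_def by simp
qed

text \<open>This is where \<open>Im z > |v k|\<close> enters. Images of the map satisfy
  \<open>|b| \<le> 1 / Im z\<close>, so \<open>|v k b|\<close> stays below some \<open>q < 1\<close>
  and \<open>Scal\<close> below a constant. Since \<open>x / (Im z + x)\<close> increases with
  \<open>x\<close>, the bound \<open>t\<close> for \<open>- Im b * Scal\<close> gives the factor
  \<open>t / (Im z + t)\<close>.\<close>

lemma Gcal_rho_exists:
  assumes z: "0 < Im z" and v: "\<And>k. k < p \<Longrightarrow> \<bar>v k\<bar> < Im z"
  shows "\<exists>\<rho>. 0 \<le> \<rho> \<and> \<rho> < 1 \<and> (\<forall>b. Im b < 0 \<and> cmod b \<le> 1 / Im z \<longrightarrow>
       (- Im b) * Scal d p v b \<le> \<rho> * (Im z + (- Im b) * Scal d p v b))"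
proof -
  \<comment> \<open>0 is inserted so that the maximum exists for \<open>p = 0\<close> as well and is
    nonnegative.\<close>
  define V where "V = Max (insert 0 ((\<lambda>k. \<bar>v k\<bar>) ` {..<p}))"
  have V: "\<bar>v k\<bar> \<le> V" if "k < p" for k unfolding V_def using that by (intro Max_ge) auto
  have V0: "0 \<le> V" unfolding V_def by (intro Max_ge) auto
  have "V \<in> insert 0 ((\<lambda>k. \<bar>v k\<bar>) ` {..<p})" unfolding V_def by (intro Max_in) auto
  hence Vz: "V < Im z" using v z by auto
  define q where "q = V / Im z"
  have q: "0 \<le> q" "q < 1" using V0 Vz z by (auto simp: q_def)
  define T where "T = real p / real d * (V\<^sup>2 / (1 - q)\<^sup>2)"
  have T0: "0 \<le> T" unfolding T_def by auto
  define t where "t = T / Im z"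
  have t0: "0 \<le> t" using T0 z by (simp add: t_def)
  define \<rho> where "\<rho> = t / (Im z + t)"
  have "(- Im b) * Scal d p v b \<le> \<rho> * (Im z + (- Im b) * Scal d p v b)" if b: "Im b < 0" "cmod b \<le> 1 / Im z" for b
  proof -
    have "V * cmod b \<le> q" unfolding q_def using mult_left_mono[OF b(2) V0] by simp
    hence "Scal d p v b \<le> T" unfolding T_def using V q V0 by (intro Scal_le) auto
    moreover have "- Im b \<le> 1 / Im z" using b(2) abs_Im_le_cmod[of b] by linarith
    ultimately have "(- Im b) * Scal d p v b \<le> (1 / Im z) * T"
      using b Scal_nonneg z by (intro mult_mono) auto
    hence x: "(- Im b) * Scal d p v b \<le> t" by (simp add: t_def)
    define x where "x = (- Im b) * Scal d p v b"
    have "x * Im z \<le> t * Im z" using x z unfolding x_def by (intro mult_right_mono) auto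
    hence "x * (Im z + t) \<le> t * (Im z + x)" by (simp add: algebra_simps)
    hence "x \<le> t * (Im z + x) / (Im z + t)" using t0 z by (simp only: pos_le_divide_eq[OF add_pos_nonneg])
    thus ?thesis unfolding \<rho>_def x_def by simp
  qed
  moreover have "0 \<le> \<rho>" "\<rho> < 1" using t0 z by (auto simp: \<rho>_def)
  ultimately show ?thesis by blast
qed

text \<open>The fixed point is given in advance; later it is the Cauchy transform of the limit
  measure. What remains is the geometric decay of the hyperbolic quotient between the iterates and
  \<open>g\<close>.\<close>

lemma Gcal_iterates_tendsto:
  assumes z: "0 < Im z" and v: "\<And>k. k < p \<Longrightarrow> \<bar>v k\<bar> < Im z" and b0: "Im b0 < 0"
    and g: "Im g < 0" "Gcal d p z v g = g"
  shows "(\<lambda>n. (Gcal d p z v ^^ n) b0) \<longlonglongrightarrow> g"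
proof -
  obtain \<rho> where \<rho>: "0 \<le> \<rho>" "\<rho> < 1" and
    ro: "\<And>b. Im b < 0 \<Longrightarrow> cmod b \<le> 1 / Im z \<Longrightarrow> (- Im b) * Scal d p v b \<le> \<rho> * (Im z + (- Im b) * Scal d p v b)"
    using Gcal_rho_exists[where d=d and p=p and v=v and z=z] z v by auto
  \<comment> \<open>The sequence starts with the first image: the initial point itself may violate
    \<open>|b| \<le> 1 / Im z\<close>, on which the contraction factor depends.\<close>
  define x where "x n = (Gcal d p z v ^^ (Suc n)) b0" for n
  have xS: "x (Suc n) = Gcal d p z v (x n)" for n by (simp add: x_def)
  have x: "Im (x n) < 0 \<and> cmod (x n) \<le> 1 / Im z" for n
  proof (induction n)
    case 0
    then show ?case using Im_Gcal_neg[OF b0 z] Gcal_norm_le[OF b0 z] by (simp add: x_def)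
  next
    case (Suc n)
    then show ?case unfolding xS using Im_Gcal_neg[OF _ z] Gcal_norm_le[OF _ z] by blast
  qed
  have gn: "cmod g \<le> 1 / Im z" using Gcal_norm_le[OF g(1) z, of d p v] g(2) by simp
  define D where "D = (cmod (x 0 - g))\<^sup>2 / (Im (x 0) * Im g)"
  have main: "(cmod (x n - g))\<^sup>2 \<le> ((\<rho>\<^sup>2)^n * D) * (Im (x n) * Im g)" for n
  proof (induction n)
    case 0
    then show ?case using x[of 0] g(1) by (simp add: D_def)
  next
    case (Suc n)
    have "(cmod (Gcal d p z v (x n) - Gcal d p z v g))\<^sup>2 \<le> (\<rho>\<^sup>2 * ((\<rho>\<^sup>2)^n * D)) * (Im (Gcal d p z v (x n)) * Im (Gcal d p z v g))"
      using x[of n] by (intro Gcal_contract[OF _ g(1) z ro ro[OF g(1) gn] \<rho>(1) Suc]) auto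
    thus ?case unfolding xS g(2) by (simp add: mult_ac)
  qed
  have D0: "0 \<le> D" unfolding D_def using x[of 0] g(1) by (intro divide_nonneg_nonneg) (auto simp: mult_nonpos_nonpos)
  \<comment> \<open>The imaginary parts are at most \<open>1 / Im z\<close> in modulus, so decay of
    the hyperbolic quotient forces decay of the Euclidean distance.\<close>
  have b2: "(cmod (x n - g))\<^sup>2 \<le> (\<rho>\<^sup>2)^n * (D * (1 / Im z * (1 / Im z)))" for n
  proof -
    have "(- Im (x n)) * (- Im g) \<le> 1 / Im z * (1 / Im z)"
      using x[of n] g(1) gn abs_Im_le_cmod[of g] abs_Im_le_cmod[of "x n"] z
      by (intro mult_mono) (auto)
    hence "((\<rho>\<^sup>2)^n * D) * (Im (x n) * Im g) \<le> ((\<rho>\<^sup>2)^n * D) * (1 / Im z * (1 / Im z))"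
      using D0 by (intro mult_left_mono) auto
    thus ?thesis using main[of n] by (simp add: mult_ac)
  qed
  have "\<rho>\<^sup>2 < 1" using \<rho> by (simp add: abs_square_less_1)
  hence "(\<lambda>n. (\<rho>\<^sup>2)^n * (D * (1 / Im z * (1 / Im z)))) \<longlonglongrightarrow> 0 * (D * (1 / Im z * (1 / Im z)))"
    by (intro tendsto_mult LIMSEQ_power_zero) auto
  hence "(\<lambda>n. (cmod (x n - g))\<^sup>2) \<longlonglongrightarrow> 0"
    using b2 by (intro Lim_null_comparison[of "\<lambda>n. (cmod (x n - g))\<^sup>2" "\<lambda>n. (\<rho>\<^sup>2)^n * (D * (1 / Im z * (1 / Im z)))"]) (auto simp: eventually_sequentially)
  hence "(\<lambda>n. sqrt ((cmod (x n - g))\<^sup>2)) \<longlonglongrightarrow> sqrt 0" by (rule tendsto_real_sqrt)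
  hence "(\<lambda>n. cmod (x n - g)) \<longlonglongrightarrow> 0" by simp
  hence "x \<longlonglongrightarrow> g" by (simp add: LIM_zero_iff tendsto_norm_zero_iff)
  thus ?thesis unfolding x_def by (simp only: filterlim_sequentially_Suc[of "\<lambda>n. (Gcal d p z v ^^ n) b0"])
qed

section \<open>Cauchy transforms and cross entropies\<close>

lemma cauchy_kernel_norm_le: "0 < Im z \<Longrightarrow> cmod (inverse (z - complex_of_real t)) \<le> 1 / Im z"
  using abs_Im_le_cmod[of "z - complex_of_real t"]
  by (simp add: norm_inverse divide_inverse le_imp_inverse_le)

lemma Im_cauchy_kernel: "0 < Im z \<Longrightarrow> - Im (inverse (z - complex_of_real t)) = Im z / ((Re z - t)\<^sup>2 + (Im z)\<^sup>2)"
  by simp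

context real_distribution begin

lemma cauchy_integrable [simp]: "0 < Im z \<Longrightarrow> integrable M (\<lambda>t. inverse (z - complex_of_real t))"
  by (rule integrable_const_bound[where B="1 / Im z"]) (auto intro: cauchy_kernel_norm_le)

lemma cauchy_norm_le: "0 < Im z \<Longrightarrow> cmod (cauchy_transform M z) \<le> 1 / Im z"
proof -
  assume z: "0 < Im z"
  have "cmod (cauchy_transform M z) \<le> (\<integral>t. cmod (inverse (z - complex_of_real t)) \<partial>M)"
    unfolding cauchy_transform_def by (rule integral_norm_bound)
  also have "\<dots> \<le> (\<integral>t. 1 / Im z \<partial>M)"
    using z by (intro integral_mono integrable_norm cauchy_integrable cauchy_kernel_norm_le) auto
  finally show ?thesis by (simp add: prob_space[unfolded space_eq_univ])
qed

lemma Im_cauchy: "0 < Im z \<Longrightarrow> - Im (cauchy_transform M z) = (\<integral>t. Im z / ((Re z - t)\<^sup>2 + (Im z)\<^sup>2) \<partial>M)"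
proof -
  assume z: "0 < Im z"
  have "Im (cauchy_transform M z) = (\<integral>t. Im (inverse (z - complex_of_real t)) \<partial>M)"
    unfolding cauchy_transform_def using z by (intro integral_Im[symmetric] cauchy_integrable)
  hence "- Im (cauchy_transform M z) = (\<integral>t. - Im (inverse (z - complex_of_real t)) \<partial>M)"
    by (simp only: Bochner_Integration.integral_minus)
  thus ?thesis unfolding Im_cauchy_kernel[OF z] .
qed

lemma poisson_kernel_integrable: "0 < y \<Longrightarrow> integrable M (\<lambda>t. y / ((x - t)\<^sup>2 + y\<^sup>2))"
proof (rule integrable_const_bound[where B="1 / y"])
  assume y: "0 < y"
  have "y / ((x - t)\<^sup>2 + y\<^sup>2) \<le> y / y\<^sup>2" for t using y by (intro divide_left_mono) (auto simp: add_nonneg_pos)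
  thus "AE t in M. norm (y / ((x - t)\<^sup>2 + y\<^sup>2)) \<le> 1 / y" using y by (auto simp: power2_eq_square abs_of_nonneg)
qed auto

lemma Im_cauchy_neg: assumes z: "0 < Im z" shows "Im (cauchy_transform M z) < 0"
proof -
  have nz: "0 < (Re z - t)\<^sup>2 + (Im z)\<^sup>2" for t using z by (simp add: add_nonneg_pos)
  have "\<not> (\<integral>t. Im z / ((Re z - t)\<^sup>2 + (Im z)\<^sup>2) \<partial>M) = 0"
  proof
    assume "(\<integral>t. Im z / ((Re z - t)\<^sup>2 + (Im z)\<^sup>2) \<partial>M) = 0"
    hence "AE t in M. Im z / ((Re z - t)\<^sup>2 + (Im z)\<^sup>2) = 0"
      using z nz by (subst (asm) integral_nonneg_eq_0_iff_AE[OF poisson_kernel_integrable]) (auto intro!: divide_nonneg_pos)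
    hence "AE t in M. False" by eventually_elim (use z nz in \<open>auto simp: less_le\<close>)
    thus False by simp
  qed
  moreover have "0 \<le> (\<integral>t. Im z / ((Re z - t)\<^sup>2 + (Im z)\<^sup>2) \<partial>M)"
    using z by (intro integral_nonneg_AE) (auto intro!: divide_nonneg_nonneg)
  ultimately show ?thesis using Im_cauchy[OF z] by linarith
qed

text \<open>Every point of the support has distance at most \<open>|Re z| + L\<close> from
  \<open>Re z\<close>. Applied on a horizontal line, this keeps the argument of the logarithm in the
  loss away from 0 at a polynomial rate.\<close>

lemma Im_cauchy_lower: assumes z: "0 < Im z" and L: "AE t in M. \<bar>t\<bar> \<le> L"
  shows "Im z / ((\<bar>Re z\<bar> + L)\<^sup>2 + (Im z)\<^sup>2) \<le> - Im (cauchy_transform M z)"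
proof -
  have "(\<integral>t. Im z / ((\<bar>Re z\<bar> + L)\<^sup>2 + (Im z)\<^sup>2) \<partial>M) \<le> (\<integral>t. Im z / ((Re z - t)\<^sup>2 + (Im z)\<^sup>2) \<partial>M)"
  proof (rule integral_mono_AE[OF _ poisson_kernel_integrable[OF z]])
    show "AE t in M. Im z / ((\<bar>Re z\<bar> + L)\<^sup>2 + (Im z)\<^sup>2) \<le> Im z / ((Re z - t)\<^sup>2 + (Im z)\<^sup>2)"
      using L
    proof eventually_elim
      case (elim t)
      have "\<bar>Re z - t\<bar>\<^sup>2 \<le> (\<bar>Re z\<bar> + L)\<^sup>2" using elim by (intro power_mono) auto
      thus ?case using z by (intro divide_left_mono mult_pos_pos add_nonneg_pos) auto
    qed
  qed auto
  thus ?thesis unfolding Im_cauchy[OF z] by (simp add: prob_space[unfolded space_eq_univ])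
qed

lemma poisson_conv_eq: "0 < \<gamma> \<Longrightarrow> poisson_conv \<gamma> M x = - (1 / pi) * Im (cauchy_transform M (Complex x \<gamma>))"
proof -
  assume g: "0 < \<gamma>"
  have "poisson_conv \<gamma> M x = (\<integral>t. (1 / pi) * (\<gamma> / ((x - t)\<^sup>2 + \<gamma>\<^sup>2)) \<partial>M)"
    unfolding poisson_conv_def poisson_kernel_def ..
  also have "\<dots> = (1 / pi) * (\<integral>t. \<gamma> / ((x - t)\<^sup>2 + \<gamma>\<^sup>2) \<partial>M)" by (rule integral_mult_right_zero)
  also have "(\<integral>t. \<gamma> / ((x - t)\<^sup>2 + \<gamma>\<^sup>2) \<partial>M) = - Im (cauchy_transform M (Complex x \<gamma>))"
    using Im_cauchy[of "Complex x \<gamma>"] g by simp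
  finally show ?thesis by simp
qed

text \<open>Differentiation under the integral with an explicit remainder:
  \<open>1/a - 1/b + (a - b)/b^2 = (a - b)^2 / (a b^2)\<close>, and on the disc of radius
  \<open>y / 2\<close> around \<open>z\<close> the right side is quadratic in \<open>a - b\<close>
  with the constant \<open>2 / y^3\<close> for all \<open>t\<close> at once.\<close>

lemma cauchy_has_field_derivative:
  assumes z: "0 < Im z"
  shows "(cauchy_transform M has_field_derivative (- (\<integral>t. (inverse (z - complex_of_real t))\<^sup>2 \<partial>M))) (at z)"
proof -
  define y where "y = Im z"
  define D where "D = - (\<integral>t. (inverse (z - complex_of_real t))\<^sup>2 \<partial>M)"
  have y: "0 < y" using z by (simp add: y_def)
  have int2: "integrable M (\<lambda>t. (inverse (z - complex_of_real t))\<^sup>2)"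
  proof (rule integrable_const_bound[where B="(1 / Im z)\<^sup>2"])
    show "AE t in M. norm ((inverse (z - complex_of_real t))\<^sup>2) \<le> (1 / Im z)\<^sup>2"
      unfolding norm_power using z by (intro AE_I2 power_mono cauchy_kernel_norm_le) auto
  qed auto
  have key: "norm (cauchy_transform M w - cauchy_transform M z - D * (w - z)) \<le> (2 / y^3) * (norm (w - z))\<^sup>2"
    if w: "dist w z < y / 2" for w
  proof -
    have "\<bar>Im (w - z)\<bar> < y / 2" using w abs_Im_le_cmod[of "w - z"] by (simp add: dist_norm)
    hence iw: "y / 2 < Im w" by (auto simp: y_def abs_if field_simps split: if_splits)
    hence iw0: "0 < Im w" using y by linarith
    have nz: "w - complex_of_real t \<noteq> 0" "z - complex_of_real t \<noteq> 0" for t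
      using iw0 z by (auto simp: complex_eq_iff)
    have "cauchy_transform M w - cauchy_transform M z - D * (w - z) =
      (\<integral>t. inverse (w - complex_of_real t) - inverse (z - complex_of_real t) + (inverse (z - complex_of_real t))\<^sup>2 * (w - z) \<partial>M)"
      unfolding cauchy_transform_def D_def using iw0 z int2 by simp
    also have "\<dots> = (\<integral>t. (w - z)\<^sup>2 * (inverse (w - complex_of_real t) * (inverse (z - complex_of_real t))\<^sup>2) \<partial>M)"
    proof (rule Bochner_Integration.integral_cong[OF refl])
      fix t
      have "inverse a - inverse b + (inverse b)\<^sup>2 * (a - b) = (a - b)\<^sup>2 * (inverse a * (inverse b)\<^sup>2)"
        if "a \<noteq> 0" "b \<noteq> 0" for a b :: complex
        using that by (simp add: field_simps power2_eq_square)
      from this[OF nz(1)[of t] nz(2)[of t]]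
      show "inverse (w - complex_of_real t) - inverse (z - complex_of_real t) + (inverse (z - complex_of_real t))\<^sup>2 * (w - z)
         = (w - z)\<^sup>2 * (inverse (w - complex_of_real t) * (inverse (z - complex_of_real t))\<^sup>2)" by simp
    qed
    also have "norm \<dots> \<le> (\<integral>t. (norm (w - z))\<^sup>2 * (2 / y^3) \<partial>M)"
    proof (rule order_trans[OF integral_norm_bound], rule integral_mono')
      fix t
      have "cmod (inverse (w - complex_of_real t)) \<le> 2 / y"
        using cauchy_kernel_norm_le[OF iw0, of t] iw y frac_le[of 1 1 "y/2" "Im w"] by simp
      moreover have "(cmod (inverse (z - complex_of_real t)))\<^sup>2 \<le> (1 / y)\<^sup>2"
        using cauchy_kernel_norm_le[OF z, of t] unfolding y_def by (intro power_mono) auto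
      ultimately have "cmod (inverse (w - complex_of_real t)) * (cmod (inverse (z - complex_of_real t)))\<^sup>2 \<le> (2 / y) * (1 / y)\<^sup>2"
        using y by (intro mult_mono) auto
      also have "\<dots> = 2 / y^3" by (simp add: power2_eq_square power3_eq_cube)
      finally show "norm ((w - z)\<^sup>2 * (inverse (w - complex_of_real t) * (inverse (z - complex_of_real t))\<^sup>2)) \<le> (norm (w - z))\<^sup>2 * (2 / y^3)"
        unfolding norm_mult norm_power by (intro mult_left_mono) auto
    qed (use y in auto)
    finally show ?thesis by (simp add: prob_space[unfolded space_eq_univ] mult.commute)
  qed
  show ?thesis unfolding D_def[symmetric] has_field_derivative_def has_derivative_at2
  proof (intro conjI bounded_linear_mult_right)
    show "((\<lambda>w. (1 / norm (w - z)) *\<^sub>R (cauchy_transform M w - (cauchy_transform M z + D * (w - z)))) \<longlongrightarrow> 0) (at z)"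
    proof (rule Lim_null_comparison)
      show "\<forall>\<^sub>F w in at z. norm ((1 / norm (w - z)) *\<^sub>R (cauchy_transform M w - (cauchy_transform M z + D * (w - z)))) \<le> (2 / y^3) * norm (w - z)"
        unfolding eventually_at
      proof (intro exI[of _ "y/2"] conjI ballI impI)
        fix w assume w: "w \<noteq> z \<and> dist w z < y / 2"
        hence "norm (w - z) > 0" by simp
        moreover have "norm (cauchy_transform M w - (cauchy_transform M z + D * (w - z))) \<le> (2 / y^3) * norm (w - z) * norm (w - z)"
          using key[of w] w by (simp add: power2_eq_square algebra_simps)
        ultimately show "norm ((1 / norm (w - z)) *\<^sub>R (cauchy_transform M w - (cauchy_transform M z + D * (w - z)))) \<le> (2 / y^3) * norm (w - z)"
          using w y by (simp add: divide_simps mult_ac)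
      qed (use y in auto)
      show "((\<lambda>w. (2 / y^3) * norm (w - z)) \<longlongrightarrow> 0) (at z)"
        using y by (auto intro!: tendsto_eq_intros)
    qed
  qed
qed

lemma cauchy_holomorphic: "cauchy_transform M holomorphic_on {z. 0 < Im z}"
  unfolding holomorphic_on_def field_differentiable_def
  using cauchy_has_field_derivative has_field_derivative_at_within by blast

end

section \<open>Identity theorem and Vitali's theorem in the upper half plane\<close>

lemma upper_half_identity:
  assumes f: "f holomorphic_on {z. 0 < Im z}" and zj: "\<And>j. f (\<xi> j) = 0" "\<And>j. 0 < Im (\<xi> j)"
    and lim: "\<xi> \<longlonglongrightarrow> \<zeta>" "\<And>j. \<xi> j \<noteq> \<zeta>" and \<zeta>: "0 < Im \<zeta>" and z: "0 < Im z"
  shows "f z = 0"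
proof (rule analytic_continuation[OF f, of "range \<xi>" \<zeta> z])
  show "open {z. 0 < Im z}" by (rule open_halfspace_Im_gt)
  show "connected {z. 0 < Im z}" by (rule convex_connected[OF convex_halfspace_Im_gt])
  show "\<zeta> islimpt range \<xi>" unfolding islimpt_sequential
    using lim by (intro exI[of _ \<xi>]) auto
qed (use zj \<zeta> z in auto)

text \<open>If convergence failed at \<open>z\<close>, some subsequence would stay away from 0
  there, and Montel's theorem would give it a convergent further subsequence. The limit vanishes at
  the accumulating points, hence everywhere, also at \<open>z\<close>. The bound
  \<open>B / Im z\<close> is uniform on a compact set because it is largest at the lowest
  point.\<close>

lemma vitali_zero:
  fixes f :: "nat \<Rightarrow> complex \<Rightarrow> complex"
  assumes f: "\<And>n. f n holomorphic_on {z. 0 < Im z}"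
    and b: "\<And>n z. 0 < Im z \<Longrightarrow> cmod (f n z) \<le> B / Im z" and B: "0 \<le> B"
    and \<xi>: "\<And>j. (\<lambda>n. f n (\<xi> j)) \<longlonglongrightarrow> 0" "\<And>j. 0 < Im (\<xi> j)"
    and lim: "\<xi> \<longlonglongrightarrow> \<zeta>" "\<And>j. \<xi> j \<noteq> \<zeta>" and \<zeta>: "0 < Im \<zeta>" and z: "0 < Im z"
  shows "(\<lambda>n. f n z) \<longlonglongrightarrow> 0"
proof (rule ccontr)
  assume "\<not> (\<lambda>n. f n z) \<longlonglongrightarrow> 0"
  then obtain e where e: "e > 0" "\<not> (\<forall>\<^sub>F n in sequentially. dist (f n z) 0 < e)"
    unfolding tendsto_iff by blast
  hence "\<exists>\<^sub>F n in sequentially. e \<le> cmod (f n z)"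
    by (simp add: not_eventually not_less)
  hence "infinite {n. e \<le> cmod (f n z)}"
    by (simp add: frequently_cofinite cofinite_eq_sequentially[symmetric])
  then obtain r :: "nat \<Rightarrow> nat" where r: "strict_mono r" "\<And>n. r n \<in> {n. e \<le> cmod (f n z)}"
    using infinite_enumerate by blast
  have *: "\<exists>B'. \<forall>h\<in>range (\<lambda>n. f (r n)). \<forall>z\<in>K. norm (h z) \<le> B'" if K: "compact K" "K \<subseteq> {z. 0 < Im z}" for K
  proof (cases "K = {}")
    case False
    obtain w where w: "w \<in> K" "\<forall>u\<in>K. Im w \<le> Im u"
      using continuous_attains_inf[OF K(1) False, of Im] continuous_on_Im[OF continuous_on_id] by blast
    have "norm (f (r n) u) \<le> B / Im w" if "u \<in> K" for n u
    proof -
      have "norm (f (r n) u) \<le> B / Im u" using that K by (intro b) auto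
      also have "\<dots> \<le> B / Im w" using that w K B by (intro divide_left_mono mult_pos_pos) auto
      finally show ?thesis .
    qed
    thus ?thesis by blast
  qed auto
  obtain g s where g: "g holomorphic_on {z. 0 < Im z}" "strict_mono (s :: nat \<Rightarrow> nat)"
     "\<And>x. x \<in> {z. 0 < Im z} \<Longrightarrow> ((\<lambda>n. f (r (s n)) x) \<longlongrightarrow> g x) sequentially"
  proof (rule Montel[of "{z. 0 < Im z}" "range (\<lambda>n. f (r n))" "\<lambda>n. f (r n)"])
    show "open {z. 0 < Im z}" by (rule open_halfspace_Im_gt)
    show "h holomorphic_on {z. 0 < Im z}" if "h \<in> range (\<lambda>n. f (r n))" for h using that f by auto
    show "\<exists>B'. \<forall>h\<in>range (\<lambda>n. f (r n)). \<forall>z\<in>K. norm (h z) \<le> B'" if "compact K" "K \<subseteq> {z. 0 < Im z}" for K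
      using that by (rule *)
  qed (auto intro: that)
  have rs: "strict_mono (\<lambda>n. r (s n))" using r(1) g(2) by (simp add: strict_mono_def)
  have "g (\<xi> j) = 0" for j
  proof -
    have "(\<lambda>n. f (r (s n)) (\<xi> j)) \<longlonglongrightarrow> 0"
      using LIMSEQ_subseq_LIMSEQ[OF \<xi>(1)[of j] rs] by (simp add: o_def)
    thus ?thesis using g(3)[of "\<xi> j"] \<xi>(2)[of j] LIMSEQ_unique by blast
  qed
  hence "g z = 0" using \<xi>(2) lim \<zeta> z by (rule upper_half_identity[OF g(1)])
  hence "(\<lambda>n. f (r (s n)) z) \<longlonglongrightarrow> 0" using g(3)[of z] z by simp
  hence "(\<lambda>n. cmod (f (r (s n)) z)) \<longlonglongrightarrow> 0" by (rule tendsto_norm_zero)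
  moreover have "e \<le> cmod (f (r (s n)) z)" for n using r(2)[of "s n"] by simp
  ultimately have "e \<le> 0" by (intro LIMSEQ_le_const[of _ _ e]) auto
  thus False using e by simp
qed

text \<open>The density \<open>u\<close> lies between a multiple of \<open>(1 + |x|)^-2\<close> and
  a constant, so \<open>ln u\<close> grows at most logarithmically in \<open>|x|\<close>. A fourth
  root is taken as weight because its square is still integrable against the Poisson kernel; the
  spare factor later controls the tails.\<close>

lemma cauchy_loss_bound:
  assumes \<gamma>: "0 < \<gamma>" and L: "0 \<le> L"
  shows "\<exists>C. \<forall>\<mu> x. real_distribution \<mu> \<and> (AE t in \<mu>. \<bar>t\<bar> \<le> L) \<longrightarrow> \<bar>cauchy_loss \<gamma> x \<mu>\<bar> \<le> C * sqrt (sqrt (1 + \<bar>x\<bar>))"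
proof -
  \<comment> \<open>The lower bound is \<open>1 / (c (1 + |x|)^2)\<close>; the constant comes from
    \<open>(|x| + L)^2 + \<gamma>^2 \<le> (1 + L + \<gamma>)^2 (1 + |x|)^2\<close>.\<close>
  define c where "c = pi * (1 + L + \<gamma>)\<^sup>2 / \<gamma>"
  have c: "0 < c" using \<gamma> L by (auto simp: c_def intro!: divide_pos_pos mult_pos_pos zero_less_power)
  define C where "C = \<bar>ln c\<bar> + 8 + \<bar>ln (1 / (pi * \<gamma>))\<bar>"
  have "\<bar>cauchy_loss \<gamma> x \<mu>\<bar> \<le> C * sqrt (sqrt (1 + \<bar>x\<bar>))" if "real_distribution \<mu>" and ae: "AE t in \<mu>. \<bar>t\<bar> \<le> L" for \<mu> x
  proof -
    interpret real_distribution \<mu> by fact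
    define u where "u = - (1 / pi) * Im (cauchy_transform \<mu> (Complex x \<gamma>))"
    define V where "V = sqrt (sqrt (1 + \<bar>x\<bar>))"
    have V1: "1 \<le> V" by (simp add: V_def)
    have V4: "V ^ 4 = 1 + \<bar>x\<bar>"
    proof -
      have "V ^ 4 = (V\<^sup>2)\<^sup>2" by (simp add: power_mult[symmetric])
      thus ?thesis by (simp add: V_def)
    qed
    have up: "u \<le> 1 / (pi * \<gamma>)"
    proof -
      have "- Im (cauchy_transform \<mu> (Complex x \<gamma>)) \<le> 1 / \<gamma>"
        using cauchy_norm_le[of "Complex x \<gamma>"] abs_Im_le_cmod[of "cauchy_transform \<mu> (Complex x \<gamma>)"] \<gamma> by simp
      hence "(1 / pi) * (- Im (cauchy_transform \<mu> (Complex x \<gamma>))) \<le> (1 / pi) * (1 / \<gamma>)" by (intro mult_left_mono) auto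
      thus ?thesis unfolding u_def by simp
    qed
    have low: "1 / (c * V ^ 8) \<le> u"
    proof -
      have "(\<bar>x\<bar> + L)\<^sup>2 + \<gamma>\<^sup>2 \<le> (\<bar>x\<bar> + L + \<gamma>)\<^sup>2" using \<gamma> L by (simp add: power2_eq_square algebra_simps)
      also have "\<dots> \<le> ((1 + L + \<gamma>) * (1 + \<bar>x\<bar>))\<^sup>2"
      proof (rule power_mono)
        have "0 \<le> \<bar>x\<bar> * (L + \<gamma>)" using L \<gamma> by (intro mult_nonneg_nonneg) auto
        thus "\<bar>x\<bar> + L + \<gamma> \<le> (1 + L + \<gamma>) * (1 + \<bar>x\<bar>)" using L \<gamma> by (simp add: algebra_simps)
      qed (use L \<gamma> in auto)
      finally have "(\<bar>x\<bar> + L)\<^sup>2 + \<gamma>\<^sup>2 \<le> (1 + L + \<gamma>)\<^sup>2 * (V^4)\<^sup>2" unfolding V4 by (simp add: power_mult_distrib)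
      hence "\<gamma> / ((1 + L + \<gamma>)\<^sup>2 * V ^ 8) \<le> \<gamma> / ((\<bar>x\<bar> + L)\<^sup>2 + \<gamma>\<^sup>2)"
        using \<gamma> by (intro divide_left_mono mult_pos_pos add_nonneg_pos) (use L V1 \<gamma> in \<open>auto simp: power_mult[symmetric]\<close>)
      also have "\<dots> \<le> - Im (cauchy_transform \<mu> (Complex x \<gamma>))"
        using Im_cauchy_lower[of "Complex x \<gamma>", OF _ ae] \<gamma> by simp
      finally have "(1 / pi) * (\<gamma> / ((1 + L + \<gamma>)\<^sup>2 * V ^ 8)) \<le> (1 / pi) * (- Im (cauchy_transform \<mu> (Complex x \<gamma>)))"
        by (intro mult_left_mono) auto
      thus ?thesis unfolding u_def c_def by simp
    qed
    have pos: "0 < 1 / (c * V ^ 8)" using c V1 by auto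
    hence u: "0 < u" using low by linarith
    have "ln (1 / (c * V ^ 8)) \<le> ln u" using low pos u by (subst ln_le_cancel_iff) auto
    moreover have "ln (1 / (c * V ^ 8)) = - (ln c + 8 * ln V)"
      using c V1 by (simp add: ln_div ln_mult ln_realpow)
    moreover have "ln V \<le> V" using V1 ln_le_minus_one[of V] by linarith
    ultimately have 1: "- ln u \<le> \<bar>ln c\<bar> + 8 * V" by linarith
    have "ln u \<le> ln (1 / (pi * \<gamma>))" using up u \<gamma> by (subst ln_le_cancel_iff) (auto intro!: divide_pos_pos mult_pos_pos)
    hence 2: "ln u \<le> \<bar>ln (1 / (pi * \<gamma>))\<bar>" by linarith
    have "\<bar>ln c\<bar> * 1 \<le> \<bar>ln c\<bar> * V" "\<bar>ln (1 / (pi * \<gamma>))\<bar> * 1 \<le> \<bar>ln (1 / (pi * \<gamma>))\<bar> * V"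
      using V1 by (intro mult_left_mono; simp)+
    hence "\<bar>ln u\<bar> \<le> C * V" using 1 2 V1 unfolding C_def distrib_right by linarith
    thus ?thesis unfolding cauchy_loss_def u_def V_def by simp
  qed
  thus ?thesis by blast
qed

lemma cauchy_loss_measurable [measurable]:
  assumes "real_distribution \<mu>" "0 < \<gamma>"
  shows "(\<lambda>x. cauchy_loss \<gamma> x \<mu>) \<in> borel_measurable borel"
proof -
  interpret real_distribution \<mu> by fact
  have "continuous_on UNIV (\<lambda>x. cauchy_transform \<mu> (Complex x \<gamma>))"
    unfolding Complex_eq using assms(2)
    by (intro continuous_on_compose2[of "{z. 0 < Im z}" "cauchy_transform \<mu>" UNIV "\<lambda>x. complex_of_real x + \<i> * complex_of_real \<gamma>"]
        holomorphic_on_imp_continuous_on cauchy_holomorphic continuous_intros) auto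
  hence [measurable]: "(\<lambda>x. cauchy_transform \<mu> (Complex x \<gamma>)) \<in> borel_measurable borel"
    by (rule borel_measurable_continuous_onI)
  show ?thesis unfolding cauchy_loss_def by measurable
qed

lemma poisson_conv_measurable [measurable]:
  assumes "real_distribution \<mu>" "0 < \<gamma>"
  shows "poisson_conv \<gamma> \<mu> \<in> borel_measurable borel"
proof -
  interpret real_distribution \<mu> by fact
  have "continuous_on UNIV (\<lambda>x. cauchy_transform \<mu> (Complex x \<gamma>))"
    unfolding Complex_eq using assms(2)
    by (intro continuous_on_compose2[of "{z. 0 < Im z}" "cauchy_transform \<mu>" UNIV "\<lambda>x. complex_of_real x + \<i> * complex_of_real \<gamma>"]
        holomorphic_on_imp_continuous_on cauchy_holomorphic continuous_intros) auto
  hence [measurable]: "(\<lambda>x. cauchy_transform \<mu> (Complex x \<gamma>)) \<in> borel_measurable borel"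
    by (rule borel_measurable_continuous_onI)
  have "poisson_conv \<gamma> \<mu> = (\<lambda>x. - (1 / pi) * Im (cauchy_transform \<mu> (Complex x \<gamma>)))"
    using poisson_conv_eq[OF assms(2)] by auto
  thus ?thesis by simp
qed

text \<open>The integrand decays like \<open>|x|^(-3/2)\<close>. It is compared with
  \<open>(1 + |x|)^(-3/2)\<close>, which has the primitive \<open>- 2 / sqrt (1 + x)\<close> on the
  positive half line; the negative half line follows by reflection.\<close>

lemma weighted_poisson_integral_finite:
  assumes \<gamma>: "0 < \<gamma>"
  shows "\<exists>c. (\<integral>\<^sup>+x. ennreal (sqrt (1 + \<bar>x\<bar>) * poisson_kernel \<gamma> x) \<partial>lborel) \<le> ennreal c \<and> 0 \<le> c"
proof -
  \<comment> \<open>Chosen so that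
    \<open>(1 + |x|)^2 \<le> 2 (1 + x^2) \<le> m (x^2 + \<gamma>^2)\<close> for every
    \<open>x\<close>.\<close>
  define m where "m = 2 * (1 + 1 / \<gamma>\<^sup>2)"
  define f :: "real \<Rightarrow> real" where "f x = 1 / ((1 + x) * sqrt (1 + x))" for x
  have bnd: "sqrt (1 + \<bar>x\<bar>) * poisson_kernel \<gamma> x \<le> (m * \<gamma> / pi) * f \<bar>x\<bar>" for x
  proof -
    have "(1 + \<bar>x\<bar>)\<^sup>2 \<le> 2 * (1 + x\<^sup>2)" using sum_squares_bound[of 1 "\<bar>x\<bar>"] by (simp add: power2_eq_square algebra_simps)
    also have "\<dots> \<le> m * (x\<^sup>2 + \<gamma>\<^sup>2)" using \<gamma> by (simp add: m_def algebra_simps divide_simps)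
    finally have a: "(1 + \<bar>x\<bar>)\<^sup>2 \<le> m * (x\<^sup>2 + \<gamma>\<^sup>2)" .
    have p: "0 < x\<^sup>2 + \<gamma>\<^sup>2" using \<gamma> by (simp add: add_nonneg_pos)
    have "1 / (x\<^sup>2 + \<gamma>\<^sup>2) \<le> m / (1 + \<bar>x\<bar>)\<^sup>2" using a p by (subst frac_le_eq) (auto simp: divide_le_0_iff mult_less_0_iff zero_less_mult_iff)
    hence "sqrt (1 + \<bar>x\<bar>) * ((\<gamma> / pi) * (1 / (x\<^sup>2 + \<gamma>\<^sup>2))) \<le> sqrt (1 + \<bar>x\<bar>) * ((\<gamma> / pi) * (m / (1 + \<bar>x\<bar>)\<^sup>2))"
      using \<gamma> by (intro mult_left_mono) auto
    also have "\<dots> = (m * \<gamma> / pi) * (sqrt (1 + \<bar>x\<bar>) / (1 + \<bar>x\<bar>)\<^sup>2)" by simp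
    also have "sqrt (1 + \<bar>x\<bar>) / (1 + \<bar>x\<bar>)\<^sup>2 = f \<bar>x\<bar>"
    proof -
      have s: "sqrt (1 + \<bar>x\<bar>) * sqrt (1 + \<bar>x\<bar>) = 1 + \<bar>x\<bar>" by simp
      have "sqrt (1 + \<bar>x\<bar>) \<noteq> 0" by (simp)
      thus ?thesis using s unfolding f_def power2_eq_square by (simp add: divide_simps)
    qed
    finally show ?thesis unfolding poisson_kernel_def by simp
  qed
  have m0: "0 \<le> m * \<gamma> / pi" using \<gamma> by (auto simp: m_def)
  have fint: "(\<integral>\<^sup>+x. ennreal (f x) * indicator {0..} x \<partial>lborel) = ennreal (0 - (- 2 / sqrt (1 + 0)))"
  proof (rule nn_integral_FTC_atLeast)
    show "f \<in> borel_measurable borel" unfolding f_def by measurable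
    show "DERIV (\<lambda>x. - 2 / sqrt (1 + x)) x :> f x" if "0 \<le> x" for x
      using that by (auto intro!: derivative_eq_intros simp: f_def power2_eq_square divide_simps)
    show "((\<lambda>x. - 2 / sqrt (1 + x)) \<longlongrightarrow> (0::real)) at_top" by real_asymp
  qed (auto simp: f_def)
  have refl: "(\<integral>\<^sup>+x. ennreal (f (- x)) * indicator {..0} x \<partial>lborel) = (\<integral>\<^sup>+x. ennreal (f x) * indicator {0..} x \<partial>lborel)"
  proof -
    have [measurable]: "f \<in> borel_measurable borel" unfolding f_def by measurable
    show ?thesis
      by (subst nn_integral_real_affine[where c="-1" and t=0]) (auto intro!: nn_integral_cong simp: indicator_def)
  qed
  have "(\<integral>\<^sup>+x. ennreal (sqrt (1 + \<bar>x\<bar>) * poisson_kernel \<gamma> x) \<partial>lborel)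
     \<le> (\<integral>\<^sup>+x. ennreal (m * \<gamma> / pi) * (ennreal (f x) * indicator {0..} x + ennreal (f (- x)) * indicator {..0} x) \<partial>lborel)"
  proof (rule nn_integral_mono)
    fix x :: real
    have "ennreal (sqrt (1 + \<bar>x\<bar>) * poisson_kernel \<gamma> x) \<le> ennreal ((m * \<gamma> / pi) * f \<bar>x\<bar>)" by (rule ennreal_leI[OF bnd])
    also have "\<dots> = ennreal (m * \<gamma> / pi) * ennreal (f \<bar>x\<bar>)" using m0 by (intro ennreal_mult) (auto simp: f_def)
    also have "\<dots> \<le> ennreal (m * \<gamma> / pi) * (ennreal (f x) * indicator {0..} x + ennreal (f (- x)) * indicator {..0} x)"
      by (intro mult_left_mono) (auto simp: indicator_def abs_if)
    finally show "ennreal (sqrt (1 + \<bar>x\<bar>) * poisson_kernel \<gamma> x) \<le> ennreal (m * \<gamma> / pi) * (ennreal (f x) * indicator {0..} x + ennreal (f (- x)) * indicator {..0} x)" .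
  qed
  also have "\<dots> = ennreal (m * \<gamma> / pi) * (ennreal 2 + ennreal 2)"
  proof -
    have [measurable]: "f \<in> borel_measurable borel" unfolding f_def by measurable
    show ?thesis using fint refl by (simp add: nn_integral_cmult nn_integral_add)
  qed
  also have "\<dots> = ennreal ((m * \<gamma> / pi) * 4)" using m0 by (subst ennreal_mult[OF m0]) auto
  finally show ?thesis using m0 by (intro exI[of _ "(m * \<gamma> / pi) * 4"] conjI mult_nonneg_nonneg) auto
qed

lemma poisson_kernel_nonneg: "0 < \<gamma> \<Longrightarrow> 0 \<le> poisson_kernel \<gamma> x"
  by (auto simp: poisson_kernel_def)

text \<open>Tonelli's theorem and the substitution \<open>x = t + s\<close> split the weight by
  means of \<open>1 + |t + s| \<le> (1 + |t|) (1 + |s|)\<close>. The factor in \<open>t\<close> is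
  enlarged from a square root to \<open>1 + |t|\<close>, so that the first moment of the measure
  appears.\<close>

lemma weighted_poisson_conv_bound:
  assumes \<gamma>: "0 < \<gamma>"
  shows "\<exists>c\<ge>0. \<forall>\<nu> m. real_distribution \<nu> \<and> integrable \<nu> (\<lambda>t. \<bar>t\<bar>) \<and> (\<integral>t. \<bar>t\<bar> \<partial>\<nu>) \<le> m \<longrightarrow>
     integrable lborel (\<lambda>x. sqrt (1 + \<bar>x\<bar>) * poisson_conv \<gamma> \<nu> x) \<and>
     (\<integral>x. sqrt (1 + \<bar>x\<bar>) * poisson_conv \<gamma> \<nu> x \<partial>lborel) \<le> c * (1 + m)"
proof -
  obtain c where c: "(\<integral>\<^sup>+x. ennreal (sqrt (1 + \<bar>x\<bar>) * poisson_kernel \<gamma> x) \<partial>lborel) \<le> ennreal c" "0 \<le> c"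
    using weighted_poisson_integral_finite[OF \<gamma>] by blast
  have "integrable lborel (\<lambda>x. sqrt (1 + \<bar>x\<bar>) * poisson_conv \<gamma> \<nu> x) \<and>
     (\<integral>x. sqrt (1 + \<bar>x\<bar>) * poisson_conv \<gamma> \<nu> x \<partial>lborel) \<le> c * (1 + m)"
    if "real_distribution \<nu>" and i: "integrable \<nu> (\<lambda>t. \<bar>t\<bar>)" and m: "(\<integral>t. \<bar>t\<bar> \<partial>\<nu>) \<le> m" for \<nu> m
  proof -
    interpret real_distribution \<nu> by fact
    note [measurable] = poisson_conv_measurable[OF that(1) \<gamma>]
    interpret pair_sigma_finite lborel \<nu> by standard
    have nn: "0 \<le> poisson_conv \<gamma> \<nu> x" for x
      unfolding poisson_conv_def using poisson_kernel_nonneg[OF \<gamma>] by (intro integral_nonneg_AE) auto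
    have m0: "0 \<le> m" by (rule order_trans[OF integral_nonneg_AE m]) auto
    have [measurable]: "poisson_kernel \<gamma> \<in> borel_measurable borel"
      unfolding poisson_kernel_def by measurable
    have pc: "ennreal (poisson_conv \<gamma> \<nu> x) = (\<integral>\<^sup>+t. ennreal (poisson_kernel \<gamma> (x - t)) \<partial>\<nu>)" for x
      unfolding poisson_conv_def
    proof (rule nn_integral_eq_integral[symmetric])
      show "integrable \<nu> (\<lambda>t. poisson_kernel \<gamma> (x - t))"
        unfolding poisson_kernel_def by (intro integrable_mult_right poisson_kernel_integrable \<gamma>)
    qed (use poisson_kernel_nonneg[OF \<gamma>] in auto)
    have "(\<integral>\<^sup>+x. ennreal (sqrt (1 + \<bar>x\<bar>) * poisson_conv \<gamma> \<nu> x) \<partial>lborel)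
      = (\<integral>\<^sup>+x. (\<integral>\<^sup>+t. ennreal (sqrt (1 + \<bar>x\<bar>)) * ennreal (poisson_kernel \<gamma> (x - t)) \<partial>\<nu>) \<partial>lborel)"
      by (subst nn_integral_cmult) (auto simp: ennreal_mult pc[symmetric] nn)
    also have "\<dots> = (\<integral>\<^sup>+t. (\<integral>\<^sup>+x. ennreal (sqrt (1 + \<bar>x\<bar>)) * ennreal (poisson_kernel \<gamma> (x - t)) \<partial>lborel) \<partial>\<nu>)"
      by (rule Fubini'[symmetric]) measurable
    also have "\<dots> \<le> (\<integral>\<^sup>+t. ennreal (1 + \<bar>t\<bar>) * ennreal c \<partial>\<nu>)"
    proof (rule nn_integral_mono)
      fix t :: real
      have "(\<integral>\<^sup>+x. ennreal (sqrt (1 + \<bar>x\<bar>)) * ennreal (poisson_kernel \<gamma> (x - t)) \<partial>lborel)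
         = (\<integral>\<^sup>+s. ennreal (sqrt (1 + \<bar>t + s\<bar>)) * ennreal (poisson_kernel \<gamma> s) \<partial>lborel)"
        by (subst nn_integral_real_affine[where c=1 and t=t]) auto
      also have "\<dots> \<le> (\<integral>\<^sup>+s. ennreal (1 + \<bar>t\<bar>) * ennreal (sqrt (1 + \<bar>s\<bar>) * poisson_kernel \<gamma> s) \<partial>lborel)"
      proof (rule nn_integral_mono)
        fix s :: real
        have "1 + \<bar>t + s\<bar> \<le> (1 + \<bar>t\<bar>) * (1 + \<bar>s\<bar>)" using abs_triangle_ineq[of t s] by (simp add: algebra_simps) (smt (verit) abs_ge_zero mult_nonneg_nonneg)
        hence "sqrt (1 + \<bar>t + s\<bar>) \<le> sqrt ((1 + \<bar>t\<bar>) * (1 + \<bar>s\<bar>))" by (rule real_sqrt_le_mono)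
        also have "\<dots> = sqrt (1 + \<bar>t\<bar>) * sqrt (1 + \<bar>s\<bar>)" by (rule real_sqrt_mult)
        also have "\<dots> \<le> (1 + \<bar>t\<bar>) * sqrt (1 + \<bar>s\<bar>)"
        proof (rule mult_right_mono)
          have "sqrt (1 + \<bar>t\<bar>) \<le> sqrt ((1 + \<bar>t\<bar>)\<^sup>2)" by (rule real_sqrt_le_mono) (simp add: power2_eq_square algebra_simps)
          thus "sqrt (1 + \<bar>t\<bar>) \<le> 1 + \<bar>t\<bar>" by simp
        qed auto
        finally have "sqrt (1 + \<bar>t + s\<bar>) * poisson_kernel \<gamma> s \<le> (1 + \<bar>t\<bar>) * (sqrt (1 + \<bar>s\<bar>) * poisson_kernel \<gamma> s)"
          using poisson_kernel_nonneg[OF \<gamma>, of s] by (simp add: mult_right_mono mult.assoc[symmetric])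
        thus "ennreal (sqrt (1 + \<bar>t + s\<bar>)) * ennreal (poisson_kernel \<gamma> s) \<le> ennreal (1 + \<bar>t\<bar>) * ennreal (sqrt (1 + \<bar>s\<bar>) * poisson_kernel \<gamma> s)"
          using poisson_kernel_nonneg[OF \<gamma>, of s] by (subst (1 2) ennreal_mult[symmetric]) (auto intro: ennreal_leI)
      qed
      also have "\<dots> = ennreal (1 + \<bar>t\<bar>) * (\<integral>\<^sup>+s. ennreal (sqrt (1 + \<bar>s\<bar>) * poisson_kernel \<gamma> s) \<partial>lborel)"
        by (rule nn_integral_cmult) measurable
      also have "\<dots> \<le> ennreal (1 + \<bar>t\<bar>) * ennreal c" by (intro mult_left_mono c) auto
      finally show "(\<integral>\<^sup>+x. ennreal (sqrt (1 + \<bar>x\<bar>)) * ennreal (poisson_kernel \<gamma> (x - t)) \<partial>lborel) \<le> ennreal (1 + \<bar>t\<bar>) * ennreal c" .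
    qed
    also have "\<dots> = (\<integral>\<^sup>+t. ennreal (c * (1 + \<bar>t\<bar>)) \<partial>\<nu>)"
      using c by (simp add: ennreal_mult mult.commute)
    also have "\<dots> = ennreal (\<integral>t. c * (1 + \<bar>t\<bar>) \<partial>\<nu>)"
      using c i by (intro nn_integral_eq_integral) auto
    also have "(\<integral>t. c * (1 + \<bar>t\<bar>) \<partial>\<nu>) = c * (1 + (\<integral>t. \<bar>t\<bar> \<partial>\<nu>))"
      using i by (simp add: prob_space[unfolded space_eq_univ])
    also have "ennreal \<dots> \<le> ennreal (c * (1 + m))" using m c by (intro ennreal_leI mult_left_mono) auto
    finally have fin: "(\<integral>\<^sup>+x. ennreal (sqrt (1 + \<bar>x\<bar>) * poisson_conv \<gamma> \<nu> x) \<partial>lborel) \<le> ennreal (c * (1 + m))" .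
    hence fin': "(\<integral>\<^sup>+x. ennreal (sqrt (1 + \<bar>x\<bar>) * poisson_conv \<gamma> \<nu> x) \<partial>lborel) < \<infinity>"
      by (rule order.strict_trans1) simp
    have int: "integrable lborel (\<lambda>x. sqrt (1 + \<bar>x\<bar>) * poisson_conv \<gamma> \<nu> x)"
      by (rule integrableI_nonneg) (use nn fin' in auto)
    have "ennreal (\<integral>x. sqrt (1 + \<bar>x\<bar>) * poisson_conv \<gamma> \<nu> x \<partial>lborel) = (\<integral>\<^sup>+x. ennreal (sqrt (1 + \<bar>x\<bar>) * poisson_conv \<gamma> \<nu> x) \<partial>lborel)"
      by (rule nn_integral_eq_integral[OF int, symmetric]) (use nn in auto)
    with fin have "ennreal (\<integral>x. sqrt (1 + \<bar>x\<bar>) * poisson_conv \<gamma> \<nu> x \<partial>lborel) \<le> ennreal (c * (1 + m))" by simp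
    hence "(\<integral>x. sqrt (1 + \<bar>x\<bar>) * poisson_conv \<gamma> \<nu> x \<partial>lborel) \<le> c * (1 + m)"
      using c m0 by (subst (asm) ennreal_le_iff) auto
    with int show ?thesis by blast
  qed
  with c(2) show ?thesis by blast
qed

lemma poisson_conv_nonneg: "0 < \<gamma> \<Longrightarrow> 0 \<le> poisson_conv \<gamma> \<nu> x"
  unfolding poisson_conv_def by (intro integral_nonneg_AE AE_I2 poisson_kernel_nonneg)

text \<open>On \<open>[-T, T]\<close> dominated convergence applies, as the densities are bounded.
  Outside, a second factor \<open>V\<close> can be inserted because the integral of
  \<open>V^2 f\<close> is at most \<open>Q\<close>; so the tail is at most \<open>Q / V T\<close>
  for every \<open>n\<close>, and \<open>T\<close> can be fixed before \<open>n\<close>.\<close>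

lemma weighted_poisson_difference_tendsto:
  assumes \<gamma>: "0 < \<gamma>"
    and \<nu>: "\<And>n. real_distribution (\<nu> n)" "\<And>n. integrable (\<nu> n) (\<lambda>t. \<bar>t\<bar>)" "\<And>n. (\<integral>t. \<bar>t\<bar> \<partial>(\<nu> n)) \<le> m"
    and \<mu>: "\<And>n. real_distribution (\<mu> n)" "\<And>n. integrable (\<mu> n) (\<lambda>t. \<bar>t\<bar>)" "\<And>n. (\<integral>t. \<bar>t\<bar> \<partial>(\<mu> n)) \<le> m"
    and lim: "\<And>z. 0 < Im z \<Longrightarrow> (\<lambda>n. cauchy_transform (\<nu> n) z - cauchy_transform (\<mu> n) z) \<longlonglongrightarrow> 0"
  shows "(\<lambda>n. \<integral>x. sqrt (sqrt (1 + \<bar>x\<bar>)) * \<bar>poisson_conv \<gamma> (\<nu> n) x - poisson_conv \<gamma> (\<mu> n) x\<bar> \<partial>lborel) \<longlonglongrightarrow> 0"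
proof -
  define f where "f n x = \<bar>poisson_conv \<gamma> (\<nu> n) x - poisson_conv \<gamma> (\<mu> n) x\<bar>" for n x
  define V :: "real \<Rightarrow> real" where "V x = sqrt (sqrt (1 + \<bar>x\<bar>))" for x
  have VV: "sqrt (1 + \<bar>x\<bar>) = V x * V x" for x unfolding V_def by simp
  have V1: "1 \<le> V x" for x by (simp add: V_def)
  have [measurable]: "V \<in> borel_measurable borel" unfolding V_def by measurable
  note [measurable] = poisson_conv_measurable[OF \<nu>(1) \<gamma>] poisson_conv_measurable[OF \<mu>(1) \<gamma>]
  have fm [measurable]: "f n \<in> borel_measurable borel" for n unfolding f_def by measurable
  obtain c where c: "0 \<le> c" "\<And>\<nu> m. real_distribution \<nu> \<Longrightarrow> integrable \<nu> (\<lambda>t. \<bar>t\<bar>) \<Longrightarrow> (\<integral>t. \<bar>t\<bar> \<partial>\<nu>) \<le> m \<Longrightarrow>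
     integrable lborel (\<lambda>x. sqrt (1 + \<bar>x\<bar>) * poisson_conv \<gamma> \<nu> x) \<and>
     (\<integral>x. sqrt (1 + \<bar>x\<bar>) * poisson_conv \<gamma> \<nu> x \<partial>lborel) \<le> c * (1 + m)"
    using weighted_poisson_conv_bound[OF \<gamma>] by blast
  define Q where "Q = 2 * (c * (1 + m))"
  have m0: "0 \<le> m" by (rule order_trans[OF integral_nonneg_AE \<nu>(3)]) auto
  have f0: "0 \<le> f n x" for n x by (simp add: f_def)
  have fle: "f n x \<le> poisson_conv \<gamma> (\<nu> n) x + poisson_conv \<gamma> (\<mu> n) x" for n x
    using poisson_conv_nonneg[OF \<gamma>, of "\<nu> n" x] poisson_conv_nonneg[OF \<gamma>, of "\<mu> n" x] by (simp add: f_def)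
  have intW: "integrable lborel (\<lambda>x. V x * V x * f n x)" and leW: "(\<integral>x. V x * V x * f n x \<partial>lborel) \<le> Q" for n
  proof -
    note a = c(2)[OF \<nu>(1) \<nu>(2) \<nu>(3), of n] and b = c(2)[OF \<mu>(1) \<mu>(2) \<mu>(3), of n]
    have le: "V x * V x * f n x \<le> sqrt (1 + \<bar>x\<bar>) * poisson_conv \<gamma> (\<nu> n) x + sqrt (1 + \<bar>x\<bar>) * poisson_conv \<gamma> (\<mu> n) x" for x
      unfolding VV distrib_left[symmetric] using V1[of x] by (intro mult_left_mono fle) auto
    have nn: "0 \<le> V x * V x * f n x" for x using V1[of x] f0[of n x] by auto
    show int: "integrable lborel (\<lambda>x. V x * V x * f n x)"
      by (rule Bochner_Integration.integrable_bound[OF Bochner_Integration.integrable_add[OF conjunct1[OF a] conjunct1[OF b]]])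
         (use le nn in \<open>auto simp: abs_of_nonneg intro!: order_trans[OF le abs_ge_self]\<close>)
    have "(\<integral>x. V x * V x * f n x \<partial>lborel) \<le> (\<integral>x. sqrt (1 + \<bar>x\<bar>) * poisson_conv \<gamma> (\<nu> n) x + sqrt (1 + \<bar>x\<bar>) * poisson_conv \<gamma> (\<mu> n) x \<partial>lborel)"
      by (rule integral_mono[OF int Bochner_Integration.integrable_add[OF conjunct1[OF a] conjunct1[OF b]] le])
    also have "\<dots> \<le> Q" using a b by (simp add: Q_def)
    finally show "(\<integral>x. V x * V x * f n x \<partial>lborel) \<le> Q" .
  qed
  have intV: "integrable lborel (\<lambda>x. V x * f n x)" for n
  proof (rule Bochner_Integration.integrable_bound[OF intW[of n]])
    have "V x * f n x \<le> V x * V x * f n x" for x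
      using V1[of x] f0[of n x] by (intro mult_right_mono) (auto simp: mult_le_cancel_left1)
    thus "AE x in lborel. norm (V x * f n x) \<le> norm (V x * V x * f n x)"
      using V1 f0 by (auto simp: abs_mult abs_of_nonneg intro!: AE_I2) (smt (verit))
  qed measurable
  have fbd: "f n x \<le> 2 / (pi * \<gamma>)" for n x
  proof -
    have "poisson_conv \<gamma> \<kappa> x \<le> 1 / (pi * \<gamma>)" if "real_distribution \<kappa>" for \<kappa>
    proof -
      interpret real_distribution \<kappa> by fact
      have "- Im (cauchy_transform \<kappa> (Complex x \<gamma>)) \<le> 1 / \<gamma>"
        using cauchy_norm_le[of "Complex x \<gamma>"] abs_Im_le_cmod[of "cauchy_transform \<kappa> (Complex x \<gamma>)"] \<gamma> by simp
      hence "(1 / pi) * (- Im (cauchy_transform \<kappa> (Complex x \<gamma>))) \<le> (1 / pi) * (1 / \<gamma>)" by (intro mult_left_mono) auto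
      thus ?thesis unfolding poisson_conv_eq[OF \<gamma>] by simp
    qed
    from this[OF \<nu>(1)[of n]] this[OF \<mu>(1)[of n]] fle[of n x] show ?thesis by simp
  qed
  have flim: "(\<lambda>n. f n x) \<longlonglongrightarrow> 0" for x
  proof -
    have "(\<lambda>n. \<bar>- (1 / pi) * Im (cauchy_transform (\<nu> n) (Complex x \<gamma>) - cauchy_transform (\<mu> n) (Complex x \<gamma>))\<bar>) \<longlonglongrightarrow> \<bar>- (1 / pi) * Im 0\<bar>"
      by (intro tendsto_intros lim) (use \<gamma> in auto)
    moreover have "f n x = \<bar>- (1 / pi) * Im (cauchy_transform (\<nu> n) (Complex x \<gamma>) - cauchy_transform (\<mu> n) (Complex x \<gamma>))\<bar>" for n
      unfolding f_def real_distribution.poisson_conv_eq[OF \<nu>(1) \<gamma>] real_distribution.poisson_conv_eq[OF \<mu>(1) \<gamma>]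
      by (simp only: minus_complex.simps right_diff_distrib)
    ultimately show ?thesis by simp
  qed
  have loc: "(\<lambda>n. \<integral>x. indicator {-T..T} x *\<^sub>R f n x \<partial>lborel) \<longlonglongrightarrow> (\<integral>x. indicator {-T..T} x *\<^sub>R 0 \<partial>lborel)" for T :: real
  proof (rule integral_dominated_convergence[where w="\<lambda>x. indicator {-T..T} x *\<^sub>R (2 / (pi * \<gamma>))"])
    show "AE x in lborel. (\<lambda>n. indicator {-T..T} x *\<^sub>R f n x) \<longlonglongrightarrow> indicator {-T..T} x *\<^sub>R 0"
      by (intro AE_I2 tendsto_intros flim)
    show "AE x in lborel. norm (indicator {-T..T} x *\<^sub>R f n x) \<le> indicator {-T..T} x *\<^sub>R (2 / (pi * \<gamma>))" for n
      using f0 fbd by (intro AE_I2) (auto simp: indicator_def abs_of_nonneg)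
  qed (auto simp del: times_divide_eq_right intro!: integrable_real_indicator integrable_mult_left emeasure_lborel_cbox_finite[where 'a=real, unfolded cbox_interval])
  \<comment> \<open>Inside the interval \<open>V x \<le> V T\<close>; outside it
    \<open>V x / V T\<close> is at least 1 and supplies the second factor \<open>V\<close>.\<close>
  have split: "(\<integral>x. V x * f n x \<partial>lborel) \<le> V T * (\<integral>x. indicator {-T..T} x *\<^sub>R f n x \<partial>lborel) + Q / V T" if "0 \<le> T" for n T
  proof -
    have ii: "integrable lborel (\<lambda>x. indicator {-T..T} x *\<^sub>R f n x)"
    proof (rule Bochner_Integration.integrable_bound[where f="\<lambda>x. indicator {-T..T} x *\<^sub>R (2 / (pi * \<gamma>))"])
      show "AE x in lborel. norm (indicator {-T..T} x *\<^sub>R f n x) \<le> norm (indicator {-T..T} x *\<^sub>R (2 / (pi * \<gamma>)))"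
        using f0[of n] fbd[of n] \<gamma> by (intro AE_I2) (auto simp: indicator_def abs_of_nonneg)
    qed (auto simp del: times_divide_eq_right intro!: integrable_real_indicator integrable_mult_left emeasure_lborel_cbox_finite[where 'a=real, unfolded cbox_interval])
    have "(\<integral>x. V x * f n x \<partial>lborel) \<le> (\<integral>x. V T * (indicator {-T..T} x *\<^sub>R f n x) + (1 / V T) * (V x * V x * f n x) \<partial>lborel)"
    proof (rule integral_mono[OF intV])
      show "integrable lborel (\<lambda>x. V T * (indicator {-T..T} x *\<^sub>R f n x) + (1 / V T) * (V x * V x * f n x))"
        by (intro Bochner_Integration.integrable_add integrable_mult_right ii intW)
      fix x :: real
      have T0: "0 < V T" using V1[of T] by linarith
      show "V x * f n x \<le> V T * (indicator {-T..T} x *\<^sub>R f n x) + (1 / V T) * (V x * V x * f n x)"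
      proof (cases "x \<in> {-T..T}")
        case True
        hence "V x \<le> V T" unfolding V_def by auto
        hence "V x * f n x \<le> V T * f n x" using f0 by (intro mult_right_mono)
        moreover have "0 \<le> (1 / V T) * (V x * V x * f n x)" using T0 V1[of x] f0[of n x] by auto
        ultimately show ?thesis using True by simp
      next
        case False
        hence "\<bar>T\<bar> \<le> \<bar>x\<bar>" using that by auto
        hence "V T \<le> V x" unfolding V_def by auto
        hence "1 \<le> (1 / V T) * V x" using T0 by simp
        hence "1 * (V x * f n x) \<le> ((1 / V T) * V x) * (V x * f n x)" using V1[of x] f0[of n x] by (intro mult_right_mono) auto
        thus ?thesis using False by (simp add: mult_ac)
      qed
    qed
    also have "\<dots> = V T * (\<integral>x. indicator {-T..T} x *\<^sub>R f n x \<partial>lborel) + (1 / V T) * (\<integral>x. V x * V x * f n x \<partial>lborel)"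
      by (subst Bochner_Integration.integral_add[OF integrable_mult_right[OF ii] integrable_mult_right[OF intW]])
         (simp only: integral_mult_right_zero)
    also have "(1 / V T) * (\<integral>x. V x * V x * f n x \<partial>lborel) \<le> (1 / V T) * Q"
      using V1[of T] by (intro mult_left_mono leW) auto
    finally show ?thesis by simp
  qed
  have Vlim: "((\<lambda>T. Q / V T) \<longlongrightarrow> 0) at_top"
    unfolding V_def by real_asymp
  have "(\<lambda>n. \<integral>x. V x * f n x \<partial>lborel) \<longlonglongrightarrow> 0"
  proof (rule LIMSEQ_I)
    fix r :: real assume r: "0 < r"
    have "\<forall>\<^sub>F T in at_top. dist (Q / V T) 0 < r / 2" by (rule tendstoD[OF Vlim]) (use r in simp)
    then obtain T where T: "0 \<le> T" "\<bar>Q / V T\<bar> < r / 2"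
      unfolding eventually_at_top_linorder by (metis dist_0_norm dist_commute max.cobounded1 max.cobounded2 real_norm_def)
    have "(\<lambda>n. V T * (\<integral>x. indicator {-T..T} x *\<^sub>R f n x \<partial>lborel)) \<longlonglongrightarrow> V T * (\<integral>x. indicator {-T..T} x *\<^sub>R 0 \<partial>lborel)"
      by (intro tendsto_intros loc)
    hence "(\<lambda>n. V T * (\<integral>x. indicator {-T..T} x *\<^sub>R f n x \<partial>lborel)) \<longlonglongrightarrow> 0" by simp
    hence "\<exists>N. \<forall>n\<ge>N. norm (V T * (\<integral>x. indicator {-T..T} x *\<^sub>R f n x \<partial>lborel) - 0) < r / 2"
      by (rule LIMSEQ_D) (use r in simp)
    then obtain N where N: "\<And>n. N \<le> n \<Longrightarrow> \<bar>V T * (\<integral>x. indicator {-T..T} x *\<^sub>R f n x \<partial>lborel)\<bar> < r / 2"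
      unfolding diff_zero real_norm_def by blast
    have "norm ((\<integral>x. V x * f n x \<partial>lborel) - 0) < r" if "N \<le> n" for n
    proof -
      have "0 \<le> (\<integral>x. V x * f n x \<partial>lborel)" using V1 f0
        by (intro integral_nonneg_AE AE_I2 mult_nonneg_nonneg) (auto intro: order_trans[OF zero_le_one])
      thus ?thesis using split[OF T(1), of n] N[OF that] T(2) unfolding diff_zero real_norm_def by linarith
    qed
    thus "\<exists>N. \<forall>n\<ge>N. norm ((\<integral>x. V x * f n x \<partial>lborel) - 0) < r" by blast
  qed
  thus ?thesis unfolding V_def f_def .
qed

text \<open>The right side involves \<open>\<kappa>\<close> only through \<open>C\<close>. With one
  \<open>C\<close> for a whole set of measures it bounds the supremum over them.\<close>

lemma cross_entropy_difference_bound: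
  assumes \<gamma>: "0 < \<gamma>"
    and \<nu>: "real_distribution \<nu>" "integrable \<nu> (\<lambda>t. \<bar>t\<bar>)"
    and \<mu>: "real_distribution \<mu>" "integrable \<mu> (\<lambda>t. \<bar>t\<bar>)"
    and \<kappa>: "real_distribution \<kappa>" "\<And>x. \<bar>cauchy_loss \<gamma> x \<kappa>\<bar> \<le> C * sqrt (sqrt (1 + \<bar>x\<bar>))"
  shows "\<bar>cauchy_cross_entropy \<gamma> \<nu> \<kappa> - cauchy_cross_entropy \<gamma> \<mu> \<kappa>\<bar>
     \<le> C * (\<integral>x. sqrt (sqrt (1 + \<bar>x\<bar>)) * \<bar>poisson_conv \<gamma> \<nu> x - poisson_conv \<gamma> \<mu> x\<bar> \<partial>lborel)"
proof -
  note [measurable] = poisson_conv_measurable[OF \<nu>(1) \<gamma>] poisson_conv_measurable[OF \<mu>(1) \<gamma>] cauchy_loss_measurable[OF \<kappa>(1) \<gamma>]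
  have C0: "0 \<le> C" using \<kappa>(2)[of 0] by simp
  have iV: "integrable lborel (\<lambda>x. sqrt (sqrt (1 + \<bar>x\<bar>)) * poisson_conv \<gamma> \<rho> x)"
    if "real_distribution \<rho>" "integrable \<rho> (\<lambda>t. \<bar>t\<bar>)" for \<rho>
  proof -
    note [measurable] = poisson_conv_measurable[OF that(1) \<gamma>]
    have i: "integrable lborel (\<lambda>x. sqrt (1 + \<bar>x\<bar>) * poisson_conv \<gamma> \<rho> x)"
      using weighted_poisson_conv_bound[OF \<gamma>] that by blast
    show ?thesis
    proof (rule Bochner_Integration.integrable_bound[OF i])
      have "sqrt (sqrt (1 + \<bar>x\<bar>)) \<le> sqrt (1 + \<bar>x\<bar>)" for x :: real
        using real_sqrt_le_mono[of "sqrt (1 + \<bar>x\<bar>)" "(sqrt (1 + \<bar>x\<bar>))\<^sup>2"] mult_left_mono[of 1 "sqrt (1 + \<bar>x\<bar>)" "sqrt (1 + \<bar>x\<bar>)"]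
        by (simp add: power2_eq_square)
      thus "AE x in lborel. norm (sqrt (sqrt (1 + \<bar>x\<bar>)) * poisson_conv \<gamma> \<rho> x) \<le> norm (sqrt (1 + \<bar>x\<bar>) * poisson_conv \<gamma> \<rho> x)"
        using poisson_conv_nonneg[OF \<gamma>, of \<rho>] by (intro AE_I2) (auto simp: abs_mult abs_of_nonneg intro!: mult_right_mono)
    qed measurable
  qed
  have il: "integrable lborel (\<lambda>x. cauchy_loss \<gamma> x \<kappa> * poisson_conv \<gamma> \<rho> x)"
    if "real_distribution \<rho>" "integrable \<rho> (\<lambda>t. \<bar>t\<bar>)" for \<rho>
  proof -
    note [measurable] = poisson_conv_measurable[OF that(1) \<gamma>]
    show ?thesis
    proof (rule Bochner_Integration.integrable_bound[OF integrable_mult_right[OF iV[OF that], of C]])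
      show "AE x in lborel. norm (cauchy_loss \<gamma> x \<kappa> * poisson_conv \<gamma> \<rho> x) \<le> norm (C * (sqrt (sqrt (1 + \<bar>x\<bar>)) * poisson_conv \<gamma> \<rho> x))"
        using poisson_conv_nonneg[OF \<gamma>, of \<rho>] C0 \<kappa>(2)
        by (intro AE_I2) (auto simp: abs_mult abs_of_nonneg mult.assoc[symmetric] intro!: mult_right_mono)
    qed measurable
  qed
  have "cauchy_cross_entropy \<gamma> \<nu> \<kappa> - cauchy_cross_entropy \<gamma> \<mu> \<kappa>
     = (\<integral>x. cauchy_loss \<gamma> x \<kappa> * (poisson_conv \<gamma> \<nu> x - poisson_conv \<gamma> \<mu> x) \<partial>lborel)"
    unfolding cauchy_cross_entropy_def using il[OF \<nu>] il[OF \<mu>] by (simp add: right_diff_distrib)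
  also have "\<bar>\<dots>\<bar> \<le> (\<integral>x. C * (sqrt (sqrt (1 + \<bar>x\<bar>)) * \<bar>poisson_conv \<gamma> \<nu> x - poisson_conv \<gamma> \<mu> x\<bar>) \<partial>lborel)"
  proof (unfold real_norm_def[symmetric], rule order_trans[OF integral_norm_bound], rule integral_mono)
    have "integrable lborel (\<lambda>x. \<bar>sqrt (sqrt (1 + \<bar>x\<bar>)) * poisson_conv \<gamma> \<nu> x - sqrt (sqrt (1 + \<bar>x\<bar>)) * poisson_conv \<gamma> \<mu> x\<bar>)"
      by (intro integrable_abs Bochner_Integration.integrable_diff iV \<nu> \<mu>)
    hence "integrable lborel (\<lambda>x. sqrt (sqrt (1 + \<bar>x\<bar>)) * \<bar>poisson_conv \<gamma> \<nu> x - poisson_conv \<gamma> \<mu> x\<bar>)"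
      unfolding right_diff_distrib[symmetric] abs_mult by simp
    thus "integrable lborel (\<lambda>x. C * (sqrt (sqrt (1 + norm x)) * norm (poisson_conv \<gamma> \<nu> x - poisson_conv \<gamma> \<mu> x)))"
      by simp
    have "integrable lborel (\<lambda>x. cauchy_loss \<gamma> x \<kappa> * (poisson_conv \<gamma> \<nu> x - poisson_conv \<gamma> \<mu> x))"
      unfolding right_diff_distrib by (intro Bochner_Integration.integrable_diff il \<nu> \<mu>)
    thus "integrable lborel (\<lambda>x. norm (cauchy_loss \<gamma> x \<kappa> * (poisson_conv \<gamma> \<nu> x - poisson_conv \<gamma> \<mu> x)))" by (rule integrable_norm)
    show "norm (cauchy_loss \<gamma> x \<kappa> * (poisson_conv \<gamma> \<nu> x - poisson_conv \<gamma> \<mu> x)) \<le> C * (sqrt (sqrt (1 + norm x)) * norm (poisson_conv \<gamma> \<nu> x - poisson_conv \<gamma> \<mu> x))" for x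
      using \<kappa>(2)[of x] by (simp add: abs_mult mult.assoc[symmetric] mult_right_mono)
  qed
  finally show ?thesis by simp
qed

section \<open>Finitely supported infinite matrices\<close>

text \<open>Finitely supported infinite matrices with the Hilbert--Schmidt norm: one normed algebra that
  contains the rectangular matrices of all formats, so that no dimension has to be tracked in
  products and derivatives.\<close>

typedef fmat = "{f :: nat \<Rightarrow> nat \<Rightarrow> complex. \<exists>N. \<forall>i j. N \<le> i \<or> N \<le> j \<longrightarrow> f i j = 0}"
  morphisms ent Fmat by (rule exI[of _ "\<lambda>_ _. 0"]) auto

text \<open>The format, as a bound on the support. A matrix has all larger formats as well, so
  matrices of different formats may be added without embedding maps.\<close>

definition car :: "nat \<Rightarrow> nat \<Rightarrow> fmat \<Rightarrow> bool" where
  "car p d X \<longleftrightarrow> (\<forall>i j. p \<le> i \<or> d \<le> j \<longrightarrow> ent X i j = 0)"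

text \<open>Products and traces have to make sense without reference to a format, so the sum runs
  over the support of its summand. \<open>nsum_eq\<close> turns it into a sum over any sufficiently
  long initial range.\<close>

definition nsum :: "(nat \<Rightarrow> complex) \<Rightarrow> complex" where "nsum f = sum f {k. f k \<noteq> 0}"

lemma nsum_eq: assumes "\<And>k. N \<le> k \<Longrightarrow> f k = 0" shows "nsum f = (\<Sum>k<N. f k)"
  unfolding nsum_def using assms by (intro sum.mono_neutral_left) (auto simp: not_less[symmetric])

lemma car_exists: "\<exists>N. car N N X"
  using ent[of X] unfolding car_def by blast

lemma car_mono: "car p d X \<Longrightarrow> p \<le> p' \<Longrightarrow> d \<le> d' \<Longrightarrow> car p' d' X"
  unfolding car_def by (meson le_trans)

lemma car_common2: "\<exists>N. car N N X \<and> car N N Y"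
proof -
  obtain a b where "car a a X" "car b b Y" using car_exists by blast
  thus ?thesis by (intro exI[of _ "max a b"]) (auto intro: car_mono)
qed

lemma car_common3: "\<exists>N. car N N X \<and> car N N Y \<and> car N N Z"
proof -
  obtain a b where "car a a X \<and> car a a Y" "car b b Z" using car_common2 car_exists by blast
  thus ?thesis by (intro exI[of _ "max a b"]) (auto intro: car_mono)
qed

lemma fmat_eqI: "(\<And>i j. ent X i j = ent Y i j) \<Longrightarrow> X = Y"
  by (metis ent_inject ext)

lemma ent_Fmat: "\<forall>i j. N \<le> i \<or> N \<le> j \<longrightarrow> f i j = 0 \<Longrightarrow> ent (Fmat f) = f"
  by (rule Fmat_inverse) blast

instantiation fmat :: ab_group_add begin
definition "0 = Fmat (\<lambda>_ _. 0)"
definition "X + Y = Fmat (\<lambda>i j. ent X i j + ent Y i j)"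
definition "- X = Fmat (\<lambda>i j. - ent X i j)"
definition "X - Y = Fmat (\<lambda>i j. ent X i j - ent Y i j)" for X :: fmat
lemma ent_zero [simp]: "ent 0 i j = 0"
  unfolding zero_fmat_def by (subst ent_Fmat[of 0]) auto
lemma ent_add [simp]: "ent (X + Y) i j = ent X i j + ent Y i j"
proof -
  obtain N where "car N N X \<and> car N N Y" using car_common2 by blast
  thus ?thesis unfolding plus_fmat_def by (subst ent_Fmat[of N]) (auto simp: car_def)
qed
lemma ent_uminus [simp]: "ent (- X) i j = - ent X i j"
proof -
  obtain N where "car N N X" using car_exists by blast
  thus ?thesis unfolding uminus_fmat_def by (subst ent_Fmat[of N]) (auto simp: car_def)
qed
lemma ent_diff [simp]: "ent (X - Y) i j = ent X i j - ent Y i j"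
proof -
  obtain N where "car N N X \<and> car N N Y" using car_common2 by blast
  thus ?thesis unfolding minus_fmat_def by (subst ent_Fmat[of N]) (auto simp: car_def)
qed
instance by standard (auto intro!: fmat_eqI)
end

definition cs :: "complex \<Rightarrow> fmat \<Rightarrow> fmat" where "cs c X = Fmat (\<lambda>i j. c * ent X i j)"
definition adj :: "fmat \<Rightarrow> fmat" where "adj X = Fmat (\<lambda>i j. cnj (ent X j i))"
definition tr :: "fmat \<Rightarrow> complex" where "tr X = nsum (\<lambda>i. ent X i i)"
definition dg :: "nat \<Rightarrow> (nat \<Rightarrow> complex) \<Rightarrow> fmat" where
  "dg n f = Fmat (\<lambda>i j. if i = j \<and> i < n then f i else 0)"
text \<open>The algebra has no unit. \<open>Idn n\<close> acts as one on matrices of matching format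
  only, which explains the \<open>car\<close> hypotheses of \<open>Idn_mult\<close> and
  \<open>mult_Idn\<close>.\<close>

abbreviation Idn :: "nat \<Rightarrow> fmat" where "Idn n \<equiv> dg n (\<lambda>_. 1)"

lemma ent_cs [simp]: "ent (cs c X) i j = c * ent X i j"
proof -
  obtain N where "car N N X" using car_exists by blast
  thus ?thesis unfolding cs_def by (subst ent_Fmat[of N]) (auto simp: car_def)
qed

lemma ent_adj [simp]: "ent (adj X) i j = cnj (ent X j i)"
proof -
  obtain N where "car N N X" using car_exists by blast
  thus ?thesis unfolding adj_def by (subst ent_Fmat[of N]) (auto simp: car_def)
qed

lemma ent_dg [simp]: "ent (dg n f) i j = (if i = j \<and> i < n then f i else 0)"
  unfolding dg_def by (subst ent_Fmat[of n]) auto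

lemma tr_eq: "car N N X \<Longrightarrow> tr X = (\<Sum>i<N. ent X i i)"
  unfolding tr_def by (rule nsum_eq) (auto simp: car_def)

instantiation fmat :: times begin
definition "X * Y = Fmat (\<lambda>i j. nsum (\<lambda>k. ent X i k * ent Y k j))"
instance ..
end

lemma ent_mult: "ent (X * Y) i j = nsum (\<lambda>k. ent X i k * ent Y k j)"
proof -
  obtain N where N: "car N N X \<and> car N N Y" using car_common2 by blast
  show ?thesis unfolding times_fmat_def
    by (subst ent_Fmat[of N]) (use N in \<open>auto simp: car_def nsum_def\<close>)
qed

lemma ent_mult_eq: "car p d X \<Longrightarrow> ent (X * Y) i j = (\<Sum>k<d. ent X i k * ent Y k j)"
  unfolding ent_mult by (rule nsum_eq) (auto simp: car_def)

lemma ent_mult_eq': "car d n Y \<Longrightarrow> ent (X * Y) i j = (\<Sum>k<d. ent X i k * ent Y k j)"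
  unfolding ent_mult by (rule nsum_eq) (auto simp: car_def)

lemma car_mult: "car p d X \<Longrightarrow> car d' n Y \<Longrightarrow> car p n (X * Y)"
  unfolding car_def ent_mult nsum_def by auto

lemma car_add: "car p d X \<Longrightarrow> car p d Y \<Longrightarrow> car p d (X + Y)"
  and car_diff: "car p d X \<Longrightarrow> car p d Y \<Longrightarrow> car p d (X - Y)"
  and car_cs: "car p d X \<Longrightarrow> car p d (cs c X)"
  and car_adj: "car p d X \<Longrightarrow> car d p (adj X)"
  and car_dg: "car n n (dg n f)"
  and car_zero: "car p d 0"
  by (auto simp: car_def)

lemmas car_intros = car_mult car_add car_diff car_cs car_adj car_dg car_zero

lemma Re_mult_cnj: "Re (a * cnj a) = (cmod a)\<^sup>2"
  unfolding cmod_power2 by (simp add: power2_eq_square)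

instantiation fmat :: real_inner begin
definition "scaleR r X = cs (complex_of_real r) X"
definition "inner X Y = Re (tr (X * adj Y))"
definition "norm X = sqrt (inner X X)" for X :: fmat
definition "sgn X = inverse (norm X) *\<^sub>R X" for X :: fmat
definition "dist X Y = norm (X - Y)" for X :: fmat
definition "(uniformity :: (fmat \<times> fmat) filter) = (INF e\<in>{0 <..}. principal {(x, y). dist x y < e})"
definition "open (U :: fmat set) \<longleftrightarrow> (\<forall>x\<in>U. \<forall>\<^sub>F (x', y) in uniformity. x' = x \<longrightarrow> y \<in> U)"

lemma inner_fmat_eq: assumes "car N N X" "car N N Y"
  shows "X \<bullet> Y = (\<Sum>i<N. \<Sum>j<N. Re (ent X i j * cnj (ent Y i j)))"
  unfolding inner_fmat_def using assms
  by (subst tr_eq[of N]) (auto intro!: car_intros simp: ent_mult_eq[OF assms(1)])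

instance
proof
  fix X Y Z :: fmat and r s :: real
  obtain N where N: "car N N X" "car N N Y" "car N N Z" using car_common3 by blast
  have NXY: "car N N (X + Y)" using N by (intro car_intros)
  have Nr: "car N N (r *\<^sub>R X)" unfolding scaleR_fmat_def using N by (intro car_intros)
  show "r *\<^sub>R (X + Y) = r *\<^sub>R X + r *\<^sub>R Y" "(r + s) *\<^sub>R X = r *\<^sub>R X + s *\<^sub>R X"
     "r *\<^sub>R s *\<^sub>R X = (r * s) *\<^sub>R X" "1 *\<^sub>R X = X"
    by (auto intro!: fmat_eqI simp: scaleR_fmat_def algebra_simps)
  show "X \<bullet> Y = Y \<bullet> X" unfolding inner_fmat_eq[OF N(1,2)] inner_fmat_eq[OF N(2,1)]
    by (simp add: mult.commute)
  show "(X + Y) \<bullet> Z = X \<bullet> Z + Y \<bullet> Z"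
    unfolding inner_fmat_eq[OF N(1,3)] inner_fmat_eq[OF N(2,3)] inner_fmat_eq[OF NXY N(3)]
    by (simp add: sum.distrib algebra_simps)
  show "r *\<^sub>R X \<bullet> Y = r * (X \<bullet> Y)"
    unfolding inner_fmat_eq[OF N(1,2)] inner_fmat_eq[OF Nr N(2)]
    by (simp add: sum_distrib_left scaleR_fmat_def algebra_simps)
  have sq: "X \<bullet> X = (\<Sum>i<N. \<Sum>j<N. (cmod (ent X i j))\<^sup>2)"
    unfolding inner_fmat_eq[OF N(1,1)] Re_mult_cnj ..
  show "0 \<le> X \<bullet> X" unfolding sq by (intro sum_nonneg) auto
  show "(X \<bullet> X = 0) = (X = 0)"
  proof
    assume "X \<bullet> X = 0"
    hence "\<forall>i<N. \<forall>j<N. ent X i j = 0"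
      unfolding sq by (subst (asm) sum_nonneg_eq_0_iff) (auto intro!: sum_nonneg simp: sum_nonneg_eq_0_iff)
    moreover have "ent X i j = 0" if "N \<le> i \<or> N \<le> j" for i j using N(1) that by (auto simp: car_def)
    ultimately show "X = 0" by (intro fmat_eqI) (metis ent_zero not_less)
  next
    assume "X = 0"
    thus "X \<bullet> X = 0" unfolding sq by simp
  qed
qed (simp_all add: norm_fmat_def sgn_fmat_def dist_fmat_def uniformity_fmat_def open_fmat_def)
end

lemma norm_fmat_sq: assumes "car p d X" shows "(norm X)\<^sup>2 = (\<Sum>i<p. \<Sum>j<d. (cmod (ent X i j))\<^sup>2)"
proof -
  define N where "N = max p d"
  have N: "car N N X" using assms by (rule car_mono) (auto simp: N_def)
  have "(norm X)\<^sup>2 = (\<Sum>i<N. \<Sum>j<N. (cmod (ent X i j))\<^sup>2)"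
    unfolding power2_norm_eq_inner inner_fmat_eq[OF N N] Re_mult_cnj ..
  also have "\<dots> = (\<Sum>i<N. \<Sum>j<d. (cmod (ent X i j))\<^sup>2)"
    using assms by (intro sum.cong refl sum.mono_neutral_right) (auto simp: N_def car_def)
  also have "\<dots> = (\<Sum>i<p. \<Sum>j<d. (cmod (ent X i j))\<^sup>2)"
    using assms by (intro sum.mono_neutral_right) (auto simp: N_def car_def)
  finally show ?thesis .
qed

instance fmat :: real_normed_algebra
proof
  fix X Y Z :: fmat and r :: real
  obtain N where N: "car N N X" "car N N Y" "car N N Z" using car_common3 by blast
  have NXY: "car N N (X * Y)" "car N N (Y * Z)" "car N N (X + Y)" using N by (auto intro: car_intros)
  show "X * Y * Z = X * (Y * Z)"
  proof (rule fmat_eqI)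
    fix i j
    have "ent (X * Y * Z) i j = (\<Sum>k<N. (\<Sum>l<N. ent X i l * ent Y l k) * ent Z k j)"
      by (simp add: ent_mult_eq[OF NXY(1)] ent_mult_eq[OF N(1)])
    also have "\<dots> = (\<Sum>l<N. \<Sum>k<N. ent X i l * (ent Y l k * ent Z k j))"
      by (subst sum.swap) (simp add: sum_distrib_right mult.assoc)
    also have "\<dots> = ent (X * (Y * Z)) i j"
      by (simp add: ent_mult_eq[OF N(1)] ent_mult_eq[OF N(2)] sum_distrib_left)
    finally show "ent (X * Y * Z) i j = ent (X * (Y * Z)) i j" .
  qed
  show "(X + Y) * Z = X * Z + Y * Z"
    by (rule fmat_eqI) (simp add: ent_mult_eq[OF N(1)] ent_mult_eq[OF N(2)] ent_mult_eq[OF NXY(3)] sum.distrib algebra_simps)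
  show "X * (Y + Z) = X * Y + X * Z"
    by (rule fmat_eqI) (simp add: ent_mult_eq[OF N(1)] sum.distrib algebra_simps)
  have "car N N (r *\<^sub>R X)" unfolding scaleR_fmat_def using N by (intro car_intros)
  thus "r *\<^sub>R X * Y = r *\<^sub>R (X * Y)"
    by (intro fmat_eqI) (simp add: ent_mult_eq[OF N(1)] ent_mult_eq scaleR_fmat_def sum_distrib_left algebra_simps)
  show "X * r *\<^sub>R Y = r *\<^sub>R (X * Y)"
    by (intro fmat_eqI) (simp add: ent_mult_eq[OF N(1)] scaleR_fmat_def sum_distrib_left algebra_simps)
  have "(norm (X * Y))\<^sup>2 = (\<Sum>i<N. \<Sum>j<N. (cmod (\<Sum>k<N. ent X i k * ent Y k j))\<^sup>2)"
    unfolding norm_fmat_sq[OF NXY(1)] ent_mult_eq[OF N(1)] ..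
  also have "\<dots> \<le> (\<Sum>i<N. \<Sum>j<N. (\<Sum>k<N. (cmod (ent X i k))\<^sup>2) * (\<Sum>k<N. (cmod (ent Y k j))\<^sup>2))"
  proof (intro sum_mono)
    fix i j
    have "cmod (\<Sum>k<N. ent X i k * ent Y k j) \<le> (\<Sum>k<N. cmod (ent X i k) * cmod (ent Y k j))"
      by (rule sum_norm_le) (simp add: norm_mult)
    hence "(cmod (\<Sum>k<N. ent X i k * ent Y k j))\<^sup>2 \<le> (\<Sum>k<N. cmod (ent X i k) * cmod (ent Y k j))\<^sup>2"
      by (rule power_mono) auto
    also have "\<dots> \<le> (\<Sum>k<N. (cmod (ent X i k))\<^sup>2) * (\<Sum>k<N. (cmod (ent Y k j))\<^sup>2)"
      by (rule Cauchy_Schwarz_ineq_sum)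
    finally show "(cmod (\<Sum>k<N. ent X i k * ent Y k j))\<^sup>2 \<le> (\<Sum>k<N. (cmod (ent X i k))\<^sup>2) * (\<Sum>k<N. (cmod (ent Y k j))\<^sup>2)" .
  qed
  also have "\<dots> = (\<Sum>i<N. \<Sum>k<N. (cmod (ent X i k))\<^sup>2) * (\<Sum>j<N. \<Sum>k<N. (cmod (ent Y k j))\<^sup>2)"
    by (simp add: sum_product)
  also have "(\<Sum>j<N. \<Sum>k<N. (cmod (ent Y k j))\<^sup>2) = (norm Y)\<^sup>2"
    unfolding norm_fmat_sq[OF N(2)] by (rule sum.swap)
  also have "(\<Sum>i<N. \<Sum>k<N. (cmod (ent X i k))\<^sup>2) = (norm X)\<^sup>2"
    unfolding norm_fmat_sq[OF N(1)] ..
  finally have "(norm (X * Y))\<^sup>2 \<le> (norm X * norm Y)\<^sup>2" by (simp add: power_mult_distrib)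
  thus "norm (X * Y) \<le> norm X * norm Y" by (rule power2_le_imp_le) simp
qed

lemma cs_mult_left [simp]: "cs c X * Y = cs c (X * Y)"
  and cs_mult_right [simp]: "X * cs c Y = cs c (X * Y)"
proof -
  obtain N where N: "car N N X \<and> car N N Y" using car_common2 by blast
  hence c: "car N N (cs c X)" by (auto intro: car_intros)
  show "cs c X * Y = cs c (X * Y)" using N
    by (intro fmat_eqI) (simp add: ent_mult_eq[OF c] ent_mult_eq[OF conjunct1[OF N]] sum_distrib_left mult_ac)
  show "X * cs c Y = cs c (X * Y)" using N
    by (intro fmat_eqI) (simp add: ent_mult_eq[OF conjunct1[OF N]] sum_distrib_left mult_ac)
qed

lemma cs_cs [simp]: "cs c (cs d X) = cs (c * d) X" and cs_one [simp]: "cs 1 X = X"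
  and cs_add: "cs c (X + Y) = cs c X + cs c Y" and cs_diff: "cs c (X - Y) = cs c X - cs c Y"
  and cs_zero [simp]: "cs c 0 = 0" and cs_zero_left [simp]: "cs 0 X = 0"
  and cs_add_left: "cs (c + d) X = cs c X + cs d X" and cs_diff_left: "cs (c - d) X = cs c X - cs d X"
  by (auto intro!: fmat_eqI simp: algebra_simps)

lemma adj_mult: "adj (X * Y) = adj Y * adj X"
proof -
  obtain N where N: "car N N X \<and> car N N Y" using car_common2 by blast
  hence c: "car N N (adj Y)" by (auto intro: car_intros)
  show ?thesis using N by (intro fmat_eqI) (simp add: ent_mult_eq[OF c] ent_mult_eq[OF conjunct1[OF N]] mult.commute)
qed

lemma adj_adj [simp]: "adj (adj X) = X" and adj_add: "adj (X + Y) = adj X + adj Y"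
  and adj_diff: "adj (X - Y) = adj X - adj Y"
  and adj_cs: "adj (cs c X) = cs (cnj c) (adj X)" and adj_scaleR: "adj (r *\<^sub>R X) = r *\<^sub>R adj X"
  and adj_dg: "adj (dg n f) = dg n (\<lambda>i. cnj (f i))"
  by (auto intro!: fmat_eqI simp: scaleR_fmat_def)

lemma tr_add: "tr (X + Y) = tr X + tr Y"
proof -
  obtain N where N: "car N N X \<and> car N N Y" using car_common2 by blast
  hence "car N N (X + Y)" by (auto intro: car_intros)
  thus ?thesis using N by (simp add: tr_eq[of N] sum.distrib)
qed

lemma tr_cs: "tr (cs c X) = c * tr X"
proof -
  obtain N where N: "car N N X" using car_exists by blast
  hence "car N N (cs c X)" by (auto intro: car_intros)
  thus ?thesis using N by (simp add: tr_eq[of N] sum_distrib_left)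
qed

lemma tr_scaleR: "tr (r *\<^sub>R X) = r *\<^sub>R tr X"
  unfolding scaleR_fmat_def tr_cs by (simp add: scaleR_conv_of_real)

lemma tr_diff: "tr (X - Y) = tr X - tr Y"
proof -
  have "X - Y = X + cs (-1) Y" by (rule fmat_eqI) simp
  thus ?thesis by (simp only: tr_add tr_cs) simp
qed

lemma tr_zero [simp]: "tr 0 = 0" using tr_cs[of 0 0] by simp

lemma tr_sum: "tr (sum f A) = (\<Sum>a\<in>A. tr (f a))"
  by (induction A rule: infinite_finite_induct) (auto simp: tr_add)

lemma tr_dg: "tr (dg n f) = (\<Sum>i<n. f i)"
  by (subst tr_eq[OF car_dg]) simp

lemma tr_mult_eq: assumes "car p d X" "car d p Y" shows "tr (X * Y) = (\<Sum>i<p. \<Sum>k<d. ent X i k * ent Y k i)"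
  using tr_eq[OF car_mult[OF assms]] by (simp add: ent_mult_eq[OF assms(1)])

lemma tr_comm: "tr (X * Y) = tr (Y * X)"
proof -
  obtain N where N: "car N N X \<and> car N N Y" using car_common2 by blast
  thus ?thesis unfolding tr_mult_eq[OF conjunct1[OF N] conjunct2[OF N]] tr_mult_eq[OF conjunct2[OF N] conjunct1[OF N]]
    by (subst sum.swap) (simp add: mult.commute)
qed

lemma tr_adj: "tr (adj X) = cnj (tr X)"
proof -
  obtain N where N: "car N N X" using car_exists by blast
  thus ?thesis by (simp add: tr_eq[OF N] tr_eq[OF car_adj[OF N]])
qed

lemma tr_mult_adj: "tr (X * adj X) = complex_of_real ((norm X)\<^sup>2)"
proof -
  obtain N where N: "car N N X" using car_exists by blast
  have "tr (X * adj X) = (\<Sum>i<N. \<Sum>k<N. ent X i k * cnj (ent X i k))"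
    unfolding tr_mult_eq[OF N car_adj[OF N]] by simp
  also have "\<dots> = complex_of_real ((norm X)\<^sup>2)"
    unfolding norm_fmat_sq[OF N] by (simp only: of_real_sum complex_norm_square)
  finally show ?thesis .
qed

lemma norm_adj [simp]: "norm (adj X) = norm X"
proof -
  have "complex_of_real ((norm (adj X))\<^sup>2) = complex_of_real ((norm X)\<^sup>2)"
    unfolding tr_mult_adj[symmetric] by (simp add: tr_comm)
  thus ?thesis by (simp only: of_real_eq_iff power2_eq_iff_nonneg norm_ge_zero)
qed

lemma norm_cs [simp]: "norm (cs c X) = cmod c * norm X"
proof -
  have "complex_of_real ((norm (cs c X))\<^sup>2) = complex_of_real ((cmod c * norm X)\<^sup>2)"
    unfolding tr_mult_adj[symmetric]
    by (simp add: adj_cs tr_cs tr_mult_adj power_mult_distrib complex_norm_square[of c, symmetric] mult.commute[of "cnj c"])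
  hence "(norm (cs c X))\<^sup>2 = (cmod c * norm X)\<^sup>2" by (simp only: of_real_eq_iff)
  thus ?thesis by (metis mult_nonneg_nonneg norm_ge_zero power2_eq_iff_nonneg)
qed

lemma tr_mult_norm_le: "cmod (tr (X * Y)) \<le> norm X * norm Y"
proof (cases "tr (X * Y) = 0")
  case False
  \<comment> \<open>The real inner product sees only the real part of the trace, so its phase is
    rotated away before Cauchy-Schwarz is applied.\<close>
  define c where "c = cnj (sgn (tr (X * Y)))"
  have c: "cmod c = 1" using False by (simp add: c_def norm_sgn)
  have "cs c X \<bullet> adj Y = Re (c * tr (X * Y))" unfolding inner_fmat_def by (simp add: tr_cs)
  also have "c * tr (X * Y) = complex_of_real (cmod (tr (X * Y)))"
    using False by (simp add: c_def sgn_eq complex_norm_square[symmetric] power2_eq_square mult.commute[of "cnj _"])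
  finally have "cmod (tr (X * Y)) \<le> norm (cs c X) * norm (adj Y)"
    using norm_cauchy_schwarz[of "cs c X" "adj Y"] by simp
  thus ?thesis using c by simp
qed auto

lemma bounded_bilinear_tr: "bounded_bilinear (\<lambda>X Y. tr (X * Y))"
proof
  show "\<exists>K. \<forall>X Y. cmod (tr (X * Y)) \<le> norm X * norm Y * K"
    using tr_mult_norm_le by (intro exI[of _ 1]) auto
qed (auto simp: tr_add tr_scaleR algebra_simps)

lemma bounded_linear_adj: "bounded_linear adj"
  by standard (auto simp: adj_add adj_scaleR intro!: exI[of _ 1])

lemma bounded_bilinear_cs: "bounded_bilinear cs"
  by standard (auto simp: cs_add cs_add_left scaleR_fmat_def scaleR_conv_of_real mult_ac intro!: exI[of _ 1])

lemma ent_dg_mult: "ent (dg n f * X) i j = (if i < n then f i * ent X i j else 0)"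
proof -
  have "ent (dg n f * X) i j = (\<Sum>k<n. if k = i then f i * ent X i j else 0)"
    unfolding ent_mult_eq[OF car_dg] by (intro sum.cong) auto
  thus ?thesis by simp
qed

lemma dg_mult_dg: "dg n f * dg n g = dg n (\<lambda>i. f i * g i)"
  by (rule fmat_eqI) (simp add: ent_dg_mult)

lemma dg_diff: "dg n f - dg n g = dg n (\<lambda>i. f i - g i)" and dg_add: "dg n f + dg n g = dg n (\<lambda>i. f i + g i)"
  and cs_dg: "cs c (dg n f) = dg n (\<lambda>i. c * f i)"
  by (auto intro!: fmat_eqI)

lemma dg_cong: "(\<And>i. i < n \<Longrightarrow> f i = g i) \<Longrightarrow> dg n f = dg n g"
  by (auto intro!: fmat_eqI)

lemma Idn_mult: "car n d X \<Longrightarrow> Idn n * X = X"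
  by (rule fmat_eqI) (auto simp: ent_dg_mult car_def)

lemma mult_Idn: "car d n X \<Longrightarrow> X * Idn n = X"
proof -
  assume "car d n X"
  hence "adj (Idn n * adj X) = adj (adj X)" using Idn_mult[OF car_adj] by metis
  thus ?thesis by (simp add: adj_mult adj_dg)
qed

text \<open>A diagonal factor counts with its largest entry and not with its Hilbert-Schmidt norm,
  which can be larger by a factor \<open>sqrt n\<close> and would spoil the rate in the
  dimension.\<close>

lemma norm_dg_mult_le: assumes "\<And>i. i < n \<Longrightarrow> cmod (f i) \<le> c" "0 \<le> c"
  shows "norm (dg n f * X) \<le> c * norm X"
proof -
  obtain N where N: "car N N X" using car_exists by blast
  define m where "m = max n N"
  have N': "car m m X" using N by (rule car_mono) (auto simp: m_def)
  have N'': "car m m (dg n f * X)" using car_mult[OF car_mono[OF car_dg, of n m m f] N'] by (simp add: m_def)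
  have "(norm (dg n f * X))\<^sup>2 \<le> (\<Sum>i<m. \<Sum>j<m. c\<^sup>2 * (cmod (ent X i j))\<^sup>2)"
    unfolding norm_fmat_sq[OF N''] ent_dg_mult
    using assms by (intro sum_mono) (auto simp: norm_mult power_mult_distrib intro!: mult_right_mono power_mono)
  also have "\<dots> = (c * norm X)\<^sup>2" unfolding power_mult_distrib norm_fmat_sq[OF N'] by (simp add: sum_distrib_left)
  finally show ?thesis by (rule power2_le_imp_le) (use assms(2) in auto)
qed

lemma norm_mult_dg_le: assumes "\<And>i. i < n \<Longrightarrow> cmod (f i) \<le> c" "0 \<le> c"
  shows "norm (X * dg n f) \<le> c * norm X"
proof -
  have "norm (X * dg n f) = norm (dg n (\<lambda>i. cnj (f i)) * adj X)"
    by (metis adj_dg adj_mult norm_adj)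
  also have "\<dots> \<le> c * norm (adj X)" by (rule norm_dg_mult_le) (use assms in auto)
  finally show ?thesis by simp
qed

section \<open>Gaussian integration by parts\<close>

definition gauss :: "real \<Rightarrow> real measure" where
  "gauss \<sigma> = density lborel (\<lambda>x. ennreal (normal_density 0 \<sigma> x))"

lemma sets_gauss [simp, measurable_cong]: "sets (gauss \<sigma>) = sets borel" and space_gauss [simp]: "space (gauss \<sigma>) = UNIV"
  by (auto simp: gauss_def)

lemma prob_space_gauss: "0 < \<sigma> \<Longrightarrow> prob_space (gauss \<sigma>)"
  unfolding gauss_def by (rule prob_space_normal_density)

lemma integrable_gauss_moment: assumes "0 < \<sigma>" shows "integrable (gauss \<sigma>) (\<lambda>x. x ^ k)"
  unfolding gauss_def
  using integrable_normal_moment[OF assms, of 0 k] by (subst integrable_density) (auto simp: normal_density_nonneg)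

text \<open>The derivative of \<open>\<phi> F\<close> is
  \<open>\<phi> F' - (t / \<sigma>^2) \<phi> F\<close>, and it integrates to 0 since
  \<open>\<phi> F\<close> vanishes at both ends. Fourth powers in the growth condition cover the
  cubic \<open>x * sq x\<close>, the fastest growing function to which the formula is
  applied.\<close>

lemma gauss_stein:
  fixes F F' :: "real \<Rightarrow> complex"
  assumes \<sigma>: "0 < \<sigma>" and F: "\<And>t. (F has_vector_derivative F' t) (at t)" and F': "continuous_on UNIV F'"
    and b: "\<And>t. cmod (F t) \<le> C * (1 + t^4)" "\<And>t. cmod (F' t) \<le> C * (1 + t^4)"
  shows "(\<integral>t. t *\<^sub>R F t \<partial>gauss \<sigma>) = \<sigma>\<^sup>2 *\<^sub>R (\<integral>t. F' t \<partial>gauss \<sigma>)"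
proof -
  define \<phi> where "\<phi> = normal_density 0 \<sigma>"
  have \<phi>_def': "\<phi> t = exp (- t\<^sup>2 / (2 * \<sigma>\<^sup>2)) / sqrt (2 * pi * \<sigma>\<^sup>2)" for t
    by (simp add: \<phi>_def normal_density_def)
  have \<phi>0: "0 \<le> \<phi> t" for t by (simp add: \<phi>_def normal_density_nonneg)
  have [measurable]: "\<phi> \<in> borel_measurable borel" unfolding \<phi>_def by measurable
  have Fc: "continuous_on UNIV F" using F by (meson continuous_at_imp_continuous_on has_vector_derivative_continuous)
  have [measurable]: "F \<in> borel_measurable borel" "F' \<in> borel_measurable borel"
    using Fc F' by (auto intro: borel_measurable_continuous_onI)
  have d\<phi>: "(\<phi> has_vector_derivative (- t / \<sigma>\<^sup>2 * \<phi> t)) (at t)" for t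
    unfolding \<phi>_def' has_real_derivative_iff_has_vector_derivative[symmetric] using \<sigma>
    by (auto intro!: derivative_eq_intros simp: field_simps power2_eq_square)
  have C0: "0 \<le> C" using order_trans[OF norm_ge_zero b(1)[of 0]] by simp
  define G where "G t = \<phi> t *\<^sub>R F t" for t
  define G' where "G' t = \<phi> t *\<^sub>R F' t + (- t / \<sigma>\<^sup>2 * \<phi> t) *\<^sub>R F t" for t
  have dG: "(G has_vector_derivative G' t) (at t)" for t
    unfolding G_def G'_def by (rule has_vector_derivative_scaleR[OF d\<phi>[unfolded has_real_derivative_iff_has_vector_derivative[symmetric]] F])
  have \<phi>c: "continuous_on UNIV \<phi>" using d\<phi> by (meson continuous_at_imp_continuous_on has_vector_derivative_continuous)
  have G'c: "continuous_on UNIV G'" unfolding G'_def by (intro continuous_intros \<phi>c Fc F') (use \<sigma> in auto)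
  have mom: "integrable lborel (\<lambda>t. \<phi> t * t ^ k)" for k
    using integrable_normal_moment[OF \<sigma>, of 0 k] by (simp add: \<phi>_def)
  have moma: "integrable lborel (\<lambda>t. \<phi> t * \<bar>t\<bar> ^ k)" for k
    using integrable_normal_moment_abs[OF \<sigma>, of 0 k] by (simp add: \<phi>_def)
  have i1: "integrable lborel (\<lambda>t. \<phi> t *\<^sub>R F' t)"
  proof (rule Bochner_Integration.integrable_bound[where f="\<lambda>t. C * (\<phi> t * t^0 + \<phi> t * t ^ 4)"])
    show "integrable lborel (\<lambda>t. C * (\<phi> t * t^0 + \<phi> t * t ^ 4))"
      by (intro integrable_mult_right Bochner_Integration.integrable_add mom)
    show "AE t in lborel. norm (\<phi> t *\<^sub>R F' t) \<le> norm (C * (\<phi> t * t^0 + \<phi> t * t ^ 4))"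
    proof (rule AE_I2)
      fix t
      have "\<phi> t * norm (F' t) \<le> \<phi> t * (C * (1 + t^4))" by (intro mult_left_mono b \<phi>0)
      also have "\<dots> = C * (\<phi> t * t^0 + \<phi> t * t ^ 4)" by (simp add: algebra_simps)
      finally show "norm (\<phi> t *\<^sub>R F' t) \<le> norm (C * (\<phi> t * t^0 + \<phi> t * t ^ 4))"
        using \<phi>0[of t] by simp
    qed
  qed measurable
  have i2: "integrable lborel (\<lambda>t. \<phi> t *\<^sub>R (t *\<^sub>R F t))"
  proof (rule Bochner_Integration.integrable_bound[where f="\<lambda>t. C * (\<phi> t * \<bar>t\<bar>^1 + \<phi> t * \<bar>t\<bar> ^ 5)"])
    show "integrable lborel (\<lambda>t. C * (\<phi> t * \<bar>t\<bar>^1 + \<phi> t * \<bar>t\<bar> ^ 5))"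
      by (intro integrable_mult_right Bochner_Integration.integrable_add moma)
    show "AE t in lborel. norm (\<phi> t *\<^sub>R (t *\<^sub>R F t)) \<le> norm (C * (\<phi> t * \<bar>t\<bar>^1 + \<phi> t * \<bar>t\<bar> ^ 5))"
    proof (rule AE_I2)
      fix t :: real
      have t4: "t ^ 4 = \<bar>t\<bar> ^ 4" by (simp add: power_even_abs)
      have "\<phi> t * (\<bar>t\<bar> * norm (F t)) \<le> \<phi> t * (\<bar>t\<bar> * (C * (1 + t^4)))" by (intro mult_left_mono b \<phi>0) auto
      also have "\<dots> = C * (\<phi> t * \<bar>t\<bar>^1 + \<phi> t * \<bar>t\<bar> ^ 5)" unfolding t4 by (simp add: algebra_simps eval_nat_numeral)
      finally show "norm (\<phi> t *\<^sub>R (t *\<^sub>R F t)) \<le> norm (C * (\<phi> t * \<bar>t\<bar>^1 + \<phi> t * \<bar>t\<bar> ^ 5))"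
        using \<phi>0[of t] unfolding norm_scaleR by (simp add: abs_of_nonneg)
    qed
  qed measurable
  have G'eq: "G' t = \<phi> t *\<^sub>R F' t - (1 / \<sigma>\<^sup>2) *\<^sub>R (\<phi> t *\<^sub>R (t *\<^sub>R F t))" for t
    by (simp add: G'_def mult_ac)
  have iG: "integrable lborel G'"
    unfolding G'eq[abs_def] by (intro Bochner_Integration.integrable_diff i1 integrable_scaleR_right i2)
  have Gb: "norm (G t) \<le> C * ((1 + t^4) * \<phi> t)" for t
    using mult_left_mono[OF b(1)[of t] \<phi>0[of t]] \<phi>0[of t] by (simp add: G_def mult_ac)
  have lim: "((\<lambda>t. C * ((1 + t^4) * \<phi> t)) \<longlongrightarrow> 0) at_top" "((\<lambda>t. C * ((1 + t^4) * \<phi> t)) \<longlongrightarrow> 0) at_bot"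
    unfolding \<phi>_def' using \<sigma> by real_asymp+
  have Glim: "(G \<longlongrightarrow> 0) at_top" "(G \<longlongrightarrow> 0) at_bot"
    using Gb by (auto intro!: Lim_null_comparison[OF _ lim(1)] Lim_null_comparison[OF _ lim(2)])
  have "(LBINT t=-\<infinity>..\<infinity>. G' t) = 0 - 0"
  proof (rule interval_integral_FTC_integrable)
    show "isCont G' x" for x using G'c by (simp add: continuous_on_eq_continuous_at)
    show "set_integrable lborel (einterval (-\<infinity>) \<infinity>) G'"
      using iG by (simp add: set_integrable_def)
    show "((G \<circ> real_of_ereal) \<longlongrightarrow> 0) (at_right (- \<infinity>))" "((G \<circ> real_of_ereal) \<longlongrightarrow> 0) (at_left \<infinity>)"
      using Glim by (simp_all add: ereal_tendsto_simps1)
  qed (use dG in auto)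
  hence "(\<integral>t. G' t \<partial>lborel) = 0"
    by (simp add: interval_lebesgue_integral_def set_lebesgue_integral_def)
  hence "(\<integral>t. \<phi> t *\<^sub>R F' t \<partial>lborel) = (1 / \<sigma>\<^sup>2) *\<^sub>R (\<integral>t. \<phi> t *\<^sub>R (t *\<^sub>R F t) \<partial>lborel)"
    unfolding G'eq using i1 i2 by (simp del: scaleR_scaleR)
  moreover have "(\<integral>t. t *\<^sub>R F t \<partial>gauss \<sigma>) = (\<integral>t. \<phi> t *\<^sub>R (t *\<^sub>R F t) \<partial>lborel)"
    unfolding gauss_def \<phi>_def by (rule integral_density) (auto simp: normal_density_nonneg)
  moreover have "(\<integral>t. F' t \<partial>gauss \<sigma>) = (\<integral>t. \<phi> t *\<^sub>R F' t \<partial>lborel)"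
    unfolding gauss_def \<phi>_def by (rule integral_density) (auto simp: normal_density_nonneg)
  ultimately show ?thesis using \<sigma> by simp
qed

locale gauss_vec =
  fixes I :: "'i set" and \<sigma> :: real
  assumes fin: "finite I" and \<sigma>: "0 < \<sigma>"
begin

definition P where "P = Pi\<^sub>M I (\<lambda>_. gauss \<sigma>)"

sublocale gauss_product: product_prob_space "\<lambda>_. gauss \<sigma>" I
  by (intro product_prob_spaceI prob_space_gauss \<sigma>)

sublocale prob_space P
  unfolding P_def by (intro prob_space_PiM prob_space_gauss \<sigma>)

lemma sets_P [measurable_cong]: "sets P = sets (Pi\<^sub>M I (\<lambda>_. borel))"
  unfolding P_def by (rule sets_PiM_cong) auto

lemma integrable_coord_power: assumes "\<alpha> \<in> I" shows "integrable P (\<lambda>x. (x \<alpha>) ^ k)"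
proof -
  have "integrable (distr (Pi\<^sub>M I (\<lambda>_. gauss \<sigma>)) (gauss \<sigma>) (\<lambda>x. x \<alpha>)) (\<lambda>x. x ^ k)"
    using distr_PiM_component[of I "\<lambda>_. gauss \<sigma>" \<alpha>] assms prob_space_gauss[OF \<sigma>] integrable_gauss_moment[OF \<sigma>] by simp
  thus ?thesis unfolding P_def using assms by (subst (asm) integrable_distr_eq) auto
qed

text \<open>Sixth powers, because a coordinate times a function bounded by fourth powers has degree
  five, and an even power avoids absolute values.\<close>

lemma integrable_poly_bound:
  fixes F :: "('i \<Rightarrow> real) \<Rightarrow> complex"
  assumes [measurable]: "F \<in> borel_measurable P"
    and b: "\<And>x. x \<in> space P \<Longrightarrow> cmod (F x) \<le> C * (1 + (\<Sum>\<beta>\<in>I. (x \<beta>) ^ 6))"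
  shows "integrable P F"
proof (rule Bochner_Integration.integrable_bound)
  show "integrable P (\<lambda>x. C * (1 + (\<Sum>\<beta>\<in>I. (x \<beta>) ^ 6)))"
    by (intro integrable_mult_right Bochner_Integration.integrable_add Bochner_Integration.integrable_sum integrable_coord_power integrable_const)
  show "AE x in P. cmod (F x) \<le> norm (C * (1 + (\<Sum>\<beta>\<in>I. (x \<beta>) ^ 6)))"
    using b by (intro AE_I2) (auto intro: order_trans[OF _ abs_ge_self])
qed measurable

lemma power4_le: "(a::real)^4 \<le> 1 + a^6" and power5_le: "\<bar>a\<bar> * (b::real)^4 \<le> a^6 + b^6 + 1"
proof -
  have *: "(a::real)^4 \<le> 1 + a^6" for a
  proof -
    have "0 \<le> (a\<^sup>2 - 1)\<^sup>2 * (a\<^sup>2 + 1)" by simp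
    also have "\<dots> = a^6 - a^4 - a^2 + 1" by (simp add: eval_nat_numeral algebra_simps)
    finally have "a^4 + a^2 \<le> 1 + a^6" by linarith
    thus ?thesis using zero_le_power2[of a] by linarith
  qed
  show "(a::real)^4 \<le> 1 + a^6" by (rule *)
  define m where "m = max \<bar>a\<bar> \<bar>b\<bar>"
  have m0: "0 \<le> m" by (simp add: m_def)
  have "\<bar>a\<bar> * b^4 = \<bar>a\<bar> * \<bar>b\<bar>^4" by (simp add: power_even_abs)
  also have "\<dots> \<le> m * m^4" by (intro mult_mono power_mono) (auto simp: m_def)
  also have "\<dots> \<le> 1 + m^6"
  proof (cases "m \<le> 1")
    case True
    have "m * m^4 = m^5" by (simp add: eval_nat_numeral)
    also have "\<dots> \<le> 1" using True m0 by (intro power_le_one)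
    finally show ?thesis using m0 by (smt (verit) zero_le_power)
  next
    case False
    hence "m^5 \<le> m^6" by (intro power_increasing) auto
    moreover have "m * m^4 = m^5" by (simp add: eval_nat_numeral)
    ultimately show ?thesis by linarith
  qed
  also have "m^6 \<le> a^6 + b^6"
  proof -
    have "m^6 = a^6 \<or> m^6 = b^6" unfolding m_def max_def by (auto simp: power_even_abs)
    moreover have "0 \<le> a^6" "0 \<le> b^6" by (auto simp: zero_le_even_power)
    ultimately show ?thesis by linarith
  qed
  finally show "\<bar>a\<bar> * (b::real)^4 \<le> a^6 + b^6 + 1" by simp
qed

text \<open>Fubini's theorem isolates the coordinate \<open>\<alpha>\<close>, and the
  one-dimensional formula applies with the other coordinates frozen; these enter its growth bound
  only through the constant.\<close>

lemma stein:
  fixes F F' :: "('i \<Rightarrow> real) \<Rightarrow> complex"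
  assumes \<alpha>: "\<alpha> \<in> I" and Fm [measurable]: "F \<in> borel_measurable P" "F' \<in> borel_measurable P"
    and d: "\<And>x t. ((\<lambda>t. F (x(\<alpha> := t))) has_vector_derivative F' (x(\<alpha> := t))) (at t)"
    and c: "\<And>x. continuous_on UNIV (\<lambda>t. F' (x(\<alpha> := t)))"
    and b: "\<And>x. cmod (F x) \<le> C * (1 + (\<Sum>\<beta>\<in>I. (x \<beta>) ^ 4))" "\<And>x. cmod (F' x) \<le> C * (1 + (\<Sum>\<beta>\<in>I. (x \<beta>) ^ 4))"
  shows "integrable P (\<lambda>x. x \<alpha> *\<^sub>R F x)" "integrable P F'"
    "(\<integral>x. x \<alpha> *\<^sub>R F x \<partial>P) = \<sigma>\<^sup>2 *\<^sub>R (\<integral>x. F' x \<partial>P)"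
proof -
  have C0: "0 \<le> C" using order_trans[OF norm_ge_zero b(1)[of "\<lambda>_. 0"]] by simp
  define n where "n = real (card I)"
  have n0: "0 \<le> n" by (simp add: n_def)
  have am: "(\<lambda>x. x \<alpha>) \<in> borel_measurable P" using \<alpha> by measurable
  have s4: "(\<Sum>\<beta>\<in>I. (x \<beta>) ^ 4) \<le> n + (\<Sum>\<beta>\<in>I. (x \<beta>) ^ 6)" for x :: "'i \<Rightarrow> real"
    using sum_mono[of I "\<lambda>\<beta>. (x \<beta>)^4" "\<lambda>\<beta>. 1 + (x \<beta>)^6", OF power4_le] by (simp add: sum.distrib n_def)
  have s6: "0 \<le> (\<Sum>\<beta>\<in>I. (x \<beta>) ^ 6)" for x :: "'i \<Rightarrow> real" by (intro sum_nonneg zero_le_even_power) auto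
  have f6: "F6 * 1 \<le> (1 + n) * (1 + (\<Sum>\<beta>\<in>I. (x \<beta>) ^ 6))" if "F6 \<le> 1 + (\<Sum>\<beta>\<in>I. (x \<beta>) ^ 4)" for x :: "'i \<Rightarrow> real" and F6
    using that s4[of x] mult_nonneg_nonneg[OF n0 s6[of x]] n0 by (simp add: algebra_simps)
  show iF': "integrable P F'"
  proof (rule integrable_poly_bound)
    fix x
    have "cmod (F' x) \<le> C * ((1 + n) * (1 + (\<Sum>\<beta>\<in>I. (x \<beta>) ^ 6)))"
      using mult_left_mono[OF f6[of "1 + (\<Sum>\<beta>\<in>I. (x \<beta>) ^ 4)" x, OF order_refl] C0] b(2)[of x] by simp
    thus "cmod (F' x) \<le> (C * (1 + n)) * (1 + (\<Sum>\<beta>\<in>I. (x \<beta>) ^ 6))" by (simp add: mult_ac)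
  qed measurable
  show iF: "integrable P (\<lambda>x. x \<alpha> *\<^sub>R F x)"
  proof (rule integrable_poly_bound)
    show "(\<lambda>x. x \<alpha> *\<^sub>R F x) \<in> borel_measurable P" using am by measurable
    fix x :: "'i \<Rightarrow> real"
    have x6: "(x \<alpha>)^6 \<le> (\<Sum>\<beta>\<in>I. (x \<beta>) ^ 6)" by (rule member_le_sum[where f="\<lambda>\<beta>. (x \<beta>) ^ 6", OF \<alpha>]) (auto simp: fin zero_le_even_power)
    have "\<bar>x \<alpha>\<bar> \<le> 1 + (x \<alpha>)^6"
    proof -
      have "\<bar>x \<alpha>\<bar> * 1^4 \<le> (x \<alpha>)^6 + 1^6 + 1" by (rule power5_le)
      moreover have "\<bar>x \<alpha>\<bar> \<le> (1 + (x \<alpha>)\<^sup>2) / 2" using sum_squares_bound[of 1 "\<bar>x \<alpha>\<bar>"] by simp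
      moreover have "(x \<alpha>)\<^sup>2 \<le> (1 + (x \<alpha>)^4) / 2" using sum_squares_bound[of 1 "(x \<alpha>)\<^sup>2"] by simp
      moreover have "0 \<le> (x \<alpha>)^6" by (rule zero_le_even_power) simp
      ultimately show ?thesis using power4_le[of "x \<alpha>"] by argo
    qed
    hence "\<bar>x \<alpha>\<bar> * (1 + (\<Sum>\<beta>\<in>I. (x \<beta>) ^ 4)) \<le> (1 + (x \<alpha>)^6) + (\<Sum>\<beta>\<in>I. (x \<alpha>)^6 + (x \<beta>)^6 + 1)"
      unfolding distrib_left sum_distrib_left by (intro add_mono sum_mono power5_le) simp
    also have "\<dots> \<le> (2 + n) * (1 + (\<Sum>\<beta>\<in>I. (x \<beta>) ^ 6))"
      using x6 n0 mult_left_mono[OF x6 n0] by (simp add: sum.distrib n_def[symmetric] algebra_simps)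
    finally have e: "\<bar>x \<alpha>\<bar> * (1 + (\<Sum>\<beta>\<in>I. (x \<beta>) ^ 4)) \<le> (2 + n) * (1 + (\<Sum>\<beta>\<in>I. (x \<beta>) ^ 6))" .
    have "cmod (x \<alpha> *\<^sub>R F x) \<le> \<bar>x \<alpha>\<bar> * (C * (1 + (\<Sum>\<beta>\<in>I. (x \<beta>) ^ 4)))" using b(1)[of x] by (simp add: mult_left_mono)
    also have "\<dots> \<le> C * ((2 + n) * (1 + (\<Sum>\<beta>\<in>I. (x \<beta>) ^ 6)))" using mult_left_mono[OF e C0] by (simp add: mult_ac)
    finally show "cmod (x \<alpha> *\<^sub>R F x) \<le> (C * (2 + n)) * (1 + (\<Sum>\<beta>\<in>I. (x \<beta>) ^ 6))" by (simp add: mult_ac)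
  qed
  define J where "J = I - {\<alpha>}"
  have J: "insert \<alpha> J = I" "\<alpha> \<notin> J" "finite J" using \<alpha> fin by (auto simp: J_def)
  have "(\<integral>x. x \<alpha> *\<^sub>R F x \<partial>P) = (\<integral>x. (\<integral>y. (x(\<alpha>:=y)) \<alpha> *\<^sub>R F (x(\<alpha>:=y)) \<partial>gauss \<sigma>) \<partial>Pi\<^sub>M J (\<lambda>_. gauss \<sigma>))"
    using gauss_product.product_integral_insert[OF J(3,2), of "\<lambda>x. x \<alpha> *\<^sub>R F x"] iF unfolding J(1) P_def by simp
  also have "\<dots> = (\<integral>x. \<sigma>\<^sup>2 *\<^sub>R (\<integral>y. F' (x(\<alpha>:=y)) \<partial>gauss \<sigma>) \<partial>Pi\<^sub>M J (\<lambda>_. gauss \<sigma>))"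
  proof (rule Bochner_Integration.integral_cong[OF refl])
    fix x :: "'i \<Rightarrow> real"
    define S where "S = (\<Sum>\<beta>\<in>J. (x \<beta>) ^ 4)"
    have S0: "0 \<le> S" unfolding S_def by (intro sum_nonneg zero_le_even_power) auto
    have Sx: "(\<Sum>\<beta>\<in>I. ((x(\<alpha>:=t)) \<beta>) ^ 4) = t^4 + S" for t
      unfolding J(1)[symmetric] S_def using J by (subst sum.insert) (auto intro!: sum.cong)
    have bb: "C * (1 + (\<Sum>\<beta>\<in>I. ((x(\<alpha>:=t)) \<beta>) ^ 4)) \<le> (C * (1 + S)) * (1 + t^4)" for t
      unfolding Sx mult.assoc using C0 S0 mult_nonneg_nonneg[OF S0, of "t^4"] by (intro mult_left_mono) (auto simp: algebra_simps zero_le_even_power)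
    have "(\<integral>y. y *\<^sub>R F (x(\<alpha>:=y)) \<partial>gauss \<sigma>) = \<sigma>\<^sup>2 *\<^sub>R (\<integral>y. F' (x(\<alpha>:=y)) \<partial>gauss \<sigma>)"
      by (rule gauss_stein[OF \<sigma> d c order_trans[OF b(1) bb] order_trans[OF b(2) bb]])
    thus "(\<integral>y. (x(\<alpha>:=y)) \<alpha> *\<^sub>R F (x(\<alpha>:=y)) \<partial>gauss \<sigma>) = \<sigma>\<^sup>2 *\<^sub>R (\<integral>y. F' (x(\<alpha>:=y)) \<partial>gauss \<sigma>)" by simp
  qed
  also have "\<dots> = \<sigma>\<^sup>2 *\<^sub>R (\<integral>x. (\<integral>y. F' (x(\<alpha>:=y)) \<partial>gauss \<sigma>) \<partial>Pi\<^sub>M J (\<lambda>_. gauss \<sigma>))" by simp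
  also have "(\<integral>x. (\<integral>y. F' (x(\<alpha>:=y)) \<partial>gauss \<sigma>) \<partial>Pi\<^sub>M J (\<lambda>_. gauss \<sigma>)) = (\<integral>x. F' x \<partial>P)"
    using gauss_product.product_integral_insert[OF J(3,2), of F'] iF' unfolding J(1) P_def by simp
  finally show "(\<integral>x. x \<alpha> *\<^sub>R F x \<partial>P) = \<sigma>\<^sup>2 *\<^sub>R (\<integral>x. F' x \<partial>P)" .
qed

definition sq :: "('i \<Rightarrow> real) \<Rightarrow> real" where "sq x = (\<Sum>\<beta>\<in>I. (x \<beta>)\<^sup>2)"

lemma sq_measurable [measurable]: "sq \<in> borel_measurable P"
  unfolding sq_def by measurable

lemma sq_nonneg: "0 \<le> sq x" unfolding sq_def by (intro sum_nonneg) auto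

lemma sq_upd: "\<alpha> \<in> I \<Longrightarrow> sq (x(\<alpha> := t)) = t\<^sup>2 + (sq x - (x \<alpha>)\<^sup>2)"
  unfolding sq_def using fin by (simp add: sum.remove[of I \<alpha>])

text \<open>Both moments come from integration by parts itself: applied to \<open>x \<alpha>\<close>
  it gives \<open>\<sigma>^2\<close>, applied to \<open>x \<alpha> * sq x\<close> it gives
  \<open>\<sigma>^2 (E sq + 2 \<sigma>^2)\<close>, and summation over \<open>\<alpha>\<close>
  produces \<open>\<sigma>^4 n (n + 2)\<close> with \<open>n = card I\<close>.\<close>

lemma expectation_sq:
  "integrable P sq" "(\<integral>x. sq x \<partial>P) = \<sigma>\<^sup>2 * card I"
  "integrable P (\<lambda>x. (sq x)\<^sup>2)" "(\<integral>x. (sq x)\<^sup>2 \<partial>P) = \<sigma>^4 * (card I * (card I + 2))"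
proof -
  have s1: "integrable P (\<lambda>x. x \<alpha> *\<^sub>R complex_of_real (x \<alpha>)) \<and> (\<integral>x. x \<alpha> *\<^sub>R complex_of_real (x \<alpha>) \<partial>P) = \<sigma>\<^sup>2 *\<^sub>R (\<integral>x. 1 \<partial>P)"
    if \<alpha>: "\<alpha> \<in> I" for \<alpha>
  proof -
    have am: "(\<lambda>x. x \<alpha>) \<in> borel_measurable P" using \<alpha> by measurable
    have *: "\<bar>x \<alpha>\<bar> \<le> 1 * (1 + (\<Sum>\<beta>\<in>I. (x \<beta>)^4))" for x :: "'i \<Rightarrow> real"
    proof -
      have "(x \<alpha>)^4 \<le> (\<Sum>\<beta>\<in>I. (x \<beta>)^4)" by (rule member_le_sum[where f="\<lambda>\<beta>. (x \<beta>) ^ 4", OF \<alpha>]) (auto simp: fin zero_le_even_power)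
      moreover have "\<bar>x \<alpha>\<bar> \<le> (1 + (x \<alpha>)\<^sup>2) / 2" using sum_squares_bound[of 1 "\<bar>x \<alpha>\<bar>"] by simp
      moreover have "(x \<alpha>)\<^sup>2 \<le> (1 + (x \<alpha>)^4) / 2" using sum_squares_bound[of 1 "(x \<alpha>)\<^sup>2"] by simp
      moreover have "0 \<le> (x \<alpha>)^4" by (rule zero_le_even_power) simp
      ultimately show ?thesis unfolding mult_1 by argo
    qed
    have **: "1 \<le> 1 * (1 + (\<Sum>\<beta>\<in>I. (x \<beta>)^4))" for x :: "'i \<Rightarrow> real"
      by (simp add: sum_nonneg zero_le_even_power)
    have dd: "((\<lambda>t. complex_of_real ((x(\<alpha> := t)) \<alpha>)) has_vector_derivative 1) (at t)" for x :: "'i \<Rightarrow> real" and t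
      by (auto intro!: derivative_eq_intros has_vector_derivative_of_real[where D=1, simplified] simp: has_real_derivative_iff_has_vector_derivative[symmetric])
    have m: "(\<lambda>x. complex_of_real (x \<alpha>)) \<in> borel_measurable P" "(\<lambda>_. 1 :: complex) \<in> borel_measurable P" using am by measurable
    have b: "cmod (complex_of_real (x \<alpha>)) \<le> 1 * (1 + (\<Sum>\<beta>\<in>I. (x \<beta>)^4))" "cmod 1 \<le> 1 * (1 + (\<Sum>\<beta>\<in>I. (x \<beta>)^4))" for x :: "'i \<Rightarrow> real"
      unfolding norm_of_real norm_one by (rule *, rule **)
    note st = stein[OF \<alpha> m dd continuous_on_const b]
    show ?thesis using st(1,3) by blast
  qed
  have coord: "integrable P (\<lambda>x. (x \<alpha>)\<^sup>2) \<and> (\<integral>x. (x \<alpha>)\<^sup>2 \<partial>P) = \<sigma>\<^sup>2" if \<alpha>: "\<alpha> \<in> I" for \<alpha>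
  proof -
    have "(\<integral>x. complex_of_real ((x \<alpha>)\<^sup>2) \<partial>P) = \<sigma>\<^sup>2"
      using s1[OF \<alpha>] by (simp add: scaleR_conv_of_real power2_eq_square prob_space)
    hence "(\<integral>x. (x \<alpha>)\<^sup>2 \<partial>P) = \<sigma>\<^sup>2" by (simp only: integral_complex_of_real of_real_eq_iff)
    thus ?thesis using integrable_coord_power[OF \<alpha>, of 2] by simp
  qed
  show i1: "integrable P sq" unfolding sq_def using coord by (intro Bochner_Integration.integrable_sum) auto
  show e1: "(\<integral>x. sq x \<partial>P) = \<sigma>\<^sup>2 * card I"
    unfolding sq_def using coord by (subst Bochner_Integration.integral_sum) auto
  have s2: "integrable P (\<lambda>x. (x \<alpha>)\<^sup>2 * sq x) \<and> (\<integral>x. (x \<alpha>)\<^sup>2 * sq x \<partial>P) = \<sigma>\<^sup>2 * ((\<integral>x. sq x \<partial>P) + 2 * \<sigma>\<^sup>2)" if \<alpha>: "\<alpha> \<in> I" for \<alpha>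
  proof -
    define F where "F x = complex_of_real (x \<alpha> * sq x)" for x
    define F' where "F' x = complex_of_real (sq x + 2 * (x \<alpha>)\<^sup>2)" for x
    have am[measurable]: "(\<lambda>x. x \<alpha>) \<in> borel_measurable P" using \<alpha> by measurable
    have Fm: "F \<in> borel_measurable P" "F' \<in> borel_measurable P" unfolding F_def F'_def by measurable
    have q2: "(a::real)\<^sup>2 \<le> 1 + a^4" for a
    proof -
      have "2 * a\<^sup>2 \<le> 1 + a^4" using sum_squares_bound[of 1 "a\<^sup>2"] by simp
      thus ?thesis using zero_le_power2[of a] by linarith
    qed
    have cube: "\<bar>a\<bar> * (b::real)\<^sup>2 \<le> 1 + a^4 + b^4" for a b
    proof -
      have "\<bar>a\<bar> * b\<^sup>2 \<le> (a\<^sup>2 + b^4) / 2" using sum_squares_bound[of "\<bar>a\<bar>" "b\<^sup>2"] by simp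
      moreover have "0 \<le> a^4" "0 \<le> b^4" by (rule zero_le_even_power; simp)+
      ultimately show ?thesis using q2[of a] by argo
    qed
    define n where "n = real (card I)"
    have x4: "(x \<alpha>)^4 \<le> (\<Sum>\<beta>\<in>I. (x \<beta>)^4)" for x :: "'i \<Rightarrow> real" by (rule member_le_sum[where f="\<lambda>\<beta>. (x \<beta>) ^ 4", OF \<alpha>]) (auto simp: fin zero_le_even_power)
    have p4: "0 \<le> (\<Sum>\<beta>\<in>I. (x \<beta>)^4)" for x :: "'i \<Rightarrow> real" by (intro sum_nonneg zero_le_even_power) auto
    have n0: "0 \<le> n" by (simp add: n_def)
    have b1: "cmod (F x) \<le> (3 + n) * (1 + (\<Sum>\<beta>\<in>I. (x \<beta>)^4))" for x
    proof -
      have "cmod (F x) = \<bar>x \<alpha>\<bar> * sq x" using sq_nonneg[of x] by (simp add: F_def norm_mult)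
      also have "\<dots> = (\<Sum>\<beta>\<in>I. \<bar>x \<alpha>\<bar> * (x \<beta>)\<^sup>2)" by (simp add: sq_def sum_distrib_left)
      also have "\<dots> \<le> (\<Sum>\<beta>\<in>I. 1 + (x \<alpha>)^4 + (x \<beta>)^4)" by (intro sum_mono cube)
      also have "\<dots> = n + n * (x \<alpha>)^4 + (\<Sum>\<beta>\<in>I. (x \<beta>)^4)" by (simp add: sum.distrib n_def algebra_simps)
      also have "\<dots> \<le> (3 + n) * (1 + (\<Sum>\<beta>\<in>I. (x \<beta>)^4))"
        using mult_left_mono[OF x4[of x] n0] p4[of x] n0 by (simp add: algebra_simps)
      finally show ?thesis .
    qed
    have b2: "cmod (F' x) \<le> (3 + n) * (1 + (\<Sum>\<beta>\<in>I. (x \<beta>)^4))" for x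
    proof -
      have "cmod (F' x) = sq x + 2 * (x \<alpha>)\<^sup>2" unfolding F'_def norm_of_real using sq_nonneg[of x] by simp
      also have "\<dots> \<le> (\<Sum>\<beta>\<in>I. 1 + (x \<beta>)^4) + 2 * (1 + (x \<alpha>)^4)"
        unfolding sq_def by (intro add_mono sum_mono mult_left_mono q2) auto
      also have "\<dots> = n + (\<Sum>\<beta>\<in>I. (x \<beta>)^4) + 2 + 2 * (x \<alpha>)^4" by (simp add: sum.distrib n_def)
      also have "\<dots> \<le> (3 + n) * (1 + (\<Sum>\<beta>\<in>I. (x \<beta>)^4))"
        using x4[of x] p4[of x] n0 mult_nonneg_nonneg[OF n0 p4[of x]] unfolding distrib_left distrib_right mult_1 mult_1_right by linarith
      finally show ?thesis .
    qed
    have d: "((\<lambda>t. F (x(\<alpha> := t))) has_vector_derivative F' (x(\<alpha> := t))) (at t)" for x t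
    proof -
      have "((\<lambda>t. (x(\<alpha> := t)) \<alpha> * sq (x(\<alpha> := t))) has_vector_derivative (sq (x(\<alpha> := t)) + 2 * ((x(\<alpha> := t)) \<alpha>)\<^sup>2)) (at t)"
        unfolding sq_upd[OF \<alpha>] fun_upd_same has_real_derivative_iff_has_vector_derivative[symmetric]
        by (auto intro!: derivative_eq_intros simp: power2_eq_square algebra_simps)
      thus ?thesis unfolding F_def F'_def has_real_derivative_iff_has_vector_derivative[symmetric] by (rule has_vector_derivative_of_real)
    qed
    have c: "continuous_on UNIV (\<lambda>t. F' (x(\<alpha> := t)))" for x
      unfolding F'_def sq_upd[OF \<alpha>] fun_upd_same by (intro continuous_intros)
    note st = stein[OF \<alpha> Fm d c b1 b2]
    have eq: "x \<alpha> *\<^sub>R F x = complex_of_real ((x \<alpha>)\<^sup>2 * sq x)" for x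
      by (simp add: F_def scaleR_conv_of_real power2_eq_square)
    have "integrable P (\<lambda>x. (x \<alpha>)\<^sup>2 * sq x)"
      using integrable_Re[OF st(1)[unfolded eq]] by simp
    moreover have "complex_of_real (\<integral>x. (x \<alpha>)\<^sup>2 * sq x \<partial>P) = complex_of_real (\<sigma>\<^sup>2 * (\<integral>x. sq x + 2 * (x \<alpha>)\<^sup>2 \<partial>P))"
      using st(3) unfolding eq F'_def integral_complex_of_real by (simp only: scaleR_conv_of_real of_real_mult)
    hence "(\<integral>x. (x \<alpha>)\<^sup>2 * sq x \<partial>P) = \<sigma>\<^sup>2 * (\<integral>x. sq x + 2 * (x \<alpha>)\<^sup>2 \<partial>P)" by (simp only: of_real_eq_iff)
    moreover have "(\<integral>x. sq x + 2 * (x \<alpha>)\<^sup>2 \<partial>P) = (\<integral>x. sq x \<partial>P) + 2 * \<sigma>\<^sup>2"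
      using coord[OF \<alpha>] i1 by simp
    ultimately show ?thesis by simp
  qed
  have sqsq: "(sq x)\<^sup>2 = (\<Sum>\<beta>\<in>I. (x \<beta>)\<^sup>2 * sq x)" for x
    by (simp add: power2_eq_square sum_distrib_right[symmetric] sq_def)
  show "integrable P (\<lambda>x. (sq x)\<^sup>2)" unfolding sqsq using s2 by (intro Bochner_Integration.integrable_sum) auto
  show "(\<integral>x. (sq x)\<^sup>2 \<partial>P) = \<sigma>^4 * (card I * (card I + 2))"
    unfolding sqsq using s2 by (subst Bochner_Integration.integral_sum) (auto simp: e1 algebra_simps eval_nat_numeral)
qed

lemma variance_sq: "integrable P (\<lambda>x. (sq x - \<sigma>\<^sup>2 * card I)\<^sup>2)" "(\<integral>x. (sq x - \<sigma>\<^sup>2 * card I)\<^sup>2 \<partial>P) = 2 * \<sigma>^4 * card I"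
proof -
  define c where "c = \<sigma>\<^sup>2 * card I"
  have eq: "(sq x - c)\<^sup>2 = (sq x)\<^sup>2 - 2 * c * sq x + c\<^sup>2" for x by (simp add: power2_eq_square algebra_simps)
  show "integrable P (\<lambda>x. (sq x - \<sigma>\<^sup>2 * card I)\<^sup>2)" unfolding c_def[symmetric] eq
    using expectation_sq by (intro Bochner_Integration.integrable_add Bochner_Integration.integrable_diff integrable_mult_right) auto
  have "(\<integral>x. (sq x - c)\<^sup>2 \<partial>P) = (\<integral>x. (sq x)\<^sup>2 \<partial>P) - 2 * c * (\<integral>x. sq x \<partial>P) + c\<^sup>2"
    unfolding eq using expectation_sq(1,3) by (simp add: prob_space)
  thus "(\<integral>x. (sq x - \<sigma>\<^sup>2 * card I)\<^sup>2 \<partial>P) = 2 * \<sigma>^4 * card I"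
    unfolding expectation_sq(2,4) c_def[symmetric] by (simp add: c_def power2_eq_square eval_nat_numeral algebra_simps)
qed

end

section \<open>The spectral theorem and resolvents\<close>

definition fm :: "complex mat \<Rightarrow> fmat" where
  "fm A = Fmat (\<lambda>i j. if i < dim_row A \<and> j < dim_col A then A $$ (i, j) else 0)"

definition mf :: "nat \<Rightarrow> nat \<Rightarrow> fmat \<Rightarrow> complex mat" where
  "mf p d X = mat p d (\<lambda>(i, j). ent X i j)"

lemma ent_fm [simp]: "ent (fm A) i j = (if i < dim_row A \<and> j < dim_col A then A $$ (i, j) else 0)"
  unfolding fm_def by (subst ent_Fmat[of "max (dim_row A) (dim_col A)"]) auto

lemma car_fm: "A \<in> carrier_mat p d \<Longrightarrow> car p d (fm A)"
  by (auto simp: car_def)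

lemma mf_carrier [simp]: "mf p d X \<in> carrier_mat p d"
  by (simp add: mf_def)

lemma mf_fm: "A \<in> carrier_mat p d \<Longrightarrow> mf p d (fm A) = A"
  by (rule eq_matI) (auto simp: mf_def)

lemma fm_mf: "car p d X \<Longrightarrow> fm (mf p d X) = X"
  by (rule fmat_eqI) (auto simp: mf_def car_def not_less)

lemma fm_mult: assumes "A \<in> carrier_mat p d" "B \<in> carrier_mat d n" shows "fm (A * B) = fm A * fm B"
proof (rule fmat_eqI)
  fix i j
  show "ent (fm (A * B)) i j = ent (fm A * fm B) i j"
  proof (cases "i < p \<and> j < n")
    case True
    have "(A * B) $$ (i, j) = (\<Sum>k<d. A $$ (i, k) * B $$ (k, j))"
      using assms True by (simp add: scalar_prod_def lessThan_atLeast0)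
    thus ?thesis using True assms by (simp add: ent_mult_eq[OF car_fm[OF assms(1)]])
  next
    case False
    thus ?thesis using assms car_mult[OF car_fm[OF assms(1)] car_fm[OF assms(2)]] by (auto simp: car_def not_less)
  qed
qed

lemma mf_mult: assumes "car p d X" "car d n Y" shows "mf p n (X * Y) = mf p d X * mf d n Y"
  using fm_mult[of "mf p d X" p d "mf d n Y" n] fm_mf[OF assms(1)] fm_mf[OF assms(2)]
  by (metis mf_carrier mf_fm mult_carrier_mat)

lemma mat_adjoint_carrier: "A \<in> carrier_mat p d \<Longrightarrow> mat_adjoint A \<in> carrier_mat d p"
  by (auto simp: mat_adjoint_def)

lemma mat_adjoint_index: assumes "A \<in> carrier_mat p d" "i < d" "j < p"
  shows "mat_adjoint A $$ (i, j) = cnj (A $$ (j, i))"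
  using assms by (auto simp: mat_adjoint_def mat_of_rows_def)

lemma fm_adjoint: assumes "A \<in> carrier_mat p d" shows "fm (mat_adjoint A) = adj (fm A)"
  by (rule fmat_eqI) (use assms mat_adjoint_carrier[OF assms] in \<open>auto simp: mat_adjoint_index\<close>)

lemma mf_adj: "car p d X \<Longrightarrow> mf d p (adj X) = mat_adjoint (mf p d X)"
  using mat_adjoint_carrier[of "mf p d X" p d]
  by (intro eq_matI) (auto simp: mf_def mat_adjoint_index[of "mat p d (\<lambda>(i, j). ent X i j)" p d])

lemma mf_dg: "mf n n (dg n f) = mat n n (\<lambda>(i, j). if i = j then f i else 0)"
  unfolding mf_def by (rule cong_mat) auto

lemma mf_Idn: "mf n n (Idn n) = 1\<^sub>m n"
  unfolding mf_dg one_mat_def by simp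

lemma char_poly_diag: "char_poly (mat n n (\<lambda>(i, j). if i = j then f i else 0) :: complex mat) = (\<Prod>i<n. [:- f i, 1:])"
proof -
  let ?D = "mat n n (\<lambda>(i, j). if i = j then f i else 0) :: complex mat"
  have "char_poly ?D = (\<Prod> a \<leftarrow> diag_mat ?D. [:- a, 1:])"
    by (rule char_poly_upper_triangular[of _ n]) auto
  also have "diag_mat ?D = map f [0..<n]"
    by (auto simp: diag_mat_def)
  also have "(\<Prod> a \<leftarrow> map f [0..<n]. [:- a, 1:]) = (\<Prod>i<n. [:- f i, 1:])"
    using prod.distinct_set_conv_list[of "[0..<n]" "\<lambda>i. [:- f i, 1:]"] by (simp add: o_def lessThan_atLeast0)
  finally show ?thesis .
qed

lemma proots_prod_linear: fixes n :: nat shows "proots (\<Prod>i<n. [:- (f i :: complex), 1:]) = image_mset f (mset_set {..<n})"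
proof (induction n)
  case (Suc n)
  have "(\<Prod>i<n. [:- f i, 1:]) \<noteq> 0" by (simp add: prod_zero_iff)
  moreover have "proots [:- f n, 1:] = {#f n#}" by simp
  ultimately have "proots ((\<Prod>i<n. [:- f i, 1:]) * [:- f n, 1:]) = proots (\<Prod>i<n. [:- f i, 1:]) + {#f n#}"
    by (subst proots_mult) auto
  thus ?case unfolding prod.lessThan_Suc Suc by (simp add: lessThan_Suc)
qed simp

section \<open>Diagonalization of self-adjoint matrices\<close>

lemma eigenvector_exists_fmat:
  assumes H: "car (Suc n) (Suc n) H"
  shows "\<exists>x e. car (Suc n) 1 x \<and> adj x * x = Idn 1 \<and> H * x = cs e x"
proof -
  let ?M = "mf (Suc n) (Suc n) H"
  obtain e where "eigenvalue ?M e" using spectrum_non_empty[of ?M "Suc n"] by (auto simp: spectrum_def)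
  then obtain v where v: "v \<in> carrier_vec (Suc n)" "v \<noteq> 0\<^sub>v (Suc n)" "?M *\<^sub>v v = e \<cdot>\<^sub>v v"
    unfolding eigenvalue_def eigenvector_def by (auto simp: mf_def)
  define y where "y = fm (mat (Suc n) 1 (\<lambda>(i, j). v $ i))"
  have y: "car (Suc n) 1 y" unfolding y_def by (rule car_fm) simp
  have ye: "ent y i j = (if i < Suc n \<and> j = 0 then v $ i else 0)" for i j by (auto simp: y_def)
  have Hy: "H * y = cs e y"
  proof (rule fmat_eqI)
    fix i j
    show "ent (H * y) i j = ent (cs e y) i j"
    proof (cases "i < Suc n \<and> j = 0")
      case True
      have "(?M *\<^sub>v v) $ i = (\<Sum>k<Suc n. ent H i k * v $ k)"
        using True v(1) by (simp add: scalar_prod_def mf_def lessThan_atLeast0 del: sum.lessThan_Suc sum.op_ivl_Suc)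
      moreover have "(?M *\<^sub>v v) $ i = e * v $ i" using True v(1) unfolding v(3) by auto
      ultimately show ?thesis using True by (simp add: ent_mult_eq[OF H] ye del: sum.lessThan_Suc)
    next
      case False
      thus ?thesis using car_mult[OF H y] by (auto simp: ye car_def not_less)
    qed
  qed
  have "y \<noteq> 0"
  proof
    assume "y = 0"
    hence "v $ i = 0" if "i < Suc n" for i using ye[of i 0] that by simp
    hence "v = 0\<^sub>v (Suc n)" using v(1) by (intro eq_vecI) auto
    thus False using v(2) by simp
  qed
  hence ny: "norm y \<noteq> 0" by simp
  define x where "x = cs (complex_of_real (1 / norm y)) y"
  have x: "car (Suc n) 1 x" unfolding x_def using y by (rule car_cs)
  have "norm x = 1" using ny by (simp add: x_def norm_divide)
  hence t: "tr (adj x * x) = 1" using tr_mult_adj[of x] by (simp add: tr_comm)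
  have "adj x * x = Idn 1"
  proof (rule fmat_eqI)
    fix i j
    have c: "car 1 1 (adj x * x)" using x by (intro car_intros)
    have "ent (adj x * x) 0 0 = 1" using t unfolding tr_eq[OF c] by simp
    thus "ent (adj x * x) i j = ent (Idn 1) i j" using c by (cases "i = 0 \<and> j = 0") (auto simp: car_def)
  qed
  moreover have "H * x = cs e x" unfolding x_def using Hy by (simp add: mult.commute)
  ultimately show ?thesis using x by blast
qed

text \<open>The basis vector with index \<open>n\<close>, as a matrix with one column: vectors are
  treated as matrices throughout, so that inner products and rank one operators are ordinary
  products.\<close>

definition bcol :: "nat \<Rightarrow> fmat" where "bcol n = Fmat (\<lambda>i j. if i = n \<and> j = 0 then 1 else 0)"

lemma ent_bcol [simp]: "ent (bcol n) i j = (if i = n \<and> j = 0 then 1 else 0)"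
  unfolding bcol_def by (subst ent_Fmat[of "Suc n"]) auto

lemma car_bcol: "car (Suc n) 1 (bcol n)" by (auto simp: car_def)

lemma mult_bcol: "ent (X * bcol n) i j = (if j = 0 then ent X i n else 0)"
  by (simp add: ent_mult_eq'[OF car_bcol])

lemma adj_bcol_bcol: "adj (bcol n) * bcol n = Idn 1"
  by (rule fmat_eqI) (auto simp: mult_bcol)

lemma car1_eq_cs: "car 1 1 X \<Longrightarrow> X = cs (ent X 0 0) (Idn 1)"
proof (rule fmat_eqI)
  fix i j assume "car 1 1 X"
  thus "ent X i j = ent (cs (ent X 0 0) (Idn 1)) i j" by (cases "i = 0 \<and> j = 0") (auto simp: car_def)
qed

text \<open>A Householder reflection carries the last basis vector to a given unit vector.\<close>

lemma unitary_last_column: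
  assumes x: "car (Suc n) 1 x" "adj x * x = Idn 1"
  shows "\<exists>U c. car (Suc n) (Suc n) U \<and> adj U = U \<and> U * U = Idn (Suc n) \<and> U * bcol n = cs c x"
proof -
  define a where "a = ent x n 0"
  \<comment> \<open>The phase makes the inner product of \<open>u\<close> with the last basis vector
    a real number \<open>r\<close>, and nonnegative. Only with a real inner product does a
    reflection carry one unit vector to the other.\<close>
  define c where "c = (if a = 0 then 1 else cnj (sgn a))"
  have cn: "cmod c = 1" by (auto simp: c_def norm_sgn)
  have cc: "c * cnj c = 1" using cn by (simp add: complex_norm_square[symmetric])
  define u where "u = cs c x"
  define r where "r = cmod a"
  have u: "car (Suc n) 1 u" unfolding u_def using x(1) by (rule car_cs)
  have uu: "adj u * u = Idn 1" unfolding u_def using x(2) cc by (simp add: adj_cs mult.commute)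
  have ca: "c * a = complex_of_real r"
    by (auto simp: c_def r_def sgn_eq complex_norm_square[symmetric] power2_eq_square mult.commute[of "cnj _"])
  let ?e = "bcol n"
  have eu: "adj ?e * u = cs (complex_of_real r) (Idn 1)"
  proof -
    have "car 1 1 (adj u * ?e)" using u car_bcol by (intro car_intros)
    moreover have "ent (adj u * ?e) 0 0 = cnj (c * a)" by (simp add: mult_bcol u_def a_def)
    ultimately have "adj u * ?e = cs (complex_of_real r) (Idn 1)"
      using car1_eq_cs[of "adj u * ?e"] by (simp add: ca)
    hence "adj (adj u * ?e) = adj (cs (complex_of_real r) (Idn 1))" by simp
    thus ?thesis by (simp add: adj_mult adj_cs adj_dg)
  qed
  hence ue: "adj u * ?e = cs (complex_of_real r) (Idn 1)"
  proof -
    have "adj (adj ?e * u) = adj (cs (complex_of_real r) (Idn 1))" using eu by simp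
    thus ?thesis by (simp add: adj_mult adj_cs adj_dg)
  qed
  define w where "w = u - ?e"
  have w: "car (Suc n) 1 w" unfolding w_def using u car_bcol by (rule car_diff)
  have ww: "adj w * w = cs (2 - 2 * complex_of_real r) (Idn 1)"
    unfolding w_def adj_diff left_diff_distrib right_diff_distrib uu ue eu adj_bcol_bcol
    by (rule fmat_eqI) auto
  have we: "adj w * ?e = cs (complex_of_real r - 1) (Idn 1)"
    unfolding w_def adj_diff left_diff_distrib ue adj_bcol_bcol by (rule fmat_eqI) auto
  show ?thesis
  \<comment> \<open>For \<open>r = 1\<close> the two unit vectors coincide and the reflection
    degenerates; the identity takes its place.\<close>
  proof (cases "r = 1")
    case True
    hence "complex_of_real ((norm w)\<^sup>2) = 0" unfolding tr_mult_adj[symmetric] tr_comm[of w] ww by simp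
    hence "w = 0" by simp
    hence "u = ?e" by (simp add: w_def)
    thus ?thesis unfolding u_def
      by (intro exI[of _ "Idn (Suc n)"] exI[of _ c]) (auto simp: car_dg adj_dg dg_mult_dg Idn_mult[OF car_bcol])
  next
    case False
    \<comment> \<open>This is \<open>2 / |w|^2\<close>, because
      \<open>|w|^2 = 2 - 2 r\<close>.\<close>
    define k where "k = complex_of_real (1 / (1 - r))"
    have kr: "k * (1 - complex_of_real r) = 1"
    proof -
      have "k * (1 - complex_of_real r) = complex_of_real ((1 / (1 - r)) * (1 - r))" unfolding k_def by simp
      thus ?thesis using False by simp
    qed
    have k2: "k * k * (2 - 2 * complex_of_real r) = 2 * k"
    proof -
      have "k * k * (2 - 2 * complex_of_real r) = 2 * k * (k * (1 - complex_of_real r))" by (simp add: algebra_simps)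
      thus ?thesis using kr by simp
    qed
    define T where "T = w * adj w"
    have T: "car (Suc n) (Suc n) T" unfolding T_def using w by (intro car_intros)
    have aT: "adj T = T" by (simp add: T_def adj_mult)
    define m where "m = 2 - 2 * complex_of_real r"
    have TT: "T * T = cs m T"
    proof -
      have "T * T = w * (adj w * w) * adj w" by (simp add: T_def mult.assoc)
      also have "\<dots> = cs (2 - 2 * complex_of_real r) (w * Idn 1 * adj w)" unfolding ww by simp
      finally show ?thesis using mult_Idn[OF w] by (simp add: T_def m_def)
    qed
    define U where "U = Idn (Suc n) - cs k T"
    have U: "car (Suc n) (Suc n) U" unfolding U_def using T by (intro car_intros)
    have "cnj k = k" by (simp add: k_def)
    hence aU: "adj U = U" by (simp add: U_def adj_diff adj_dg adj_cs aT)
    have UU: "U * U = Idn (Suc n)"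
    proof -
      have "U * U = Idn (Suc n) - cs k T - cs k T + cs (k * k * m) T"
        unfolding U_def left_diff_distrib right_diff_distrib using Idn_mult[OF T] mult_Idn[OF T]
        by (simp add: dg_mult_dg TT mult_ac)
      also have "\<dots> = Idn (Suc n)" unfolding k2[folded m_def] by (rule fmat_eqI) (simp add: algebra_simps)
      finally show ?thesis .
    qed
    have "U * ?e = ?e - cs k (w * (adj w * ?e))"
      unfolding U_def left_diff_distrib T_def using Idn_mult[OF car_bcol] by (simp add: mult.assoc)
    also have "\<dots> = ?e + cs (k * (1 - complex_of_real r)) w"
      unfolding we using mult_Idn[OF w] by (intro fmat_eqI) (simp add: algebra_simps)
    also have "\<dots> = cs c x" unfolding kr by (simp add: w_def u_def)
    finally show ?thesis using U aU UU by blast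
  qed
qed

text \<open>Induction on the size. Conjugation with a reflection that carries the last basis vector
  to a multiple of an eigenvector makes the last column diagonal; self-adjointness then clears the
  last row and makes the eigenvalue real. What is left has format \<open>n\<close>.\<close>

lemma spectral_theorem:
  "car n n H \<Longrightarrow> adj H = H \<Longrightarrow> \<exists>Q l. car n n Q \<and> adj Q * Q = Idn n \<and> Q * adj Q = Idn n \<and> H = Q * dg n (\<lambda>i. complex_of_real (l i)) * adj Q"
proof (induction n arbitrary: H)
  case 0
  hence "H = 0" by (intro fmat_eqI) (auto simp: car_def)
  moreover have "Idn 0 = 0" by (rule fmat_eqI) simp
  ultimately show ?case by (intro exI[of _ 0]) (auto simp: car_zero)
next
  case (Suc n)
  note H = Suc.prems
  obtain x e where x: "car (Suc n) 1 x" "adj x * x = Idn 1" "H * x = cs e x"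
    using eigenvector_exists_fmat[OF H(1)] by blast
  obtain U c where U: "car (Suc n) (Suc n) U" "adj U = U" "U * U = Idn (Suc n)" "U * bcol n = cs c x"
    using unitary_last_column[OF x(1,2)] by blast
  let ?e = "bcol n"
  define H' where "H' = U * H * U"
  have cH': "car (Suc n) (Suc n) H'" unfolding H'_def using U(1) H(1) by (intro car_intros)
  have aH': "adj H' = H'" by (simp add: H'_def adj_mult U(2) H(2) mult.assoc)
  have "H' * ?e = U * (H * (U * ?e))" by (simp add: H'_def mult.assoc)
  also have "\<dots> = cs e (U * (U * ?e))" unfolding U(4) by (simp add: x(3) mult.commute)
  also have "U * (U * ?e) = ?e" unfolding mult.assoc[symmetric] U(3) by (rule Idn_mult[OF car_bcol])
  finally have H'e: "H' * ?e = cs e ?e" .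
  have colH': "ent H' i n = (if i = n then e else 0)" for i
    using arg_cong[OF H'e, of "\<lambda>X. ent X i 0"] by (simp add: mult_bcol)
  have hH': "ent H' i j = cnj (ent H' j i)" for i j using arg_cong[OF aH', of "\<lambda>X. ent X i j"] by simp
  have ereal: "e = complex_of_real (Re e)" using hH'[of n n] colH'[of n] by (simp add: complex_eq_iff)
  \<comment> \<open>The projection onto the last basis vector. Since all formats live in one type, a
    block sum is ordinary addition: \<open>K + e N\<close> for the matrix, \<open>Q + N\<close> for
    the unitary, and the mixed products vanish.\<close>
  define N where "N = dg (Suc n) (\<lambda>i. if i = n then 1 else 0)"
  define K where "K = H' - cs e N"
  have K: "car n n K"
    unfolding car_def
  proof (intro allI impI)
    fix i j assume ij: "n \<le> i \<or> n \<le> j"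
    consider "Suc n \<le> i \<or> Suc n \<le> j" | "j = n" | "i = n" using ij by linarith
    thus "ent K i j = 0"
    proof cases
      case 1
      thus ?thesis using cH' by (auto simp: K_def N_def car_def)
    next
      case 2
      thus ?thesis using colH'[of i] by (auto simp: K_def N_def)
    next
      case 3
      thus ?thesis using colH'[of j] hH'[of i j] ereal by (auto simp: K_def N_def)
    qed
  qed
  have "cnj e = e" using ereal by (metis complex_cnj_complex_of_real)
  hence aK: "adj K = K" unfolding K_def N_def by (simp add: adj_diff aH' adj_cs adj_dg if_distrib cong: if_cong)
  obtain Q l where Q: "car n n Q" "adj Q * Q = Idn n" "Q * adj Q = Idn n" "K = Q * dg n (\<lambda>i. complex_of_real (l i)) * adj Q"
    using Suc.IH[OF K aK] by blast
  have NZ1: "N * X = 0" if "car n n X" for X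
    using that by (intro fmat_eqI) (auto simp: N_def ent_dg_mult car_def)
  have aN: "adj N = N" unfolding N_def adj_dg by (rule dg_cong) auto
  have NZ: "N * X = 0" "X * N = 0" if "car n n X" for X
  proof -
    show "N * X = 0" using that by (rule NZ1)
    have "adj (N * adj X) = adj 0" unfolding NZ1[OF car_adj[OF that]] ..
    moreover have "adj 0 = 0" by (rule fmat_eqI) simp
    ultimately show "X * N = 0" by (simp add: adj_mult aN)
  qed
  have NN: "N * N = N" unfolding N_def dg_mult_dg by (rule dg_cong) auto
  have IN: "Idn n + N = Idn (Suc n)" by (rule fmat_eqI) (auto simp: N_def)
  have cN: "car (Suc n) (Suc n) N" unfolding N_def by (rule car_dg)
  define Q' where "Q' = Q + N"
  have cQ: "car (Suc n) (Suc n) Q" using Q(1) by (rule car_mono) auto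
  have Q': "car (Suc n) (Suc n) Q'" unfolding Q'_def using cQ cN by (rule car_add)
  have Q'1: "adj Q' * Q' = Idn (Suc n)" "Q' * adj Q' = Idn (Suc n)"
    unfolding Q'_def adj_add aN distrib_left distrib_right using NZ[OF Q(1)] NZ[OF car_adj[OF Q(1)]]
    by (simp_all add: Q(2,3) NN IN)
  define l' where "l' i = (if i = n then Re e else l i)" for i
  have D: "dg (Suc n) (\<lambda>i. complex_of_real (l' i)) = dg n (\<lambda>i. complex_of_real (l i)) + cs e N"
    by (rule fmat_eqI) (use ereal in \<open>auto simp: N_def l'_def\<close>)
  have H'D: "H' = Q' * dg (Suc n) (\<lambda>i. complex_of_real (l' i)) * adj Q'"
  proof -
    have "Q' * dg (Suc n) (\<lambda>i. complex_of_real (l' i)) * adj Q' = K + cs e N"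
      unfolding D Q'_def adj_add aN distrib_left distrib_right Q(4)
      using NZ[OF Q(1)] NZ[OF car_adj[OF Q(1)]] NZ[OF car_dg[of n "\<lambda>i. complex_of_real (l i)"]]
      by (simp add: NN mult.assoc)
    thus ?thesis by (simp add: K_def)
  qed
  have "H = U * H' * U"
  proof -
    have "U * H' * U = (U * U) * H * (U * U)" by (simp add: H'_def mult.assoc)
    thus ?thesis using U(3) Idn_mult[OF H(1)] mult_Idn[OF H(1)] by simp
  qed
  hence "H = (U * Q') * dg (Suc n) (\<lambda>i. complex_of_real (l' i)) * adj (U * Q')"
    unfolding H'D by (simp add: adj_mult U(2) mult.assoc)
  moreover have "car (Suc n) (Suc n) (U * Q')" using U(1) Q' by (rule car_mult)
  moreover have "adj (U * Q') * (U * Q') = adj Q' * ((U * U) * Q')" by (simp add: adj_mult U(2) mult.assoc)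
  hence "adj (U * Q') * (U * Q') = Idn (Suc n)" using U(3) Idn_mult[OF Q'] Q'1 by simp
  moreover have "(U * Q') * adj (U * Q') = U * (Q' * adj Q') * U" by (simp add: adj_mult U(2) mult.assoc)
  hence "(U * Q') * adj (U * Q') = Idn (Suc n)" using U(3) mult_Idn[OF U(1)] Q'1 by simp
  ultimately show ?case by blast
qed

text \<open>\<open>X\<close> may have rows beyond \<open>n\<close>, which \<open>Q\<close>
  annihilates. The exact statement is \<open>norm (Q * X) = norm (Idn n * X)\<close>, and the
  cut-off accounts for the inequality.\<close>

lemma norm_isometry_mult_le: assumes "car n n Q" "adj Q * Q = Idn n" shows "norm (Q * X) \<le> norm X" "norm (X * adj Q) \<le> norm X"
proof -
  have *: "norm (Q * X) \<le> norm X" for X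
  proof -
    have "complex_of_real ((norm (Q * X))\<^sup>2) = tr ((Q * X) * adj (Q * X))" by (rule tr_mult_adj[symmetric])
    also have "\<dots> = tr (adj X * (adj Q * Q) * X)" unfolding tr_comm[of "Q * X"] adj_mult by (simp add: mult.assoc)
    also have "\<dots> = tr (adj (Idn n * X) * (Idn n * X))" unfolding assms(2) adj_mult
      by (simp add: adj_dg mult.assoc[of _ "Idn n"] mult.assoc[symmetric, of "Idn n" "Idn n"] dg_mult_dg)
    also have "\<dots> = complex_of_real ((norm (Idn n * X))\<^sup>2)" unfolding tr_comm[of "adj _"] by (rule tr_mult_adj)
    finally have "(norm (Q * X))\<^sup>2 = (norm (Idn n * X))\<^sup>2" by (simp only: of_real_eq_iff)
    hence "norm (Q * X) = norm (Idn n * X)" by simp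
    also have "\<dots> \<le> 1 * norm X" by (rule norm_dg_mult_le) auto
    finally show ?thesis by simp
  qed
  show "norm (Q * X) \<le> norm X" by (rule *)
  have "norm (X * adj Q) = norm (Q * adj X)" by (metis adj_adj adj_mult norm_adj)
  thus "norm (X * adj Q) \<le> norm X" using *[of "adj X"] by simp
qed

text \<open>The resolvent \<open>(z - H)^-1\<close> relative to the local unit \<open>Idn d\<close>.
  By \<open>Rs_spectral\<close> the choice is unique as soon as \<open>H\<close> is self-adjoint of
  format \<open>d\<close> and \<open>Im z > 0\<close>.\<close>

definition Rs :: "nat \<Rightarrow> complex \<Rightarrow> fmat \<Rightarrow> fmat" where
  "Rs d z H = (SOME R. car d d R \<and> (cs z (Idn d) - H) * R = Idn d)"

lemma Rs_spectral:
  assumes Q: "car d d Q" "adj Q * Q = Idn d" "Q * adj Q = Idn d" and H: "H = Q * dg d (\<lambda>i. complex_of_real (l i)) * adj Q"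
    and z: "0 < Im z"
  shows "Rs d z H = Q * dg d (\<lambda>i. 1 / (z - complex_of_real (l i))) * adj Q"
    and "(cs z (Idn d) - H) * Rs d z H = Idn d" and "Rs d z H * (cs z (Idn d) - H) = Idn d"
proof -
  define R0 where "R0 = Q * dg d (\<lambda>i. 1 / (z - complex_of_real (l i))) * adj Q"
  have nz: "z - complex_of_real (l i) \<noteq> 0" for i using z by (auto simp: complex_eq_iff)
  have R0: "car d d R0" unfolding R0_def by (rule car_mult[OF car_mult[OF Q(1) car_dg] car_adj[OF Q(1)]])
  have zH: "cs z (Idn d) - H = Q * dg d (\<lambda>i. z - complex_of_real (l i)) * adj Q"
  proof -
    have "Q * dg d (\<lambda>i. z - complex_of_real (l i)) * adj Q = Q * (cs z (Idn d) - dg d (\<lambda>i. complex_of_real (l i))) * adj Q"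
      unfolding cs_dg dg_diff by simp
    also have "\<dots> = cs z (Q * Idn d * adj Q) - H" unfolding H by (simp add: left_diff_distrib right_diff_distrib)
    also have "Q * Idn d * adj Q = Idn d" using mult_Idn[OF Q(1)] Q(3) by simp
    finally show ?thesis by simp
  qed
  have cz: "car d d (cs z (Idn d) - H)" unfolding zH by (rule car_mult[OF car_mult[OF Q(1) car_dg] car_adj[OF Q(1)]])
  have prod: "(Q * dg d f * adj Q) * (Q * dg d g * adj Q) = Q * dg d (\<lambda>i. f i * g i) * adj Q" for f g
  proof -
    have "(Q * dg d f * adj Q) * (Q * dg d g * adj Q) = Q * dg d f * (adj Q * Q) * dg d g * adj Q" by (simp add: mult.assoc)
    also have "\<dots> = Q * (dg d f * Idn d * dg d g) * adj Q" unfolding Q(2) by (simp add: mult.assoc)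
    finally show ?thesis by (simp add: dg_mult_dg)
  qed
  have one: "Q * dg d (\<lambda>i. 1) * adj Q = Idn d" using mult_Idn[OF Q(1)] Q(3) by simp
  have r: "(cs z (Idn d) - H) * R0 = Idn d" unfolding zH R0_def prod using nz one by simp
  have l: "R0 * (cs z (Idn d) - H) = Idn d" unfolding zH R0_def prod using nz one by simp
  have "car d d (Rs d z H) \<and> (cs z (Idn d) - H) * Rs d z H = Idn d"
    unfolding Rs_def by (rule someI[of _ R0]) (use R0 r in blast)
  hence c: "car d d (Rs d z H)" and r': "(cs z (Idn d) - H) * Rs d z H = Idn d" by blast+
  have "Rs d z H = (R0 * (cs z (Idn d) - H)) * Rs d z H" unfolding l using Idn_mult[OF c] by simp
  also have "\<dots> = R0" unfolding mult.assoc r' using mult_Idn[OF R0] .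
  finally have e: "Rs d z H = R0" .
  show "Rs d z H = Q * dg d (\<lambda>i. 1 / (z - complex_of_real (l i))) * adj Q" using e by (simp add: R0_def)
  show "(cs z (Idn d) - H) * Rs d z H = Idn d" by (rule r')
  show "Rs d z H * (cs z (Idn d) - H) = Idn d" unfolding e by (rule l)
qed

lemma resolvent_norm_le: "0 < Im z \<Longrightarrow> cmod (1 / (z - complex_of_real t)) \<le> 1 / Im z"
  using abs_Im_le_cmod[of "z - complex_of_real t"] by (simp add: norm_divide frac_le)

text \<open>The operator norm bound \<open>1 / Im z\<close> is stated as a multiplier bound in the
  Hilbert-Schmidt norm, so that a resolvent factor never costs a power of the dimension.\<close>

lemma Rs_properties:
  assumes H: "car d d H" "adj H = H" and z: "0 < Im z"
  shows Rs_car: "car d d (Rs d z H)" and Rs_right: "(cs z (Idn d) - H) * Rs d z H = Idn d"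
    and Rs_left: "Rs d z H * (cs z (Idn d) - H) = Idn d"
    and norm_Rs_mult_le: "norm (Rs d z H * X) \<le> norm X / Im z" and norm_mult_Rs_le: "norm (X * Rs d z H) \<le> norm X / Im z"
    and Rs_tr: "\<exists>l. tr (Rs d z H) = (\<Sum>i<d. 1 / (z - complex_of_real (l i)))"
proof -
  obtain Q l where Q: "car d d Q" "adj Q * Q = Idn d" "Q * adj Q = Idn d" "H = Q * dg d (\<lambda>i. complex_of_real (l i)) * adj Q"
    using spectral_theorem[OF H] by blast
  note R = Rs_spectral[OF Q z]
  show "car d d (Rs d z H)" unfolding R(1) by (rule car_mult[OF car_mult[OF Q(1) car_dg] car_adj[OF Q(1)]])
  show "(cs z (Idn d) - H) * Rs d z H = Idn d" "Rs d z H * (cs z (Idn d) - H) = Idn d" by (rule R)+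
  let ?D = "dg d (\<lambda>i. 1 / (z - complex_of_real (l i)))"
  have Q': "car d d (adj Q)" "adj (adj Q) * adj Q = Idn d" using Q by (auto intro: car_adj)
  have "norm (Rs d z H * X) = norm (Q * (?D * (adj Q * X)))" unfolding R(1) by (simp add: mult.assoc)
  also have "\<dots> \<le> norm (?D * (adj Q * X))" by (rule norm_isometry_mult_le[OF Q(1,2)])
  also have "\<dots> \<le> (1 / Im z) * norm (adj Q * X)" using z by (intro norm_dg_mult_le resolvent_norm_le) auto
  also have "\<dots> \<le> (1 / Im z) * norm X" using z by (intro mult_left_mono norm_isometry_mult_le[OF Q']) auto
  finally show "norm (Rs d z H * X) \<le> norm X / Im z" by simp
  have "norm (X * Rs d z H) = norm (((X * Q) * ?D) * adj Q)" unfolding R(1) by (simp add: mult.assoc)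
  also have "\<dots> \<le> norm ((X * Q) * ?D)" by (rule norm_isometry_mult_le[OF Q(1,2)])
  also have "\<dots> \<le> (1 / Im z) * norm (X * Q)" using z by (intro norm_mult_dg_le resolvent_norm_le) auto
  also have "\<dots> \<le> (1 / Im z) * norm X" using z norm_isometry_mult_le(2)[OF Q', of X] by (intro mult_left_mono) auto
  finally show "norm (X * Rs d z H) \<le> norm X / Im z" by simp
  have "tr (Rs d z H) = tr (?D * (adj Q * Q))" unfolding R(1) mult.assoc tr_comm[of Q] by (simp add: mult.assoc)
  also have "\<dots> = (\<Sum>i<d. 1 / (z - complex_of_real (l i)))" unfolding Q(2) by (simp add: dg_mult_dg tr_dg)
  finally show "\<exists>l. tr (Rs d z H) = (\<Sum>i<d. 1 / (z - complex_of_real (l i)))" by blast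
qed

lemma tr_Rs_norm_le: assumes H: "car d d H" "adj H = H" and z: "0 < Im z"
  shows "cmod (tr (Rs d z H)) \<le> real d / Im z"
proof -
  obtain l where "tr (Rs d z H) = (\<Sum>i<d. 1 / (z - complex_of_real (l i)))" using Rs_tr[OF assms] by blast
  also have "cmod \<dots> \<le> (\<Sum>i<d. 1 / Im z)" by (rule sum_norm_le) (rule resolvent_norm_le[OF z])
  finally show ?thesis by simp
qed

lemma Im_tr_Rs: assumes H: "car d d H" "adj H = H" and z: "0 < Im z" and d: "1 \<le> d"
  shows "Im (tr (Rs d z H)) < 0"
proof -
  obtain l where l: "tr (Rs d z H) = (\<Sum>i<d. 1 / (z - complex_of_real (l i)))" using Rs_tr[OF H z] by blast
  have "0 < (Re (z - complex_of_real (l i)))\<^sup>2 + (Im (z - complex_of_real (l i)))\<^sup>2" for i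
    using z by (intro add_nonneg_pos) auto
  hence "Im (1 / (z - complex_of_real (l i))) < 0" for i
    using z by (subst Im_divide) (auto intro!: divide_neg_pos)
  hence "(\<Sum>i<d. Im (1 / (z - complex_of_real (l i)))) < 0"
    using d sum_strict_mono[of "{..<d}" "\<lambda>i. Im (1 / (z - complex_of_real (l i)))" "\<lambda>_. 0"] by (auto simp: lessThan_empty_iff)
  thus ?thesis unfolding l Im_sum .
qed

text \<open>The resolvent identity. The Lipschitz bound and the derivative of the resolvent are both
  read off from it.\<close>

lemma Rs_diff:
  assumes H: "car d d H" "adj H = H" and H': "car d d H'" "adj H' = H'" and z: "0 < Im z"
  shows "Rs d z H' - Rs d z H = Rs d z H' * (H' - H) * Rs d z H"
proof -
  have "Rs d z H' * (H' - H) * Rs d z H = Rs d z H' * ((cs z (Idn d) - H) - (cs z (Idn d) - H')) * Rs d z H" by simp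
  also have "\<dots> = Rs d z H' * ((cs z (Idn d) - H) * Rs d z H) - (Rs d z H' * (cs z (Idn d) - H')) * Rs d z H"
    unfolding right_diff_distrib[of "Rs d z H'"] left_diff_distrib[of _ _ "Rs d z H"] by (simp add: mult.assoc)
  also have "\<dots> = Rs d z H' - Rs d z H"
    unfolding Rs_right[OF H z] Rs_left[OF H' z] using Idn_mult[OF Rs_car[OF H z]] mult_Idn[OF Rs_car[OF H' z]] by simp
  finally show ?thesis by simp
qed

lemma Rs_dist_le:
  assumes H: "car d d H" "adj H = H" and H': "car d d H'" "adj H' = H'" and z: "0 < Im z"
  shows "norm (Rs d z H' - Rs d z H) \<le> norm (H' - H) / (Im z)\<^sup>2"
proof -
  have "norm (Rs d z H' * (H' - H) * Rs d z H) \<le> norm (Rs d z H' * (H' - H)) / Im z" by (rule norm_mult_Rs_le[OF H z])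
  also have "\<dots> \<le> (norm (H' - H) / Im z) / Im z" using z by (intro divide_right_mono norm_Rs_mult_le[OF H' z]) auto
  finally show ?thesis unfolding Rs_diff[OF assms] by (simp add: power2_eq_square)
qed

lemma Rs_tendsto:
  assumes H: "\<And>x. car d d (H x)" "\<And>x. adj (H x) = H x" and z: "0 < Im z" and L: "car d d L" "adj L = L" and lim: "(H \<longlongrightarrow> L) F"
  shows "((\<lambda>x. Rs d z (H x)) \<longlongrightarrow> Rs d z L) F"
proof -
  have "((\<lambda>x. norm (H x - L) / (Im z)\<^sup>2) \<longlongrightarrow> norm (L - L) / (Im z)\<^sup>2) F"
    using z by (intro tendsto_intros lim) auto
  hence 0: "((\<lambda>x. norm (H x - L) / (Im z)\<^sup>2) \<longlongrightarrow> 0) F" by simp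
  have "((\<lambda>x. Rs d z (H x) - Rs d z L) \<longlongrightarrow> 0) F"
    by (rule Lim_null_comparison[OF _ 0]) (intro always_eventually allI Rs_dist_le L H z)
  thus ?thesis by (simp add: LIM_zero_iff)
qed

lemma Rs_continuous:
  assumes H: "\<And>x. car d d (H x)" "\<And>x. adj (H x) = H x" and z: "0 < Im z" and c: "continuous_on S H"
  shows "continuous_on S (\<lambda>x. Rs d z (H x))"
  using c unfolding continuous_on_def by (auto intro!: Rs_tendsto H z)

text \<open>In this form the exact difference quotient supplied by \<open>Rs_diff\<close> can be
  passed to the limit directly.\<close>

lemma has_vector_derivative_iff_quotient:
  "(f has_vector_derivative D) (at x) \<longleftrightarrow> ((\<lambda>h. (f (x + h) - f x) /\<^sub>R h) \<longlongrightarrow> D) (at 0)"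
proof -
  have "norm (f (x + h) - f x - h *\<^sub>R D) / norm h = norm ((f (x + h) - f x) /\<^sub>R h - D)" if "h \<noteq> 0" for h
  proof -
    have "(f (x + h) - f x) /\<^sub>R h - D = (f (x + h) - f x - h *\<^sub>R D) /\<^sub>R h"
      using that by (simp add: scaleR_diff_right)
    thus ?thesis by (simp add: divide_inverse mult.commute)
  qed
  hence "((\<lambda>h. norm (f (x + h) - f x - h *\<^sub>R D) / norm h) \<longlongrightarrow> 0) (at 0)
     \<longleftrightarrow> ((\<lambda>h. norm ((f (x + h) - f x) /\<^sub>R h - D)) \<longlongrightarrow> 0) (at 0)"
    by (intro LIM_cong refl)
  thus ?thesis unfolding has_vector_derivative_def has_derivative_at
    by (simp add: bounded_linear_scaleR_left tendsto_norm_zero_iff LIM_zero_iff)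
qed

lemma Rs_has_vector_derivative:
  assumes H: "\<And>t. car d d (H t)" "\<And>t. adj (H t) = H t" and z: "0 < Im z" and D: "(H has_vector_derivative H') (at t)"
  shows "((\<lambda>t. Rs d z (H t)) has_vector_derivative (Rs d z (H t) * H' * Rs d z (H t))) (at t)"
proof -
  have "isCont H t" using D by (rule has_vector_derivative_continuous)
  hence "((\<lambda>h. H (t + h)) \<longlongrightarrow> H t) (at 0)" by (simp add: isCont_iff)
  hence "((\<lambda>h. Rs d z (H (t + h))) \<longlongrightarrow> Rs d z (H t)) (at 0)" by (intro Rs_tendsto H z)
  moreover have "((\<lambda>h. (H (t + h) - H t) /\<^sub>R h) \<longlongrightarrow> H') (at 0)" using D unfolding has_vector_derivative_iff_quotient .
  ultimately have "((\<lambda>h. Rs d z (H (t + h)) * ((H (t + h) - H t) /\<^sub>R h) * Rs d z (H t)) \<longlongrightarrow> Rs d z (H t) * H' * Rs d z (H t)) (at 0)"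
    by (intro tendsto_mult tendsto_const)
  moreover have "Rs d z (H (t + h)) * ((H (t + h) - H t) /\<^sub>R h) * Rs d z (H t) = (Rs d z (H (t + h)) - Rs d z (H t)) /\<^sub>R h" for h
    unfolding Rs_diff[OF H[of t] H[of "t + h"] z] by simp
  ultimately show ?thesis unfolding has_vector_derivative_iff_quotient by (simp only:)
qed

section \<open>The resolvent of a Gaussian sample covariance matrix\<close>

lemma car_sum: "(\<And>a. a \<in> S \<Longrightarrow> car p d (f a)) \<Longrightarrow> car p d (sum f S)"
  by (induction S rule: infinite_finite_induct) (auto intro: car_zero car_add)

text \<open>Exhibits a diagonal matrix as a finite sum of bounded linear images of its entries, so
  that its continuity and its derivative reduce to those of the entries.\<close>

lemma dg_eq_sum: "dg n c = (\<Sum>i<n. cs (c i) (dg n (\<lambda>j. if j = i then 1 else 0)))"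
proof (rule fmat_eqI)
  fix a b
  have car: "ent (\<Sum>i\<in>S. cs (c i) (dg n (\<lambda>j. if j = i then 1 else 0))) a b = (\<Sum>i\<in>S. ent (cs (c i) (dg n (\<lambda>j. if j = i then 1 else 0))) a b)" for S :: "nat set"
    by (induction S rule: infinite_finite_induct) auto
  have "ent (cs (c i) (dg n (\<lambda>j. if j = i then 1 else 0))) a b = (if i = a then (if a = b \<and> a < n then c a else 0) else 0)" for i
    by auto
  thus "ent (dg n c) a b = ent (\<Sum>i<n. cs (c i) (dg n (\<lambda>j. if j = i then 1 else 0))) a b"
    unfolding car by simp
qed

lemma dg_has_vector_derivative:
  assumes "\<And>i. i < n \<Longrightarrow> ((\<lambda>t. f t i) has_vector_derivative f' i) (at t)"
  shows "((\<lambda>t. dg n (f t)) has_vector_derivative dg n f') (at t)"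
proof -
  have "((\<lambda>t. \<Sum>i<n. cs (f t i) (dg n (\<lambda>j. if j = i then 1 else 0))) has_vector_derivative
    (\<Sum>i<n. cs (f' i) (dg n (\<lambda>j. if j = i then 1 else 0)))) (at t)"
    by (intro has_vector_derivative_sum bounded_linear.has_vector_derivative[OF bounded_bilinear.bounded_linear_left[OF bounded_bilinear_cs]] assms) auto
  thus ?thesis unfolding dg_eq_sum[symmetric] .
qed

lemma dg_continuous_on:
  assumes "\<And>i. i < n \<Longrightarrow> continuous_on S (\<lambda>t. f t i)"
  shows "continuous_on S (\<lambda>t. dg n (f t))"
proof -
  have "continuous_on S (\<lambda>t. \<Sum>i<n. cs (f t i) (dg n (\<lambda>j. if j = i then 1 else 0)))"
    by (intro continuous_on_sum bounded_linear.continuous_on[OF bounded_bilinear.bounded_linear_left[OF bounded_bilinear_cs]] assms) auto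
  thus ?thesis unfolding dg_eq_sum[symmetric] .
qed

text \<open>Covers real and complex Ginibre matrices at once: \<open>Ym\<close> has independent real
  Gaussian coordinates along \<open>Eb\<close>. \<open>contr\<close> encodes the covariance and
  produces the main term over both fields. \<open>extra\<close> is the contraction without adjoint,
  which vanishes in the complex basis and is an error term in the real one. \<open>bessel\<close>
  bounds gradients. The middle matrix \<open>A\<close> is diagonal because the diagonalizing unitary
  is made part of \<open>Eb\<close>.\<close>

locale gaussian_matrix = gauss_vec I "1 / sqrt (real d)" for I :: "'i::countable set" and d :: nat +
  fixes p :: nat and Eb :: "'i \<Rightarrow> fmat" and v :: "nat \<Rightarrow> real" and V C :: real
  assumes d: "1 \<le> d" and V: "0 < V" "\<And>i. i < p \<Longrightarrow> \<bar>v i\<bar> \<le> V" and C: "real p \<le> C * real d"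
    and card: "card I \<le> 2 * p * d"
    and carE: "\<And>\<alpha>. \<alpha> \<in> I \<Longrightarrow> car p d (Eb \<alpha>)"
    and contr: "\<And>X. car d d X \<Longrightarrow> (\<Sum>\<alpha>\<in>I. Eb \<alpha> * X * adj (Eb \<alpha>)) = cs (tr X) (Idn p)"
    and bessel: "\<And>X. car d p X \<Longrightarrow> (\<Sum>\<alpha>\<in>I. (cmod (tr (Eb \<alpha> * X)))\<^sup>2) \<le> (norm X)\<^sup>2"
    and extra: "\<And>X X'. car d p X \<Longrightarrow> car d p X' \<Longrightarrow> cmod (\<Sum>\<alpha>\<in>I. tr (Eb \<alpha> * X * Eb \<alpha> * X')) \<le> norm X * norm X'"
    and normY: "\<And>x. (norm (\<Sum>\<alpha>\<in>I. x \<alpha> *\<^sub>R Eb \<alpha>))\<^sup>2 \<le> (\<Sum>\<alpha>\<in>I. (x \<alpha>)\<^sup>2)"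
begin

definition A where "A = dg p (\<lambda>i. complex_of_real (v i))"
definition Ym where "Ym x = (\<Sum>\<alpha>\<in>I. x \<alpha> *\<^sub>R Eb \<alpha>)" for x :: "'i \<Rightarrow> real"
definition Hm where "Hm x = adj (Ym x) * A * Ym x"
definition G where "G z x = tr (Rs d z (Hm x)) / of_nat d"

lemma carY: "car p d (Ym x)"
  unfolding Ym_def scaleR_fmat_def by (intro car_sum car_cs carE)

lemma carA: "car p p A" and adjA: "adj A = A"
  by (auto simp: A_def car_dg adj_dg)

lemma carH: "car d d (Hm x)"
  unfolding Hm_def by (rule car_mult[OF car_mult[OF car_adj[OF carY] carA] carY])

lemma adjH: "adj (Hm x) = Hm x"
  unfolding Hm_def by (simp add: adj_mult adjA mult.assoc)

lemma norm_Ym: "(norm (Ym x))\<^sup>2 \<le> sq x"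
  unfolding Ym_def sq_def by (rule normY)

lemma Y_continuous: "continuous_on UNIV Ym"
  unfolding Ym_def by (intro continuous_intros continuous_on_product_coordinates)

lemma H_continuous: "continuous_on UNIV Hm"
  unfolding Hm_def by (intro continuous_intros Y_continuous bounded_linear.continuous_on[OF bounded_linear_adj])

lemma R_continuous: "0 < Im z \<Longrightarrow> continuous_on UNIV (\<lambda>x. Rs d z (Hm x))"
  by (rule Rs_continuous[OF carH adjH _ H_continuous])

text \<open>The trace is not bounded in the Hilbert-Schmidt norm across all formats, but the pairing
  with \<open>Idn d\<close> is. Continuity and derivatives of \<open>G\<close> therefore go through
  \<open>bounded_bilinear_tr\<close>.\<close>

lemma tr_R: "0 < Im z \<Longrightarrow> tr (Rs d z (Hm x)) = tr (Idn d * Rs d z (Hm x))"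
  by (simp only: Idn_mult[OF Rs_car[OF carH adjH]])

lemma G_continuous: "0 < Im z \<Longrightarrow> continuous_on UNIV (G z)"
  unfolding G_def[abs_def] tr_R divide_inverse
  by (intro continuous_intros bounded_linear.continuous_on[OF bounded_bilinear.bounded_linear_right[OF bounded_bilinear_tr]] R_continuous)

lemma G_norm: "0 < Im z \<Longrightarrow> cmod (G z x) \<le> 1 / Im z"
proof -
  assume z: "0 < Im z"
  have "cmod (G z x) = cmod (tr (Rs d z (Hm x))) / real d" by (simp add: G_def norm_divide)
  also have "\<dots> \<le> (real d / Im z) / real d" by (intro divide_right_mono tr_Rs_norm_le carH adjH z) auto
  finally show ?thesis using d by simp
qed

lemma Im_G: "0 < Im z \<Longrightarrow> Im (G z x) < 0"
proof -
  assume z: "0 < Im z"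
  have "Im (G z x) = Im (tr (Rs d z (Hm x))) / real d" by (simp add: G_def Im_divide_of_nat)
  thus ?thesis using Im_tr_Rs[OF carH adjH z d] d by (simp add: divide_neg_pos)
qed

text \<open>Continuity refers to the full function space, measurability to the finite product.
  Setting the coordinates outside \<open>I\<close> to 0 connects them; the index type is countable
  so that measurability into the function space can be tested coordinatewise.\<close>

lemma borel_measurable_continuous_PiM:
  fixes f :: "('i \<Rightarrow> real) \<Rightarrow> complex"
  assumes f: "continuous_on UNIV f" and dep: "\<And>x. f x = f (\<lambda>\<alpha>. if \<alpha> \<in> I then x \<alpha> else 0)"
  shows "f \<in> borel_measurable P"
proof -
  have "(\<lambda>x \<alpha>. if \<alpha> \<in> I then x \<alpha> else (0::real)) \<in> borel_measurable P"
  proof (rule measurable_coordinatewise_then_product)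
    show "(\<lambda>x. if \<alpha> \<in> I then x \<alpha> else (0::real)) \<in> borel_measurable P" for \<alpha> by (cases "\<alpha> \<in> I") auto
  qed
  hence "(\<lambda>x. f (\<lambda>\<alpha>. if \<alpha> \<in> I then x \<alpha> else 0)) \<in> borel_measurable P"
    using borel_measurable_continuous_onI[OF f] by (rule measurable_compose)
  thus ?thesis unfolding dep[symmetric] .
qed

lemma Ym_dep: "Ym x = Ym (\<lambda>\<alpha>. if \<alpha> \<in> I then x \<alpha> else 0)"
  unfolding Ym_def by (intro sum.cong) auto

lemma normE: assumes "\<alpha> \<in> I" shows "norm (Eb \<alpha>) \<le> 1"
proof -
  define x where "x \<beta> = (if \<beta> = \<alpha> then 1 else 0 :: real)" for \<beta>
  have "(\<Sum>\<beta>\<in>I. x \<beta> *\<^sub>R Eb \<beta>) = Eb \<alpha>"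
    using assms fin by (simp add: x_def if_distrib[of "\<lambda>r. r *\<^sub>R _"] cong: if_cong)
  moreover have "(\<Sum>\<beta>\<in>I. (x \<beta>)\<^sup>2) = 1"
    using assms fin by (simp add: x_def if_distrib[of "\<lambda>r. r\<^sup>2"] cong: if_cong)
  ultimately have "(norm (Eb \<alpha>))\<^sup>2 \<le> 1\<^sup>2" using normY[of x] by simp
  thus ?thesis by (rule power2_le_imp_le) simp
qed

lemma norm_A_mult: "norm (A * X) \<le> V * norm X" "norm (X * A) \<le> V * norm X"
  unfolding A_def using V by (auto intro!: norm_dg_mult_le norm_mult_dg_le)

section \<open>Integration by parts at a point far above the real axis\<close>

context
  fixes z :: complex
  assumes z: "0 < Im z" "2 * V \<le> Im z"
begin

abbreviation "y \<equiv> Im z"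
abbreviation R where "R x \<equiv> Rs d z (Hm x)"
abbreviation g where "g x \<equiv> G z x"
text \<open>\<open>B b\<close> is \<open>A (1 - b A)^-1\<close> and \<open>Bd b\<close> its
  derivative in \<open>b\<close>; \<open>hh\<close> is the defect of the fixed point equation and
  \<open>hp\<close> its derivative. \<open>DH\<close>, \<open>DR\<close> and \<open>Dg\<close> are
  derivatives in the coordinate \<open>\<alpha>\<close>.\<close>

definition B where "B b = dg p (\<lambda>i. complex_of_real (v i) / (1 - complex_of_real (v i) * b))"
definition Bd where "Bd b = dg p (\<lambda>i. (complex_of_real (v i))\<^sup>2 / (1 - complex_of_real (v i) * b)\<^sup>2)"
definition hh where "hh b = z * b - 1 - b * Rcal d p v b"
definition hp where "hp b = z - Rcal d p v b - b * Kcal d p v b b"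
definition DH where "DH \<alpha> x = adj (Ym x) * A * Eb \<alpha> + (adj (Eb \<alpha>) * A) * Ym x"
definition DR where "DR \<alpha> x = R x * DH \<alpha> x * R x"
definition Dg where "Dg \<alpha> x = tr (Idn d * DR \<alpha> x) / of_nat d"
text \<open>The test function. \<open>B (g x)\<close> is inserted because
  \<open>B - g B A = A\<close> makes the contracted terms collapse to the defect, and the factor
  \<open>cnj (hh (g x))\<close> turns that defect into \<open>|hh|^2\<close>, so that the identity
  yields a second moment at once.\<close>

definition Fs where "Fs \<alpha> x = tr (Eb \<alpha> * (R x * adj (Ym x) * B (g x))) * cnj (hh (g x))"
definition Fd where "Fd \<alpha> x = tr (Eb \<alpha> * (R x * adj (Ym x) * B (g x))) * cnj (Dg \<alpha> x * hp (g x))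
   + tr (Eb \<alpha> * (R x * adj (Ym x) * cs (Dg \<alpha> x) (Bd (g x)) + (R x * adj (Eb \<alpha>) + DR \<alpha> x * adj (Ym x)) * B (g x))) * cnj (hh (g x))"

text \<open>The reason for the threshold \<open>2 * V \<le> Im z\<close>: then
  \<open>|v i b| \<le> V / Im z \<le> 1 / 2\<close>, and \<open>B\<close> and its derivative are
  bounded independently of the dimension.\<close>

lemma half: assumes "i < p" "cmod b \<le> 1 / y" shows "1 / 2 \<le> cmod (1 - complex_of_real (v i) * b)"
proof -
  have "\<bar>v i\<bar> * cmod b \<le> V * (1 / y)" using V(2)[OF assms(1)] assms(2) V(1) by (intro mult_mono) auto
  also have "\<dots> \<le> 1 / 2" using z by (simp add: field_simps)
  finally show ?thesis using norm_triangle_ineq2[of 1 "complex_of_real (v i) * b"] by (simp add: norm_mult)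
qed

lemma phi_le: assumes "i < p" "cmod b \<le> 1 / y" shows "cmod (complex_of_real (v i) / (1 - complex_of_real (v i) * b)) \<le> 2 * V"
proof -
  have "\<bar>v i\<bar> / cmod (1 - complex_of_real (v i) * b) \<le> V / (1 / 2)"
    using V(1) V(2)[OF assms(1)] half[OF assms] by (intro frac_le) auto
  thus ?thesis by (simp add: norm_divide)
qed

lemma phid_le: assumes "i < p" "cmod b \<le> 1 / y" shows "cmod ((complex_of_real (v i))\<^sup>2 / (1 - complex_of_real (v i) * b)\<^sup>2) \<le> 4 * V\<^sup>2"
  using power_mono[OF phi_le[OF assms], of 2] by (simp add: norm_divide norm_power power_divide power_mult_distrib)

lemma norm_mult_B: "norm (X * B (g x)) \<le> 2 * V * norm X" and norm_mult_Bd: "norm (X * Bd (g x)) \<le> 4 * V\<^sup>2 * norm X"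
  unfolding B_def Bd_def using V(1) G_norm[OF z(1), of x] phi_le phid_le
  by (auto intro!: norm_mult_dg_le)

lemma norm_R_mult: "norm (R x * X) \<le> norm X / y" and norm_mult_R: "norm (X * R x) \<le> norm X / y"
  by (rule norm_Rs_mult_le[OF carH adjH z(1)], rule norm_mult_Rs_le[OF carH adjH z(1)])

lemma p_d: "real p / real d \<le> C" using C d by (simp add: divide_le_eq)

lemma C0: "0 \<le> C" using order_trans[OF _ p_d, of 0] by simp

lemma Rcal_bound: "cmod b \<le> 1 / y \<Longrightarrow> cmod (Rcal d p v b) \<le> 2 * V * C"
proof -
  assume b: "cmod b \<le> 1 / y"
  have "cmod (\<Sum>i<p. complex_of_real (v i) / (1 - complex_of_real (v i) * b)) \<le> (\<Sum>i<p. 2 * V)"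
    by (rule sum_norm_le) (use phi_le b in auto)
  hence "cmod (Rcal d p v b) \<le> (1 / real d) * (real p * (2 * V))"
    unfolding Rcal_def by (simp add: norm_mult norm_divide divide_right_mono)
  also have "\<dots> = (real p / real d) * (2 * V)" by simp
  also have "\<dots> \<le> C * (2 * V)" using V(1) p_d by (intro mult_right_mono) auto
  finally show ?thesis by (simp add: mult_ac)
qed

lemma Kcal_bound: "cmod b \<le> 1 / y \<Longrightarrow> cmod c \<le> 1 / y \<Longrightarrow> cmod (Kcal d p v b c) \<le> 4 * V\<^sup>2 * C"
proof -
  assume b: "cmod b \<le> 1 / y" and c: "cmod c \<le> 1 / y"
  have "cmod ((complex_of_real (v i))\<^sup>2 / ((1 - complex_of_real (v i) * b) * (1 - complex_of_real (v i) * c))) \<le> (2 * V) * (2 * V)" if "i < p" for i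
    using mult_mono[OF phi_le[OF that b] phi_le[OF that c]] V(1) by (simp add: norm_divide norm_mult norm_power power2_eq_square)
  hence "cmod (\<Sum>i<p. (complex_of_real (v i))\<^sup>2 / ((1 - complex_of_real (v i) * b) * (1 - complex_of_real (v i) * c))) \<le> (\<Sum>i<p. (2 * V) * (2 * V))"
    by (intro sum_norm_le) auto
  hence "cmod (Kcal d p v b c) \<le> (1 / real d) * (real p * ((2 * V) * (2 * V)))"
    unfolding Kcal_def by (simp add: norm_mult norm_divide divide_right_mono)
  also have "\<dots> = (real p / real d) * (4 * V\<^sup>2)" by (simp add: power2_eq_square)
  also have "\<dots> \<le> C * (4 * V\<^sup>2)" using V(1) p_d by (intro mult_right_mono) auto
  finally show ?thesis by (simp add: mult_ac)
qed

definition Hb where "Hb = cmod z / y + 1 + 2 * V * C / y"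
definition Hd where "Hd = cmod z + 2 * V * C + 4 * V\<^sup>2 * C / y"

lemma Hb0: "0 \<le> Hb" and Hd0: "0 \<le> Hd" using V(1) C0 z by (auto simp: Hb_def Hd_def)

lemma hh_bound: "cmod (hh (g x)) \<le> Hb"
proof -
  note b = G_norm[OF z(1), of x]
  have "cmod (hh (g x)) \<le> cmod z * cmod (g x) + 1 + cmod (g x) * cmod (Rcal d p v (g x))"
    using norm_triangle_ineq4[of "z * g x - 1" "g x * Rcal d p v (g x)"] norm_triangle_ineq4[of "z * g x" 1]
    unfolding hh_def norm_mult norm_one by linarith
  also have "\<dots> \<le> cmod z * (1 / y) + 1 + (1 / y) * (2 * V * C)"
    using b Rcal_bound[OF b] by (intro add_mono mult_mono order_refl) (use V(1) C0 z in auto)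
  finally show ?thesis by (simp add: Hb_def)
qed

lemma hp_bound: "cmod (hp (g x)) \<le> Hd"
proof -
  note b = G_norm[OF z(1), of x]
  have "cmod (hp (g x)) \<le> cmod z + cmod (Rcal d p v (g x)) + cmod (g x) * cmod (Kcal d p v (g x) (g x))"
    using norm_triangle_ineq4[of "z - Rcal d p v (g x)" "g x * Kcal d p v (g x) (g x)"] norm_triangle_ineq4[of z "Rcal d p v (g x)"]
    unfolding hp_def norm_mult by linarith
  also have "\<dots> \<le> cmod z + 2 * V * C + (1 / y) * (4 * V\<^sup>2 * C)"
    using b Rcal_bound[OF b] Kcal_bound[OF b b] by (intro add_mono mult_mono order_refl) (use V(1) C0 z in auto)
  finally show ?thesis by (simp add: Hd_def)
qed

lemma dY: assumes "\<alpha> \<in> I" shows "((\<lambda>t. Ym (x(\<alpha> := t))) has_vector_derivative Eb \<alpha>) (at t)"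
proof -
  have "Ym (x(\<alpha> := t)) = t *\<^sub>R Eb \<alpha> + (\<Sum>\<beta>\<in>I - {\<alpha>}. x \<beta> *\<^sub>R Eb \<beta>)" for t
    unfolding Ym_def using assms fin by (simp add: sum.remove[of I \<alpha>])
  thus ?thesis by (auto intro!: derivative_eq_intros)
qed

lemma dH: assumes "\<alpha> \<in> I" shows "((\<lambda>t. Hm (x(\<alpha> := t))) has_vector_derivative DH \<alpha> (x(\<alpha> := t))) (at t)"
proof -
  have a: "((\<lambda>t. adj (Ym (x(\<alpha> := t)))) has_vector_derivative adj (Eb \<alpha>)) (at t)"
    by (rule bounded_linear.has_vector_derivative[OF bounded_linear_adj dY[OF assms]])
  have b: "((\<lambda>t. adj (Ym (x(\<alpha> := t))) * A) has_vector_derivative adj (Eb \<alpha>) * A) (at t)"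
    by (rule bounded_linear.has_vector_derivative[OF bounded_linear_mult_left a])
  show ?thesis unfolding Hm_def DH_def
    by (rule has_vector_derivative_mult[OF b dY[OF assms]])
qed

lemma dR: assumes "\<alpha> \<in> I" shows "((\<lambda>t. R (x(\<alpha> := t))) has_vector_derivative DR \<alpha> (x(\<alpha> := t))) (at t)"
  unfolding DR_def by (rule Rs_has_vector_derivative[OF carH adjH z(1) dH[OF assms]])

lemma dG: assumes "\<alpha> \<in> I" shows "((\<lambda>t. g (x(\<alpha> := t))) has_vector_derivative Dg \<alpha> (x(\<alpha> := t))) (at t)"
proof -
  have "((\<lambda>t. tr (Idn d * R (x(\<alpha> := t)))) has_vector_derivative tr (Idn d * DR \<alpha> (x(\<alpha> := t)))) (at t)"
    by (rule bounded_linear.has_vector_derivative[OF bounded_bilinear.bounded_linear_right[OF bounded_bilinear_tr] dR[OF assms]])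
  thus ?thesis unfolding G_def Dg_def tr_R[OF z(1)] divide_inverse
    by (rule bounded_linear.has_vector_derivative[OF bounded_linear_mult_left])
qed

lemma nz: "i < p \<Longrightarrow> 1 - complex_of_real (v i) * g x \<noteq> 0"
  by (rule one_minus_nz[OF Im_G[OF z(1)]])

lemma dB: assumes "\<alpha> \<in> I" shows "((\<lambda>t. B (g (x(\<alpha> := t)))) has_vector_derivative cs (Dg \<alpha> (x(\<alpha> := t))) (Bd (g (x(\<alpha> := t))))) (at t)"
  unfolding B_def Bd_def cs_dg
proof (rule dg_has_vector_derivative)
  fix i assume i: "i < p"
  have "((\<lambda>b. complex_of_real (v i) / (1 - complex_of_real (v i) * b)) has_field_derivative
     (complex_of_real (v i))\<^sup>2 / (1 - complex_of_real (v i) * g (x(\<alpha> := t)))\<^sup>2) (at (g (x(\<alpha> := t))))"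
    using nz[OF i] by (auto intro!: derivative_eq_intros simp: power2_eq_square)
  from field_vector_diff_chain_at[OF dG[OF assms] this]
  show "((\<lambda>t. complex_of_real (v i) / (1 - complex_of_real (v i) * g (x(\<alpha> := t)))) has_vector_derivative
     Dg \<alpha> (x(\<alpha> := t)) * ((complex_of_real (v i))\<^sup>2 / (1 - complex_of_real (v i) * g (x(\<alpha> := t)))\<^sup>2)) (at t)"
    by (simp only: o_def)
qed

lemma dh: assumes "\<alpha> \<in> I" shows "((\<lambda>t. hh (g (x(\<alpha> := t)))) has_vector_derivative Dg \<alpha> (x(\<alpha> := t)) * hp (g (x(\<alpha> := t)))) (at t)"
proof -
  have "(hh has_field_derivative hp (g (x(\<alpha> := t)))) (at (g (x(\<alpha> := t))))"
    unfolding hh_def hp_def using nz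
    by (auto intro!: derivative_eq_intros Rcal_has_field_derivative)
  from field_vector_diff_chain_at[OF dG[OF assms] this] show ?thesis by (simp only: o_def)
qed

lemma dF: assumes "\<alpha> \<in> I" shows "((\<lambda>t. Fs \<alpha> (x(\<alpha> := t))) has_vector_derivative Fd \<alpha> (x(\<alpha> := t))) (at t)"
proof -
  have a: "((\<lambda>t. adj (Ym (x(\<alpha> := t)))) has_vector_derivative adj (Eb \<alpha>)) (at t)"
    by (rule bounded_linear.has_vector_derivative[OF bounded_linear_adj dY[OF assms]])
  note 1 = has_vector_derivative_mult[OF has_vector_derivative_mult[OF dR[OF assms] a] dB[OF assms]]
  note 2 = bounded_linear.has_vector_derivative[OF bounded_bilinear.bounded_linear_right[OF bounded_bilinear_tr, of "Eb \<alpha>"] 1]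
  show ?thesis unfolding Fs_def Fd_def
    by (rule has_vector_derivative_mult[OF 2 has_vector_derivative_cnj[OF dh[OF assms]]])
qed

lemma g_continuous: "continuous_on UNIV g" by (rule G_continuous[OF z(1)])

lemma B_continuous: "continuous_on UNIV (\<lambda>x. B (g x))" and Bd_continuous: "continuous_on UNIV (\<lambda>x. Bd (g x))"
proof -
  have "continuous_on UNIV (\<lambda>x. complex_of_real (v i) / (1 - complex_of_real (v i) * g x))"
    "continuous_on UNIV (\<lambda>x. (complex_of_real (v i))\<^sup>2 / (1 - complex_of_real (v i) * g x)\<^sup>2)" if "i < p" for i
    using nz[OF that] by (auto intro!: continuous_intros g_continuous)
  thus "continuous_on UNIV (\<lambda>x. B (g x))" "continuous_on UNIV (\<lambda>x. Bd (g x))"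
    unfolding B_def Bd_def by (auto intro: dg_continuous_on)
qed

lemma hh_continuous: "continuous_on UNIV (\<lambda>x. hh (g x))" and hp_continuous: "continuous_on UNIV (\<lambda>x. hp (g x))"
proof -
  have R: "continuous_on UNIV (\<lambda>x. Rcal d p v (g x))" and K: "continuous_on UNIV (\<lambda>x. Kcal d p v (g x) (g x))"
    unfolding Rcal_def Kcal_def using nz d by (auto intro!: continuous_intros g_continuous)
  show "continuous_on UNIV (\<lambda>x. hh (g x))" "continuous_on UNIV (\<lambda>x. hp (g x))"
    unfolding hh_def hp_def by (auto intro!: continuous_intros g_continuous R K)
qed

lemma adjY_continuous: "continuous_on UNIV (\<lambda>x. adj (Ym x))"
  by (rule bounded_linear.continuous_on[OF bounded_linear_adj Y_continuous])

lemma tr_continuous: "continuous_on S f \<Longrightarrow> continuous_on S (\<lambda>x. tr (X * f x))"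
  by (rule bounded_linear.continuous_on[OF bounded_bilinear.bounded_linear_right[OF bounded_bilinear_tr]])

lemma DR_continuous: "continuous_on UNIV (\<lambda>x. DR \<alpha> x)"
  unfolding DR_def[abs_def] DH_def by (intro continuous_intros R_continuous z adjY_continuous Y_continuous)

lemma Dg_continuous: "continuous_on UNIV (\<lambda>x. Dg \<alpha> x)"
  unfolding Dg_def[abs_def] divide_inverse by (intro continuous_intros tr_continuous DR_continuous)

lemma Fs_continuous: "continuous_on UNIV (Fs \<alpha>)"
  unfolding Fs_def[abs_def] by (intro continuous_intros tr_continuous R_continuous z adjY_continuous B_continuous hh_continuous)

lemma Fd_continuous: "continuous_on UNIV (Fd \<alpha>)"
  unfolding Fd_def[abs_def]
  by (intro continuous_intros tr_continuous R_continuous z adjY_continuous B_continuous hh_continuous hp_continuous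
      DR_continuous Dg_continuous bounded_bilinear.continuous_on[OF bounded_bilinear_cs] Bd_continuous)

lemma deps: "Hm x = Hm (\<lambda>\<alpha>. if \<alpha> \<in> I then x \<alpha> else 0)" "g x = g (\<lambda>\<alpha>. if \<alpha> \<in> I then x \<alpha> else 0)"
  "DR \<alpha> x = DR \<alpha> (\<lambda>\<alpha>. if \<alpha> \<in> I then x \<alpha> else 0)" "Dg \<alpha> x = Dg \<alpha> (\<lambda>\<alpha>. if \<alpha> \<in> I then x \<alpha> else 0)"
  by (simp_all add: G_def Hm_def DR_def DH_def Dg_def flip: Ym_dep)

lemma Fs_measurable: "Fs \<alpha> \<in> borel_measurable P" and Fd_measurable: "Fd \<alpha> \<in> borel_measurable P"
  by (rule borel_measurable_continuous_PiM[OF Fs_continuous], simp add: Fs_def flip: deps Ym_dep,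
      rule borel_measurable_continuous_PiM[OF Fd_continuous], simp add: Fd_def flip: deps Ym_dep)

lemma norm_adjY_bounds:
  shows "norm (R x * adj (Ym x)) \<le> norm (Ym x) / y"
    and "norm (R x * adj (Ym x) * B (g x)) \<le> 2 * V * (norm (Ym x) / y)"
    and "norm (R x * adj (Ym x) * Bd (g x)) \<le> 4 * V\<^sup>2 * (norm (Ym x) / y)"
    and "norm (R x * adj (Ym x) * A) \<le> V * (norm (Ym x) / y)"
proof -
  show 1: "norm (R x * adj (Ym x)) \<le> norm (Ym x) / y" using norm_R_mult[of x "adj (Ym x)"] by simp
  show "norm (R x * adj (Ym x) * B (g x)) \<le> 2 * V * (norm (Ym x) / y)"
    by (rule order_trans[OF norm_mult_B mult_left_mono[OF 1]]) (use V(1) in auto)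
  show "norm (R x * adj (Ym x) * Bd (g x)) \<le> 4 * V\<^sup>2 * (norm (Ym x) / y)"
    by (rule order_trans[OF norm_mult_Bd mult_left_mono[OF 1]]) auto
  show "norm (R x * adj (Ym x) * A) \<le> V * (norm (Ym x) / y)"
    by (rule order_trans[OF norm_A_mult(2) mult_left_mono[OF 1]]) (use V(1) in auto)
qed

lemma norm_DR: assumes "\<alpha> \<in> I" shows "norm (DR \<alpha> x) \<le> 2 * V * norm (Ym x) / y / y"
proof -
  have "norm (adj (Ym x) * A * Eb \<alpha>) \<le> norm (adj (Ym x) * A) * norm (Eb \<alpha>)" by (rule norm_mult_ineq)
  also have "\<dots> \<le> (V * norm (Ym x)) * 1"
    using norm_A_mult(2)[of "adj (Ym x)"] normE[OF assms] V(1) by (intro mult_mono) auto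
  finally have a: "norm (adj (Ym x) * A * Eb \<alpha>) \<le> V * norm (Ym x)" by simp
  have "norm (adj (Eb \<alpha>) * A * Ym x) \<le> norm (adj (Eb \<alpha>) * A) * norm (Ym x)" by (rule norm_mult_ineq)
  also have "\<dots> \<le> (V * norm (Eb \<alpha>)) * norm (Ym x)"
    using norm_A_mult(2)[of "adj (Eb \<alpha>)"] by (intro mult_right_mono) auto
  also have "\<dots> \<le> (V * 1) * norm (Ym x)" using normE[OF assms] V(1) by (intro mult_right_mono mult_left_mono) auto
  finally have b: "norm (adj (Eb \<alpha>) * A * Ym x) \<le> V * norm (Ym x)" by simp
  have "norm (DH \<alpha> x) \<le> 2 * V * norm (Ym x)"
    unfolding DH_def using norm_triangle_ineq[of "adj (Ym x) * A * Eb \<alpha>" "adj (Eb \<alpha>) * A * Ym x"] a b by simp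
  hence "norm (R x * DH \<alpha> x) \<le> 2 * V * norm (Ym x) / y"
    by (intro order_trans[OF norm_R_mult] divide_right_mono) (use z in auto)
  thus ?thesis unfolding DR_def
    by (intro order_trans[OF norm_mult_R] divide_right_mono) (use z in auto)
qed

text \<open>A qualitative bound. \<open>K\<close> may depend on \<open>d\<close> and on
  \<open>card I\<close>, as it only licenses the use of \<open>stein\<close>; the estimate that is
  uniform in the dimension is \<open>error_bound\<close>.\<close>

lemma stein_growth:
  assumes \<alpha>: "\<alpha> \<in> I"
  shows "\<exists>K. \<forall>x. cmod (Fs \<alpha> x) \<le> K * (1 + (\<Sum>\<beta>\<in>I. (x \<beta>) ^ 4)) \<and> cmod (Fd \<alpha> x) \<le> K * (1 + (\<Sum>\<beta>\<in>I. (x \<beta>) ^ 4))"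
proof -
  define n1 where "n1 = norm (Idn d) * (2 * V / y / y)"
  have n10: "0 \<le> n1" using V(1) z by (simp add: n1_def)
  define k1 where "k1 = 2 * V / y * Hb"
  define k2 where "k2 = 2 * V / y * (n1 * Hd) + (4 * V\<^sup>2 / y * n1 + (1 / y + 2 * V / y / y) * (2 * V)) * Hb"
  have k: "0 \<le> k1" "0 \<le> k2" using V(1) z Hb0 Hd0 n10 by (auto simp: k1_def k2_def)
  define c where "c = 1 + real (card I)"
  have main: "cmod (Fs \<alpha> x) \<le> (k1 + k2) * (1 + (norm (Ym x))\<^sup>2)" "cmod (Fd \<alpha> x) \<le> (k1 + k2) * (1 + (norm (Ym x))\<^sup>2)" for x
  proof -
    define n where "n = norm (Ym x)"
    define N where "N = 1 + n\<^sup>2"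
    have n0: "0 \<le> n" by (simp add: n_def)
    have "2 * n \<le> 1 + n\<^sup>2" using sum_squares_bound[of 1 n] by simp
    hence nN: "n \<le> N" using n0 by (simp add: N_def)
    have N: "1 \<le> N" "n * n \<le> N" by (auto simp: N_def power2_eq_square)
    have trE: "cmod (tr (Eb \<alpha> * X)) \<le> norm X" for X
      using order_trans[OF tr_mult_norm_le mult_right_mono[OF normE[OF \<alpha>]], of X] by simp
    have t1: "cmod (tr (Eb \<alpha> * (R x * adj (Ym x) * B (g x)))) \<le> 2 * V * (n / y)"
      unfolding n_def by (rule order_trans[OF trE norm_adjY_bounds(2)])
    have "cmod (Fs \<alpha> x) \<le> (2 * V * (n / y)) * Hb"
      unfolding Fs_def norm_mult complex_mod_cnj using t1 hh_bound[of x] V(1) z n0 by (intro mult_mono) auto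
    also have "\<dots> = k1 * n" by (simp add: k1_def)
    also have "\<dots> \<le> (k1 + k2) * N" using k nN n0 by (intro mult_mono) auto
    finally show "cmod (Fs \<alpha> x) \<le> (k1 + k2) * (1 + (norm (Ym x))\<^sup>2)" by (simp add: N_def n_def)
    have "cmod (tr (Idn d * DR \<alpha> x)) \<le> norm (Idn d) * (2 * V * n / y / y)"
      unfolding n_def by (rule order_trans[OF tr_mult_norm_le mult_left_mono[OF norm_DR[OF \<alpha>]]]) simp
    hence "cmod (Dg \<alpha> x) \<le> norm (Idn d) * (2 * V * n / y / y) / real d"
      unfolding Dg_def norm_divide norm_of_nat by (rule divide_right_mono) simp
    also have "\<dots> \<le> norm (Idn d) * (2 * V * n / y / y) / 1" using d V(1) n0 z by (intro divide_left_mono mult_nonneg_nonneg) auto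
    finally have Dgb: "cmod (Dg \<alpha> x) \<le> n1 * n" by (simp add: n1_def mult_ac)
    have e1: "norm (R x * adj (Ym x) * cs (Dg \<alpha> x) (Bd (g x))) \<le> (n1 * n) * (4 * V\<^sup>2 * (n / y))"
      unfolding cs_mult_right norm_cs n_def by (intro mult_mono norm_adjY_bounds Dgb[unfolded n_def]) (use n10 in auto)
    have "norm (R x * adj (Eb \<alpha>)) \<le> 1 / y"
      using norm_R_mult[of x "adj (Eb \<alpha>)"] normE[OF \<alpha>] z(1) by (simp add: divide_right_mono order_trans)
    moreover have "norm (DR \<alpha> x * adj (Ym x)) \<le> (2 * V * n / y / y) * n"
      unfolding n_def norm_adj[of "Ym x", symmetric]
      by (rule order_trans[OF norm_mult_ineq mult_right_mono]) (use norm_DR[OF \<alpha>, of x] in auto)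
    ultimately have "norm (R x * adj (Eb \<alpha>) + DR \<alpha> x * adj (Ym x)) \<le> 1 / y + (2 * V * n / y / y) * n"
      by (rule norm_triangle_mono)
    hence e2: "norm ((R x * adj (Eb \<alpha>) + DR \<alpha> x * adj (Ym x)) * B (g x)) \<le> (2 * V) * (1 / y + (2 * V * n / y / y) * n)"
      by (intro order_trans[OF norm_mult_B] mult_left_mono) (use V(1) in auto)
    have t2: "cmod (tr (Eb \<alpha> * (R x * adj (Ym x) * cs (Dg \<alpha> x) (Bd (g x)) + (R x * adj (Eb \<alpha>) + DR \<alpha> x * adj (Ym x)) * B (g x))))
        \<le> (n1 * n) * (4 * V\<^sup>2 * (n / y)) + (2 * V) * (1 / y + (2 * V * n / y / y) * n)"
      by (rule order_trans[OF trE norm_triangle_mono[OF e1 e2]])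
    have "cmod (Fd \<alpha> x) \<le> (2 * V * (n / y)) * ((n1 * n) * Hd) + ((n1 * n) * (4 * V\<^sup>2 * (n / y)) + (2 * V) * (1 / y + (2 * V * n / y / y) * n)) * Hb"
      unfolding Fd_def
      by (rule norm_triangle_mono; unfold norm_mult complex_mod_cnj; intro mult_mono t1 t2 Dgb hp_bound hh_bound)
         (use V(1) z n0 n10 in \<open>auto intro!: mult_nonneg_nonneg add_nonneg_nonneg\<close>)
    also have "\<dots> = 2 * V / y * (n1 * Hd) * (n * n) + (4 * V\<^sup>2 / y * n1 * (n * n) + (1 / y * 1 + 2 * V / y / y * (n * n)) * (2 * V)) * Hb"
      by (simp add: algebra_simps)
    also have "\<dots> \<le> 2 * V / y * (n1 * Hd) * N + (4 * V\<^sup>2 / y * n1 * N + (1 / y * N + 2 * V / y / y * N) * (2 * V)) * Hb"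
      using V(1) z n0 n10 Hb0 Hd0 N by (intro add_mono mult_left_mono mult_right_mono) auto
    also have "\<dots> = k2 * N" by (simp add: k2_def algebra_simps)
    also have "\<dots> \<le> (k1 + k2) * N" using k N by (intro mult_right_mono) auto
    finally show "cmod (Fd \<alpha> x) \<le> (k1 + k2) * (1 + (norm (Ym x))\<^sup>2)" by (simp add: N_def n_def)
  qed
  have sx: "1 + (norm (Ym x))\<^sup>2 \<le> c * (1 + (\<Sum>\<beta>\<in>I. (x \<beta>) ^ 4))" for x
  proof -
    have "sq x \<le> (\<Sum>\<beta>\<in>I. 1 + (x \<beta>)^4)" unfolding sq_def
    proof (rule sum_mono)
      fix \<beta>
      have "2 * (x \<beta>)\<^sup>2 \<le> 1 + (x \<beta>)^4" using sum_squares_bound[of 1 "(x \<beta>)\<^sup>2"] by simp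
      thus "(x \<beta>)\<^sup>2 \<le> 1 + (x \<beta>)^4" using zero_le_power2[of "x \<beta>"] by linarith
    qed
    hence "1 + (norm (Ym x))\<^sup>2 \<le> 1 + (real (card I) + (\<Sum>\<beta>\<in>I. (x \<beta>)^4))"
      using norm_Ym[of x] by (simp add: sum.distrib)
    also have "\<dots> \<le> c * (1 + (\<Sum>\<beta>\<in>I. (x \<beta>) ^ 4))"
    proof -
      have "0 \<le> real (card I) * (\<Sum>\<beta>\<in>I. (x \<beta>)^4)" by (intro mult_nonneg_nonneg sum_nonneg zero_le_even_power) auto
      thus ?thesis by (simp add: c_def algebra_simps)
    qed
    finally show ?thesis .
  qed
  have "cmod (Fs \<alpha> x) \<le> ((k1 + k2) * c) * (1 + (\<Sum>\<beta>\<in>I. (x \<beta>) ^ 4)) \<and> cmod (Fd \<alpha> x) \<le> ((k1 + k2) * c) * (1 + (\<Sum>\<beta>\<in>I. (x \<beta>) ^ 4))" for x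
    using order_trans[OF main(1) mult_left_mono[OF sx]] order_trans[OF main(2) mult_left_mono[OF sx]] k by (simp add: mult.assoc)
  thus ?thesis by blast
qed

lemma stein_applied:
  assumes \<alpha>: "\<alpha> \<in> I"
  shows "integrable P (\<lambda>x. x \<alpha> *\<^sub>R Fs \<alpha> x)" "integrable P (Fd \<alpha>)"
    "(\<integral>x. x \<alpha> *\<^sub>R Fs \<alpha> x \<partial>P) = (1 / real d) *\<^sub>R (\<integral>x. Fd \<alpha> x \<partial>P)"
proof -
  obtain K where K: "\<And>x. cmod (Fs \<alpha> x) \<le> K * (1 + (\<Sum>\<beta>\<in>I. (x \<beta>) ^ 4))" "\<And>x. cmod (Fd \<alpha> x) \<le> K * (1 + (\<Sum>\<beta>\<in>I. (x \<beta>) ^ 4))"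
    using stein_growth[OF \<alpha>] by blast
  have c: "continuous_on UNIV (\<lambda>t. Fd \<alpha> (x(\<alpha> := t)))" for x
  proof (rule continuous_on_compose2[OF Fd_continuous])
    show "continuous_on UNIV (\<lambda>t. x(\<alpha> := t))"
    proof (rule continuous_on_coordinatewise_then_product)
      show "continuous_on UNIV (\<lambda>t. (x(\<alpha> := t)) i)" for i by (cases "i = \<alpha>") auto
    qed
  qed auto
  note st = stein[OF \<alpha> Fs_measurable Fd_measurable dF[OF \<alpha>] c K]
  show "integrable P (\<lambda>x. x \<alpha> *\<^sub>R Fs \<alpha> x)" "integrable P (Fd \<alpha>)" by (rule st)+
  show "(\<integral>x. x \<alpha> *\<^sub>R Fs \<alpha> x \<partial>P) = (1 / real d) *\<^sub>R (\<integral>x. Fd \<alpha> x \<partial>P)"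
    using st(3) by (simp add: power_divide)
qed

lemma tr_adj_mult: "tr (adj E * X) = cnj (tr (E * adj X))"
  using tr_adj[of "adj X * E"] by (simp add: adj_mult tr_comm)

lemma Dg_eq: assumes "\<alpha> \<in> I"
  shows "Dg \<alpha> x = (tr (Eb \<alpha> * (R x * R x * adj (Ym x) * A)) + cnj (tr (Eb \<alpha> * adj (A * Ym x * R x * R x)))) / of_nat d"
proof -
  have c: "car d d (DR \<alpha> x)"
    unfolding DR_def DH_def
    by (rule car_mult[OF car_mult[OF Rs_car[OF carH adjH z(1)] car_add[OF car_mult[OF car_mult[OF car_adj[OF carY] carA] carE[OF assms]]
        car_mult[OF car_mult[OF car_adj[OF carE[OF assms]] carA] carY]]] Rs_car[OF carH adjH z(1)]])
  have "tr (Idn d * DR \<alpha> x) = tr (R x * (adj (Ym x) * A * Eb \<alpha>) * R x) + tr (R x * (adj (Eb \<alpha>) * A * Ym x) * R x)"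
    unfolding Idn_mult[OF c] unfolding DR_def DH_def distrib_left distrib_right tr_add ..
  also have "tr (R x * (adj (Ym x) * A * Eb \<alpha>) * R x) = tr (Eb \<alpha> * (R x * R x * adj (Ym x) * A))"
    using tr_comm[of "R x * adj (Ym x) * A" "Eb \<alpha> * R x"] by (simp add: mult.assoc)
  also have "tr (R x * (adj (Eb \<alpha>) * A * Ym x) * R x) = tr (adj (Eb \<alpha>) * (A * Ym x * R x * R x))"
    using tr_comm[of "R x" "adj (Eb \<alpha>) * A * Ym x * R x"] by (simp add: mult.assoc)
  finally show ?thesis unfolding Dg_def tr_adj_mult by simp
qed

text \<open>By \<open>Dg_eq\<close> every component of the gradient of \<open>g\<close> is a sum of
  two pairings with \<open>Eb \<alpha>\<close>, the second conjugated, so Bessel's inequality bounds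
  all components together without a factor for their number. The normalized trace contributes
  \<open>1 / d\<close>, which makes \<open>X3\<close> and \<open>X4\<close> small.\<close>

lemma Dg_L2: "L2_set (\<lambda>\<alpha>. cmod (Dg \<alpha> x)) I \<le> 2 * V * norm (Ym x) / (y\<^sup>2 * real d)"
proof -
  define X1 where "X1 = R x * R x * adj (Ym x) * A"
  define X2 where "X2 = adj (A * Ym x * R x * R x)"
  have cR: "car d d (R x)" by (rule Rs_car[OF carH adjH z(1)])
  have c: "car d p X1" "car d p X2"
    unfolding X1_def X2_def by (rule car_mult[OF car_mult[OF car_mult[OF cR cR] car_adj[OF carY]] carA],
      rule car_adj[OF car_mult[OF car_mult[OF car_mult[OF carA carY] cR] cR]])
  have L: "L2_set (\<lambda>\<alpha>. cmod (tr (Eb \<alpha> * X))) I \<le> norm X" if "car d p X" for X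
    unfolding L2_set_def by (rule real_le_lsqrt) (use bessel[OF that] in \<open>auto intro: sum_nonneg\<close>)
  have n1: "norm X1 \<le> V * norm (Ym x) / y / y"
  proof -
    have "norm (R x * R x * adj (Ym x)) \<le> norm (Ym x) / y / y"
      unfolding mult.assoc using z(1) norm_R_mult[of x "adj (Ym x)"]
      by (intro order_trans[OF norm_R_mult] divide_right_mono) auto
    hence "V * norm (R x * R x * adj (Ym x)) \<le> V * (norm (Ym x) / y / y)" using V(1) by (intro mult_left_mono) auto
    thus ?thesis unfolding X1_def using norm_A_mult(2)[of "R x * R x * adj (Ym x)"] by simp
  qed
  have n2: "norm X2 \<le> V * norm (Ym x) / y / y"
  proof -
    have "norm (A * Ym x * R x * R x) \<le> norm (A * Ym x * R x) / y" by (rule norm_mult_R)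
    also have "\<dots> \<le> norm (A * Ym x) / y / y" using z(1) by (intro divide_right_mono norm_mult_R) auto
    also have "\<dots> \<le> V * norm (Ym x) / y / y" using z(1) by (intro divide_right_mono norm_A_mult) auto
    finally show ?thesis by (simp add: X2_def)
  qed
  have "L2_set (\<lambda>\<alpha>. cmod (Dg \<alpha> x)) I \<le> L2_set (\<lambda>\<alpha>. (cmod (tr (Eb \<alpha> * X1)) + cmod (tr (Eb \<alpha> * X2))) * (1 / real d)) I"
  proof (rule L2_set_mono)
    fix \<alpha> assume "\<alpha> \<in> I"
    have "cmod (tr (Eb \<alpha> * X1) + cnj (tr (Eb \<alpha> * X2))) \<le> cmod (tr (Eb \<alpha> * X1)) + cmod (tr (Eb \<alpha> * X2))"
      using norm_triangle_ineq[of "tr (Eb \<alpha> * X1)" "cnj (tr (Eb \<alpha> * X2))"] by simp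
    thus "cmod (Dg \<alpha> x) \<le> (cmod (tr (Eb \<alpha> * X1)) + cmod (tr (Eb \<alpha> * X2))) * (1 / real d)"
      unfolding Dg_eq[OF \<open>\<alpha> \<in> I\<close>] X1_def[symmetric] X2_def[symmetric] norm_divide norm_of_nat by (simp add: divide_right_mono)
  qed auto
  also have "\<dots> = L2_set (\<lambda>\<alpha>. cmod (tr (Eb \<alpha> * X1)) + cmod (tr (Eb \<alpha> * X2))) I * (1 / real d)"
    by (rule L2_set_left_distrib[symmetric]) auto
  also have "\<dots> \<le> (L2_set (\<lambda>\<alpha>. cmod (tr (Eb \<alpha> * X1))) I + L2_set (\<lambda>\<alpha>. cmod (tr (Eb \<alpha> * X2))) I) * (1 / real d)"
    by (intro mult_right_mono L2_set_triangle_ineq) auto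
  also have "\<dots> \<le> (V * norm (Ym x) / y / y + V * norm (Ym x) / y / y) * (1 / real d)"
    by (intro mult_right_mono add_mono order_trans[OF L[OF c(1)] n1] order_trans[OF L[OF c(2)] n2]) auto
  finally show ?thesis by (simp add: power2_eq_square)
qed

lemma tr_L2: assumes "car d p X" shows "L2_set (\<lambda>\<alpha>. cmod (tr (Eb \<alpha> * X))) I \<le> norm X"
  unfolding L2_set_def by (rule real_le_lsqrt) (use bessel[OF assms] in \<open>auto intro: sum_nonneg\<close>)

lemma contr_tr: assumes "car d d X" shows "(\<Sum>\<alpha>\<in>I. tr (Eb \<alpha> * X * adj (Eb \<alpha>) * Z)) = tr X * tr (Idn p * Z)"
proof -
  have "(\<Sum>\<alpha>\<in>I. tr (Eb \<alpha> * X * adj (Eb \<alpha>) * Z)) = tr ((\<Sum>\<alpha>\<in>I. Eb \<alpha> * X * adj (Eb \<alpha>)) * Z)"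
    unfolding sum_distrib_right tr_sum ..
  thus ?thesis unfolding contr[OF assms] by (simp add: tr_cs)
qed

text \<open>The three error terms: \<open>X1\<close> comes from the contraction without adjoint in
  the derivative of the resolvent, \<open>X3\<close> from differentiating \<open>B (g x)\<close>,
  and \<open>X4\<close> from differentiating \<open>cnj (hh (g x))\<close>.\<close>

definition X1 where "X1 x = (\<Sum>\<alpha>\<in>I. tr (Eb \<alpha> * (R x * adj (Ym x) * A) * Eb \<alpha> * (R x * adj (Ym x) * B (g x))))"
definition X3 where "X3 x = (\<Sum>\<alpha>\<in>I. Dg \<alpha> x * tr (Eb \<alpha> * (R x * adj (Ym x) * Bd (g x))))"
definition X4 where "X4 x = (\<Sum>\<alpha>\<in>I. tr (Eb \<alpha> * (R x * adj (Ym x) * B (g x))) * cnj (Dg \<alpha> x * hp (g x)))"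

lemma cars: "car d d (R x)" "car d p (R x * adj (Ym x))" "car d p (R x * adj (Ym x) * A)"
  "car d p (R x * adj (Ym x) * B (g x))" "car d p (R x * adj (Ym x) * Bd (g x))" "car p p (B (g x))"
proof -
  show 1: "car d d (R x)" by (rule Rs_car[OF carH adjH z(1)])
  show 2: "car d p (R x * adj (Ym x))" by (rule car_mult[OF 1 car_adj[OF carY]])
  show 3: "car p p (B (g x))" unfolding B_def by (rule car_dg)
  have 4: "car p p (Bd (g x))" unfolding Bd_def by (rule car_dg)
  show "car d p (R x * adj (Ym x) * A)" "car d p (R x * adj (Ym x) * B (g x))" "car d p (R x * adj (Ym x) * Bd (g x))"
    by (rule car_mult[OF 2 carA], rule car_mult[OF 2 3], rule car_mult[OF 2 4])
qed

text \<open>The product rule, sorted by contractions. \<open>contr\<close> evaluates the terms of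
  the form \<open>E X E\<^sup>*\<close>: one arises from differentiating \<open>adj (Ym x)\<close>,
  the other from the part of \<open>DH\<close> that contains
  \<open>adj (Eb \<alpha>)\<close>.\<close>

lemma sum_Fd: "(\<Sum>\<alpha>\<in>I. Fd \<alpha> x) = (tr (R x) * tr (B (g x)) + tr (R x) * tr (A * Ym x * R x * adj (Ym x) * B (g x)) + X1 x + X3 x) * cnj (hh (g x)) + X4 x"
proof -
  have e: "tr (Eb \<alpha> * (R x * adj (Ym x) * cs (Dg \<alpha> x) (Bd (g x)) + (R x * adj (Eb \<alpha>) + DR \<alpha> x * adj (Ym x)) * B (g x)))
     = Dg \<alpha> x * tr (Eb \<alpha> * (R x * adj (Ym x) * Bd (g x))) + tr (Eb \<alpha> * R x * adj (Eb \<alpha>) * B (g x))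
       + (tr (Eb \<alpha> * (R x * adj (Ym x) * A) * Eb \<alpha> * (R x * adj (Ym x) * B (g x))) + tr (Eb \<alpha> * R x * adj (Eb \<alpha>) * (A * Ym x * R x * adj (Ym x) * B (g x))))" for \<alpha>
    unfolding DR_def DH_def by (simp only: distrib_left distrib_right tr_add cs_mult_right tr_cs mult.assoc add.assoc)
  have c1: "(\<Sum>\<alpha>\<in>I. tr (Eb \<alpha> * R x * adj (Eb \<alpha>) * B (g x))) = tr (R x) * tr (B (g x))"
    unfolding contr_tr[OF cars(1)] Idn_mult[OF cars(6)] ..
  have cc: "car p p (A * Ym x * R x * adj (Ym x) * B (g x))"
    by (rule car_mult[OF car_mult[OF car_mult[OF car_mult[OF carA carY] cars(1)] car_adj[OF carY]] cars(6)])
  have c2: "(\<Sum>\<alpha>\<in>I. tr (Eb \<alpha> * R x * adj (Eb \<alpha>) * (A * Ym x * R x * adj (Ym x) * B (g x)))) = tr (R x) * tr (A * Ym x * R x * adj (Ym x) * B (g x))"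
    unfolding contr_tr[OF cars(1)] Idn_mult[OF cc] ..
  show ?thesis unfolding Fd_def e sum.distrib sum_distrib_right[symmetric] c1 c2 X1_def X3_def X4_def
    by (simp add: algebra_simps)
qed

lemma sum_Fs: "(\<Sum>\<alpha>\<in>I. x \<alpha> *\<^sub>R Fs \<alpha> x) = tr (Ym x * (R x * adj (Ym x) * B (g x))) * cnj (hh (g x))"
  unfolding Fs_def
proof -
  have "tr (Ym x * Z) = (\<Sum>\<alpha>\<in>I. x \<alpha> *\<^sub>R tr (Eb \<alpha> * Z))" for Z
    unfolding Ym_def sum_distrib_right tr_sum by (simp add: tr_scaleR)
  thus "(\<Sum>\<alpha>\<in>I. x \<alpha> *\<^sub>R (tr (Eb \<alpha> * (R x * adj (Ym x) * B (g x))) * cnj (hh (g x)))) = tr (Ym x * (R x * adj (Ym x) * B (g x))) * cnj (hh (g x))"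
    by (simp add: sum_distrib_right)
qed

text \<open>By \<open>B - g B A = A\<close> and cyclicity the first two traces combine to
  \<open>tr (Hm x * R x)\<close>, which the resolvent equation evaluates as
  \<open>d (z g - 1)\<close>. The third trace is \<open>d\<close> times \<open>Rcal\<close>, so the
  whole is \<open>d\<close> times the defect.\<close>

lemma main_cancellation:
  "tr (Ym x * (R x * adj (Ym x) * B (g x))) - g x * tr (A * Ym x * R x * adj (Ym x) * B (g x)) - g x * tr (B (g x)) = of_nat d * hh (g x)"
proof -
  define T where "T = Ym x * R x * adj (Ym x)"
  have BA: "B (g x) - cs (g x) (B (g x) * A) = A"
    unfolding B_def A_def dg_mult_dg cs_dg dg_diff
  proof (rule dg_cong)
    fix i assume "i < p"
    thus "complex_of_real (v i) / (1 - complex_of_real (v i) * g x) - g x * (complex_of_real (v i) / (1 - complex_of_real (v i) * g x) * complex_of_real (v i)) = complex_of_real (v i)"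
      using nz[of i x] by (simp add: divide_simps) (simp add: algebra_simps)
  qed
  have "tr (Ym x * (R x * adj (Ym x) * B (g x))) - g x * tr (A * Ym x * R x * adj (Ym x) * B (g x))
     = tr (T * B (g x)) - g x * tr (T * (B (g x) * A))"
    using tr_comm[of A "T * B (g x)"] by (simp add: T_def mult.assoc)
  also have "\<dots> = tr (T * (B (g x) - cs (g x) (B (g x) * A)))"
    by (simp only: right_diff_distrib tr_diff cs_mult_right tr_cs)
  also have "\<dots> = tr (T * A)" unfolding BA ..
  also have "\<dots> = tr (adj (Ym x) * A * Ym x * R x)" unfolding T_def
    using tr_comm[of "Ym x * R x" "adj (Ym x) * A"] by (simp add: mult.assoc)
  also have "\<dots> = tr (Hm x * R x)" unfolding Hm_def[of x, symmetric] ..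
  also have "Hm x * R x = cs z (R x) - Idn d"
    using Rs_right[OF carH[of x] adjH[of x] z(1)] Idn_mult[OF cars(1)[of x]] unfolding left_diff_distrib cs_mult_left
    by (simp add: algebra_simps)
  also have "tr (cs z (R x) - Idn d) = of_nat d * (z * g x - 1)"
    using d by (simp add: tr_diff tr_cs tr_dg G_def algebra_simps)
  finally have 1: "tr (Ym x * (R x * adj (Ym x) * B (g x))) - g x * tr (A * Ym x * R x * adj (Ym x) * B (g x)) = of_nat d * (z * g x - 1)" .
  have "tr (B (g x)) = of_nat d * Rcal d p v (g x)"
    using d unfolding B_def tr_dg Rcal_def by simp
  thus ?thesis using 1 by (simp add: hh_def algebra_simps)
qed

text \<open>The left side has mean 0 by integration by parts with variance \<open>1 / d\<close>.
  Taking expectations expresses the second moment of the defect through the error terms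
  alone.\<close>

lemma pointwise_identity:
  "(\<Sum>\<alpha>\<in>I. x \<alpha> *\<^sub>R Fs \<alpha> x) - (1 / of_nat d) * (\<Sum>\<alpha>\<in>I. Fd \<alpha> x) =
    of_nat d * (hh (g x) * cnj (hh (g x))) - (1 / of_nat d) * ((X1 x + X3 x) * cnj (hh (g x)) + X4 x)"
proof -
  have gd: "tr (R x) = of_nat d * g x" using d by (simp add: G_def)
  have "(1 / of_nat d) * (\<Sum>\<alpha>\<in>I. Fd \<alpha> x) = (g x * tr (B (g x)) + g x * tr (A * Ym x * R x * adj (Ym x) * B (g x))) * cnj (hh (g x))
      + (1 / of_nat d) * ((X1 x + X3 x) * cnj (hh (g x)) + X4 x)"
    unfolding sum_Fd gd using d by (simp add: field_simps)
  moreover have "of_nat d * (hh (g x) * cnj (hh (g x))) = (tr (Ym x * (R x * adj (Ym x) * B (g x))) - g x * tr (A * Ym x * R x * adj (Ym x) * B (g x)) - g x * tr (B (g x))) * cnj (hh (g x))"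
    unfolding main_cancellation by (simp add: mult.assoc)
  ultimately show ?thesis unfolding sum_Fs by (simp add: algebra_simps)
qed

definition c1 where "c1 = 2 * V\<^sup>2 / y\<^sup>2"
definition c4 where "c4 = 8 * V^3 / y^3 * Hb + 4 * V\<^sup>2 / y^3 * Hd"

text \<open>\<open>X1\<close> has no factor \<open>1 / d\<close>, so its factor \<open>|hh|\<close>
  is kept for absorption. In the other two terms the gradient of \<open>g\<close> provides
  \<open>1 / d\<close>, and there \<open>|hh|\<close> may be replaced by the constant
  \<open>Hb\<close>.\<close>

lemma error_bound: "cmod ((X1 x + X3 x) * cnj (hh (g x)) + X4 x) \<le> c1 * (norm (Ym x))\<^sup>2 * cmod (hh (g x)) + c4 * (norm (Ym x))\<^sup>2 / real d"
proof -
  define n where "n = norm (Ym x)"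
  have n0: "0 \<le> n" by (simp add: n_def)
  have y0: "0 < y" by (rule z(1))
  have b1: "cmod (X1 x) \<le> (V * (n / y)) * (2 * V * (n / y))"
    unfolding X1_def n_def
    by (rule order_trans[OF extra[OF cars(3,4)] mult_mono]) (use norm_adjY_bounds V(1) z(1) in auto)
  have b3: "cmod (X3 x) \<le> (2 * V * n / (y\<^sup>2 * real d)) * (4 * V\<^sup>2 * (n / y))"
  proof -
    have "cmod (X3 x) \<le> (\<Sum>\<alpha>\<in>I. \<bar>cmod (Dg \<alpha> x)\<bar> * \<bar>cmod (tr (Eb \<alpha> * (R x * adj (Ym x) * Bd (g x))))\<bar>)"
      unfolding X3_def by (rule sum_norm_le) (simp add: norm_mult)
    also have "\<dots> \<le> L2_set (\<lambda>\<alpha>. cmod (Dg \<alpha> x)) I * L2_set (\<lambda>\<alpha>. cmod (tr (Eb \<alpha> * (R x * adj (Ym x) * Bd (g x))))) I"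
      by (rule L2_set_mult_ineq)
    also have "\<dots> \<le> (2 * V * n / (y\<^sup>2 * real d)) * (4 * V\<^sup>2 * (n / y))"
      unfolding n_def using order_trans[OF tr_L2[OF cars(5)] norm_adjY_bounds(3)] V(1) y0
      by (intro mult_mono Dg_L2) auto
    finally show ?thesis .
  qed
  have b4: "cmod (X4 x) \<le> Hd * ((2 * V * n / (y\<^sup>2 * real d)) * (2 * V * (n / y)))"
  proof -
    have "cmod (X4 x) \<le> (\<Sum>\<alpha>\<in>I. Hd * (\<bar>cmod (Dg \<alpha> x)\<bar> * \<bar>cmod (tr (Eb \<alpha> * (R x * adj (Ym x) * B (g x))))\<bar>))"
      unfolding X4_def
    proof (rule sum_norm_le)
      fix \<alpha>
      have "cmod (tr (Eb \<alpha> * (R x * adj (Ym x) * B (g x))) * cnj (Dg \<alpha> x * hp (g x))) = cmod (hp (g x)) * (cmod (Dg \<alpha> x) * cmod (tr (Eb \<alpha> * (R x * adj (Ym x) * B (g x)))))"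
        by (simp add: norm_mult)
      also have "\<dots> \<le> Hd * (cmod (Dg \<alpha> x) * cmod (tr (Eb \<alpha> * (R x * adj (Ym x) * B (g x)))))"
        by (intro mult_right_mono hp_bound) auto
      finally show "cmod (tr (Eb \<alpha> * (R x * adj (Ym x) * B (g x))) * cnj (Dg \<alpha> x * hp (g x))) \<le> Hd * (\<bar>cmod (Dg \<alpha> x)\<bar> * \<bar>cmod (tr (Eb \<alpha> * (R x * adj (Ym x) * B (g x))))\<bar>)"
        by simp
    qed
    also have "\<dots> = Hd * (\<Sum>\<alpha>\<in>I. \<bar>cmod (Dg \<alpha> x)\<bar> * \<bar>cmod (tr (Eb \<alpha> * (R x * adj (Ym x) * B (g x))))\<bar>)"
      by (rule sum_distrib_left[symmetric])
    also have "\<dots> \<le> Hd * (L2_set (\<lambda>\<alpha>. cmod (Dg \<alpha> x)) I * L2_set (\<lambda>\<alpha>. cmod (tr (Eb \<alpha> * (R x * adj (Ym x) * B (g x))))) I)"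
      by (intro mult_left_mono L2_set_mult_ineq Hd0)
    also have "\<dots> \<le> Hd * ((2 * V * n / (y\<^sup>2 * real d)) * (2 * V * (n / y)))"
      unfolding n_def using order_trans[OF tr_L2[OF cars(4)] norm_adjY_bounds(2)] V(1) y0
      by (intro mult_left_mono[OF _ Hd0] mult_mono Dg_L2) auto
    finally show ?thesis .
  qed
  have "cmod ((X1 x + X3 x) * cnj (hh (g x)) + X4 x) \<le> cmod (X1 x) * cmod (hh (g x)) + cmod (X3 x) * cmod (hh (g x)) + cmod (X4 x)"
    using norm_triangle_ineq[of "(X1 x + X3 x) * cnj (hh (g x))" "X4 x"]
      norm_triangle_ineq[of "X1 x * cnj (hh (g x))" "X3 x * cnj (hh (g x))"]
    by (simp add: norm_mult distrib_right)
  also have "\<dots> \<le> (V * (n / y)) * (2 * V * (n / y)) * cmod (hh (g x)) + (2 * V * n / (y\<^sup>2 * real d)) * (4 * V\<^sup>2 * (n / y)) * Hb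
      + Hd * ((2 * V * n / (y\<^sup>2 * real d)) * (2 * V * (n / y)))"
    using b1 b3 b4 hh_bound[of x] V(1) y0 n0 by (intro add_mono mult_mono) auto
  also have "\<dots> = c1 * n\<^sup>2 * cmod (hh (g x)) + c4 * n\<^sup>2 / real d"
    unfolding c1_def c4_def using y0 d by (simp add: field_simps power2_eq_square power3_eq_cube)
  finally show ?thesis by (simp add: n_def)
qed

lemma hh_measurable: "(\<lambda>x. hh (g x)) \<in> borel_measurable P"
  by (rule borel_measurable_continuous_PiM[OF hh_continuous]) (simp flip: deps)

lemma integrable_hh: "integrable P (\<lambda>x. (cmod (hh (g x)))\<^sup>2)"
proof (rule integrable_const_bound[where B="Hb\<^sup>2"])
  show "AE x in P. norm ((cmod (hh (g x)))\<^sup>2) \<le> Hb\<^sup>2" using power_mono[OF hh_bound, where n=2] by simp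
  show "(\<lambda>x. (cmod (hh (g x)))\<^sup>2) \<in> borel_measurable P" using hh_measurable by measurable
qed

text \<open>With \<open>m\<close> the second moment, \<open>d^2 m\<close> equals the mean of the
  error. As \<open>E sq\<close> is of order \<open>d\<close> and \<open>E sq^2\<close> of order
  \<open>d^2\<close>, the terms with \<open>1 / d\<close> contribute a constant, and the
  arithmetic-geometric mean inequality splits the \<open>X1\<close> part into half of
  \<open>d^2 m\<close> and a constant.\<close>

lemma hh_second_moment: "(\<integral>x. (cmod (hh (g x)))\<^sup>2 \<partial>P) \<le> (12 * c1\<^sup>2 * C\<^sup>2 + 4 * c4 * C) / (real d)\<^sup>2"
proof -
  define m where "m = (\<integral>x. (cmod (hh (g x)))\<^sup>2 \<partial>P)"
  define err where "err x = (X1 x + X3 x) * cnj (hh (g x)) + X4 x" for x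
  define D where "D = real d"
  have D: "1 \<le> D" "0 < D" using d by (auto simp: D_def)
  have c40: "0 \<le> c4" using V(1) z Hb0 Hd0 by (auto simp: c4_def)
  have c10: "0 \<le> c1" by (auto simp: c1_def)
  define Phi where "Phi x = (\<Sum>\<alpha>\<in>I. x \<alpha> *\<^sub>R Fs \<alpha> x) - (1 / of_nat d) * (\<Sum>\<alpha>\<in>I. Fd \<alpha> x)" for x
  have iP: "integrable P Phi" unfolding Phi_def
    by (intro Bochner_Integration.integrable_diff Bochner_Integration.integrable_sum integrable_mult_right stein_applied)
  have "(\<integral>x. Phi x \<partial>P) = (\<Sum>\<alpha>\<in>I. (\<integral>x. x \<alpha> *\<^sub>R Fs \<alpha> x \<partial>P)) - (1 / of_nat d) * (\<Sum>\<alpha>\<in>I. (\<integral>x. Fd \<alpha> x \<partial>P))"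
    unfolding Phi_def using stein_applied(1,2)
    by (subst Bochner_Integration.integral_diff) (auto intro!: Bochner_Integration.integrable_sum simp: Bochner_Integration.integral_sum)
  also have "\<dots> = 0"
    using stein_applied(3) by (simp add: scaleR_conv_of_real sum_distrib_left)
  finally have P0: "(\<integral>x. Phi x \<partial>P) = 0" .
  have err_eq: "err x = of_nat d * (of_nat d * complex_of_real ((cmod (hh (g x)))\<^sup>2)) - of_nat d * Phi x" for x
    using d unfolding Phi_def pointwise_identity err_def complex_norm_square by (simp add: field_simps)
  have ih: "integrable P (\<lambda>x. complex_of_real ((cmod (hh (g x)))\<^sup>2))" by (rule integrable_of_real[OF integrable_hh])
  have ie: "integrable P err" unfolding err_eq[abs_def] by (intro Bochner_Integration.integrable_diff integrable_mult_right ih iP)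
  have "(\<integral>x. err x \<partial>P) = of_nat d * (of_nat d * complex_of_real m) - of_nat d * 0"
    unfolding err_eq using ih iP by (simp only: Bochner_Integration.integral_diff integrable_mult_right integral_mult_right_zero P0 integral_complex_of_real m_def)
  hence "Re (\<integral>x. err x \<partial>P) = D * (D * m)" by (simp add: D_def)
  hence I1: "(\<integral>x. Re (err x) \<partial>P) = D\<^sup>2 * m" using ie by (simp add: power2_eq_square)
  have bnd: "Re (err x) \<le> (D\<^sup>2 / 2) * (cmod (hh (g x)))\<^sup>2 + (c1\<^sup>2 / (2 * D\<^sup>2)) * (sq x)\<^sup>2 + (c4 / D) * sq x" for x
  proof -
    define n where "n = (norm (Ym x))\<^sup>2"
    define h where "h = cmod (hh (g x))"
    have n: "0 \<le> n" "n \<le> sq x" using norm_Ym[of x] by (auto simp: n_def)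
    have "Re (err x) \<le> c1 * n * h + c4 * n / D"
      using order_trans[OF complex_Re_le_cmod error_bound[of x]] by (simp add: err_def n_def h_def D_def)
    also have "c1 * n * h \<le> (D\<^sup>2 / 2) * h\<^sup>2 + (c1\<^sup>2 / (2 * D\<^sup>2)) * n\<^sup>2"
    proof -
      \<comment> \<open>The factors are balanced so that exactly half of \<open>D^2 h^2\<close>
        appears on the right, which the left side can absorb.\<close>
      have "2 * (D * h) * (c1 * n / D) \<le> (D * h)\<^sup>2 + (c1 * n / D)\<^sup>2" by (rule sum_squares_bound)
      moreover have "2 * (D * h) * (c1 * n / D) = 2 * (c1 * n * h)" using D by simp
      ultimately show ?thesis by (simp add: power_mult_distrib power_divide)
    qed
    also have "(c1\<^sup>2 / (2 * D\<^sup>2)) * n\<^sup>2 \<le> (c1\<^sup>2 / (2 * D\<^sup>2)) * (sq x)\<^sup>2" using n by (intro mult_left_mono power_mono) auto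
    also have "c4 * n / D \<le> (c4 / D) * sq x" using n c40 D by (simp add: mult_left_mono divide_right_mono)
    finally show ?thesis by (simp add: h_def)
  qed
  have "D\<^sup>2 * m \<le> (\<integral>x. (D\<^sup>2 / 2) * (cmod (hh (g x)))\<^sup>2 + (c1\<^sup>2 / (2 * D\<^sup>2)) * (sq x)\<^sup>2 + (c4 / D) * sq x \<partial>P)"
    unfolding I1[symmetric] using ie
    by (intro integral_mono bnd Bochner_Integration.integrable_add integrable_mult_right integrable_hh expectation_sq) auto
  also have "\<dots> = (D\<^sup>2 / 2) * m + (c1\<^sup>2 / (2 * D\<^sup>2)) * (\<integral>x. (sq x)\<^sup>2 \<partial>P) + (c4 / D) * (\<integral>x. sq x \<partial>P)"
    unfolding m_def using integrable_hh expectation_sq(1,3) by simp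
  finally have fin1: "D\<^sup>2 * m \<le> (D\<^sup>2 / 2) * m + (c1\<^sup>2 / (2 * D\<^sup>2)) * (\<integral>x. (sq x)\<^sup>2 \<partial>P) + (c4 / D) * (\<integral>x. sq x \<partial>P)" .
  define N where "N = real (card I)"
  have N0: "0 \<le> N" by (simp add: N_def)
  have "N \<le> real (2 * p * d)" unfolding N_def using card by (simp only: of_nat_le_iff)
  also have "\<dots> = (2 * D) * real p" by (simp add: D_def)
  also have "\<dots> \<le> (2 * D) * (C * D)" using C D by (intro mult_left_mono) (auto simp: D_def)
  finally have N: "N \<le> 2 * C * D\<^sup>2" by (simp add: power2_eq_square mult_ac)
  have e1: "(\<integral>x. sq x \<partial>P) \<le> 2 * C * D"
  proof -
    have "(\<integral>x. sq x \<partial>P) = N / D" unfolding expectation_sq(2) using d by (simp add: N_def D_def power_divide)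
    also have "\<dots> \<le> (2 * C * D\<^sup>2) / D" using N D by (intro divide_right_mono) auto
    finally show ?thesis using D by (simp add: power2_eq_square)
  qed
  have e2: "(\<integral>x. (sq x)\<^sup>2 \<partial>P) \<le> 12 * C\<^sup>2 * D\<^sup>2"
  proof -
    have d4: "(1 / sqrt (real d))^4 = 1 / D\<^sup>2"
    proof -
      have "(1 / sqrt (real d))^4 = ((1 / sqrt (real d))\<^sup>2)\<^sup>2" by (simp add: power_mult[symmetric])
      thus ?thesis by (simp add: power_divide D_def)
    qed
    have "(\<integral>x. (sq x)\<^sup>2 \<partial>P) = (N * (N + 2)) / D\<^sup>2" unfolding expectation_sq(4) d4 N_def of_nat_mult of_nat_add of_nat_numeral by (simp only: mult_1_left times_divide_eq_left)
    also have "\<dots> \<le> (3 * N\<^sup>2) / D\<^sup>2"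
    proof (intro divide_right_mono)
      \<comment> \<open>\<open>N\<close> is an integer: either it is 0 or
        \<open>N + 2 \<le> 3 * N\<close>.\<close>
      have "card I = 0 \<or> 1 \<le> N" by (cases "card I") (auto simp: N_def)
      thus "N * (N + 2) \<le> 3 * N\<^sup>2"
      proof
        assume "1 \<le> N"
        hence "N * (N + 2) \<le> N * (3 * N)" by (intro mult_left_mono) auto
        thus ?thesis by (simp add: power2_eq_square)
      qed (simp add: N_def)
    qed auto
    also have "\<dots> \<le> (3 * (2 * C * D\<^sup>2)\<^sup>2) / D\<^sup>2" using N N0 by (intro divide_right_mono mult_left_mono power_mono) auto
    also have "\<dots> = 12 * C\<^sup>2 * D\<^sup>2" using D by (simp add: field_simps power2_eq_square)
    finally show ?thesis .
  qed
  have "(c1\<^sup>2 / (2 * D\<^sup>2)) * (\<integral>x. (sq x)\<^sup>2 \<partial>P) \<le> (c1\<^sup>2 / (2 * D\<^sup>2)) * (12 * C\<^sup>2 * D\<^sup>2)" by (intro mult_left_mono e2) auto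
  also have "\<dots> = 6 * c1\<^sup>2 * C\<^sup>2" using D by (simp add: field_simps)
  finally have f2: "(c1\<^sup>2 / (2 * D\<^sup>2)) * (\<integral>x. (sq x)\<^sup>2 \<partial>P) \<le> 6 * c1\<^sup>2 * C\<^sup>2" .
  have "(c4 / D) * (\<integral>x. sq x \<partial>P) \<le> (c4 / D) * (2 * C * D)" using c40 D by (intro mult_left_mono e1) auto
  also have "\<dots> = 2 * c4 * C" using D by simp
  finally have f3: "(c4 / D) * (\<integral>x. sq x \<partial>P) \<le> 2 * c4 * C" .
  \<comment> \<open>Moving half of \<open>D^2 * m\<close> to the left doubles the constants 6 and
    2.\<close>
  have "D\<^sup>2 * m \<le> 12 * c1\<^sup>2 * C\<^sup>2 + 4 * c4 * C" using fin1 f2 f3 by (simp add: algebra_simps)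
  hence "m \<le> (12 * c1\<^sup>2 * C\<^sup>2 + 4 * c4 * C) / D\<^sup>2" using D by (simp add: pos_le_divide_eq mult.commute)
  thus ?thesis by (simp add: m_def D_def)
qed

end
end

section \<open>Spectral distributions of Gaussian models\<close>

text \<open>\<open>spectral_distribution\<close> lives on the discrete sigma-algebra. The
  push-forward under the identity places it on the Borel sets, as \<open>real_distribution\<close>
  demands, and keeps the integrals of Borel functions.\<close>

definition esd :: "complex mat \<Rightarrow> real measure" where
  "esd W = distr (spectral_distribution W) borel (\<lambda>t. t)"

lemma esd_real_distribution: "real_distribution (esd W)"
  unfolding esd_def spectral_distribution_def
  by (intro real_distribution.intro real_distribution_axioms.intro prob_space.prob_space_distr prob_space_measure_pmf) auto

lemma poisson_conv_esd: "poisson_conv \<gamma> (esd W) = poisson_conv \<gamma> (spectral_distribution W)"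
  unfolding poisson_conv_def esd_def spectral_distribution_def poisson_kernel_def
  by (rule ext, subst integral_distr) auto

lemma cross_entropy_esd: "cauchy_cross_entropy \<gamma> (esd W) \<mu> = cauchy_cross_entropy \<gamma> (spectral_distribution W) \<mu>"
  unfolding cauchy_cross_entropy_def poisson_conv_esd ..

lemma integral_pmf_of_image_mset:
  fixes f :: "real \<Rightarrow> 'b :: {banach, second_countable_topology}" and l :: "nat \<Rightarrow> real"
  assumes "1 \<le> d"
  shows "(\<integral>t. f t \<partial>measure_pmf (pmf_of_multiset (image_mset l (mset_set {..<d})))) = (1 / real d) *\<^sub>R (\<Sum>i<d. f (l i))"
proof -
  let ?M = "image_mset l (mset_set {..<d})"
  have ne: "?M \<noteq> {#}" using assms by (simp add: mset_set_empty_iff lessThan_empty_iff)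
  have "(\<integral>t. f t \<partial>measure_pmf (pmf_of_multiset ?M)) = (\<Sum>a\<in>set_mset ?M. (real (count ?M a) / real d) *\<^sub>R f a)"
    using integral_measure_pmf[of "set_mset ?M" "pmf_of_multiset ?M" f] ne by simp
  also have "\<dots> = (\<Sum>a\<in>l ` {..<d}. (1 / real d) *\<^sub>R (\<Sum>i\<in>{x \<in> {..<d}. l x = a}. f (l i)))"
  proof (rule sum.cong)
    fix a
    have "count ?M a = card {x \<in> {..<d}. l x = a}" by (simp add: count_image_mset_eq_card_vimage)
    thus "(real (count ?M a) / real d) *\<^sub>R f a = (1 / real d) *\<^sub>R (\<Sum>i\<in>{x \<in> {..<d}. l x = a}. f (l i))"
      by (simp add: sum_constant_scaleR)
  qed simp
  also have "\<dots> = (1 / real d) *\<^sub>R (\<Sum>i<d. f (l i))"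
    unfolding scaleR_sum_right[symmetric] by (subst sum.group) auto
  finally show ?thesis .
qed

lemma spectral_proots:
  assumes W: "W \<in> carrier_mat d d" and Q: "car d d Q" "adj Q * Q = Idn d" "Q * adj Q = Idn d"
    and H: "fm W = Q * dg d (\<lambda>i. complex_of_real (l i)) * adj Q"
  shows "proots (char_poly W) = image_mset (\<lambda>i. complex_of_real (l i)) (mset_set {..<d})"
    and "char_poly W = (\<Prod>i<d. [:- complex_of_real (l i), 1:])"
proof -
  let ?D = "mf d d (dg d (\<lambda>i. complex_of_real (l i)))"
  have WQ: "W = mf d d Q * ?D * mf d d (adj Q)"
  proof -
    have "W = mf d d (fm W)" using mf_fm[OF W] by simp
    also have "\<dots> = mf d d Q * ?D * mf d d (adj Q)" unfolding H
      by (simp add: mf_mult[OF car_mult[OF Q(1) car_dg] car_adj[OF Q(1)]] mf_mult[OF Q(1) car_dg])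
    finally show ?thesis .
  qed
  have "similar_mat_wit W ?D (mf d d Q) (mf d d (adj Q))"
  proof (rule similar_mat_witI[of _ _ d])
    show "mf d d Q * mf d d (adj Q) = 1\<^sub>m d" using mf_mult[OF Q(1) car_adj[OF Q(1)]] Q(3) mf_Idn by simp
    show "mf d d (adj Q) * mf d d Q = 1\<^sub>m d" using mf_mult[OF car_adj[OF Q(1)] Q(1)] Q(2) mf_Idn by simp
  qed (use WQ W in auto)
  hence "char_poly W = char_poly ?D" by (intro char_poly_similar) (auto simp: similar_mat_def)
  also have "\<dots> = (\<Prod>i<d. [:- complex_of_real (l i), 1:])" unfolding mf_dg by (rule char_poly_diag)
  finally show "char_poly W = (\<Prod>i<d. [:- complex_of_real (l i), 1:])" .
  thus "proots (char_poly W) = image_mset (\<lambda>i. complex_of_real (l i)) (mset_set {..<d})"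
    using proots_prod_linear[of "\<lambda>i. complex_of_real (l i)" d] by simp
qed

lemma hermitian_spectral:
  assumes W: "W \<in> carrier_mat d d" "mat_adjoint W = W"
  obtains Q l where "car d d Q" "adj Q * Q = Idn d" "Q * adj Q = Idn d" "fm W = Q * dg d (\<lambda>i. complex_of_real (l i)) * adj Q"
  using spectral_theorem[OF car_fm[OF W(1)]] fm_adjoint[OF W(1)] W(2) by metis

lemma esd_integral:
  fixes f :: "real \<Rightarrow> 'b :: {banach, second_countable_topology}"
  assumes W: "W \<in> carrier_mat d d" "1 \<le> d" and Q: "car d d Q" "adj Q * Q = Idn d" "Q * adj Q = Idn d"
    and H: "fm W = Q * dg d (\<lambda>i. complex_of_real (l i)) * adj Q" and f: "f \<in> borel_measurable borel"
  shows "(\<integral>t. f t \<partial>esd W) = (1 / real d) *\<^sub>R (\<Sum>i<d. f (l i))" "integrable (esd W) f"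
proof -
  have m: "image_mset Re (proots (char_poly W)) = image_mset l (mset_set {..<d})"
    unfolding spectral_proots(1)[OF W(1) Q H] by (simp add: multiset.map_comp o_def)
  show "(\<integral>t. f t \<partial>esd W) = (1 / real d) *\<^sub>R (\<Sum>i<d. f (l i))"
    unfolding esd_def spectral_distribution_def m using f by (subst integral_distr) (auto simp: integral_pmf_of_image_mset[OF W(2)])
  have "image_mset l (mset_set {..<d}) \<noteq> {#}" using W(2) by (simp add: mset_set_empty_iff lessThan_empty_iff)
  hence "integrable (measure_pmf (pmf_of_multiset (image_mset l (mset_set {..<d})))) f"
    by (intro integrable_measure_pmf_finite) simp
  thus "integrable (esd W) f"
    unfolding esd_def spectral_distribution_def m using f by (subst integrable_distr_eq) auto
qed

lemma esd_cauchy: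
  assumes W: "W \<in> carrier_mat d d" "mat_adjoint W = W" "1 \<le> d" and z: "0 < Im z"
  shows "cauchy_transform (esd W) z = tr (Rs d z (fm W)) / of_nat d"
proof -
  obtain Q l where Q: "car d d Q" "adj Q * Q = Idn d" "Q * adj Q = Idn d" "fm W = Q * dg d (\<lambda>i. complex_of_real (l i)) * adj Q"
    using hermitian_spectral[OF W(1,2)] by blast
  have "cauchy_transform (esd W) z = (1 / real d) *\<^sub>R (\<Sum>i<d. inverse (z - complex_of_real (l i)))"
    unfolding cauchy_transform_def by (rule esd_integral[OF W(1,3) Q]) measurable
  also have "(\<Sum>i<d. inverse (z - complex_of_real (l i))) = tr (dg d (\<lambda>i. 1 / (z - complex_of_real (l i))) * (adj Q * Q))"
    unfolding Q(2) by (simp add: dg_mult_dg tr_dg inverse_eq_divide)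
  also have "\<dots> = tr (Rs d z (fm W))" unfolding Rs_spectral(1)[OF Q z] mult.assoc tr_comm[of Q] by (simp add: mult.assoc)
  finally show ?thesis by (simp add: scaleR_conv_of_real)
qed

text \<open>The eigenvalues are the diagonal entries of \<open>T\<^sup>* A T\<close> with
  \<open>T = Y Q\<close>, that is, sums of \<open>v i |T i k|^2\<close>. Hence the sum of their
  moduli is at most \<open>V |T|^2 \<le> V |Y|^2\<close>, which is the trace norm estimate without
  trace norms.\<close>

lemma esd_first_moment:
  assumes W: "W \<in> carrier_mat d d" "mat_adjoint W = W" "1 \<le> d" and Y: "car p d Y"
    and WY: "fm W = adj Y * dg p (\<lambda>i. complex_of_real (v i)) * Y" and V: "\<And>i. i < p \<Longrightarrow> \<bar>v i\<bar> \<le> V" "0 \<le> V"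
  shows "integrable (esd W) (\<lambda>t. \<bar>t\<bar>)" "(\<integral>t. \<bar>t\<bar> \<partial>esd W) \<le> V * (norm Y)\<^sup>2 / real d"
proof -
  obtain Q l where Q: "car d d Q" "adj Q * Q = Idn d" "Q * adj Q = Idn d" "fm W = Q * dg d (\<lambda>i. complex_of_real (l i)) * adj Q"
    using hermitian_spectral[OF W(1,2)] by blast
  show "integrable (esd W) (\<lambda>t. \<bar>t\<bar>)" by (rule esd_integral[OF W(1,3) Q]) measurable
  let ?D = "dg d (\<lambda>i. complex_of_real (l i))"
  define T where "T = Y * Q"
  have T: "car p d T" unfolding T_def by (rule car_mult[OF Y Q(1)])
  have "adj T * dg p (\<lambda>i. complex_of_real (v i)) * T = adj Q * fm W * Q" unfolding WY T_def by (simp add: adj_mult mult.assoc)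
  also have "\<dots> = (adj Q * Q) * ?D * (adj Q * Q)" unfolding Q(4) by (simp add: mult.assoc)
  also have "\<dots> = ?D" unfolding Q(2) by (simp add: dg_mult_dg)
  finally have TD: "adj T * (dg p (\<lambda>i. complex_of_real (v i)) * T) = ?D" by (simp add: mult.assoc)
  have lk: "\<bar>l k\<bar> \<le> (\<Sum>i<p. V * (cmod (ent T i k))\<^sup>2)" if "k < d" for k
  proof -
    have "complex_of_real (l k) = ent ?D k k" using that by simp
    also have "\<dots> = (\<Sum>i<p. cnj (ent T i k) * (complex_of_real (v i) * ent T i k))"
      unfolding TD[symmetric] ent_mult_eq[OF car_adj[OF T]] by (simp add: ent_dg_mult)
    finally have "\<bar>l k\<bar> = cmod (\<Sum>i<p. cnj (ent T i k) * (complex_of_real (v i) * ent T i k))"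
      by (metis norm_of_real)
    also have "\<dots> \<le> (\<Sum>i<p. V * (cmod (ent T i k))\<^sup>2)"
      by (rule sum_norm_le) (use V in \<open>auto simp: norm_mult power2_eq_square mult.left_commute[of _ "\<bar>_\<bar>"] intro!: mult_right_mono\<close>)
    finally show ?thesis .
  qed
  have "(\<Sum>k<d. \<bar>l k\<bar>) \<le> (\<Sum>k<d. \<Sum>i<p. V * (cmod (ent T i k))\<^sup>2)" by (intro sum_mono lk) auto
  also have "\<dots> = V * (norm T)\<^sup>2" unfolding norm_fmat_sq[OF T] by (subst sum.swap) (simp add: sum_distrib_left)
  also have "\<dots> \<le> V * (norm Y)\<^sup>2"
  proof (intro mult_left_mono power_mono V(2))
    show "norm T \<le> norm Y"
      using norm_isometry_mult_le(2)[of d "adj Q" Y] Q(1,3) by (simp add: T_def car_adj)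
  qed auto
  finally have "(\<Sum>k<d. \<bar>l k\<bar>) \<le> V * (norm Y)\<^sup>2" .
  hence "(1 / real d) * (\<Sum>k<d. \<bar>l k\<bar>) \<le> (1 / real d) * (V * (norm Y)\<^sup>2)" by (intro mult_left_mono) auto
  moreover have "(\<integral>t. \<bar>t\<bar> \<partial>esd W) = (1 / real d) *\<^sub>R (\<Sum>k<d. \<bar>l k\<bar>)"
    by (rule esd_integral[OF W(1,3) Q]) measurable
  ultimately show "(\<integral>t. \<bar>t\<bar> \<partial>esd W) \<le> V * (norm Y)\<^sup>2 / real d" by simp
qed

section \<open>Matrix units and the Gaussian bases over the two fields\<close>

definition um :: "nat \<Rightarrow> nat \<Rightarrow> fmat" where "um k l = Fmat (\<lambda>i j. if i = k \<and> j = l then 1 else 0)"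

lemma ent_um [simp]: "ent (um k l) i j = (if i = k \<and> j = l then 1 else 0)"
  unfolding um_def by (subst ent_Fmat[of "Suc (max k l)"]) auto

lemma car_um: "k < p \<Longrightarrow> l < d \<Longrightarrow> car p d (um k l)" by (auto simp: car_def)

lemma ent_um_mult: "ent (um k l * X) i j = (if i = k then ent X l j else 0)"
proof -
  have "ent (um k l * X) i j = (\<Sum>m<Suc l. if m = l then (if i = k then ent X l j else 0) else 0)"
    unfolding ent_mult_eq[OF car_um[of k "Suc k" l "Suc l", OF lessI lessI]] by (intro sum.cong) auto
  thus ?thesis by simp
qed

lemma ent_mult_um: "ent (X * um k l) i j = (if j = l then ent X i k else 0)"
proof -
  have "ent (X * um k l) i j = (\<Sum>m<Suc k. if m = k then (if j = l then ent X i k else 0) else 0)"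
    unfolding ent_mult_eq'[OF car_um[of k "Suc k" l "Suc l", OF lessI lessI]] by (intro sum.cong) auto
  thus ?thesis by simp
qed

lemma tr_um_mult: assumes "k < p" "l < d" "car d p X" shows "tr (um k l * X) = ent X l k"
  using assms by (subst tr_eq[OF car_mult[OF car_um assms(3)]]) (auto simp: ent_um_mult)

text \<open>The assumptions of \<open>gaussian_matrix\<close> that concern the basis alone,
  collected so that \<open>gbasis_rotate\<close> can carry them over to a rotated basis.\<close>

definition gbasis :: "nat \<Rightarrow> nat \<Rightarrow> 'i set \<Rightarrow> ('i \<Rightarrow> fmat) \<Rightarrow> bool" where
  "gbasis p d I E \<longleftrightarrow> (\<forall>\<alpha>\<in>I. car p d (E \<alpha>)) \<and>
    (\<forall>X. car d d X \<longrightarrow> (\<Sum>\<alpha>\<in>I. E \<alpha> * X * adj (E \<alpha>)) = cs (tr X) (Idn p)) \<and>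
    (\<forall>X. car d p X \<longrightarrow> (\<Sum>\<alpha>\<in>I. (cmod (tr (E \<alpha> * X)))\<^sup>2) \<le> (norm X)\<^sup>2) \<and>
    (\<forall>X X'. car d p X \<and> car d p X' \<longrightarrow> cmod (\<Sum>\<alpha>\<in>I. tr (E \<alpha> * X * E \<alpha> * X')) \<le> norm X * norm X') \<and>
    (\<forall>x. (norm (\<Sum>\<alpha>\<in>I. x \<alpha> *\<^sub>R E \<alpha>))\<^sup>2 \<le> (\<Sum>\<alpha>\<in>I. (x \<alpha>)\<^sup>2))"

text \<open>The coordinates stay the same real Gaussians and only the basis turns. So a complex
  unitary is admissible in the real case too, where the rotated matrix is in general no longer a
  Ginibre matrix.\<close>

lemma gbasis_rotate:
  assumes E: "gbasis p d I E" and U: "car p p U" "adj U * U = Idn p" "U * adj U = Idn p"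
  shows "gbasis p d I (\<lambda>\<alpha>. adj U * E \<alpha>)"
  unfolding gbasis_def
proof (intro conjI allI impI ballI)
  have U': "car p p (adj U)" "adj (adj U) * adj U = Idn p" using U by (auto intro: car_adj)
  have nU: "norm (X * adj U) \<le> norm X" "norm (adj U * X) \<le> norm X" for X
    using norm_isometry_mult_le[OF U(1,2), of X] norm_isometry_mult_le[OF U', of X] by auto
  show "car p d (adj U * E \<alpha>)" if "\<alpha> \<in> I" for \<alpha>
    using E that by (intro car_mult[OF U'(1)]) (auto simp: gbasis_def)
  show "(\<Sum>\<alpha>\<in>I. adj U * E \<alpha> * X * adj (adj U * E \<alpha>)) = cs (tr X) (Idn p)" if X: "car d d X" for X
  proof -
    have "(\<Sum>\<alpha>\<in>I. adj U * E \<alpha> * X * adj (adj U * E \<alpha>)) = adj U * (\<Sum>\<alpha>\<in>I. E \<alpha> * X * adj (E \<alpha>)) * U"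
      unfolding sum_distrib_left sum_distrib_right by (simp add: adj_mult mult.assoc)
    also have "\<dots> = cs (tr X) (adj U * (Idn p * U))" using E X by (simp add: gbasis_def mult.assoc)
    finally show ?thesis unfolding Idn_mult[OF U(1)] U(2) .
  qed
  have trU: "tr (adj U * E \<alpha> * X) = tr (E \<alpha> * (X * adj U))" for \<alpha> X
    using tr_comm[of "adj U" "E \<alpha> * X"] by (simp add: mult.assoc)
  have cX: "car d p (X * adj U)" if "car d p X" for X by (rule car_mult[OF that U'(1)])
  show "(\<Sum>\<alpha>\<in>I. (cmod (tr (adj U * E \<alpha> * X)))\<^sup>2) \<le> (norm X)\<^sup>2" if X: "car d p X" for X
  proof -
    have "(\<Sum>\<alpha>\<in>I. (cmod (tr (adj U * E \<alpha> * X)))\<^sup>2) \<le> (norm (X * adj U))\<^sup>2"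
      unfolding trU using E cX[OF X] by (simp add: gbasis_def)
    also have "\<dots> \<le> (norm X)\<^sup>2" by (intro power_mono nU) auto
    finally show ?thesis .
  qed
  show "cmod (\<Sum>\<alpha>\<in>I. tr (adj U * E \<alpha> * X * (adj U * E \<alpha>) * X')) \<le> norm X * norm X'" if X: "car d p X \<and> car d p X'" for X X'
  proof -
    have "tr (adj U * E \<alpha> * X * (adj U * E \<alpha>) * X') = tr (E \<alpha> * (X * adj U) * E \<alpha> * (X' * adj U))" for \<alpha>
      using tr_comm[of "adj U" "E \<alpha> * X * (adj U * E \<alpha>) * X'"] by (simp add: mult.assoc)
    hence "cmod (\<Sum>\<alpha>\<in>I. tr (adj U * E \<alpha> * X * (adj U * E \<alpha>) * X')) \<le> norm (X * adj U) * norm (X' * adj U)"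
      using E cX X by (simp add: gbasis_def)
    also have "\<dots> \<le> norm X * norm X'" by (intro mult_mono nU) auto
    finally show ?thesis .
  qed
  show "(norm (\<Sum>\<alpha>\<in>I. x \<alpha> *\<^sub>R (adj U * E \<alpha>)))\<^sup>2 \<le> (\<Sum>\<alpha>\<in>I. (x \<alpha>)\<^sup>2)" for x
  proof -
    have "(\<Sum>\<alpha>\<in>I. x \<alpha> *\<^sub>R (adj U * E \<alpha>)) = adj U * (\<Sum>\<alpha>\<in>I. x \<alpha> *\<^sub>R E \<alpha>)" by (simp add: sum_distrib_left)
    hence "(norm (\<Sum>\<alpha>\<in>I. x \<alpha> *\<^sub>R (adj U * E \<alpha>)))\<^sup>2 \<le> (norm (\<Sum>\<alpha>\<in>I. x \<alpha> *\<^sub>R E \<alpha>))\<^sup>2" using nU(2) by (simp add: power_mono)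
    also have "\<dots> \<le> (\<Sum>\<alpha>\<in>I. (x \<alpha>)\<^sup>2)" using E by (simp add: gbasis_def)
    finally show ?thesis .
  qed
qed

lemma ent_sum: "ent (sum f S) i j = (\<Sum>a\<in>S. ent (f a) i j)"
  by (induction S rule: infinite_finite_induct) auto

definition realE :: "nat \<times> nat \<Rightarrow> fmat" where "realE = (\<lambda>(k, l). um k l)"
definition complexE :: "nat \<times> nat \<times> bool \<Rightarrow> fmat" where
  "complexE = (\<lambda>(k, l, b). cs ((if b then 1 else \<i>) / complex_of_real (sqrt 2)) (um k l))"

lemma um_contr: assumes "car d d X" shows "(\<Sum>k<p. \<Sum>l<d. um k l * X * adj (um k l)) = cs (tr X) (Idn p)"
proof (rule fmat_eqI)
  fix i j
  have a: "adj (um k l) = um l k" for k l by (rule fmat_eqI) auto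
  have "ent (\<Sum>k<p. \<Sum>l<d. um k l * X * adj (um k l)) i j = (\<Sum>k<p. \<Sum>l<d. if k = i then (if i = j then ent X l l else 0) else 0)"
    unfolding ent_sum a by (intro sum.cong refl) (auto simp: ent_mult_um ent_um_mult)
  also have "\<dots> = (\<Sum>k<p. if k = i then (\<Sum>l<d. if i = j then ent X l l else 0) else 0)" by (intro sum.cong) auto
  also have "\<dots> = ent (cs (tr X) (Idn p)) i j" by (auto simp: tr_eq[OF assms])
  finally show "ent (\<Sum>k<p. \<Sum>l<d. um k l * X * adj (um k l)) i j = ent (cs (tr X) (Idn p)) i j" .
qed

lemma um_norm: assumes "car d p X" shows "(\<Sum>k<p. \<Sum>l<d. (cmod (tr (um k l * X)))\<^sup>2) = (norm X)\<^sup>2"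
  unfolding norm_fmat_sq[OF assms] by (subst sum.swap) (intro sum.cong refl, auto simp: tr_um_mult[OF _ _ assms])

lemma um_extra: assumes X: "car d p X" and X': "car d p X'"
  shows "cmod (\<Sum>k<p. \<Sum>l<d. tr (um k l * X * um k l * X')) \<le> norm X * norm X'"
proof -
  have e: "tr (um k l * X * um k l * X') = ent X l k * ent X' l k" if "k < p" "l < d" for k l
  proof -
    have c: "car d p (X * um k l * X')" by (rule car_mult[OF car_mult[OF X car_um[OF that]] X'])
    have "tr (um k l * X * um k l * X') = tr (um k l * (X * um k l * X'))" by (simp add: mult.assoc)
    also have "\<dots> = ent (X * (um k l * X')) l k" unfolding tr_um_mult[OF that c] by (simp add: mult.assoc)
    also have "\<dots> = (\<Sum>m<p. if m = k then ent X l k * ent X' l k else 0)"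
      unfolding ent_mult_eq[OF X] by (intro sum.cong) (auto simp: ent_um_mult)
    finally show ?thesis using that by simp
  qed
  have "(\<Sum>k<p. \<Sum>l<d. tr (um k l * X * um k l * X')) = (\<Sum>k<p. \<Sum>l<d. ent X l k * ent X' l k)"
    using e by (intro sum.cong) auto
  also have "cmod \<dots> \<le> (\<Sum>k<p. \<Sum>l<d. cmod (ent X l k) * cmod (ent X' l k))"
    by (intro sum_norm_le) (auto simp: norm_mult intro!: sum_norm_le)
  also have "\<dots> = (\<Sum>a\<in>{..<p} \<times> {..<d}. \<bar>cmod (ent X (snd a) (fst a))\<bar> * \<bar>cmod (ent X' (snd a) (fst a))\<bar>)"
    by (simp add: sum.cartesian_product case_prod_beta)
  also have "\<dots> \<le> L2_set (\<lambda>a. cmod (ent X (snd a) (fst a))) ({..<p} \<times> {..<d}) * L2_set (\<lambda>a. cmod (ent X' (snd a) (fst a))) ({..<p} \<times> {..<d})"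
    by (rule L2_set_mult_ineq)
  also have "\<dots> = norm X * norm X'"
  proof -
    have "L2_set (\<lambda>a. cmod (ent X (snd a) (fst a))) ({..<p} \<times> {..<d}) = norm X" if "car d p X" for X
    proof -
      have "(\<Sum>a\<in>{..<p} \<times> {..<d}. (cmod (ent X (snd a) (fst a)))\<^sup>2) = (norm X)\<^sup>2"
        unfolding norm_fmat_sq[OF that] by (subst sum.swap) (simp add: sum.cartesian_product case_prod_beta)
      thus ?thesis by (simp add: L2_set_def)
    qed
    thus ?thesis using X X' by simp
  qed
  finally show ?thesis .
qed

lemma gbasis_real: "gbasis p d ({..<p} \<times> {..<d}) realE"
  unfolding gbasis_def
proof (intro conjI allI impI ballI)
  show "car p d (realE \<alpha>)" if "\<alpha> \<in> {..<p} \<times> {..<d}" for \<alpha> using that by (auto simp: realE_def intro: car_um)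
  show "(\<Sum>\<alpha>\<in>{..<p} \<times> {..<d}. realE \<alpha> * X * adj (realE \<alpha>)) = cs (tr X) (Idn p)" if "car d d X" for X
    using um_contr[OF that, of p] by (simp add: realE_def sum.cartesian_product case_prod_beta)
  show "(\<Sum>\<alpha>\<in>{..<p} \<times> {..<d}. (cmod (tr (realE \<alpha> * X)))\<^sup>2) \<le> (norm X)\<^sup>2" if "car d p X" for X
    using um_norm[OF that] by (simp add: realE_def sum.cartesian_product case_prod_beta)
  show "cmod (\<Sum>\<alpha>\<in>{..<p} \<times> {..<d}. tr (realE \<alpha> * X * realE \<alpha> * X')) \<le> norm X * norm X'" if "car d p X \<and> car d p X'" for X X'
    using um_extra[of d p X X'] that by (simp add: realE_def sum.cartesian_product case_prod_beta)
  show "(norm (\<Sum>\<alpha>\<in>{..<p} \<times> {..<d}. x \<alpha> *\<^sub>R realE \<alpha>))\<^sup>2 \<le> (\<Sum>\<alpha>\<in>{..<p} \<times> {..<d}. (x \<alpha>)\<^sup>2)" for x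
  proof -
    have c: "car p d (\<Sum>\<alpha>\<in>{..<p} \<times> {..<d}. x \<alpha> *\<^sub>R realE \<alpha>)"
      unfolding scaleR_fmat_def by (intro car_sum car_cs) (auto simp: realE_def intro: car_um)
    have "ent (\<Sum>\<alpha>\<in>{..<p} \<times> {..<d}. x \<alpha> *\<^sub>R realE \<alpha>) i j = complex_of_real (x (i, j))" if "i < p" "j < d" for i j
    proof -
      have "ent (\<Sum>\<alpha>\<in>{..<p} \<times> {..<d}. x \<alpha> *\<^sub>R realE \<alpha>) i j = (\<Sum>\<alpha>\<in>{..<p} \<times> {..<d}. if \<alpha> = (i, j) then complex_of_real (x (i, j)) else 0)"
        unfolding ent_sum by (intro sum.cong) (auto simp: realE_def scaleR_fmat_def split: if_splits)
      thus ?thesis using that by simp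
    qed
    thus ?thesis unfolding norm_fmat_sq[OF c] by (simp add: sum.cartesian_product)
  qed
qed

lemma sum_bool_prod: "(\<Sum>\<alpha>\<in>{..<p} \<times> {..<d} \<times> (UNIV :: bool set). f \<alpha>) = (\<Sum>k<p. \<Sum>l<d. f (k, l, True) + f (k, l, False))"
  for f :: "nat \<times> nat \<times> bool \<Rightarrow> 'b :: comm_monoid_add"
  unfolding sum.cartesian_product[symmetric] sum.Sigma[symmetric]
  by (simp add: sum.cartesian_product' UNIV_bool add.commute)

text \<open>The coefficients \<open>1 / sqrt 2\<close> and \<open>\<i> / sqrt 2\<close> have squared
  moduli that add up to 1, which reduces \<open>contr\<close> and \<open>bessel\<close> to matrix
  units. Their squares add up to 0, so the contraction without adjoint vanishes.\<close>

lemma gbasis_complex: "gbasis p d ({..<p} \<times> {..<d} \<times> UNIV) complexE"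
  unfolding gbasis_def
proof (intro conjI allI impI ballI)
  have s2: "complex_of_real (sqrt 2) * complex_of_real (sqrt 2) = 2" by (simp add: of_real_mult[symmetric] del: of_real_mult)
  have h: "1 / complex_of_real (sqrt 2) * cnj (1 / complex_of_real (sqrt 2)) = 1/2" "\<i> / complex_of_real (sqrt 2) * cnj (\<i> / complex_of_real (sqrt 2)) = 1/2"
     "1 / complex_of_real (sqrt 2) * (1 / complex_of_real (sqrt 2)) = 1/2" "\<i> / complex_of_real (sqrt 2) * (\<i> / complex_of_real (sqrt 2)) = - 1/2"
    using s2 by (auto simp: field_simps)
  show "car p d (complexE \<alpha>)" if "\<alpha> \<in> {..<p} \<times> {..<d} \<times> UNIV" for \<alpha>
    using that by (auto simp: complexE_def intro!: car_um car_cs)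
  show "(\<Sum>\<alpha>\<in>{..<p} \<times> {..<d} \<times> UNIV. complexE \<alpha> * X * adj (complexE \<alpha>)) = cs (tr X) (Idn p)" if "car d d X" for X
  proof -
    have "complexE (k, l, True) * X * adj (complexE (k, l, True)) + complexE (k, l, False) * X * adj (complexE (k, l, False)) = um k l * X * adj (um k l)" for k l
      unfolding complexE_def by (simp add: adj_cs cs_add_left[symmetric] mult.commute[of "cnj _"]) (simp add: h(1,2)[simplified] cs_add_left[symmetric])
    thus ?thesis unfolding sum_bool_prod using um_contr[OF that] by simp
  qed
  show "(\<Sum>\<alpha>\<in>{..<p} \<times> {..<d} \<times> UNIV. (cmod (tr (complexE \<alpha> * X)))\<^sup>2) \<le> (norm X)\<^sup>2" if "car d p X" for X
  proof -
    have "(cmod (tr (complexE (k, l, True) * X)))\<^sup>2 + (cmod (tr (complexE (k, l, False) * X)))\<^sup>2 = (cmod (tr (um k l * X)))\<^sup>2" for k l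
      unfolding complexE_def by (simp add: tr_cs norm_mult norm_divide power_divide)
    thus ?thesis unfolding sum_bool_prod using um_norm[OF that] by simp
  qed
  show "cmod (\<Sum>\<alpha>\<in>{..<p} \<times> {..<d} \<times> UNIV. tr (complexE \<alpha> * X * complexE \<alpha> * X')) \<le> norm X * norm X'" if "car d p X \<and> car d p X'" for X X'
  proof -
    have "tr (complexE (k, l, True) * X * complexE (k, l, True) * X') + tr (complexE (k, l, False) * X * complexE (k, l, False) * X') = 0" for k l
      unfolding complexE_def using h(3,4) by (simp add: tr_cs)
    thus ?thesis unfolding sum_bool_prod by simp
  qed
  show "(norm (\<Sum>\<alpha>\<in>{..<p} \<times> {..<d} \<times> UNIV. x \<alpha> *\<^sub>R complexE \<alpha>))\<^sup>2 \<le> (\<Sum>\<alpha>\<in>{..<p} \<times> {..<d} \<times> UNIV. (x \<alpha>)\<^sup>2)" for x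
  proof -
    define c where "c k l = (complex_of_real (x (k, l, True)) + \<i> * complex_of_real (x (k, l, False))) / complex_of_real (sqrt 2)" for k l
    have e: "(\<Sum>\<alpha>\<in>{..<p} \<times> {..<d} \<times> UNIV. x \<alpha> *\<^sub>R complexE \<alpha>) = (\<Sum>k<p. \<Sum>l<d. cs (c k l) (um k l))"
      unfolding sum_bool_prod complexE_def c_def scaleR_fmat_def by (simp add: cs_add_left[symmetric] add_divide_distrib mult.commute)
    have car: "car p d (\<Sum>k<p. \<Sum>l<d. cs (c k l) (um k l))" by (intro car_sum car_cs car_um) auto
    have "ent (\<Sum>k<p. \<Sum>l<d. cs (c k l) (um k l)) i j = c i j" if "i < p" "j < d" for i j
    proof -
      have "ent (\<Sum>k<p. \<Sum>l<d. cs (c k l) (um k l)) i j = (\<Sum>k<p. \<Sum>l<d. if l = j then (if k = i then c i j else 0) else 0)"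
        unfolding ent_sum by (intro sum.cong) auto
      thus ?thesis using that by simp
    qed
    hence "(norm (\<Sum>\<alpha>\<in>{..<p} \<times> {..<d} \<times> UNIV. x \<alpha> *\<^sub>R complexE \<alpha>))\<^sup>2 = (\<Sum>k<p. \<Sum>l<d. (cmod (c k l))\<^sup>2)"
      unfolding e norm_fmat_sq[OF car] by simp
    also have "\<dots> \<le> (\<Sum>k<p. \<Sum>l<d. (x (k, l, True))\<^sup>2 + (x (k, l, False))\<^sup>2)"
    proof (intro sum_mono)
      fix k l
      define S where "S = (x (k, l, True))\<^sup>2 + (x (k, l, False))\<^sup>2"
      have "(cmod (c k l))\<^sup>2 = S / 2"
        unfolding c_def norm_divide power_divide cmod_power2[of "_ + _"] S_def by simp
      moreover have "0 \<le> S" by (simp add: S_def)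
      ultimately show "(cmod (c k l))\<^sup>2 \<le> (x (k, l, True))\<^sup>2 + (x (k, l, False))\<^sup>2" unfolding S_def[symmetric] by simp
    qed
    finally show ?thesis unfolding sum_bool_prod .
  qed
qed

section \<open>Existence of the limit measures\<close>

context real_distribution begin

text \<open>An interval of radius \<open>y\<close> around a point outside \<open>[-L, L]\<close> has
  mass at most \<open>2 c y^2\<close>. Covering a fixed interval takes about \<open>1 / y\<close> of
  them, so its mass is of order \<open>y\<close> for every \<open>y\<close> and therefore 0.\<close>

lemma AE_bounded_of_local_bound:
  assumes c: "\<And>x y. L < \<bar>x\<bar> \<Longrightarrow> 0 < y \<Longrightarrow> - Im (cauchy_transform M (Complex x y)) \<le> c * y" and L: "0 \<le> L"
  shows "AE t in M. \<bar>t\<bar> \<le> L"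
proof -
  have c0: "0 \<le> c"
  proof -
    have "0 < - Im (cauchy_transform M (Complex (L + 1) 1))" using Im_cauchy_neg[of "Complex (L + 1) 1"] by simp
    also have "\<dots> \<le> c * 1" by (rule c) (use L in auto)
    finally show ?thesis by simp
  qed
  \<comment> \<open>On the interval of radius \<open>y\<close> around \<open>x\<close> the kernel
    \<open>y / ((x - t)^2 + y^2)\<close> is at least \<open>1 / (2 y)\<close>.\<close>
  have local: "measure M {x - y..x + y} \<le> 2 * c * y\<^sup>2" if x: "L < \<bar>x\<bar>" and y: "0 < y" for x y
  proof -
    have "(1 / (2 * y)) * measure M {x - y..x + y} = (\<integral>t. (1 / (2 * y)) * indicator {x - y..x + y} t \<partial>M)" by simp
    also have "\<dots> \<le> (\<integral>t. y / ((x - t)\<^sup>2 + y\<^sup>2) \<partial>M)"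
    proof (rule integral_mono[OF _ poisson_kernel_integrable[OF y]])
      show "integrable M (\<lambda>t. (1 / (2 * y)) * indicator {x - y..x + y} t)" by (intro integrable_mult_right) (simp add: integrable_indicator_iff emeasure_eq_measure)
      fix t
      show "(1 / (2 * y)) * indicator {x - y..x + y} t \<le> y / ((x - t)\<^sup>2 + y\<^sup>2)"
      proof (cases "t \<in> {x - y..x + y}")
        case True
        hence "\<bar>x - t\<bar>\<^sup>2 \<le> y\<^sup>2" by (intro power_mono) auto
        hence "y / (2 * y\<^sup>2) \<le> y / ((x - t)\<^sup>2 + y\<^sup>2)" using y by (intro divide_left_mono mult_pos_pos add_nonneg_pos) auto
        thus ?thesis using True y by (simp add: power2_eq_square)
      next
        case False
        thus ?thesis using y by (auto intro!: divide_nonneg_nonneg)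
      qed
    qed
    also have "\<dots> \<le> c * y" using c[OF x y] Im_cauchy[of "Complex x y"] y by simp
    finally show ?thesis using y by (simp add: field_simps power2_eq_square)
  qed
  have interval: "measure M {a..b} = 0" if ab: "a < b" "L < a \<or> b < - L" for a b
  proof -
    have le: "measure M {a..b} \<le> (c * (b - a)\<^sup>2 / 2) * (1 / real (Suc n))" for n
    proof -
      define N where "N = real (Suc n)"
      define y where "y = (b - a) / (2 * N)"
      define x where "x k = a + (2 * real k + 1) * y" for k :: nat
      have N: "0 < N" by (simp add: N_def)
      have y: "0 < y" using ab N by (simp add: y_def)
      have Ny: "2 * N * y = b - a" using N by (simp add: y_def)
      have "{a..b} \<subseteq> (\<Union>k\<in>{..n}. {x k - y..x k + y})"
      proof
        fix t assume t: "t \<in> {a..b}"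
        \<comment> \<open>The right end point would receive the index \<open>n + 1\<close> from the
          floor and is assigned to the last interval by hand.\<close>
        define k where "k = (if t = b then n else nat \<lfloor>(t - a) / (2 * y)\<rfloor>)"
        have q0: "0 \<le> (t - a) / (2 * y)" using t y by auto
        show "t \<in> (\<Union>k\<in>{..n}. {x k - y..x k + y})"
        proof (cases "t = b")
          case True
          have "t \<in> {x n - y..x n + y}" using Ny y True by (auto simp: x_def N_def algebra_simps)
          thus ?thesis by auto
        next
          case False
          have "(t - a) / (2 * y) < N" using t False y Ny by (simp add: divide_less_eq algebra_simps)
          hence "\<lfloor>(t - a) / (2 * y)\<rfloor> < int (Suc n)" unfolding N_def by (simp add: floor_less_iff)
          hence kn: "k \<le> n" using False q0 by (simp add: k_def)
          have k1: "real k \<le> (t - a) / (2 * y)" "(t - a) / (2 * y) < real k + 1"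
            using False q0 by (auto simp: k_def)
          have "real k * (2 * y) \<le> t - a" "t - a < (real k + 1) * (2 * y)"
            using k1 y by (auto simp: le_divide_eq divide_less_eq)
          hence "t \<in> {x k - y..x k + y}" by (auto simp: x_def algebra_simps)
          thus ?thesis using kn by blast
        qed
      qed
      hence "measure M {a..b} \<le> measure M (\<Union>k\<in>{..n}. {x k - y..x k + y})" by (intro finite_measure_mono) auto
      also have "\<dots> \<le> (\<Sum>k\<le>n. measure M {x k - y..x k + y})" by (intro finite_measure_subadditive_finite) auto
      also have "\<dots> \<le> (\<Sum>k\<le>n. 2 * c * y\<^sup>2)"
      proof (intro sum_mono local y)
        fix k assume "k \<in> {..n}"
        hence "(2 * real k + 1) * y \<le> (2 * N) * y" using y by (intro mult_right_mono) (auto simp: N_def)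
        moreover have "0 < (2 * real k + 1) * y" using y by (intro mult_pos_pos) auto
        ultimately have "a < x k" "x k \<le> b" using Ny by (auto simp: x_def)
        thus "L < \<bar>x k\<bar>" using ab L by auto
      qed
      also have "\<dots> = N * (2 * c * y\<^sup>2)" by (simp add: N_def)
      also have "\<dots> = (c * (b - a)\<^sup>2 / 2) * (1 / N)" using N by (simp add: y_def power2_eq_square field_simps)
      finally show ?thesis by (simp add: N_def)
    qed
    have "(\<lambda>n. (c * (b - a)\<^sup>2 / 2) * (1 / real (Suc n))) \<longlonglongrightarrow> (c * (b - a)\<^sup>2 / 2) * 0"
      by (intro tendsto_intros LIMSEQ_Suc lim_1_over_n)
    hence "measure M {a..b} \<le> (c * (b - a)\<^sup>2 / 2) * 0" using le by (intro LIMSEQ_le_const) auto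
    thus ?thesis using measure_nonneg[of M "{a..b}"] by simp
  qed
  \<comment> \<open>Countably many compact intervals that exhaust the complement of
    \<open>[-L, L]\<close>.\<close>
  have null: "{L + 1 / real (Suc n)..L + 1 + real (Suc n)} \<in> null_sets M" "{- (L + 1 + real (Suc n))..- (L + 1 / real (Suc n))} \<in> null_sets M" for n
  proof -
    have s: "1 / real (Suc n) \<le> 1" "0 < 1 / real (Suc n)" "0 < real (Suc n)" by auto
    have "measure M {L + 1 / real (Suc n)..L + 1 + real (Suc n)} = 0" by (intro interval disjI1; use s in linarith)
    thus "{L + 1 / real (Suc n)..L + 1 + real (Suc n)} \<in> null_sets M" by (auto simp: null_sets_def emeasure_eq_measure)
    have "measure M {- (L + 1 + real (Suc n))..- (L + 1 / real (Suc n))} = 0" by (intro interval disjI2; use s in linarith)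
    thus "{- (L + 1 + real (Suc n))..- (L + 1 / real (Suc n))} \<in> null_sets M" by (auto simp: null_sets_def emeasure_eq_measure)
  qed
  have U: "(\<Union>n. {L + 1 / real (Suc n)..L + 1 + real (Suc n)} \<union> {- (L + 1 + real (Suc n))..- (L + 1 / real (Suc n))}) \<in> null_sets M"
    by (intro null_sets_UN null_sets.Un null)
  show ?thesis
  proof (rule AE_I'[OF U], rule subsetI)
    fix t assume "t \<in> {t \<in> space M. \<not> \<bar>t\<bar> \<le> L}"
    hence t: "L < \<bar>t\<bar>" by auto
    obtain n1 where n1: "1 / real (Suc n1) < \<bar>t\<bar> - L" using t by (meson diff_gt_0_iff_gt nat_approx_posE)
    obtain n2 where n2: "\<bar>t\<bar> < real n2" using reals_Archimedean2 by blast
    define n where "n = max n1 n2"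
    have "1 / real (Suc n) \<le> 1 / real (Suc n1)" by (intro divide_left_mono) (auto simp: n_def)
    hence a: "L + 1 / real (Suc n) \<le> \<bar>t\<bar>" using n1 by linarith
    have "\<bar>t\<bar> \<le> L + 1 + real (Suc n)" using n2 L by (auto simp: n_def)
    hence "t \<in> {L + 1 / real (Suc n)..L + 1 + real (Suc n)} \<union> {- (L + 1 + real (Suc n))..- (L + 1 / real (Suc n))}"
      using a by (cases "0 \<le> t") auto
    thus "t \<in> (\<Union>n. {L + 1 / real (Suc n)..L + 1 + real (Suc n)} \<union> {- (L + 1 + real (Suc n))..- (L + 1 / real (Suc n))})" by blast
  qed
qed

text \<open>On a vertical ray far from the spectrum the modulus of the solution omits an interval, so it stays on the small branch
  that behaves like \<open>1 / z\<close>.\<close>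

lemma AE_bounded_of_fixpoint:
  assumes fp: "\<And>z. 0 < Im z \<Longrightarrow> Gcal d p z v (cauchy_transform M z) = cauchy_transform M z"
    and v: "\<And>i. i < p \<Longrightarrow> \<bar>v i\<bar> \<le> V" and V: "0 < V" and C: "real p / real d \<le> C"
  shows "AE t in M. \<bar>t\<bar> \<le> (4 + 6 * C) * V"
proof -
  \<comment> \<open>For \<open>|b| \<le> r\<close> all \<open>|v i b|\<close> are at most
    \<open>1 / 2\<close>, hence \<open>Rcal\<close> is bounded by \<open>2 * C * V\<close>.\<close>
  define r where "r = 1 / (2 * V)"
  \<comment> \<open>Chosen so that \<open>L - 2 * C * V \<ge> 4 * V * (1 + C)\<close>. For
    \<open>|z| > L\<close>, a value of modulus at most \<open>r\<close> then has modulus at most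
    \<open>1 / (4 * V * (1 + C))\<close>, which is at most \<open>r / 2\<close>; this is the omitted
    interval.\<close>
  define L where "L = (4 + 6 * C) * V"
  have C0: "0 \<le> C" using order_trans[OF _ C, of 0] by simp
  have r0: "0 < r" using V by (simp add: r_def)
  have L0: "0 \<le> L" using C0 V by (simp add: L_def)
  have Rb: "cmod (Rcal d p v b) \<le> 2 * C * V" if b: "cmod b \<le> r" for b
  proof -
    have "cmod (complex_of_real (v i) / (1 - complex_of_real (v i) * b)) \<le> 2 * V" if i: "i < p" for i
    proof -
      have "\<bar>v i\<bar> * cmod b \<le> V * r" using v[OF i] b V by (intro mult_mono) auto
      hence "\<bar>v i\<bar> * cmod b \<le> 1 / 2" using V by (simp add: r_def)
      hence "1 / 2 \<le> cmod (1 - complex_of_real (v i) * b)" using norm_triangle_ineq2[of 1 "complex_of_real (v i) * b"] by (simp add: norm_mult)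
      hence "\<bar>v i\<bar> / cmod (1 - complex_of_real (v i) * b) \<le> V / (1 / 2)" using V v[OF i] by (intro frac_le) auto
      thus ?thesis by (simp add: norm_divide)
    qed
    hence "cmod (\<Sum>i<p. complex_of_real (v i) / (1 - complex_of_real (v i) * b)) \<le> (\<Sum>i<p. 2 * V)" by (intro sum_norm_le) auto
    hence "cmod (Rcal d p v b) \<le> (1 / real d) * (real p * (2 * V))" unfolding Rcal_def by (simp add: norm_mult norm_divide divide_right_mono)
    also have "\<dots> = (real p / real d) * (2 * V)" by simp
    also have "\<dots> \<le> C * (2 * V)" using V C by (intro mult_right_mono) auto
    finally show ?thesis by simp
  qed
  let ?G = "cauchy_transform M"
  have gap: "cmod (?G z) \<le> 1 / (4 * V * (1 + C))" if z: "0 < Im z" "L < cmod z" "cmod (?G z) \<le> r" for z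
  proof -
    have "4 * V * (1 + C) \<le> L - 2 * C * V" by (simp add: L_def algebra_simps)
    also have "\<dots> \<le> cmod z - cmod (Rcal d p v (?G z))" using z Rb[OF z(3)] by linarith
    also have "\<dots> \<le> cmod (z - Rcal d p v (?G z))" by (rule norm_triangle_ineq2)
    finally have "4 * V * (1 + C) \<le> cmod (z - Rcal d p v (?G z))" .
    hence "inverse (cmod (z - Rcal d p v (?G z))) \<le> inverse (4 * V * (1 + C))" using V C0 by (intro le_imp_inverse_le) auto
    moreover have "cmod (?G z) = inverse (cmod (z - Rcal d p v (?G z)))" using fp[OF z(1)] unfolding Gcal_def by (metis norm_inverse)
    ultimately show ?thesis by (simp add: inverse_eq_divide)
  qed
  have e_le: "1 / (4 * V * (1 + C)) \<le> r / 2"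
  proof -
    have "4 * V * 1 \<le> 4 * V * (1 + C)" using V C0 by (intro mult_left_mono) auto
    hence "1 / (4 * V * (1 + C)) \<le> 1 / (4 * V)" using V C0 by (intro divide_left_mono) auto
    thus ?thesis by (simp add: r_def)
  qed
  have small: "cmod (?G (Complex x y)) \<le> r" if x: "L < \<bar>x\<bar>" and y: "0 < y" for x y
  proof (rule ccontr)
    assume "\<not> cmod (?G (Complex x y)) \<le> r"
    hence big: "r < cmod (?G (Complex x y))" by simp
    \<comment> \<open>At height \<open>T\<close> the modulus is at most
      \<open>1 / T \<le> r\<close>. If it exceeds \<open>r\<close> at height \<open>y\<close>, it
      equals \<open>r\<close> somewhere in between, inside the omitted interval.\<close>
    define T where "T = max y (1 / r)"
    have T: "0 < T" "1 / r \<le> T" "y \<le> T" using y by (auto simp: T_def)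
    have "cmod (?G (Complex x T)) \<le> 1 / T" using cauchy_norm_le[of "Complex x T"] T by simp
    also have "\<dots> \<le> r" using T r0 by (simp add: field_simps)
    finally have Ts: "cmod (?G (Complex x T)) \<le> r" .
    have "continuous_on {y..T} (\<lambda>s. cmod (?G (Complex x s)))"
      unfolding Complex_eq
      by (intro continuous_intros continuous_on_compose2[of "{z. 0 < Im z}" ?G "{y..T}" "\<lambda>s. complex_of_real x + \<i> * complex_of_real s"]
        holomorphic_on_imp_continuous_on cauchy_holomorphic) (use y in auto)
    then obtain s where s: "y \<le> s" "s \<le> T" "cmod (?G (Complex x s)) = r"
      using IVT2'[of "\<lambda>s. cmod (?G (Complex x s))" T r y] Ts big T by auto
    have "L < cmod (Complex x s)" using x abs_Re_le_cmod[of "Complex x s"] by simp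
    hence "cmod (?G (Complex x s)) \<le> 1 / (4 * V * (1 + C))" using s y by (intro gap) auto
    hence "r \<le> r / 2" unfolding s(3) using e_le by (rule order_trans)
    thus False using r0 by simp
  qed
  have "- Im (?G (Complex x y)) \<le> (2 * r\<^sup>2) * y" if x: "L < \<bar>x\<bar>" and y: "0 < y" for x y
  proof -
    let ?z = "Complex x y"
    define g where "g = ?G ?z"
    have z: "0 < Im ?z" using y by simp
    have gr: "cmod g \<le> r" using small[OF x y] by (simp add: g_def)
    have ge: "cmod g \<le> 1 / (4 * V * (1 + C))"
      using gap[OF z _ gr[unfolded g_def]] x abs_Re_le_cmod[of ?z] by (simp add: g_def)
    have gneg: "Im g < 0" unfolding g_def by (rule Im_cauchy_neg[OF z])
    have Im: "- Im g = (cmod g)\<^sup>2 * (y - Im g * Scal d p v g)"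
      using Im_Gcal[OF gneg z, of d p v] fp[OF z] by (simp add: g_def)
    have "V * cmod g \<le> V * r" using gr V by (intro mult_left_mono) auto
    hence "V * cmod g \<le> 1 / 2" using V by (simp add: r_def)
    hence "Scal d p v g \<le> real p / real d * (V\<^sup>2 / (1 - 1/2)\<^sup>2)" using v V by (intro Scal_le) auto
    also have "\<dots> \<le> C * (V\<^sup>2 / (1 - 1/2)\<^sup>2)" using C by (intro mult_right_mono) auto
    finally have S: "Scal d p v g \<le> 4 * C * V\<^sup>2" by (simp add: power2_eq_square)
    \<comment> \<open>On the small branch the general bound 1 for \<open>|g|^2 * Scal\<close>
      improves to \<open>1 / 2\<close>. Half of the identity for \<open>- Im g\<close> is then
      absorbed and \<open>- Im g \<le> 2 |g|^2 y\<close> remains.\<close>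
    have "(cmod g)\<^sup>2 * Scal d p v g \<le> (1 / (4 * V * (1 + C)))\<^sup>2 * (4 * C * V\<^sup>2)"
      by (intro mult_mono S power_mono ge Scal_nonneg) auto
    also have "\<dots> = C / (4 * (1 + C)\<^sup>2)" using V by (simp add: power_divide power_mult_distrib)
    also have "\<dots> \<le> 1 / 2"
    proof -
      have "2 * C \<le> 4 * (1 + C)\<^sup>2" using C0 by (simp add: power2_eq_square algebra_simps)
      thus ?thesis using C0 by (simp add: divide_le_eq)
    qed
    finally have "(- Im g) * ((cmod g)\<^sup>2 * Scal d p v g) \<le> (- Im g) * (1 / 2)" using gneg by (intro mult_left_mono) auto
    moreover have "- Im g = (cmod g)\<^sup>2 * y + (- Im g) * ((cmod g)\<^sup>2 * Scal d p v g)" using Im by (simp add: algebra_simps)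
    ultimately have "- Im g \<le> 2 * ((cmod g)\<^sup>2 * y)" by linarith
    also have "\<dots> \<le> 2 * (r\<^sup>2 * y)" using gr y by (intro mult_left_mono mult_right_mono power_mono) auto
    finally show ?thesis by (simp add: g_def)
  qed
  thus ?thesis unfolding L_def[symmetric] by (rule AE_bounded_of_local_bound[OF _ L0])
qed

end

section \<open>Second moments, tightness and construction of the limit\<close>

lemma gaussian_matrix_of_gbasis:
  fixes I :: "'i :: countable set"
  assumes "gbasis p d I E" "finite I" "card I \<le> 2 * p * d" "1 \<le> d" "0 < V" "\<And>i. i < p \<Longrightarrow> \<bar>v i\<bar> \<le> V" "real p \<le> C * real d"
  shows "gaussian_matrix I d p E v V C"
  using assms by unfold_locales (auto simp: gbasis_def)

definition defect :: "nat \<Rightarrow> nat \<Rightarrow> (nat \<Rightarrow> real) \<Rightarrow> complex \<Rightarrow> complex \<Rightarrow> complex" where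
  "defect d p v z b = z * b - 1 - b * Rcal d p v b"

lemma defect_zero_iff: assumes "Im b < 0" "0 < Im z" shows "defect d p v z b = 0 \<longleftrightarrow> Gcal d p z v b = b"
proof -
  have "defect d p v z b = 0 \<longleftrightarrow> b * (z - Rcal d p v b) = 1" unfolding defect_def by (auto simp: algebra_simps)
  also have "\<dots> \<longleftrightarrow> Gcal d p z v b = b" unfolding Gcal_def using Gcal_nz[OF assms, of d p v]
    by (metis inverse_unique mult.commute right_inverse)
  finally show ?thesis .
qed

text \<open>The constant of \<open>hh_second_moment\<close> with all abbreviations unfolded. It is
  built from \<open>z\<close>, \<open>V\<close> and \<open>C\<close> and thus is the same for all
  dimensions.\<close>

definition mconst :: "complex \<Rightarrow> real \<Rightarrow> real \<Rightarrow> real" where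
  "mconst z V C = (let y = Im z in 12 * (2 * V\<^sup>2 / y\<^sup>2)\<^sup>2 * C\<^sup>2 + 4 * (8 * V^3 / y^3 * (cmod z / y + 1 + 2 * V * C / y)
     + 4 * V\<^sup>2 / y^3 * (cmod z + 2 * V * C + 4 * V\<^sup>2 * C / y)) * C)"

context gaussian_matrix begin

lemma defect_moment:
  assumes z: "0 < Im z" "2 * V \<le> Im z"
  shows "integrable P (\<lambda>x. (cmod (defect d p v z (G z x)))\<^sup>2)" "(\<integral>x. (cmod (defect d p v z (G z x)))\<^sup>2 \<partial>P) \<le> mconst z V C / (real d)\<^sup>2"
  using integrable_hh[OF z] hh_second_moment[OF z]
  unfolding hh_def[OF z] defect_def[symmetric] mconst_def Let_def c1_def[OF z] c4_def[OF z] Hb_def[OF z] Hd_def[OF z] by auto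

text \<open>\<open>card I / d^2\<close> is the mean of \<open>sq / d\<close>. This controls the
  squared norm of \<open>Ym\<close> divided by \<open>d\<close>, and through
  \<open>esd_first_moment\<close> the first moments of the spectral distributions.\<close>

lemma sq_concentration:
  shows "integrable P (\<lambda>x. (sq x / real d - card I / (real d)\<^sup>2)\<^sup>2)"
    "(\<integral>x. (sq x / real d - card I / (real d)\<^sup>2)\<^sup>2 \<partial>P) \<le> 4 * C / (real d)\<^sup>2"
proof -
  define D where "D = real d"
  have D: "1 \<le> D" using d by (simp add: D_def)
  have e: "(sq x / D - card I / D\<^sup>2)\<^sup>2 = (1 / D\<^sup>2) * (sq x - (1 / sqrt D)\<^sup>2 * card I)\<^sup>2" for x
    using D by (simp add: power_divide field_simps power2_eq_square)
  show "integrable P (\<lambda>x. (sq x / real d - card I / (real d)\<^sup>2)\<^sup>2)"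
    unfolding D_def[symmetric] e using variance_sq(1) by (simp add: D_def)
  have "(\<integral>x. (sq x / D - card I / D\<^sup>2)\<^sup>2 \<partial>P) = (1 / D\<^sup>2) * (2 * (1 / sqrt D)^4 * card I)"
    unfolding e using variance_sq(2) by (simp add: D_def)
  also have "(1 / sqrt D)^4 = 1 / D\<^sup>2"
  proof -
    have "(1 / sqrt D)^4 = ((1 / sqrt D)\<^sup>2)\<^sup>2" by (simp add: power_mult[symmetric])
    thus ?thesis using D by (simp add: power_divide)
  qed
  also have "(1 / D\<^sup>2) * (2 * (1 / D\<^sup>2) * real (card I)) \<le> (1 / D\<^sup>2) * (2 * (1 / D\<^sup>2) * (2 * C * D\<^sup>2))"
  proof (intro mult_left_mono)
    have "real (card I) \<le> real (2 * p * d)" using card by (simp only: of_nat_le_iff)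
    also have "\<dots> = (2 * D) * real p" by (simp add: D_def)
    also have "\<dots> \<le> (2 * D) * (C * D)" using C D by (intro mult_left_mono) (auto simp: D_def)
    finally show "real (card I) \<le> 2 * C * D\<^sup>2" by (simp add: power2_eq_square mult_ac)
  qed auto
  also have "\<dots> = 4 * C / D\<^sup>2" using D by simp
  finally show "(\<integral>x. (sq x / real d - card I / (real d)\<^sup>2)\<^sup>2 \<partial>P) \<le> 4 * C / (real d)\<^sup>2" by (simp add: D_def)
qed

lemma card_ratio: "real (card I) / (real d)\<^sup>2 \<le> 2 * C"
proof -
  have "real (card I) \<le> real (2 * p * d)" using card by (simp only: of_nat_le_iff)
  also have "\<dots> = (2 * real d) * real p" by simp
  also have "\<dots> \<le> (2 * real d) * (C * real d)" using C by (intro mult_left_mono) auto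
  finally show ?thesis using d by (simp add: divide_le_eq power2_eq_square mult_ac)
qed

end

lemma exists_le_expectation:
  assumes "prob_space M" "integrable M (f :: _ \<Rightarrow> real)" "(\<integral>x. f x \<partial>M) \<le> c"
  shows "\<exists>x\<in>space M. f x \<le> c"
proof (rule ccontr)
  interpret prob_space M by fact
  assume "\<not> (\<exists>x\<in>space M. f x \<le> c)"
  hence *: "\<And>x. x \<in> space M \<Longrightarrow> c < f x" by force
  have "(\<integral>x. f x - c \<partial>M) \<le> 0" using assms(2,3) by (simp add: prob_space)
  moreover have "0 \<le> (\<integral>x. f x - c \<partial>M)" using * by (intro integral_nonneg_AE) (auto intro: less_imp_le)
  ultimately have "(\<integral>x. f x - c \<partial>M) = 0" by simp
  hence "AE x in M. f x - c = 0" using assms(2) * by (subst (asm) integral_nonneg_eq_0_iff_AE) (auto intro: less_imp_le)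
  hence "AE x in M. False" using AE_space by eventually_elim (use * in force)
  thus False by simp
qed

lemma Rcal_replicate:
  assumes "1 \<le> p" "1 \<le> n"
  shows "Rcal (n * d) (n * p) (\<lambda>i. v (i mod p)) b = Rcal d p v b"
proof -
  define f where "f i = complex_of_real (v i) / (1 - complex_of_real (v i) * b)" for i
  have "(\<Sum>i\<in>{m * p..<m * p + p}. f (i mod p)) = (\<Sum>i<p. f i)" for m
  proof -
    have "(\<Sum>i\<in>{0 + m * p..<p + m * p}. f (i mod p)) = (\<Sum>i\<in>{0..<p}. f ((i + m * p) mod p))"
      by (rule sum.shift_bounds_nat_ivl)
    also have "\<dots> = (\<Sum>i<p. f i)" unfolding lessThan_atLeast0 by (intro sum.cong) auto
    finally show ?thesis by (simp add: add.commute)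
  qed
  hence "(\<Sum>i<n * p. f (i mod p)) = of_nat n * (\<Sum>i<p. f i)"
    unfolding sum.nat_group[of "\<lambda>i. f (i mod p)" p n, symmetric] by simp
  thus ?thesis using assms unfolding Rcal_def f_def by simp
qed

lemma tight_of_first_moment:
  assumes \<nu>: "\<And>n. real_distribution (\<nu> n)" "\<And>n. integrable (\<nu> n) (\<lambda>t. \<bar>t\<bar>)" "\<And>n. (\<integral>t. \<bar>t\<bar> \<partial>(\<nu> n)) \<le> B"
  shows "tight \<nu>"
  unfolding tight_def
proof (intro conjI allI impI \<nu>(1))
  fix \<epsilon> :: real assume \<epsilon>: "0 < \<epsilon>"
  have B0: "0 \<le> B" by (rule order_trans[OF integral_nonneg_AE \<nu>(3)]) auto
  define R where "R = (B + 1) / \<epsilon>"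
  have R: "0 < R" using B0 \<epsilon> by (simp add: R_def)
  have "1 - \<epsilon> < measure (\<nu> n) {- R<..R}" for n
  proof -
    interpret real_distribution "\<nu> n" by (rule \<nu>(1))
    have "B / R < \<epsilon>" using B0 \<epsilon> by (simp add: R_def divide_less_eq)
    hence "1 - \<epsilon> < 1 - (1 / R) * B" by simp
    also have "\<dots> \<le> 1 - (1 / R) * (\<integral>t. \<bar>t\<bar> \<partial>(\<nu> n))" using R \<nu>(3) by (intro diff_left_mono mult_left_mono) auto
    also have "\<dots> = (\<integral>t. 1 - (1 / R) * \<bar>t\<bar> \<partial>(\<nu> n))" using \<nu>(2)[of n] by (simp add: prob_space[unfolded space_eq_univ])
    also have "\<dots> \<le> (\<integral>t. indicator {- R<..R} t \<partial>(\<nu> n))"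
    proof (rule integral_mono)
      show "integrable (\<nu> n) (\<lambda>t. 1 - (1 / R) * \<bar>t\<bar>)" using \<nu>(2)[of n] by simp
      show "integrable (\<nu> n) (indicator {- R<..R} :: real \<Rightarrow> real)" by (simp add: integrable_indicator_iff emeasure_eq_measure)
      show "1 - (1 / R) * \<bar>t\<bar> \<le> indicator {- R<..R} t" for t
      proof (cases "t \<in> {- R<..R}")
        case False
        hence "R \<le> \<bar>t\<bar>" by auto
        thus ?thesis using False R by (simp add: le_divide_eq)
      qed (use R in auto)
    qed
    finally show ?thesis by simp
  qed
  thus "\<exists>a b. a < b \<and> (\<forall>n. 1 - \<epsilon> < measure (\<nu> n) {a<..b})" using R by (intro exI[of _ "- R"] exI[of _ R]) auto
qed

lemma cauchy_transform_weak_limit: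
  assumes "\<And>n. real_distribution (\<nu> n)" "real_distribution \<mu>" "weak_conv_m \<nu> \<mu>" and z: "0 < Im z"
  shows "(\<lambda>n. cauchy_transform (\<nu> n) z) \<longlonglongrightarrow> cauchy_transform \<mu> z"
  unfolding cauchy_transform_def
proof (rule weak_conv_imp_integral_bdd_continuous_conv[OF assms(1-3)])
  have "z - complex_of_real x \<noteq> 0" for x using z by (auto simp: complex_eq_iff)
  thus "isCont (\<lambda>t. inverse (z - complex_of_real t)) x" for x by (intro continuous_intros) auto
  show "norm (inverse (z - complex_of_real x)) \<le> 1 / Im z" for x by (rule cauchy_kernel_norm_le[OF z])
qed

text \<open>Countably many points, so that almost sure statements at all of them can be intersected,
  with an accumulation point inside the half plane for the identity theorem.\<close>

definition yseq :: "real \<Rightarrow> nat \<Rightarrow> complex" where "yseq y j = Complex 0 (y + 1 / real (Suc j))"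

lemma yseq: "yseq y \<longlonglongrightarrow> Complex 0 y" "yseq y j \<noteq> Complex 0 y" "y < Im (yseq y j)"
proof -
  have "(\<lambda>j. Complex 0 (y + 1 / real (Suc j))) \<longlonglongrightarrow> Complex 0 (y + 0)"
    by (intro tendsto_intros LIMSEQ_Suc lim_1_over_n)
  thus "yseq y \<longlonglongrightarrow> Complex 0 y" by (simp add: yseq_def[abs_def])
qed (auto simp: yseq_def)

lemma Rcal_holomorphic: "Rcal d p v holomorphic_on {b. Im b < 0}"
  unfolding holomorphic_on_def field_differentiable_def
  using Rcal_has_field_derivative[OF one_minus_nz] has_field_derivative_at_within by blast

text \<open>The Cauchy transform maps into the lower half plane, where \<open>Rcal\<close> is
  holomorphic. The defect is thus holomorphic in \<open>z\<close> and vanishes identically once it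
  vanishes on the sequence.\<close>

lemma fixpoint_of_sequence:
  assumes \<mu>: "real_distribution \<mu>" and y: "0 < y"
    and zero: "\<And>j. defect d p v (yseq y j) (cauchy_transform \<mu> (yseq y j)) = 0" and z: "0 < Im z"
  shows "Gcal d p z v (cauchy_transform \<mu> z) = cauchy_transform \<mu> z"
proof -
  interpret real_distribution \<mu> by fact
  have "(Rcal d p v \<circ> cauchy_transform \<mu>) holomorphic_on {z. 0 < Im z}"
    by (rule holomorphic_on_compose_gen[OF cauchy_holomorphic Rcal_holomorphic]) (auto simp: Im_cauchy_neg)
  hence "(\<lambda>z. defect d p v z (cauchy_transform \<mu> z)) holomorphic_on {z. 0 < Im z}"
    unfolding defect_def o_def by (intro holomorphic_intros cauchy_holomorphic)
  hence "defect d p v z (cauchy_transform \<mu> z) = 0"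
    using zero
    by (rule upper_half_identity[where \<xi>="yseq y" and \<zeta>="Complex 0 y"]) (use yseq[of y] y z in \<open>auto intro: less_trans\<close>)
  thus ?thesis using defect_zero_iff[OF Im_cauchy_neg[OF z] z] by simp
qed

text \<open>Probability serves here as an existence argument: for each multiple \<open>N\<close> a
  single functional \<open>T\<close>, which collects the weighted squared defects at the first
  \<open>N\<close> points and the deviation of the norm, has mean at most \<open>m / N^2\<close>, so
  one outcome is good for all of them together.\<close>

theorem limit_measure_exists:
  assumes p: "1 \<le> p" and d: "1 \<le> d"
  shows "\<exists>\<mu>. real_distribution \<mu> \<and> (\<forall>z. 0 < Im z \<longrightarrow> Gcal d p z v (cauchy_transform \<mu> z) = cauchy_transform \<mu> z)"
proof -
  define V where "V = 1 + (\<Sum>i<p. \<bar>v i\<bar>)"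
  have V: "0 < V" unfolding V_def by (intro add_pos_nonneg sum_nonneg) auto
  have vV: "\<bar>v i\<bar> \<le> V" if "i < p" for i
    using member_le_sum[of i "{..<p}" "\<lambda>i. \<bar>v i\<bar>"] that by (simp add: V_def)
  define C where "C = real p / real d"
  have Cnn: "0 \<le> C" by (simp add: C_def)
  define y where "y = 2 * V"
  have y: "0 < y" using V by (simp add: y_def)
  define \<xi> where "\<xi> = yseq y"
  have \<xi>: "0 < Im (\<xi> j)" "2 * V \<le> Im (\<xi> j)" for j using yseq(3)[of y j] y by (auto simp: \<xi>_def y_def)
  \<comment> \<open>The weights make the sum of the moment bounds over all \<open>j\<close> a
    geometric series.\<close>
  define c where "c j = 1 / (2^j * (1 + \<bar>mconst (\<xi> j) V C\<bar>))" for j :: nat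
  have c0: "0 < c j" for j by (simp add: c_def add_pos_nonneg)
  \<comment> \<open>2 is the sum of the geometric series, and \<open>4 * C\<close> is the bound from
    \<open>sq_concentration\<close>.\<close>
  define m where "m = 2 + 4 * C"
  \<comment> \<open>\<open>2 * C\<close> bounds the mean of \<open>sq / D\<close>, and
    \<open>1 + m\<close> its deviation \<open>a\<close>, because \<open>a^2 \<le> m\<close> implies
    \<open>a \<le> 1 + m\<close>.\<close>
  define Bm where "Bm = V * (2 * C + 1 + m)"
  have step: "\<exists>\<nu>. real_distribution \<nu> \<and> integrable \<nu> (\<lambda>t. \<bar>t\<bar>) \<and> (\<integral>t. \<bar>t\<bar> \<partial>\<nu>) \<le> Bm \<and>
     (\<forall>j<N. c j * (cmod (defect d p v (\<xi> j) (cauchy_transform \<nu> (\<xi> j))))\<^sup>2 \<le> m / (real N)\<^sup>2)" if N: "1 \<le> N" for N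
  proof -
    \<comment> \<open>The real basis serves for both fields, since the fixed point equation is the
      same.\<close>
    interpret gaussian_matrix "{..<N * p} \<times> {..<N * d}" "N * d" "N * p" realE "\<lambda>i. v (i mod p)" V C
      by (rule gaussian_matrix_of_gbasis[OF gbasis_real]) (use N d p V vV in \<open>auto simp: C_def\<close>)
    define D where "D = real (N * d)"
    have D: "1 \<le> D" "real N \<le> D" using N d by (auto simp: D_def mult_le_cancel_left1 simp flip: of_nat_mult)
    define k where "k = real (card ({..<N * p} \<times> {..<N * d}))"
    define T where "T x = (\<Sum>j<N. c j * (cmod (defect d p v (\<xi> j) (G (\<xi> j) x)))\<^sup>2) + (sq x / D - k / D\<^sup>2)\<^sup>2" for x
    have def_eq: "defect (N * d) (N * p) (\<lambda>i. v (i mod p)) z b = defect d p v z b" for z b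
      unfolding defect_def Rcal_replicate[OF p N] ..
    note dm = defect_moment[OF \<xi>, unfolded def_eq]
    have sc: "integrable P (\<lambda>x. (sq x / D - k / D\<^sup>2)\<^sup>2)" "(\<integral>x. (sq x / D - k / D\<^sup>2)\<^sup>2 \<partial>P) \<le> 4 * C / D\<^sup>2"
      unfolding k_def D_def by (rule sq_concentration)+
    have iT: "integrable P T" unfolding T_def
      by (intro Bochner_Integration.integrable_add Bochner_Integration.integrable_sum integrable_mult_right dm sc)
    have "(\<integral>x. T x \<partial>P) = (\<Sum>j<N. c j * (\<integral>x. (cmod (defect d p v (\<xi> j) (G (\<xi> j) x)))\<^sup>2 \<partial>P)) + (\<integral>x. (sq x / D - k / D\<^sup>2)\<^sup>2 \<partial>P)"
      unfolding T_def using dm(1)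
      by (subst Bochner_Integration.integral_add[OF _ sc(1)]) (auto intro!: Bochner_Integration.integrable_sum simp: Bochner_Integration.integral_sum)
    also have "\<dots> \<le> (\<Sum>j<N. (1/2)^j * (1 / D\<^sup>2)) + 4 * C / D\<^sup>2"
    proof (intro add_mono sum_mono sc(2))
      fix j
      define M where "M = mconst (\<xi> j) V C"
      have "c j * (\<integral>x. (cmod (defect d p v (\<xi> j) (G (\<xi> j) x)))\<^sup>2 \<partial>P) \<le> c j * (M / D\<^sup>2)"
        using dm(2)[of j] c0[of j] by (intro mult_left_mono) (auto simp: M_def D_def)
      also have "\<dots> \<le> c j * ((1 + \<bar>M\<bar>) / D\<^sup>2)" using c0[of j] by (intro mult_left_mono divide_right_mono) auto
      also have "\<dots> = (1/2)^j * (1 / D\<^sup>2)"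
      proof -
        have "1 + \<bar>M\<bar> \<noteq> 0" by linarith
        thus ?thesis unfolding c_def M_def[symmetric] by (simp add: power_divide)
      qed
      finally show "c j * (\<integral>x. (cmod (defect d p v (\<xi> j) (G (\<xi> j) x)))\<^sup>2 \<partial>P) \<le> (1/2)^j * (1 / D\<^sup>2)" .
    qed
    also have "\<dots> \<le> m / D\<^sup>2"
    proof -
      have "(\<Sum>j<N. (1/2::real)^j) \<le> (\<Sum>j. (1/2)^j)" by (intro sum_le_suminf summable_geometric) auto
      hence "(\<Sum>j<N. (1/2::real)^j) \<le> 2" by (simp add: suminf_geometric)
      hence "(\<Sum>j<N. (1/2)^j) * (1 / D\<^sup>2) \<le> 2 * (1 / D\<^sup>2)" by (rule mult_right_mono) auto
      thus ?thesis by (simp add: m_def sum_distrib_right add_divide_distrib sum_divide_distrib)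
    qed
    also have "\<dots> \<le> m / (real N)\<^sup>2" using D N Cnn by (intro divide_left_mono power_mono mult_pos_pos) (auto simp: m_def)
    finally obtain x where x: "T x \<le> m / (real N)\<^sup>2"
      using exists_le_expectation[OF prob_space_axioms iT] by blast
    define W where "W = mf (N * d) (N * d) (Hm x)"
    have W: "W \<in> carrier_mat (N * d) (N * d)" "mat_adjoint W = W" "fm W = Hm x"
      unfolding W_def using mf_adj[OF carH[of x]] adjH[of x] fm_mf[OF carH[of x]] by auto
    have Nd: "1 \<le> N * d" using N d by (simp add: Suc_le_eq)
    have cG: "cauchy_transform (esd W) z = G z x" if "0 < Im z" for z
      unfolding esd_cauchy[OF W(1,2) Nd that] W(3) G_def ..
    have s0: "0 \<le> (\<Sum>j<N. c j * (cmod (defect d p v (\<xi> j) (G (\<xi> j) x)))\<^sup>2)"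
      using c0 by (intro sum_nonneg mult_nonneg_nonneg) (auto intro: less_imp_le)
    have mN: "m / (real N)\<^sup>2 \<le> m"
    proof -
      have "m / (real N)\<^sup>2 \<le> m / 1" using N Cnn by (intro divide_left_mono) (auto simp: m_def)
      thus ?thesis by simp
    qed
    define a where "a = sq x / D - k / D\<^sup>2"
    have "a\<^sup>2 \<le> m" using x s0 mN by (simp add: T_def a_def)
    hence "a \<le> 1 + m" using sum_squares_bound[of a 1] by (smt (verit) one_power2 mult_1_right zero_le_power2)
    moreover have "k / D\<^sup>2 \<le> 2 * C" using card_ratio[folded D_def k_def] .
    ultimately have sD: "sq x / D \<le> 2 * C + 1 + m" by (simp add: a_def)
    note fmom = esd_first_moment[OF W(1,2) Nd carY[of x] W(3)[unfolded Hm_def A_def] _ less_imp_le[OF V(1)]]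
    have vv: "\<bar>v (i mod p)\<bar> \<le> V" for i using vV p by simp
    have "(\<integral>t. \<bar>t\<bar> \<partial>esd W) \<le> V * (norm (Ym x))\<^sup>2 / D" unfolding D_def by (rule fmom(2)) (rule vv)
    also have "\<dots> \<le> V * (sq x / D)" using norm_Ym[of x] V D by (simp add: divide_right_mono mult_left_mono)
    also have "\<dots> \<le> Bm" unfolding Bm_def using sD V by (intro mult_left_mono) auto
    finally have 1: "(\<integral>t. \<bar>t\<bar> \<partial>esd W) \<le> Bm" .
    have 2: "c j * (cmod (defect d p v (\<xi> j) (cauchy_transform (esd W) (\<xi> j))))\<^sup>2 \<le> m / (real N)\<^sup>2" if j: "j < N" for j
    proof -
      have "c j * (cmod (defect d p v (\<xi> j) (G (\<xi> j) x)))\<^sup>2 \<le> (\<Sum>j<N. c j * (cmod (defect d p v (\<xi> j) (G (\<xi> j) x)))\<^sup>2)"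
        by (rule member_le_sum[where f="\<lambda>j. c j * (cmod (defect d p v (\<xi> j) (G (\<xi> j) x)))\<^sup>2"]) (use j less_imp_le[OF c0] in auto)
      also have "\<dots> \<le> T x" by (simp add: T_def)
      finally show ?thesis using x unfolding cG[OF \<xi>(1)] by linarith
    qed
    show ?thesis using esd_real_distribution[of W] fmom(1)[OF vv] 1 2 by blast
  qed
  have "\<forall>n. \<exists>\<nu>. real_distribution \<nu> \<and> integrable \<nu> (\<lambda>t. \<bar>t\<bar>) \<and> (\<integral>t. \<bar>t\<bar> \<partial>\<nu>) \<le> Bm \<and>
     (\<forall>j<Suc n. c j * (cmod (defect d p v (\<xi> j) (cauchy_transform \<nu> (\<xi> j))))\<^sup>2 \<le> m / (real (Suc n))\<^sup>2)"
    by (intro allI step) simp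
  then obtain \<nu> where \<nu>: "\<And>n. real_distribution (\<nu> n)" "\<And>n. integrable (\<nu> n) (\<lambda>t. \<bar>t\<bar>)" "\<And>n. (\<integral>t. \<bar>t\<bar> \<partial>\<nu> n) \<le> Bm"
     "\<And>n j. j < Suc n \<Longrightarrow> c j * (cmod (defect d p v (\<xi> j) (cauchy_transform (\<nu> n) (\<xi> j))))\<^sup>2 \<le> m / (real (Suc n))\<^sup>2"
    by (subst (asm) choice_iff) blast
  have "tight \<nu>" by (rule tight_of_first_moment[OF \<nu>(1-3)])
  then obtain r \<mu> where r: "strict_mono (r :: nat \<Rightarrow> nat)" and \<mu>: "real_distribution \<mu>" and wc: "weak_conv_m (\<nu> \<circ> id \<circ> r) \<mu>"
    using tight_imp_convergent_subsubsequence[of \<nu> id] strict_mono_id by blast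
  have wc': "weak_conv_m (\<lambda>n. \<nu> (r n)) \<mu>" using wc by (simp add: o_def)
  interpret \<mu>: real_distribution \<mu> by fact
  have zero: "defect d p v (\<xi> j) (cauchy_transform \<mu> (\<xi> j)) = 0" for j
  proof -
    let ?g = "cauchy_transform \<mu> (\<xi> j)"
    have lim: "(\<lambda>n. cauchy_transform (\<nu> (r n)) (\<xi> j)) \<longlonglongrightarrow> ?g"
      by (rule cauchy_transform_weak_limit[OF \<nu>(1) \<mu> wc' \<xi>(1)])
    have "isCont (Rcal d p v) ?g"
      by (rule DERIV_isCont[OF Rcal_has_field_derivative[OF one_minus_nz[OF \<mu>.Im_cauchy_neg[OF \<xi>(1)]]]])
    hence "(\<lambda>n. Rcal d p v (cauchy_transform (\<nu> (r n)) (\<xi> j))) \<longlonglongrightarrow> Rcal d p v ?g"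
      using lim by (rule isCont_tendsto_compose)
    hence l1: "(\<lambda>n. defect d p v (\<xi> j) (cauchy_transform (\<nu> (r n)) (\<xi> j))) \<longlonglongrightarrow> defect d p v (\<xi> j) ?g"
      unfolding defect_def by (intro tendsto_intros lim)
    hence l2: "(\<lambda>n. c j * (cmod (defect d p v (\<xi> j) (cauchy_transform (\<nu> (r n)) (\<xi> j))))\<^sup>2) \<longlonglongrightarrow> c j * (cmod (defect d p v (\<xi> j) ?g))\<^sup>2"
      by (intro tendsto_intros)
    have l3: "(\<lambda>n. m / (real (Suc n))\<^sup>2) \<longlonglongrightarrow> 0" by real_asymp
    have l4: "(\<lambda>n. m / (real (Suc (r n)))\<^sup>2) \<longlonglongrightarrow> 0" using LIMSEQ_subseq_LIMSEQ[OF l3 r] by (simp add: o_def)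
    have "c j * (cmod (defect d p v (\<xi> j) ?g))\<^sup>2 \<le> 0"
    proof (rule LIMSEQ_le[OF l2 l4], intro exI[of _ j] allI impI)
      fix n assume "j \<le> n"
      also have "n \<le> r n" by (rule seq_suble[OF r])
      finally show "c j * (cmod (defect d p v (\<xi> j) (cauchy_transform (\<nu> (r n)) (\<xi> j))))\<^sup>2 \<le> m / (real (Suc (r n)))\<^sup>2"
        by (intro \<nu>(4)) simp
    qed
    hence "(cmod (defect d p v (\<xi> j) ?g))\<^sup>2 \<le> 0" using c0[of j] by (simp add: mult_le_0_iff)
    thus ?thesis by simp
  qed
  show ?thesis using \<mu> fixpoint_of_sequence[OF \<mu> y zero[unfolded \<xi>_def]] by blast
qed

section \<open>Almost sure convergence for Ginibre matrices\<close>

text \<open>Subtracting the equations gives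
  \<open>(z - R(b)) (b - g) = defect + (R(b) - R(g)) g\<close>. The left factor has modulus at least
  \<open>Im z\<close>, and \<open>8 * C * V^2 \<le> (Im z)^2\<close> makes the last term at most
  \<open>|b - g| Im z / 2\<close>, which is absorbed.\<close>

lemma defect_stability:
  assumes v: "\<And>i. i < p \<Longrightarrow> \<bar>v i\<bar> \<le> V" and V: "0 < V" and C: "real p / real d \<le> C"
    and z: "0 < Im z" "2 * V \<le> Im z" "8 * C * V\<^sup>2 \<le> (Im z)\<^sup>2"
    and b: "Im b < 0" "cmod b \<le> 1 / Im z" and g: "Im g < 0" "Gcal d p z v g = g"
  shows "cmod (b - g) \<le> (2 / Im z) * cmod (defect d p v z b)"
proof -
  have gn: "cmod g \<le> 1 / Im z" using Gcal_norm_le[OF g(1) z(1), of d p v] g(2) by simp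
  have S: "Scal d p v c \<le> 4 * C * V\<^sup>2" if c: "cmod c \<le> 1 / Im z" for c
  proof -
    have "V * cmod c \<le> V * (1 / Im z)" using V c by (intro mult_left_mono) auto
    also have "\<dots> \<le> 1 / 2" using z by (simp add: field_simps)
    finally have "Scal d p v c \<le> real p / real d * (V\<^sup>2 / (1 - 1/2)\<^sup>2)" using v V by (intro Scal_le) auto
    also have "\<dots> \<le> C * (V\<^sup>2 / (1 - 1/2)\<^sup>2)" using C by (intro mult_right_mono) auto
    finally show ?thesis by (simp add: power2_eq_square)
  qed
  have C0: "0 \<le> 4 * C * V\<^sup>2" using order_trans[OF Scal_nonneg S[OF b(2)]] .
  have "(cmod (Kcal d p v b g))\<^sup>2 \<le> (4 * C * V\<^sup>2) * (4 * C * V\<^sup>2)"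
    by (rule order_trans[OF Kcal_le mult_mono[OF S[OF b(2)] S[OF gn] C0 Scal_nonneg]])
  hence K: "cmod (Kcal d p v b g) \<le> 4 * C * V\<^sup>2"
    using C0 by (simp only: power2_eq_square[symmetric] power2_le_iff_abs_le abs_norm_cancel)
  have "(z - Rcal d p v g) * g = 1" using Gcal_nz[OF g(1) z(1), of d p v] g(2) unfolding Gcal_def by (metis right_inverse)
  hence e: "(z - Rcal d p v b) * (b - g) = defect d p v z b + (Rcal d p v b - Rcal d p v g) * g"
    by (simp add: defect_def algebra_simps)
  have Rd: "Rcal d p v b - Rcal d p v g = (b - g) * Kcal d p v b g"
    by (rule Rcal_diff) (use one_minus_nz[OF b(1)] one_minus_nz[OF g(1)] in auto)
  have "Im z \<le> cmod (z - Rcal d p v b)"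
    using Rcal_lower[OF b(1) z(1), of d p v] abs_Im_le_cmod[of "z - Rcal d p v b"] by linarith
  hence "Im z * cmod (b - g) \<le> cmod ((z - Rcal d p v b) * (b - g))" unfolding norm_mult by (rule mult_right_mono) simp
  also have "\<dots> \<le> cmod (defect d p v z b) + cmod (b - g) * cmod (Kcal d p v b g) * cmod g"
    unfolding e Rd using norm_triangle_ineq[of "defect d p v z b" "(b - g) * Kcal d p v b g * g"] by (simp add: norm_mult)
  also have "\<dots> \<le> cmod (defect d p v z b) + cmod (b - g) * (4 * C * V\<^sup>2) * (1 / Im z)"
    using K gn C0 z(1) by (intro add_left_mono mult_mono) auto
  also have "cmod (b - g) * (4 * C * V\<^sup>2) * (1 / Im z) \<le> cmod (b - g) * (Im z / 2)"
  proof -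
    have "(4 * C * V\<^sup>2) * (1 / Im z) \<le> Im z / 2" using z(1,3) by (simp add: divide_le_eq power2_eq_square mult_ac)
    thus ?thesis unfolding mult.assoc by (rule mult_left_mono) simp
  qed
  finally have "(Im z / 2) * cmod (b - g) \<le> cmod (defect d p v z b)" by (simp add: algebra_simps)
  hence "(2 / Im z) * ((Im z / 2) * cmod (b - g)) \<le> (2 / Im z) * cmod (defect d p v z b)" using z(1) by (intro mult_left_mono) auto
  moreover have "(2 / Im z) * ((Im z / 2) * cmod (b - g)) = cmod (b - g)" using z(1) by simp
  ultimately show ?thesis by simp
qed

text \<open>The expectations are summable, so the series of the variables is almost surely finite
  and its terms tend to 0. The joint law of the variables does not enter.\<close>

lemma AE_tendsto_zero_of_quadratic_decay:
  fixes X :: "nat \<Rightarrow> 'a \<Rightarrow> real"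
  assumes X: "\<And>n. integrable M (X n)" "\<And>n x. 0 \<le> X n x" "\<And>n. (\<integral>x. X n x \<partial>M) \<le> K / (real (Suc n))\<^sup>2"
  shows "AE x in M. (\<lambda>n. X n x) \<longlonglongrightarrow> 0"
proof -
  have K0: "0 \<le> K" using order_trans[OF integral_nonneg_AE X(3)[of 0]] X(2) by simp
  have [measurable]: "X n \<in> borel_measurable M" for n using X(1) by auto
  have "(\<integral>\<^sup>+x. (\<Sum>n. ennreal (X n x)) \<partial>M) = (\<Sum>n. \<integral>\<^sup>+x. ennreal (X n x) \<partial>M)"
    by (rule nn_integral_suminf) measurable
  also have "\<dots> \<le> (\<Sum>n. ennreal (K / (real (Suc n))\<^sup>2))"
  proof (rule suminf_le)
    show "(\<integral>\<^sup>+x. ennreal (X n x) \<partial>M) \<le> ennreal (K / (real (Suc n))\<^sup>2)" for n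
      using nn_integral_eq_integral[OF X(1)[of n]] X(2,3) by (simp add: ennreal_leI)
  qed auto
  also have "\<dots> < \<infinity>"
  proof -
    have "summable (\<lambda>n. K * (1 / (real (Suc n))\<^sup>2))"
      by (intro summable_mult) (use inverse_squares_sums in \<open>simp add: sums_iff\<close>)
    hence "summable (\<lambda>n. K / (real (Suc n))\<^sup>2)" by simp
    hence "(\<Sum>n. ennreal (K / (real (Suc n))\<^sup>2)) = ennreal (\<Sum>n. K / (real (Suc n))\<^sup>2)"
      using K0 by (intro suminf_ennreal2) auto
    thus ?thesis by simp
  qed
  finally have "(\<integral>\<^sup>+x. (\<Sum>n. ennreal (X n x)) \<partial>M) \<noteq> \<infinity>" by simp
  hence "AE x in M. (\<Sum>n. ennreal (X n x)) \<noteq> \<infinity>" by (intro nn_integral_PInf_AE) measurable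
  thus ?thesis
  proof eventually_elim
    case (elim x)
    hence "summable (\<lambda>n. X n x)" using X(2) by (intro summable_suminf_not_top) auto
    thus ?case by (rule summable_LIMSEQ_zero)
  qed
qed

text \<open>The interface between the Gaussian calculus and the almost sure statements; it no longer
  mentions the field or the basis. \<open>S\<close> stands for the normalized squared norm of the
  Gaussian matrix and \<open>a\<close> for its mean.\<close>

definition matrix_estimates :: "'a measure \<Rightarrow> nat \<Rightarrow> nat \<Rightarrow> (nat \<Rightarrow> real) \<Rightarrow> real \<Rightarrow> real \<Rightarrow> ('a \<Rightarrow> complex mat) \<Rightarrow> bool" where
  "matrix_estimates Pr p d v V C W \<longleftrightarrow>
    (\<forall>z. 0 < Im z \<and> 2 * V \<le> Im z \<longrightarrow> integrable Pr (\<lambda>\<omega>. (cmod (defect d p v z (cauchy_transform (esd (W \<omega>)) z)))\<^sup>2) \<and>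
       (\<integral>\<omega>. (cmod (defect d p v z (cauchy_transform (esd (W \<omega>)) z)))\<^sup>2 \<partial>Pr) \<le> mconst z V C / (real d)\<^sup>2) \<and>
    (\<exists>S a. a \<le> 2 * C \<and> (\<forall>\<omega>\<in>space Pr. integrable (esd (W \<omega>)) (\<lambda>t. \<bar>t\<bar>) \<and> (\<integral>t. \<bar>t\<bar> \<partial>esd (W \<omega>)) \<le> V * S \<omega>) \<and>
       integrable Pr (\<lambda>\<omega>. (S \<omega> - a)\<^sup>2) \<and> (\<integral>\<omega>. (S \<omega> - a)\<^sup>2 \<partial>Pr) \<le> 4 * C / (real d)\<^sup>2)"

lemma matrix_estimatesD:
  assumes "matrix_estimates Pr p d v V C W"
  shows "0 < Im z \<Longrightarrow> 2 * V \<le> Im z \<Longrightarrow> integrable Pr (\<lambda>\<omega>. (cmod (defect d p v z (cauchy_transform (esd (W \<omega>)) z)))\<^sup>2)"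
    and "0 < Im z \<Longrightarrow> 2 * V \<le> Im z \<Longrightarrow> (\<integral>\<omega>. (cmod (defect d p v z (cauchy_transform (esd (W \<omega>)) z)))\<^sup>2 \<partial>Pr) \<le> mconst z V C / (real d)\<^sup>2"
    and "\<exists>S a. a \<le> 2 * C \<and> (\<forall>\<omega>\<in>space Pr. integrable (esd (W \<omega>)) (\<lambda>t. \<bar>t\<bar>) \<and> (\<integral>t. \<bar>t\<bar> \<partial>esd (W \<omega>)) \<le> V * S \<omega>) \<and>
       integrable Pr (\<lambda>\<omega>. (S \<omega> - a)\<^sup>2) \<and> (\<integral>\<omega>. (S \<omega> - a)\<^sup>2 \<partial>Pr) \<le> 4 * C / (real d)\<^sup>2"
  using assms unfolding matrix_estimates_def by auto

lemma W_CW_properties: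
  assumes Z: "Z \<in> carrier_mat p d" and A: "A \<in> carrier_mat p p" "mat_adjoint A = A"
  shows "W_CW Z A \<in> carrier_mat d d" "mat_adjoint (W_CW Z A) = W_CW Z A" "fm (W_CW Z A) = adj (fm Z) * fm A * fm Z"
proof -
  have Za: "mat_adjoint Z \<in> carrier_mat d p" using Z by (rule mat_adjoint_carrier)
  show W: "W_CW Z A \<in> carrier_mat d d" unfolding W_CW_def using Z Za A by (intro mult_carrier_mat)
  show f: "fm (W_CW Z A) = adj (fm Z) * fm A * fm Z"
    unfolding W_CW_def fm_mult[OF mult_carrier_mat[OF Za A(1)] Z] fm_mult[OF Za A(1)] fm_adjoint[OF Z] ..
  have "fm (mat_adjoint (W_CW Z A)) = fm (W_CW Z A)"
    unfolding fm_adjoint[OF W] f using fm_adjoint[OF A(1)] A(2) by (simp add: adj_mult mult.assoc)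
  hence "mf d d (fm (mat_adjoint (W_CW Z A))) = mf d d (fm (W_CW Z A))" by simp
  thus "mat_adjoint (W_CW Z A) = W_CW Z A" by (simp add: mf_fm[OF W] mf_fm[OF mat_adjoint_carrier[OF W]])
qed

text \<open>By independence the coordinates have the product law \<open>gm.P\<close>, so
  expectations transfer. With the rotated basis the Gaussian matrix is
  \<open>adj U * fm (Z \<omega>)\<close>, and sandwiching the diagonal of eigenvalues by it gives
  back \<open>W_CW (Z \<omega>) A\<close> itself, not just a matrix with the same law.\<close>

lemma matrix_estimates_gaussian:
  fixes I :: "'i :: countable set" and f :: "'i \<Rightarrow> 'a \<Rightarrow> real"
  assumes Pr: "prob_space Pr" and indep: "prob_space.indep_vars Pr (\<lambda>_. borel) f I"
    and dist: "\<And>\<alpha>. \<alpha> \<in> I \<Longrightarrow> distributed Pr lborel (f \<alpha>) (\<lambda>x. ennreal (normal_density 0 (1 / sqrt (real d)) x))"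
    and E: "gbasis p d I E" and I: "finite I" "I \<noteq> {}" "card I \<le> 2 * p * d" and d: "1 \<le> d"
    and V: "0 < V" "\<And>i. i < p \<Longrightarrow> \<bar>v i\<bar> \<le> V" and C: "real p \<le> C * real d"
    and A: "A \<in> carrier_mat p p" "mat_adjoint A = A"
    and U: "car p p U" "adj U * U = Idn p" "U * adj U = Idn p" "fm A = U * dg p (\<lambda>i. complex_of_real (v i)) * adj U"
    and Z: "\<And>\<omega>. \<omega> \<in> space Pr \<Longrightarrow> Z \<omega> \<in> carrier_mat p d" "\<And>\<omega>. \<omega> \<in> space Pr \<Longrightarrow> fm (Z \<omega>) = (\<Sum>\<alpha>\<in>I. f \<alpha> \<omega> *\<^sub>R E \<alpha>)"
  shows "matrix_estimates Pr p d v V C (\<lambda>\<omega>. W_CW (Z \<omega>) A)"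
proof -
  interpret Pr: prob_space Pr by fact
  interpret gm: gaussian_matrix I d p "\<lambda>\<alpha>. adj U * E \<alpha>" v V C
    by (rule gaussian_matrix_of_gbasis[OF gbasis_rotate[OF E U(1-3)]]) (use I d V C in auto)
  define X where "X \<omega> = (\<lambda>\<alpha>\<in>I. f \<alpha> \<omega>)" for \<omega>
  have fm': "f \<alpha> \<in> borel_measurable Pr" if "\<alpha> \<in> I" for \<alpha> using dist[OF that] by (simp add: distributed_def)
  have X: "X \<in> measurable Pr (Pi\<^sub>M I (\<lambda>_. borel))" unfolding X_def using fm' by (intro measurable_restrict) auto
  have dX: "distr Pr (Pi\<^sub>M I (\<lambda>_. borel)) X = gm.P"
  proof -
    have "distr Pr (Pi\<^sub>M I (\<lambda>_. borel)) X = Pi\<^sub>M I (\<lambda>i. distr Pr borel (f i))"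
      unfolding X_def using Pr.indep_vars_iff_distr_eq_PiM'[where M'="\<lambda>_. borel" and X=f, OF I(2)] fm' indep by simp
    also have "\<dots> = Pi\<^sub>M I (\<lambda>_. gauss (1 / sqrt (real d)))"
    proof (rule PiM_cong[OF refl])
      fix i assume "i \<in> I"
      have "distr Pr borel (f i) = distr Pr lborel (f i)" by (rule distr_cong) auto
      also have "\<dots> = gauss (1 / sqrt (real d))" using dist[OF \<open>i \<in> I\<close>] by (simp add: distributed_def gauss_def)
      finally show "distr Pr borel (f i) = gauss (1 / sqrt (real d))" .
    qed
    finally show ?thesis by (simp add: gm.P_def)
  qed
  have transfer: "integrable Pr (\<lambda>\<omega>. h (X \<omega>))" "(\<integral>\<omega>. h (X \<omega>) \<partial>Pr) = (\<integral>x. h x \<partial>gm.P)" if h: "integrable gm.P h" for h :: "_ \<Rightarrow> real"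
  proof -
    have hm: "h \<in> borel_measurable (Pi\<^sub>M I (\<lambda>_. borel))" using borel_measurable_integrable[OF h] measurable_cong_sets[OF gm.sets_P refl] by blast
    show "integrable Pr (\<lambda>\<omega>. h (X \<omega>))" using h unfolding dX[symmetric] by (subst (asm) integrable_distr_eq[OF X hm])
    show "(\<integral>\<omega>. h (X \<omega>) \<partial>Pr) = (\<integral>x. h x \<partial>gm.P)" unfolding dX[symmetric] by (rule integral_distr[OF X hm, symmetric])
  qed
  have Y: "gm.Ym (X \<omega>) = adj U * fm (Z \<omega>)" if "\<omega> \<in> space Pr" for \<omega>
    unfolding gm.Ym_def Z(2)[OF that] sum_distrib_left by (intro sum.cong) (auto simp: X_def)
  have W: "W_CW (Z \<omega>) A \<in> carrier_mat d d" "mat_adjoint (W_CW (Z \<omega>) A) = W_CW (Z \<omega>) A" "fm (W_CW (Z \<omega>) A) = gm.Hm (X \<omega>)" if "\<omega> \<in> space Pr" for \<omega>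
  proof -
    note w = W_CW_properties[OF Z(1)[OF that] A]
    show "W_CW (Z \<omega>) A \<in> carrier_mat d d" "mat_adjoint (W_CW (Z \<omega>) A) = W_CW (Z \<omega>) A" by (rule w)+
    show "fm (W_CW (Z \<omega>) A) = gm.Hm (X \<omega>)"
      unfolding w(3) U(4) gm.Hm_def gm.A_def Y[OF that] by (simp add: adj_mult mult.assoc)
  qed
  have G: "cauchy_transform (esd (W_CW (Z \<omega>) A)) z = gm.G z (X \<omega>)" if "\<omega> \<in> space Pr" "0 < Im z" for \<omega> z
    unfolding esd_cauchy[OF W(1,2)[OF that(1)] d that(2)] W(3)[OF that(1)] gm.G_def ..
  show ?thesis unfolding matrix_estimates_def
  proof (intro conjI allI impI)
    fix z assume z: "0 < Im z \<and> 2 * V \<le> Im z"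
    note dm = gm.defect_moment[OF conjunct1[OF z] conjunct2[OF z]]
    have c: "(cmod (defect d p v z (cauchy_transform (esd (W_CW (Z \<omega>) A)) z)))\<^sup>2 = (cmod (defect d p v z (gm.G z (X \<omega>))))\<^sup>2" if "\<omega> \<in> space Pr" for \<omega>
      using G[OF that, of z] z by simp
    show "integrable Pr (\<lambda>\<omega>. (cmod (defect d p v z (cauchy_transform (esd (W_CW (Z \<omega>) A)) z)))\<^sup>2)"
      using transfer(1)[OF dm(1)] by (subst Bochner_Integration.integrable_cong[OF refl c])
    show "(\<integral>\<omega>. (cmod (defect d p v z (cauchy_transform (esd (W_CW (Z \<omega>) A)) z)))\<^sup>2 \<partial>Pr) \<le> mconst z V C / (real d)\<^sup>2"
      using dm(2) by (subst Bochner_Integration.integral_cong[OF refl c]) (simp_all add: transfer(2)[OF dm(1)])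
  next
    note sc = gm.sq_concentration
    show "\<exists>S a. a \<le> 2 * C \<and> (\<forall>\<omega>\<in>space Pr. integrable (esd (W_CW (Z \<omega>) A)) (\<lambda>t. \<bar>t\<bar>) \<and> (\<integral>t. \<bar>t\<bar> \<partial>esd (W_CW (Z \<omega>) A)) \<le> V * S \<omega>) \<and>
       integrable Pr (\<lambda>\<omega>. (S \<omega> - a)\<^sup>2) \<and> (\<integral>\<omega>. (S \<omega> - a)\<^sup>2 \<partial>Pr) \<le> 4 * C / (real d)\<^sup>2"
    proof (intro exI conjI ballI)
      show "real (card I) / (real d)\<^sup>2 \<le> 2 * C" by (rule gm.card_ratio)
      show "integrable Pr (\<lambda>\<omega>. (gm.sq (X \<omega>) / real d - real (card I) / (real d)\<^sup>2)\<^sup>2)" by (rule transfer(1)[OF sc(1)])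
      show "(\<integral>\<omega>. (gm.sq (X \<omega>) / real d - real (card I) / (real d)\<^sup>2)\<^sup>2 \<partial>Pr) \<le> 4 * C / (real d)\<^sup>2"
        unfolding transfer(2)[OF sc(1)] by (rule sc(2))
      fix \<omega> assume w: "\<omega> \<in> space Pr"
      note fmom = esd_first_moment[OF W(1,2)[OF w] d gm.carY[of "X \<omega>"] W(3)[OF w, unfolded gm.Hm_def gm.A_def] V(2) less_imp_le[OF V(1)]]
      show "integrable (esd (W_CW (Z \<omega>) A)) (\<lambda>t. \<bar>t\<bar>)" by (rule fmom(1))
      have "V * (norm (gm.Ym (X \<omega>)))\<^sup>2 / real d \<le> V * (gm.sq (X \<omega>) / real d)"
        using gm.norm_Ym[of "X \<omega>"] V(1) by (simp add: divide_right_mono mult_left_mono)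
      thus "(\<integral>t. \<bar>t\<bar> \<partial>esd (W_CW (Z \<omega>) A)) \<le> V * (gm.sq (X \<omega>) / real d)" using fmom(2) by (rule order_trans[rotated])
    qed
  qed
qed

lemma matrix_estimates_ginibre:
  assumes Pr: "prob_space Pr" and G: "ginibre Pr K p d Z" and p: "1 \<le> p" and d: "1 \<le> d"
    and V: "0 < V" "\<And>i. i < p \<Longrightarrow> \<bar>v i\<bar> \<le> V" and C: "real p \<le> C * real d"
    and A: "A \<in> carrier_mat p p" "mat_adjoint A = A"
    and U: "car p p U" "adj U * U = Idn p" "U * adj U = Idn p" "fm A = U * dg p (\<lambda>i. complex_of_real (v i)) * adj U"
  shows "matrix_estimates Pr p d v V C (\<lambda>\<omega>. W_CW (Z \<omega>) A)"
proof -
  have Zc: "Z \<omega> \<in> carrier_mat p d" if "\<omega> \<in> space Pr" for \<omega> using G that by (simp add: ginibre_def)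
  show ?thesis
  proof (cases K)
    case Reals
    then obtain f :: "nat \<times> nat \<Rightarrow> 'a \<Rightarrow> real" where f: "prob_space.indep_vars Pr (\<lambda>_. borel) f ({..<p} \<times> {..<d})"
      "\<forall>kl \<in> {..<p} \<times> {..<d}. distributed Pr lborel (f kl) (\<lambda>x. ennreal (normal_density 0 (1 / sqrt (real d)) x))"
      "\<forall>\<omega>\<in>space Pr. \<forall>k<p. \<forall>l<d. Z \<omega> $$ (k, l) = complex_of_real (f (k, l) \<omega>)"
      using G by (auto simp: ginibre_def)
    show ?thesis
    proof (rule matrix_estimates_gaussian[OF Pr f(1) _ gbasis_real _ _ _ d V C A U Zc])
      show "{..<p} \<times> {..<d} \<noteq> {}" using p d by (auto simp: lessThan_empty_iff)
      show "card ({..<p} \<times> {..<d}) \<le> 2 * p * d" by simp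
      fix \<omega> assume w: "\<omega> \<in> space Pr"
      show "fm (Z \<omega>) = (\<Sum>\<alpha>\<in>{..<p} \<times> {..<d}. f \<alpha> \<omega> *\<^sub>R realE \<alpha>)"
      proof (rule fmat_eqI)
        fix i j
        have "ent (\<Sum>\<alpha>\<in>{..<p} \<times> {..<d}. f \<alpha> \<omega> *\<^sub>R realE \<alpha>) i j = (\<Sum>\<alpha>\<in>{..<p} \<times> {..<d}. if \<alpha> = (i, j) then complex_of_real (f (i, j) \<omega>) else 0)"
          unfolding ent_sum by (intro sum.cong) (auto simp: realE_def scaleR_fmat_def split: if_splits)
        thus "ent (fm (Z \<omega>)) i j = ent (\<Sum>\<alpha>\<in>{..<p} \<times> {..<d}. f \<alpha> \<omega> *\<^sub>R realE \<alpha>) i j"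
          using f(3) w Zc[OF w] by auto
      qed
    qed (use f(2) in auto)
  next
    case Complexes
    then obtain f :: "nat \<times> nat \<times> bool \<Rightarrow> 'a \<Rightarrow> real" where f: "prob_space.indep_vars Pr (\<lambda>_. borel) f ({..<p} \<times> {..<d} \<times> UNIV)"
      "\<forall>klb \<in> {..<p} \<times> {..<d} \<times> UNIV. distributed Pr lborel (f klb) (\<lambda>x. ennreal (normal_density 0 (1 / sqrt (real d)) x))"
      "\<forall>\<omega>\<in>space Pr. \<forall>k<p. \<forall>l<d. Z \<omega> $$ (k, l) = Complex (f (k, l, True) \<omega>) (f (k, l, False) \<omega>) / complex_of_real (sqrt 2)"
      using G by (auto simp: ginibre_def)
    show ?thesis
    proof (rule matrix_estimates_gaussian[OF Pr f(1) _ gbasis_complex _ _ _ d V C A U Zc])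
      show "{..<p} \<times> {..<d} \<times> (UNIV :: bool set) \<noteq> {}" using p d by (auto simp: lessThan_empty_iff)
      show "card ({..<p} \<times> {..<d} \<times> (UNIV :: bool set)) \<le> 2 * p * d" by (simp add: card_UNIV_bool)
      fix \<omega> assume w: "\<omega> \<in> space Pr"
      show "fm (Z \<omega>) = (\<Sum>\<alpha>\<in>{..<p} \<times> {..<d} \<times> UNIV. f \<alpha> \<omega> *\<^sub>R complexE \<alpha>)"
      proof (rule fmat_eqI)
        fix i j
        define c where "c k l = Complex (f (k, l, True) \<omega>) (f (k, l, False) \<omega>) / complex_of_real (sqrt 2)" for k l
        have "ent (\<Sum>\<alpha>\<in>{..<p} \<times> {..<d} \<times> UNIV. f \<alpha> \<omega> *\<^sub>R complexE \<alpha>) i j = (\<Sum>k<p. \<Sum>l<d. if l = j then (if k = i then c i j else 0) else 0)"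
          unfolding sum_bool_prod ent_sum
          by (intro sum.cong) (auto simp: complexE_def scaleR_fmat_def c_def Complex_eq add_divide_distrib mult.commute)
        also have "\<dots> = (if i < p \<and> j < d then c i j else 0)" by (cases "j < d"; cases "i < p") auto
        finally show "ent (fm (Z \<omega>)) i j = ent (\<Sum>\<alpha>\<in>{..<p} \<times> {..<d} \<times> UNIV. f \<alpha> \<omega> *\<^sub>R complexE \<alpha>) i j"
          using f(3) w Zc[OF w] by (auto simp: c_def)
      qed
    qed (use f(2) in auto)
  qed
qed

lemma Bseq_of_tendsto_offset:
  fixes S :: "nat \<Rightarrow> real"
  assumes "(\<lambda>n. (S n - a n)\<^sup>2) \<longlonglongrightarrow> 0" "\<And>n. a n \<le> c"
  shows "\<exists>m. \<forall>n. S n \<le> m"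
proof -
  have "Bseq (\<lambda>n. (S n - a n)\<^sup>2)" by (rule convergent_imp_Bseq[OF convergentI[OF assms(1)]])
  then obtain K where K: "\<And>n. norm ((S n - a n)\<^sup>2) \<le> K" unfolding Bseq_def by blast
  have "S n \<le> c + (1 + K)" for n
  proof -
    define q where "q = (S n - a n)\<^sup>2"
    have "2 * (S n - a n) \<le> 1 + q" using sum_squares_bound[of 1 "S n - a n"] by (simp add: q_def)
    moreover have "q \<le> K" "0 \<le> q" using K[of n] by (auto simp: q_def)
    ultimately show ?thesis using assms(2)[of n] by argo
  qed
  thus ?thesis by blast
qed

text \<open>Small defects give small differences of Cauchy transforms only high above the real axis,
  where \<open>defect_stability\<close> applies; all other points are reached by
  \<open>vitali_zero\<close>. As only the countable sequence \<open>yseq\<close> is sampled, one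
  null set serves all \<open>z\<close>. The matrix with index \<open>n\<close> has size
  \<open>Suc n\<close>, so size 0 does not occur.\<close>

theorem matrix_estimates_AE:
  fixes p :: "nat \<Rightarrow> nat" and v :: "nat \<Rightarrow> nat \<Rightarrow> real"
  assumes Pr: "prob_space Pr" and est: "\<And>n. matrix_estimates Pr (p n) (Suc n) (v n) V C (W n)"
    and V: "0 < V" "\<And>n i. i < p n \<Longrightarrow> \<bar>v n i\<bar> \<le> V" and C: "\<And>n. real (p n) / real (Suc n) \<le> C"
    and \<mu>: "\<And>n. real_distribution (\<mu> n)" "\<And>n z. 0 < Im z \<Longrightarrow> Gcal (Suc n) (p n) z (v n) (cauchy_transform (\<mu> n) z) = cauchy_transform (\<mu> n) z"
  shows "AE \<omega> in Pr. (\<forall>z. 0 < Im z \<longrightarrow> (\<lambda>n. cauchy_transform (esd (W n \<omega>)) z - cauchy_transform (\<mu> n) z) \<longlonglongrightarrow> 0) \<and>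
     (\<exists>m. \<forall>n. integrable (esd (W n \<omega>)) (\<lambda>t. \<bar>t\<bar>) \<and> (\<integral>t. \<bar>t\<bar> \<partial>esd (W n \<omega>)) \<le> m)"
proof -
  have C0: "0 \<le> C" using order_trans[OF _ C[of 0], of 0] by simp
  \<comment> \<open>Large enough for both thresholds: \<open>2 * V \<le> y\<close>, and
    \<open>8 * C * V^2 \<le> y \<le> y^2\<close>, where the summand 1 ensures
    \<open>y \<ge> 1\<close>.\<close>
  define y where "y = 2 * V + 8 * C * V\<^sup>2 + 1"
  have y: "2 * V \<le> y" "8 * C * V\<^sup>2 \<le> y" "1 \<le> y" using V(1) C0 by (auto simp: y_def)
  have \<xi>: "y < Im (yseq y j)" for j by (rule yseq(3))
  have \<xi>': "0 < Im (yseq y j)" "2 * V \<le> Im (yseq y j)" "8 * C * V\<^sup>2 \<le> (Im (yseq y j))\<^sup>2" for j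
  proof -
    show "0 < Im (yseq y j)" "2 * V \<le> Im (yseq y j)" using \<xi>[of j] y by auto
    have "y * 1 \<le> Im (yseq y j) * Im (yseq y j)" using \<xi>[of j] y by (intro mult_mono) auto
    thus "8 * C * V\<^sup>2 \<le> (Im (yseq y j))\<^sup>2" using y by (simp add: power2_eq_square)
  qed
  let ?D = "\<lambda>j n \<omega>. defect (Suc n) (p n) (v n) (yseq y j) (cauchy_transform (esd (W n \<omega>)) (yseq y j))"
  have "AE \<omega> in Pr. (\<lambda>n. (cmod (?D j n \<omega>))\<^sup>2) \<longlonglongrightarrow> 0" for j
  proof (rule AE_tendsto_zero_of_quadratic_decay[where K="mconst (yseq y j) V C"])
    show "integrable Pr (\<lambda>\<omega>. (cmod (?D j n \<omega>))\<^sup>2)" "(\<integral>\<omega>. (cmod (?D j n \<omega>))\<^sup>2 \<partial>Pr) \<le> mconst (yseq y j) V C / (real (Suc n))\<^sup>2" for n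
      by (rule matrix_estimatesD(1,2)[OF est \<xi>'(1,2)])+
  qed auto
  hence ae1: "AE \<omega> in Pr. \<forall>j. (\<lambda>n. (cmod (?D j n \<omega>))\<^sup>2) \<longlonglongrightarrow> 0" by (simp add: AE_all_countable)
  define Q where "Q n Sa \<longleftrightarrow> snd Sa \<le> 2 * C \<and> (\<forall>\<omega>\<in>space Pr. integrable (esd (W n \<omega>)) (\<lambda>t. \<bar>t\<bar>) \<and> (\<integral>t. \<bar>t\<bar> \<partial>esd (W n \<omega>)) \<le> V * fst Sa \<omega>) \<and>
       integrable Pr (\<lambda>\<omega>. (fst Sa \<omega> - snd Sa)\<^sup>2) \<and> (\<integral>\<omega>. (fst Sa \<omega> - snd Sa)\<^sup>2 \<partial>Pr) \<le> 4 * C / (real (Suc n))\<^sup>2" for n and Sa :: "('a \<Rightarrow> real) \<times> real"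
  have "\<exists>Sa. Q n Sa" for n
  proof -
    obtain S a where "Q n (S, a)" unfolding Q_def fst_conv snd_conv using matrix_estimatesD(3)[OF est[of n]] by metis
    thus ?thesis ..
  qed
  then obtain Sa' where Q: "\<And>n. Q n (Sa' n)" by metis
  define S a where "S n = fst (Sa' n)" and "a n = snd (Sa' n)" for n
  have Sa: "a n \<le> 2 * C"
      "\<omega> \<in> space Pr \<Longrightarrow> integrable (esd (W n \<omega>)) (\<lambda>t. \<bar>t\<bar>)" "\<omega> \<in> space Pr \<Longrightarrow> (\<integral>t. \<bar>t\<bar> \<partial>esd (W n \<omega>)) \<le> V * S n \<omega>"
      "integrable Pr (\<lambda>\<omega>. (S n \<omega> - a n)\<^sup>2)" "(\<integral>\<omega>. (S n \<omega> - a n)\<^sup>2 \<partial>Pr) \<le> 4 * C / (real (Suc n))\<^sup>2" for n \<omega>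
    using Q[of n] unfolding Q_def S_def a_def by auto
  have ae2: "AE \<omega> in Pr. (\<lambda>n. (S n \<omega> - a n)\<^sup>2) \<longlonglongrightarrow> 0"
    by (rule AE_tendsto_zero_of_quadratic_decay[OF Sa(4) _ Sa(5)]) auto
  from ae1 ae2 AE_space show ?thesis
  proof eventually_elim
    case (elim \<omega>)
    interpret E: real_distribution "esd (W n \<omega>)" for n by (rule esd_real_distribution)
    interpret M: real_distribution "\<mu> n" for n by (rule \<mu>(1))
    obtain m where m: "\<And>n. S n \<omega> \<le> m" using Bseq_of_tendsto_offset[OF elim(2) Sa(1)] by blast
    have 2: "\<forall>n. integrable (esd (W n \<omega>)) (\<lambda>t. \<bar>t\<bar>) \<and> (\<integral>t. \<bar>t\<bar> \<partial>esd (W n \<omega>)) \<le> V * m"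
    proof (intro allI conjI)
      fix n
      show "integrable (esd (W n \<omega>)) (\<lambda>t. \<bar>t\<bar>)" by (rule Sa(2)[OF elim(3)])
      have "(\<integral>t. \<bar>t\<bar> \<partial>esd (W n \<omega>)) \<le> V * S n \<omega>" by (rule Sa(3)[OF elim(3)])
      also have "\<dots> \<le> V * m" using m V(1) by (intro mult_left_mono) auto
      finally show "(\<integral>t. \<bar>t\<bar> \<partial>esd (W n \<omega>)) \<le> V * m" .
    qed
    define f where "f n z = cauchy_transform (esd (W n \<omega>)) z - cauchy_transform (\<mu> n) z" for n z
    have fj: "(\<lambda>n. f n (yseq y j)) \<longlonglongrightarrow> 0" for j
    proof -
      have "(\<lambda>n. sqrt ((cmod (?D j n \<omega>))\<^sup>2)) \<longlonglongrightarrow> sqrt 0" by (intro tendsto_real_sqrt) (use elim(1) in blast)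
      hence "(\<lambda>n. (2 / Im (yseq y j)) * cmod (?D j n \<omega>)) \<longlonglongrightarrow> (2 / Im (yseq y j)) * 0" by (intro tendsto_intros) simp
      hence l: "(\<lambda>n. (2 / Im (yseq y j)) * cmod (?D j n \<omega>)) \<longlonglongrightarrow> 0" by simp
      show ?thesis
      proof (rule Lim_null_comparison[OF always_eventually l], rule allI)
        fix n
        show "norm (f n (yseq y j)) \<le> (2 / Im (yseq y j)) * cmod (?D j n \<omega>)"
          unfolding f_def
          by (rule defect_stability[OF V(2) V(1) C \<xi>' E.Im_cauchy_neg[OF \<xi>'(1)] E.cauchy_norm_le[OF \<xi>'(1)] M.Im_cauchy_neg[OF \<xi>'(1)] \<mu>(2)[OF \<xi>'(1)]])
      qed
    qed
    have "(\<lambda>n. f n z) \<longlonglongrightarrow> 0" if z: "0 < Im z" for z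
    proof (rule vitali_zero[where B=2 and f=f and \<xi>="yseq y" and \<zeta>="Complex 0 y", OF _ _ _ fj \<xi>'(1) yseq(1,2) _ z])
      show "f n holomorphic_on {z. 0 < Im z}" for n
        unfolding f_def[abs_def] by (intro holomorphic_intros E.cauchy_holomorphic M.cauchy_holomorphic)
      show "cmod (f n z) \<le> 2 / Im z" if "0 < Im z" for n z
        using norm_triangle_ineq4[of "cauchy_transform (esd (W n \<omega>)) z" "cauchy_transform (\<mu> n) z"]
          E.cauchy_norm_le[OF that, of n] M.cauchy_norm_le[OF that, of n] by (simp add: f_def)
      show "0 < Im (Complex 0 y)" using y by simp
    qed simp
    thus ?case using 2 unfolding f_def by blast
  qed
qed

section \<open>Smooth dependence on the parameter\<close>

text \<open>Polynomials in the coordinates and in the unknown \<open>b\<close>. The class is closed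
  under partial derivatives, and it contains the fixed point equation after the denominators have
  been cleared.\<close>

inductive polyfun :: "((nat \<Rightarrow> real) \<Rightarrow> complex \<Rightarrow> complex) \<Rightarrow> bool" where
  pf_const: "polyfun (\<lambda>x b. c)"
| pf_coord: "polyfun (\<lambda>x b. complex_of_real (x k))"
| pf_var: "polyfun (\<lambda>x b. b)"
| pf_add: "polyfun F \<Longrightarrow> polyfun H \<Longrightarrow> polyfun (\<lambda>x b. F x b + H x b)"
| pf_mult: "polyfun F \<Longrightarrow> polyfun H \<Longrightarrow> polyfun (\<lambda>x b. F x b * H x b)"

lemma pf_sum: "(\<And>i. i \<in> S \<Longrightarrow> polyfun (F i)) \<Longrightarrow> polyfun (\<lambda>x b. \<Sum>i\<in>S. F i x b)"
  by (induction S rule: infinite_finite_induct) (auto intro: polyfun.intros)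

lemma pf_prod: "(\<And>i. i \<in> S \<Longrightarrow> polyfun (F i)) \<Longrightarrow> polyfun (\<lambda>x b. \<Prod>i\<in>S. F i x b)"
  by (induction S rule: infinite_finite_induct) (auto intro: polyfun.intros)

lemma pf_diff: assumes "polyfun F" "polyfun H" shows "polyfun (\<lambda>x b. F x b - H x b)"
proof -
  have "polyfun (\<lambda>x b. F x b + (- 1) * H x b)" by (intro polyfun.intros assms)
  thus ?thesis by simp
qed

text \<open>The derivative is taken jointly in \<open>x k\<close> and \<open>b\<close>, as the
  implicit function argument requires, and both partial derivatives are polynomials again.\<close>

lemma polyfun_derivative:
  "polyfun F \<Longrightarrow> \<exists>Fk Fb. polyfun Fk \<and> polyfun Fb \<and>
     (\<forall>x b. ((\<lambda>p. F (x(k := fst p)) (snd p)) has_derivative (\<lambda>q. complex_of_real (fst q) * Fk x b + snd q * Fb x b)) (at (x k, b)))"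
proof (induction F rule: polyfun.induct)
  case (pf_const c)
  show ?case by (intro exI[of _ "\<lambda>x b. 0"] conjI polyfun.intros allI) auto
next
  case (pf_coord j)
  show ?case
  proof (cases "j = k")
    case True
    show ?thesis unfolding True
      by (intro exI[of _ "\<lambda>x b. 1"] exI[of _ "\<lambda>x b. 0"] conjI polyfun.intros allI) (auto intro!: derivative_eq_intros)
  next
    case False
    thus ?thesis by (intro exI[of _ "\<lambda>x b. 0"] conjI polyfun.intros allI) auto
  qed
next
  case pf_var
  show ?case by (intro exI[of _ "\<lambda>x b. 0"] exI[of _ "\<lambda>x b. 1"] conjI polyfun.intros allI) (auto intro!: derivative_eq_intros)
next
  case (pf_add F H)
  then obtain Fk Fb Hk Hb where *: "polyfun Fk" "polyfun Fb" "polyfun Hk" "polyfun Hb"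
    "\<And>x b. ((\<lambda>p. F (x(k := fst p)) (snd p)) has_derivative (\<lambda>q. complex_of_real (fst q) * Fk x b + snd q * Fb x b)) (at (x k, b))"
    "\<And>x b. ((\<lambda>p. H (x(k := fst p)) (snd p)) has_derivative (\<lambda>q. complex_of_real (fst q) * Hk x b + snd q * Hb x b)) (at (x k, b))" by blast
  show ?case
    by (intro exI[of _ "\<lambda>x b. Fk x b + Hk x b"] exI[of _ "\<lambda>x b. Fb x b + Hb x b"] conjI polyfun.intros * allI)
       (rule has_derivative_eq_rhs[OF has_derivative_add[OF *(5,6)]], simp add: algebra_simps)
next
  case (pf_mult F H)
  then obtain Fk Fb Hk Hb where *: "polyfun Fk" "polyfun Fb" "polyfun Hk" "polyfun Hb"
    "\<And>x b. ((\<lambda>p. F (x(k := fst p)) (snd p)) has_derivative (\<lambda>q. complex_of_real (fst q) * Fk x b + snd q * Fb x b)) (at (x k, b))"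
    "\<And>x b. ((\<lambda>p. H (x(k := fst p)) (snd p)) has_derivative (\<lambda>q. complex_of_real (fst q) * Hk x b + snd q * Hb x b)) (at (x k, b))" by blast
  show ?case
    by (intro exI[of _ "\<lambda>x b. F x b * Hk x b + Fk x b * H x b"] exI[of _ "\<lambda>x b. F x b * Hb x b + Fb x b * H x b"] conjI polyfun.intros * pf_mult.hyps allI)
       (rule has_derivative_eq_rhs[OF has_derivative_mult[OF *(5,6)]], simp add: algebra_simps)
qed

lemma polyfun_continuous: "polyfun F \<Longrightarrow> continuous_on UNIV g \<Longrightarrow> continuous_on UNIV (\<lambda>x. F x (g x))"
  by (induction F rule: polyfun.induct) (auto intro!: continuous_intros continuous_on_product_coordinates)

text \<open>Rational expressions in the coordinates and in \<open>G\<close> itself. If the first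
  partial derivatives of \<open>G\<close> belong to this class, then the class is closed under
  partial derivatives, so all iterated ones exist and are continuous. This replaces an induction
  over orders of differentiability.\<close>

inductive smf :: "((nat \<Rightarrow> real) \<Rightarrow> complex) \<Rightarrow> ((nat \<Rightarrow> real) \<Rightarrow> complex) \<Rightarrow> bool" for G where
  smf_const: "smf G (\<lambda>x. c)"
| smf_coord: "smf G (\<lambda>x. complex_of_real (x k))"
| smf_base: "smf G G"
| smf_add: "smf G f \<Longrightarrow> smf G h \<Longrightarrow> smf G (\<lambda>x. f x + h x)"
| smf_mult: "smf G f \<Longrightarrow> smf G h \<Longrightarrow> smf G (\<lambda>x. f x * h x)"
| smf_inverse: "smf G f \<Longrightarrow> (\<And>x. f x \<noteq> 0) \<Longrightarrow> smf G (\<lambda>x. inverse (f x))"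

lemma polyfun_smf: "polyfun F \<Longrightarrow> smf G (\<lambda>x. F x (G x))"
  by (induction F rule: polyfun.induct) (auto intro: smf.intros)

lemma smf_derivative:
  assumes G: "continuous_on UNIV G"
    and G': "\<And>k. \<exists>G'. smf G G' \<and> (\<forall>x. ((\<lambda>t. G (x(k := t))) has_vector_derivative G' x) (at (x k)))"
    and f: "smf G f"
  shows "continuous_on UNIV f \<and> (\<exists>f'. smf G f' \<and> (\<forall>x. ((\<lambda>t. f (x(k := t))) has_vector_derivative f' x) (at (x k))))"
  using f
proof (induction f rule: smf.induct)
  case (smf_const c)
  show ?case by (intro conjI exI[of _ "\<lambda>x. 0"] smf.intros allI) auto
next
  case (smf_coord j)
  have "\<exists>f'. smf G f' \<and> (\<forall>x. ((\<lambda>t. complex_of_real ((x(k := t)) j)) has_vector_derivative f' x) (at (x k)))"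
  proof (cases "j = k")
    case True
    show ?thesis unfolding True
      by (intro exI[of _ "\<lambda>x. 1"] conjI smf.intros allI) (auto intro!: has_vector_derivative_of_real[where D=1, simplified] derivative_eq_intros)
  next
    case False
    thus ?thesis by (intro exI[of _ "\<lambda>x. 0"] conjI smf.intros allI) auto
  qed
  thus ?case by (auto intro!: continuous_intros continuous_on_product_coordinates)
next
  case smf_base
  show ?case using G G' by blast
next
  case (smf_add f h)
  then obtain f' h' where *: "smf G f'" "smf G h'" "\<And>x. ((\<lambda>t. f (x(k := t))) has_vector_derivative f' x) (at (x k))"
     "\<And>x. ((\<lambda>t. h (x(k := t))) has_vector_derivative h' x) (at (x k))" by blast
  show ?case using smf_add
    by (intro conjI exI[of _ "\<lambda>x. f' x + h' x"] smf.intros * allI has_vector_derivative_add) (auto intro!: continuous_intros)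
next
  case (smf_mult f h)
  then obtain f' h' where *: "smf G f'" "smf G h'" "\<And>x. ((\<lambda>t. f (x(k := t))) has_vector_derivative f' x) (at (x k))"
     "\<And>x. ((\<lambda>t. h (x(k := t))) has_vector_derivative h' x) (at (x k))" by blast
  have "((\<lambda>t. f (x(k := t)) * h (x(k := t))) has_vector_derivative (f x * h' x + f' x * h x)) (at (x k))" for x
    using has_vector_derivative_mult[OF *(3)[of x] *(4)[of x]] by simp
  moreover have "smf G (\<lambda>x. f x * h' x + f' x * h x)" using smf_mult.hyps * by (intro smf.intros)
  moreover have "continuous_on UNIV (\<lambda>x. f x * h x)" using smf_mult.IH by (intro continuous_on_mult) auto
  ultimately show ?case by blast
next
  case (smf_inverse f)
  then obtain f' where *: "smf G f'" "\<And>x. ((\<lambda>t. f (x(k := t))) has_vector_derivative f' x) (at (x k))" by blast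
  have "((\<lambda>t. inverse (f (x(k := t)))) has_vector_derivative (f' x * (- 1 * (inverse (f x) * inverse (f x))))) (at (x k))" for x
  proof -
    have "(inverse has_field_derivative (- 1 * (inverse (f x) * inverse (f x)))) (at (f (x(k := x k))))"
      using smf_inverse.hyps(2)[of x] by (auto intro!: derivative_eq_intros)
    from field_vector_diff_chain_at[OF *(2)[of x] this] show ?thesis by (simp only: o_def)
  qed
  moreover have "smf G (\<lambda>x. f' x * (- 1 * (inverse (f x) * inverse (f x))))" using smf_inverse.hyps * by (intro smf.intros)
  moreover have "continuous_on UNIV (\<lambda>x. inverse (f x))" using smf_inverse by (intro continuous_on_inverse) auto
  ultimately show ?case by blast
qed

lemma smooth_coords_of_smf:
  assumes G: "continuous_on UNIV G"
    and G': "\<And>k. \<exists>G'. smf G G' \<and> (\<forall>x. ((\<lambda>t. G (x(k := t))) has_vector_derivative G' x) (at (x k)))"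
  shows "smooth_coords N G"
proof -
  have it: "smf G (iter_partial ks G)" for ks
  proof (induction ks)
    case (Cons k ks)
    obtain f' where f': "smf G f'" "\<And>x. ((\<lambda>t. iter_partial ks G (x(k := t))) has_vector_derivative f' x) (at (x k))"
      using smf_derivative[OF G G' Cons, of k] by blast
    have "partial_coord k (iter_partial ks G) = f'"
      unfolding partial_coord_def using vector_derivative_at[OF f'(2)] by blast
    thus ?case using f'(1) by simp
  qed (auto intro: smf_base)
  show ?thesis unfolding smooth_coords_def
  proof (intro allI impI conjI)
    fix ks k x
    show "continuous_on UNIV (iter_partial ks G)" using smf_derivative[OF G G' it] by blast
    obtain f' where "((\<lambda>t. iter_partial ks G (x(k := t))) has_vector_derivative f' x) (at (x k))"
      using smf_derivative[OF G G' it[of ks], of k] by blast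
    thus "(\<lambda>t. iter_partial ks G (x(k := t))) differentiable (at (x k))"
      unfolding has_vector_derivative_def differentiable_def by blast
  qed
qed

text \<open>The solution curve is already known to be continuous, so only its derivative has to be
  found. Linearizing \<open>F\<close> at the point gives \<open>|\<Delta>b - D \<Delta>t| \<le> e
  (|\<Delta>t| + |\<Delta>b|)\<close> for every \<open>e > 0\<close>, locally.\<close>

lemma implicit_vector_derivative:
  fixes F :: "real \<times> complex \<Rightarrow> complex" and b :: "real \<Rightarrow> complex"
  assumes F: "(F has_derivative (\<lambda>q. complex_of_real (fst q) * Fk + snd q * Fb)) (at (t0, b t0))" and Fb: "Fb \<noteq> 0"
    and b: "isCont b t0" and z: "\<And>t. F (t, b t) = 0"
  shows "(b has_vector_derivative (- Fk / Fb)) (at t0)"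
proof -
  define D where "D = - Fk / Fb"
  have small: "\<exists>\<delta>>0. \<forall>t. \<bar>t - t0\<bar> < \<delta> \<longrightarrow> cmod (b t - b t0 - (t - t0) *\<^sub>R D) \<le> e * (\<bar>t - t0\<bar> + cmod (b t - b t0))" if e: "0 < e" for e
  proof -
    have "0 < e * cmod Fb" using e Fb by simp
    then obtain r where r: "0 < r" "\<And>y. norm (y - (t0, b t0)) < r \<Longrightarrow>
        norm (F y - F (t0, b t0) - (complex_of_real (fst (y - (t0, b t0))) * Fk + snd (y - (t0, b t0)) * Fb)) \<le> (e * cmod Fb) * norm (y - (t0, b t0))"
      using F unfolding has_derivative_at_alt by blast
    obtain s where s: "0 < s" "\<And>t. dist t t0 < s \<Longrightarrow> dist (b t) (b t0) < r / 2"
      using b r(1) unfolding continuous_at_eps_delta by (metis half_gt_zero)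
    have "cmod (b t - b t0 - (t - t0) *\<^sub>R D) \<le> e * (\<bar>t - t0\<bar> + cmod (b t - b t0))" if t: "\<bar>t - t0\<bar> < min s (r / 2)" for t
    proof -
      have n: "norm ((t, b t) - (t0, b t0)) \<le> \<bar>t - t0\<bar> + cmod (b t - b t0)"
        using norm_Pair_le[of "t - t0" "b t - b t0"] by simp
      also have "\<dots> < r" using s(2)[of t] t by (simp add: dist_norm)
      finally have lt: "norm ((t, b t) - (t0, b t0)) < r" .
      have "cmod (complex_of_real (t - t0) * Fk + (b t - b t0) * Fb) \<le> (e * cmod Fb) * norm ((t, b t) - (t0, b t0))"
        using r(2)[OF lt] by (simp only: z fst_diff snd_diff fst_conv snd_conv diff_self diff_0 norm_minus_cancel)
      also have "\<dots> \<le> (e * cmod Fb) * (\<bar>t - t0\<bar> + cmod (b t - b t0))" using n e by (intro mult_left_mono) auto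
      also have "complex_of_real (t - t0) * Fk + (b t - b t0) * Fb = Fb * (b t - b t0 - (t - t0) *\<^sub>R D)"
        using Fb by (simp add: D_def scaleR_conv_of_real field_simps)
      finally have "cmod Fb * cmod (b t - b t0 - (t - t0) *\<^sub>R D) \<le> cmod Fb * (e * (\<bar>t - t0\<bar> + cmod (b t - b t0)))"
        by (simp add: norm_mult mult_ac)
      thus ?thesis using Fb by (simp add: mult_le_cancel_left)
    qed
    thus ?thesis using s(1) r(1) by (intro exI[of _ "min s (r / 2)"]) auto
  qed
  \<comment> \<open>The value \<open>e = 1/2\<close> yields a Lipschitz bound for \<open>b\<close>;
    with it the term \<open>|\<Delta>b|\<close> on the right is replaced by a multiple of
    \<open>|\<Delta>t|\<close> for arbitrary \<open>e\<close>.\<close>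
  obtain d1 where d1: "0 < d1" "\<And>t. \<bar>t - t0\<bar> < d1 \<Longrightarrow> cmod (b t - b t0 - (t - t0) *\<^sub>R D) \<le> (1/2) * (\<bar>t - t0\<bar> + cmod (b t - b t0))"
    using small[of "1/2"] by auto
  define M where "M = 2 * (cmod D + 1)"
  have lip: "cmod (b t - b t0) \<le> M * \<bar>t - t0\<bar>" if t: "\<bar>t - t0\<bar> < d1" for t
  proof -
    have "cmod (b t - b t0) \<le> cmod (b t - b t0 - (t - t0) *\<^sub>R D) + cmod ((t - t0) *\<^sub>R D)"
      using norm_triangle_ineq[of "b t - b t0 - (t - t0) *\<^sub>R D" "(t - t0) *\<^sub>R D"] by simp
    also have "\<dots> \<le> (1/2) * (\<bar>t - t0\<bar> + cmod (b t - b t0)) + \<bar>t - t0\<bar> * cmod D" using d1(2)[OF t] by simp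
    finally have "cmod (b t - b t0) \<le> \<bar>t - t0\<bar> + 2 * (\<bar>t - t0\<bar> * cmod D)" by (simp add: field_simps)
    moreover have "M * \<bar>t - t0\<bar> = 2 * (\<bar>t - t0\<bar> * cmod D) + 2 * \<bar>t - t0\<bar>" by (simp add: M_def algebra_simps)
    ultimately show ?thesis using abs_ge_zero[of "t - t0"] by argo
  qed
  have M0: "0 \<le> M" by (simp add: M_def)
  show ?thesis unfolding has_vector_derivative_def has_derivative_at_alt D_def[symmetric]
  proof (intro conjI allI impI bounded_linear_scaleR_left)
    fix e :: real assume e: "0 < e"
    hence "0 < e / (1 + M)" using M0 by simp
    from small[OF this] obtain d2 where d2: "0 < d2" "\<And>t. \<bar>t - t0\<bar> < d2 \<Longrightarrow> cmod (b t - b t0 - (t - t0) *\<^sub>R D) \<le> e / (1 + M) * (\<bar>t - t0\<bar> + cmod (b t - b t0))"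
      by blast
    have "cmod (b t - b t0 - (t - t0) *\<^sub>R D) \<le> e * \<bar>t - t0\<bar>" if t: "\<bar>t - t0\<bar> < min d1 d2" for t
    proof -
      have "cmod (b t - b t0 - (t - t0) *\<^sub>R D) \<le> e / (1 + M) * (\<bar>t - t0\<bar> + cmod (b t - b t0))" using d2(2) t by simp
      also have "\<dots> \<le> e / (1 + M) * (\<bar>t - t0\<bar> + M * \<bar>t - t0\<bar>)" using lip[of t] t e M0 by (intro mult_left_mono add_left_mono) auto
      also have "\<dots> = e * \<bar>t - t0\<bar>"
      proof -
        have "\<bar>t - t0\<bar> + M * \<bar>t - t0\<bar> = (1 + M) * \<bar>t - t0\<bar>" by (simp only: distrib_right mult_1)
        moreover have "e / (1 + M) * ((1 + M) * \<bar>t - t0\<bar>) = e * \<bar>t - t0\<bar>" using M0 by simp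
        ultimately show ?thesis by simp
      qed
      finally show ?thesis .
    qed
    thus "\<exists>d>0. \<forall>y. norm (y - t0) < d \<longrightarrow> norm (b y - b t0 - (y - t0) *\<^sub>R D) \<le> e * norm (y - t0)"
      using d1(1) d2(1) by (intro exI[of _ "min d1 d2"]) auto
  qed
qed

text \<open>The determinant of \<open>1 - b A\<close> for the matrix \<open>A\<close> with
  coordinates \<open>x\<close>. It is polynomial in \<open>x\<close> and \<open>b\<close>, and its
  logarithmic derivative in \<open>b\<close> is \<open>- d R(b)\<close>, which makes
  \<open>R\<close> a rational function of the matrix entries even though the eigenvalues are
  not.\<close>

definition Qdet :: "nat \<Rightarrow> (nat \<Rightarrow> real) \<Rightarrow> complex \<Rightarrow> complex" where
  "Qdet p x b = det (mat p p (\<lambda>(i, j). (if i = j then 1 else 0) - b * herm_of p x $$ (i, j)))"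

lemma polyfun_herm_of: assumes "i < p" "j < p" shows "polyfun (\<lambda>x b. herm_of p x $$ (i, j))"
proof -
  have c: "polyfun (\<lambda>x b. Complex (x k) (x l))" for k l
    unfolding Complex_eq by (intro polyfun.intros)
  have c': "polyfun (\<lambda>x b. Complex (x k) (- x l))" for k l
  proof -
    have "polyfun (\<lambda>x b. complex_of_real (x k) + (- \<i>) * complex_of_real (x l))" by (intro polyfun.intros)
    thus ?thesis unfolding Complex_eq by simp
  qed
  consider "i = j" | "i < j" | "j < i" by linarith
  thus ?thesis using assms by cases (simp_all add: herm_of_def c c' pf_coord)
qed

lemma polyfun_Qdet: "polyfun (Qdet p)"
proof -
  have "Qdet p = (\<lambda>x b. \<Sum>\<pi>\<in>{\<pi>. \<pi> permutes {0..<p}}. signof \<pi> * (\<Prod>i\<in>{0..<p}. (if i = \<pi> i then 1 else 0) - b * herm_of p x $$ (i, \<pi> i)))"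
  proof (intro ext)
    fix x b
    show "Qdet p x b = (\<Sum>\<pi>\<in>{\<pi>. \<pi> permutes {0..<p}}. signof \<pi> * (\<Prod>i\<in>{0..<p}. (if i = \<pi> i then 1 else 0) - b * herm_of p x $$ (i, \<pi> i)))"
      unfolding Qdet_def
    proof (subst det_def'[of _ p], simp, rule sum.cong[OF refl])
      fix \<pi> assume "\<pi> \<in> {\<pi>. \<pi> permutes {0..<p}}"
      hence "\<pi> i < p" if "i < p" for i using that permutes_in_image[of \<pi> "{0..<p}" i] by simp
      thus "signof \<pi> * (\<Prod>i = 0..<p. mat p p (\<lambda>(i, j). (if i = j then 1 else 0) - b * herm_of p x $$ (i, j)) $$ (i, \<pi> i))
        = signof \<pi> * (\<Prod>i\<in>{0..<p}. (if i = \<pi> i then 1 else 0) - b * herm_of p x $$ (i, \<pi> i))"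
        by (intro arg_cong2[where f="(*)"] prod.cong refl) auto
    qed
  qed
  moreover have "polyfun (\<lambda>x b. \<Sum>\<pi>\<in>{\<pi>. \<pi> permutes {0..<p}}. signof \<pi> * (\<Prod>i\<in>{0..<p}. (if i = \<pi> i then 1 else 0) - b * herm_of p x $$ (i, \<pi> i)))"
    by (intro pf_sum pf_mult pf_prod pf_const pf_diff pf_var polyfun_herm_of) (auto dest: permutes_in_image)
  ultimately show ?thesis by simp
qed

lemma herm_of_carrier: "herm_of p x \<in> carrier_mat p p"
  by (simp add: herm_of_def)

lemma herm_of_adjoint: "mat_adjoint (herm_of p x) = herm_of p x"
proof (rule eq_matI)
  fix i j assume "i < dim_row (herm_of p x)" "j < dim_col (herm_of p x)"
  hence ij: "i < p" "j < p" by (auto simp: herm_of_def)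
  show "mat_adjoint (herm_of p x) $$ (i, j) = herm_of p x $$ (i, j)"
    unfolding mat_adjoint_index[OF herm_of_carrier ij] using ij by (auto simp: herm_of_def complex_eq_iff)
qed (use mat_adjoint_carrier[OF herm_of_carrier] in \<open>auto simp: herm_of_def\<close>)

lemma Qdet_spectral:
  assumes U: "car p p U" "adj U * U = Idn p" "U * adj U = Idn p" "fm (herm_of p x) = U * dg p (\<lambda>i. complex_of_real (l i)) * adj U"
  shows "Qdet p x b = (\<Prod>i<p. 1 - complex_of_real (l i) * b)"
proof -
  let ?D = "dg p (\<lambda>i. 1 - complex_of_real (l i) * b)"
  have "mat p p (\<lambda>(i, j). (if i = j then 1 else 0) - b * herm_of p x $$ (i, j)) = mf p p (Idn p - cs b (fm (herm_of p x)))"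
    unfolding mf_def using herm_of_carrier[of p x] by (intro cong_mat) auto
  also have "Idn p - cs b (fm (herm_of p x)) = U * (Idn p - cs b (dg p (\<lambda>i. complex_of_real (l i)))) * adj U"
    unfolding U(4) right_diff_distrib left_diff_distrib mult_Idn[OF U(1)] U(3) by simp
  also have "Idn p - cs b (dg p (\<lambda>i. complex_of_real (l i))) = ?D"
    unfolding cs_dg dg_diff by (simp add: mult.commute)
  also have "mf p p (U * ?D * adj U) = mf p p U * mf p p ?D * mf p p (adj U)"
    by (simp add: mf_mult[OF car_mult[OF U(1) car_dg] car_adj[OF U(1)]] mf_mult[OF U(1) car_dg])
  finally have Q: "Qdet p x b = det (mf p p U * mf p p ?D * mf p p (adj U))" by (simp add: Qdet_def)
  have c: "mf p p X \<in> carrier_mat p p" for X by (simp add: mf_def)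
  have "det (mf p p U * mf p p ?D * mf p p (adj U)) = det (mf p p U) * det (mf p p ?D) * det (mf p p (adj U))"
    by (simp add: det_mult[OF mult_carrier_mat[OF c c] c] det_mult[OF c c])
  also have "\<dots> = det (mf p p ?D) * (det (mf p p U) * det (mf p p (adj U)))" by simp
  also have "det (mf p p U) * det (mf p p (adj U)) = det (mf p p U * mf p p (adj U))" by (simp add: det_mult[OF c c])
  also have "mf p p U * mf p p (adj U) = 1\<^sub>m p" using mf_mult[OF U(1) car_adj[OF U(1)]] U(3) mf_Idn by simp
  also have "det (mf p p ?D) = prod_list (diag_mat (mf p p ?D))"
    by (rule det_upper_triangular[of _ p]) (auto simp: mf_def)
  also have "diag_mat (mf p p ?D) = map (\<lambda>i. 1 - complex_of_real (l i) * b) [0..<p]" by (auto simp: diag_mat_def mf_def)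
  finally show ?thesis unfolding Q
    using prod.distinct_set_conv_list[of "[0..<p]" "\<lambda>i. 1 - complex_of_real (l i) * b"] by (simp add: lessThan_atLeast0)
qed

locale implicit_family =
  fixes p d :: nat and z :: complex and G :: "(nat \<Rightarrow> real) \<Rightarrow> complex"
  assumes d: "1 \<le> d" and z: "0 < Im z" and Gneg: "\<And>x. Im (G x) < 0"
    and Gfix: "\<And>x U l. car p p U \<Longrightarrow> adj U * U = Idn p \<Longrightarrow> U * adj U = Idn p \<Longrightarrow> fm (herm_of p x) = U * dg p (\<lambda>i. complex_of_real (l i)) * adj U
       \<Longrightarrow> Gcal d p z l (G x) = G x"
begin

text \<open>Eigenvalues chosen for each \<open>x\<close> separately, with no relation between
  different \<open>x\<close>. Regularity comes from \<open>Q_eq\<close> and \<open>R_eq\<close>,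
  whose left sides are symmetric in them.\<close>

definition lam :: "(nat \<Rightarrow> real) \<Rightarrow> nat \<Rightarrow> real" where
  "lam x = (SOME l. \<exists>U. car p p U \<and> adj U * U = Idn p \<and> U * adj U = Idn p \<and> fm (herm_of p x) = U * dg p (\<lambda>i. complex_of_real (l i)) * adj U)"

lemma lam: "\<exists>U. car p p U \<and> adj U * U = Idn p \<and> U * adj U = Idn p \<and> fm (herm_of p x) = U * dg p (\<lambda>i. complex_of_real (lam x i)) * adj U"
proof -
  obtain U l where "car p p U" "adj U * U = Idn p" "U * adj U = Idn p" "fm (herm_of p x) = U * dg p (\<lambda>i. complex_of_real (l i)) * adj U"
    using hermitian_spectral[OF herm_of_carrier herm_of_adjoint] by blast
  hence "\<exists>l U. car p p U \<and> adj U * U = Idn p \<and> U * adj U = Idn p \<and> fm (herm_of p x) = U * dg p (\<lambda>i. complex_of_real (l i)) * adj U"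
    by blast
  thus ?thesis unfolding lam_def by (rule someI_ex)
qed

lemma G_fixpoint: "Gcal d p z (lam x) (G x) = G x"
  using lam[of x] Gfix by blast

lemma Q_eq: "Qdet p x b = (\<Prod>i<p. 1 - complex_of_real (lam x i) * b)"
  using lam[of x] Qdet_spectral by blast

definition Qb where "Qb = (SOME Fb. polyfun Fb \<and> (\<forall>x b. (Qdet p x has_field_derivative Fb x b) (at b)))"

lemma polyfun_field_derivative: assumes "polyfun F"
  shows "\<exists>Fb. polyfun Fb \<and> (\<forall>x b. (F x has_field_derivative Fb x b) (at b))"
proof -
  obtain Fk Fb where F: "polyfun Fb" "\<And>x b. ((\<lambda>p. F (x(0 := fst p)) (snd p)) has_derivative (\<lambda>q. complex_of_real (fst q) * Fk x b + snd q * Fb x b)) (at (x 0, b))"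
    using polyfun_derivative[OF assms, of 0] by blast
  have "(F x has_field_derivative Fb x b) (at b)" for x b
  proof -
    have "((\<lambda>b. (x 0, b)) has_derivative (\<lambda>h. (0, h))) (at b)" by (auto intro!: derivative_eq_intros)
    from has_derivative_compose[OF this F(2)[of x b]]
    have "((\<lambda>b. F x b) has_derivative (\<lambda>h. h * Fb x b)) (at b)" by simp
    moreover have "(\<lambda>h. h * Fb x b) = (*) (Fb x b)" by (auto simp: mult.commute)
    ultimately show ?thesis unfolding has_field_derivative_def by simp
  qed
  thus ?thesis using F(1) by blast
qed

lemma Qb: "polyfun Qb" "(Qdet p x has_field_derivative Qb x b) (at b)"
  using someI_ex[OF polyfun_field_derivative[OF polyfun_Qdet[of p]]] unfolding Qb_def by blast+

lemma Q_nz: "Im b < 0 \<Longrightarrow> Qdet p x b \<noteq> 0"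
  unfolding Q_eq using one_minus_nz by (simp add: prod_zero_iff)

lemma Qb_eq: assumes b: "Im b < 0" shows "Qb x b = - Qdet p x b * (of_nat d * Rcal d p (lam x) b)"
proof -
  have "((\<lambda>b. \<Prod>i<p. 1 - complex_of_real (lam x i) * b) has_field_derivative
     (\<Prod>i<p. 1 - complex_of_real (lam x i) * b) * (\<Sum>i<p. (- complex_of_real (lam x i)) / (1 - complex_of_real (lam x i) * b))) (at b)"
    by (rule has_field_derivative_prod') (use one_minus_nz[OF b] in \<open>auto intro!: derivative_eq_intros\<close>)
  hence "Qb x b = Qdet p x b * (\<Sum>i<p. (- complex_of_real (lam x i)) / (1 - complex_of_real (lam x i) * b))"
    using Qb(2)[of x b] unfolding Q_eq by (rule DERIV_unique[rotated])
  thus ?thesis using d by (simp add: Rcal_def sum_negf)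
qed

lemma R_eq: assumes "Im b < 0" shows "Rcal d p (lam x) b = - Qb x b / (of_nat d * Qdet p x b)"
  unfolding Qb_eq[OF assms] using Q_nz[OF assms, of x] d by simp

lemma R_continuous: assumes b: "Im b < 0" shows "continuous_on UNIV (\<lambda>x. Rcal d p (lam x) b)"
  unfolding R_eq[OF b] using Q_nz[OF b] d
  by (intro continuous_intros polyfun_continuous[OF Qb(1) continuous_on_const] polyfun_continuous[OF polyfun_Qdet continuous_on_const]) auto

text \<open>The eigenvalues vary with \<open>x\<close>, but at the fixed point \<open>c\<close> of
  the parameter \<open>x0\<close> the number \<open>R(c)\<close> depends continuously on
  \<open>x\<close>. Comparing \<open>G x\<close> with \<open>c\<close> therefore leaves one term
  that tends to 0 and one that is absorbed by means of \<open>Kcal_le\<close>.\<close>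

lemma G_continuous: "continuous_on UNIV G"
  unfolding continuous_on_def
proof (intro ballI)
  fix x0
  define c where "c = G x0"
  have c: "Im c < 0" "Gcal d p z (lam x0) c = c" unfolding c_def by (rule Gneg, rule G_fixpoint)
  \<comment> \<open>Bounds \<open>|b c K(b, c)|\<close> at the parameter \<open>x\<close>, since the
    factor of the fixed point \<open>b = G x\<close> is below 1. It is below 1 at \<open>x0\<close>
    by \<open>Scal_fixpoint_less\<close>, hence below the midpoint \<open>(1 + S x0) / 2\<close> for
    nearby \<open>x\<close>.\<close>
  define S where "S x = sqrt ((cmod c)\<^sup>2 * Scal d p (lam x) c)" for x
  have Sc: "Scal d p (lam x) c = Im (Rcal d p (lam x) c) / Im c" for x
    using Im_Rcal[of p "lam x" c d] one_minus_nz[OF c(1)] c(1) by simp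
  have lim: "((\<lambda>x. Rcal d p (lam x) c) \<longlongrightarrow> Rcal d p (lam x0) c) (at x0 within UNIV)"
    using R_continuous[OF c(1)] unfolding continuous_on_def by blast
  have "(S \<longlongrightarrow> S x0) (at x0 within UNIV)" unfolding S_def Sc by (intro tendsto_intros lim) (use c in auto)
  moreover have S0: "S x0 < 1" unfolding S_def using Scal_fixpoint_less[OF c(1) z c(2)] by simp
  ultimately have ev: "\<forall>\<^sub>F x in at x0 within UNIV. S x < (1 + S x0) / 2" by (intro order_tendstoD) auto
  define k where "k = (Im z)\<^sup>2 * (1 - S x0) / 2"
  have k: "0 < k" using S0 z by (simp add: k_def)
  have bnd: "norm (G x - c) \<le> cmod (Rcal d p (lam x) c - Rcal d p (lam x0) c) / k" if Sx: "S x < (1 + S x0) / 2" for x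
  proof -
    define b where "b = G x"
    have b: "Im b < 0" "Gcal d p z (lam x) b = b" unfolding b_def by (rule Gneg, rule G_fixpoint)
    have nb: "cmod b \<le> 1 / Im z" "cmod c \<le> 1 / Im z" using Gcal_norm_le[OF b(1) z, of d p "lam x"] Gcal_norm_le[OF c(1) z, of d p "lam x0"] b c by auto
    have eqs: "(z - Rcal d p (lam x) b) * b = 1" "(z - Rcal d p (lam x0) c) * c = 1"
      using Gcal_nz[OF b(1) z, of d p "lam x"] Gcal_nz[OF c(1) z, of d p "lam x0"] b(2) c(2) unfolding Gcal_def by (metis right_inverse)+
    \<comment> \<open>Two parameters meet only in the second summand of the next line, and there at
      the same argument \<open>c\<close>.\<close>
    have "b - c = b * ((z - Rcal d p (lam x0) c) * c) - c * ((z - Rcal d p (lam x) b) * b)" unfolding eqs by simp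
    also have "\<dots> = b * c * (Rcal d p (lam x) b - Rcal d p (lam x) c) + b * c * (Rcal d p (lam x) c - Rcal d p (lam x0) c)" by (simp add: algebra_simps)
    also have "Rcal d p (lam x) b - Rcal d p (lam x) c = (b - c) * Kcal d p (lam x) b c"
      by (rule Rcal_diff) (use one_minus_nz[OF b(1)] one_minus_nz[OF c(1)] in auto)
    finally have "cmod (b - c) \<le> cmod (b - c) * (cmod b * cmod c * cmod (Kcal d p (lam x) b c)) + cmod b * cmod c * cmod (Rcal d p (lam x) c - Rcal d p (lam x0) c)"
      using norm_triangle_ineq[of "b * c * ((b - c) * Kcal d p (lam x) b c)" "b * c * (Rcal d p (lam x) c - Rcal d p (lam x0) c)"]
      by (simp add: norm_mult mult_ac)
    moreover have "cmod b * cmod c * cmod (Kcal d p (lam x) b c) \<le> S x"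
    proof -
      have "(cmod b * cmod c * cmod (Kcal d p (lam x) b c))\<^sup>2 \<le> (cmod b)\<^sup>2 * (cmod c)\<^sup>2 * (Scal d p (lam x) b * Scal d p (lam x) c)"
        unfolding power_mult_distrib by (intro mult_left_mono Kcal_le) auto
      also have "\<dots> = ((cmod b)\<^sup>2 * Scal d p (lam x) b) * ((cmod c)\<^sup>2 * Scal d p (lam x) c)" by (simp add: mult_ac)
      also have "\<dots> \<le> 1 * ((cmod c)\<^sup>2 * Scal d p (lam x) c)"
        using Scal_fixpoint_less[OF b(1) z b(2)] Scal_nonneg[of d p "lam x" c] by (intro mult_right_mono) auto
      finally show ?thesis unfolding S_def by (intro real_le_rsqrt) simp
    qed
    hence "cmod (b - c) * (cmod b * cmod c * cmod (Kcal d p (lam x) b c)) \<le> cmod (b - c) * S x" by (intro mult_left_mono) auto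
    moreover have "cmod b * cmod c * cmod (Rcal d p (lam x) c - Rcal d p (lam x0) c) \<le> (1 / Im z * (1 / Im z)) * cmod (Rcal d p (lam x) c - Rcal d p (lam x0) c)"
      using nb z by (intro mult_right_mono mult_mono) auto
    ultimately have "cmod (b - c) * (1 - S x) \<le> (1 / Im z * (1 / Im z)) * cmod (Rcal d p (lam x) c - Rcal d p (lam x0) c)"
      unfolding right_diff_distrib by linarith
    moreover have "cmod (b - c) * ((1 - S x0) / 2) \<le> cmod (b - c) * (1 - S x)" using Sx by (intro mult_left_mono) auto
    ultimately have "cmod (b - c) * ((1 - S x0) / 2) \<le> (1 / Im z * (1 / Im z)) * cmod (Rcal d p (lam x) c - Rcal d p (lam x0) c)" by (rule order_trans[rotated])
    hence "(Im z)\<^sup>2 * (cmod (b - c) * ((1 - S x0) / 2)) \<le> (Im z)\<^sup>2 * ((1 / Im z * (1 / Im z)) * cmod (Rcal d p (lam x) c - Rcal d p (lam x0) c))"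
      by (intro mult_left_mono) auto
    also have "\<dots> = cmod (Rcal d p (lam x) c - Rcal d p (lam x0) c)" using z by (simp add: power2_eq_square)
    finally have "cmod (b - c) * k \<le> cmod (Rcal d p (lam x) c - Rcal d p (lam x0) c)" by (simp add: k_def mult_ac)
    thus ?thesis using k by (simp add: b_def pos_le_divide_eq)
  qed
  have "((\<lambda>x. cmod (Rcal d p (lam x) c - Rcal d p (lam x0) c) / k) \<longlongrightarrow> cmod (Rcal d p (lam x0) c - Rcal d p (lam x0) c) / k) (at x0 within UNIV)"
    by (intro tendsto_intros lim) (use k in auto)
  hence l0: "((\<lambda>x. cmod (Rcal d p (lam x) c - Rcal d p (lam x0) c) / k) \<longlongrightarrow> 0) (at x0 within UNIV)" by simp
  have "((\<lambda>x. G x - c) \<longlongrightarrow> 0) (at x0 within UNIV)"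
    by (rule Lim_null_comparison[OF _ l0]) (use ev bnd in \<open>auto elim: eventually_mono\<close>)
  thus "(G \<longlongrightarrow> G x0) (at x0 within UNIV)" unfolding c_def by (simp add: LIM_zero_iff)
qed

text \<open>The defect times \<open>Qdet\<close>, written without denominators by means of
  \<open>Qdet * R = - Qb / d\<close>. In contrast to the defect it is polynomial in the coordinates
  and in \<open>b\<close>.\<close>

definition F where "F x b = b * z * Qdet p x b + (b * (1 / of_nat d)) * Qb x b - Qdet p x b"

lemma polyfun_F: "polyfun F"
proof -
  have "polyfun (\<lambda>x b. b * z * Qdet p x b + (b * (1 / of_nat d)) * Qb x b - Qdet p x b)"
    by (intro pf_diff polyfun.intros polyfun_Qdet Qb)
  thus ?thesis unfolding F_def[abs_def] .
qed

lemma F_eq: "Im b < 0 \<Longrightarrow> F x b = Qdet p x b * defect d p (lam x) z b"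
  unfolding F_def defect_def Qb_eq using d by (simp add: algebra_simps)

lemma F_zero: "F x (G x) = 0"
  unfolding F_eq[OF Gneg] using defect_zero_iff[OF Gneg z] G_fixpoint by simp

text \<open>At a zero of the defect the product rule leaves \<open>Qdet\<close> times the derivative
  of the defect, and \<open>g\<close> times the latter is \<open>1 - g^2 K(g, g)\<close>. So the
  nondegeneracy is that of the fixed point map, \<open>Gcal_deriv_fixpoint\<close>.\<close>

lemma F_derivative_nonzero: assumes "(F x has_field_derivative D) (at (G x))" shows "D \<noteq> 0"
proof -
  define g where "g = G x"
  have g: "Im g < 0" "Gcal d p z (lam x) g = g" unfolding g_def by (rule Gneg, rule G_fixpoint)
  have dg: "defect d p (lam x) z g = 0" using defect_zero_iff[OF g(1) z] g(2) by simp
  have "(defect d p (lam x) z has_field_derivative (z - Rcal d p (lam x) g - g * Kcal d p (lam x) g g)) (at g)"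
    unfolding defect_def[abs_def] using one_minus_nz[OF g(1)]
    by (auto intro!: derivative_eq_intros Rcal_has_field_derivative simp: algebra_simps)
  from DERIV_mult[OF Qb(2)[of x g] this]
  have "((\<lambda>b. Qdet p x b * defect d p (lam x) z b) has_field_derivative
      Qdet p x g * (z - Rcal d p (lam x) g - g * Kcal d p (lam x) g g)) (at g)"
    by (simp add: dg mult.commute)
  hence "(F x has_field_derivative Qdet p x g * (z - Rcal d p (lam x) g - g * Kcal d p (lam x) g g)) (at g)"
    by (rule has_field_derivative_transform_within_open[where S="{b. Im b < 0}"]) (use g F_eq in \<open>auto intro: open_halfspace_Im_lt\<close>)
  hence D: "D = Qdet p x g * (z - Rcal d p (lam x) g - g * Kcal d p (lam x) g g)"
    using assms unfolding g_def by (rule DERIV_unique[rotated])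
  have nz: "g \<noteq> 0" using g(1) by auto
  have "(z - Rcal d p (lam x) g) * g = 1" using Gcal_nz[OF g(1) z, of d p "lam x"] g(2) unfolding Gcal_def by (metis right_inverse)
  hence "g * (z - Rcal d p (lam x) g - g * Kcal d p (lam x) g g) = 1 - g\<^sup>2 * Kcal d p (lam x) g g" by (simp add: algebra_simps power2_eq_square)
  moreover have "1 - g\<^sup>2 * Kcal d p (lam x) g g \<noteq> 0" using Gcal_deriv_fixpoint(2)[OF g(1) z g(2)] by auto
  ultimately show ?thesis unfolding D using Q_nz[OF g(1), of x] nz by auto
qed

lemma smooth: "smooth_coords N G"
proof (rule smooth_coords_of_smf[OF G_continuous])
  fix k
  obtain Fk Fb where F: "polyfun Fk" "polyfun Fb"
     "\<And>x b. ((\<lambda>p. F (x(k := fst p)) (snd p)) has_derivative (\<lambda>q. complex_of_real (fst q) * Fk x b + snd q * Fb x b)) (at (x k, b))"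
    using polyfun_derivative[OF polyfun_F, of k] by blast
  have fd: "(F x has_field_derivative Fb x b) (at b)" for x b
  proof -
    have "((\<lambda>b. (x k, b)) has_derivative (\<lambda>h. (0, h))) (at b)" by (auto intro!: derivative_eq_intros)
    from has_derivative_compose[OF this F(3)[of x b]]
    have "((\<lambda>b. F x b) has_derivative (\<lambda>h. h * Fb x b)) (at b)" by simp
    moreover have "(\<lambda>h. h * Fb x b) = (*) (Fb x b)" by (auto simp: mult.commute)
    ultimately show ?thesis unfolding has_field_derivative_def by simp
  qed
  have nz: "Fb x (G x) \<noteq> 0" for x by (rule F_derivative_nonzero[OF fd])
  have cl: "continuous_on UNIV (\<lambda>t. x(k := t))" for x :: "nat \<Rightarrow> real"
  proof (rule continuous_on_coordinatewise_then_product)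
    show "continuous_on UNIV (\<lambda>t. (x(k := t)) i)" for i by (cases "i = k") auto
  qed
  have "((\<lambda>t. G (x(k := t))) has_vector_derivative (- Fk x (G x) / Fb x (G x))) (at (x k))" for x
  proof (rule implicit_vector_derivative[where F="\<lambda>p. F (x(k := fst p)) (snd p)"])
    show "((\<lambda>p. F (x(k := fst p)) (snd p)) has_derivative (\<lambda>q. complex_of_real (fst q) * Fk x (G x) + snd q * Fb x (G x))) (at (x k, G (x(k := x k))))"
      using F(3)[of x "G x"] by simp
    show "isCont (\<lambda>t. G (x(k := t))) (x k)"
      using continuous_on_compose2[OF G_continuous cl, of x] by (simp add: continuous_on_eq_continuous_at)
  qed (use nz F_zero in auto)
  moreover have "smf G (\<lambda>x. (- 1) * Fk x (G x) * inverse (Fb x (G x)))"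
    by (intro smf.intros polyfun_smf F nz)
  ultimately show "\<exists>G'. smf G G' \<and> (\<forall>x. ((\<lambda>t. G (x(k := t))) has_vector_derivative G' x) (at (x k)))"
    by (intro exI[of _ "\<lambda>x. (- 1) * Fk x (G x) * inverse (Fb x (G x))"]) (simp add: divide_inverse)
qed

end

section \<open>The compound Wishart model\<close>

subsection \<open>Spectral decompositions and the operator norm\<close>

definition spectral_decomposition :: "nat \<Rightarrow> complex mat \<Rightarrow> fmat \<Rightarrow> (nat \<Rightarrow> real) \<Rightarrow> bool" where
  "spectral_decomposition p A U l \<longleftrightarrow> car p p U \<and> adj U * U = Idn p \<and> U * adj U = Idn p \<and>
     fm A = U * dg p (\<lambda>i. complex_of_real (l i)) * adj U"

lemma spectral_decomposition_exists:
  assumes "A \<in> carrier_mat p p" "mat_adjoint A = A"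
  shows "\<exists>U l. spectral_decomposition p A U l"
  using hermitian_spectral[OF assms] unfolding spectral_decomposition_def by metis

lemma diag_real_carrier: "diag_real p v \<in> carrier_mat p p"
  by (simp add: diag_real_def)

lemma diag_real_adjoint: "mat_adjoint (diag_real p v) = diag_real p v"
proof (rule eq_matI)
  fix i j assume "i < dim_row (diag_real p v)" "j < dim_col (diag_real p v)"
  hence ij: "i < p" "j < p" by (auto simp: diag_real_def)
  show "mat_adjoint (diag_real p v) $$ (i, j) = diag_real p v $$ (i, j)"
    unfolding mat_adjoint_index[OF diag_real_carrier ij] using ij by (auto simp: diag_real_def)
qed (use mat_adjoint_carrier[OF diag_real_carrier] in \<open>auto simp: diag_real_def\<close>)

lemma adj_Idn: "adj (Idn p) = Idn p"
  by (rule fmat_eqI) auto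

lemma spectral_decomposition_diag_real: "spectral_decomposition p (diag_real p v) (Idn p) v"
proof -
  have "fm (diag_real p v) = dg p (\<lambda>i. complex_of_real (v i))" by (rule fmat_eqI) (auto simp: diag_real_def)
  moreover have "Idn p * dg p f = dg p f" "dg p f * Idn p = dg p f" for f by (simp_all add: dg_mult_dg)
  ultimately show ?thesis unfolding spectral_decomposition_def adj_Idn by (simp add: car_dg)
qed

definition column_fmat :: "complex vec \<Rightarrow> fmat" where
  "column_fmat x = fm (mat (dim_vec x) 1 (\<lambda>(i, j). x $ i))"

lemma vec_norm2_eq: "vec_norm2 x = norm (column_fmat x)"
proof -
  have c: "car (dim_vec x) 1 (column_fmat x)" unfolding column_fmat_def by (rule car_fm) simp
  have "(norm (column_fmat x))\<^sup>2 = (\<Sum>i<dim_vec x. (cmod (x $ i))\<^sup>2)"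
    unfolding norm_fmat_sq[OF c] by (simp add: column_fmat_def)
  thus ?thesis unfolding vec_norm2_def by (metis norm_ge_zero real_sqrt_abs abs_of_nonneg)
qed

lemma column_fmat_mult_mat_vec:
  assumes A: "A \<in> carrier_mat p q" and x: "x \<in> carrier_vec q"
  shows "column_fmat (A *\<^sub>v x) = fm A * column_fmat x"
proof -
  have d: "dim_vec (A *\<^sub>v x) = p" "dim_vec x = q" using A x by auto
  have "mat p 1 (\<lambda>(i, j). (A *\<^sub>v x) $ i) = A * mat q 1 (\<lambda>(i, j). x $ i)"
  proof (rule eq_matI)
    fix i j assume "i < dim_row (A * mat q 1 (\<lambda>(i, j). x $ i))" "j < dim_col (A * mat q 1 (\<lambda>(i, j). x $ i))"
    hence ij: "i < p" "j = 0" using A by auto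
    have "col (mat q 1 (\<lambda>(i, j). x $ i)) 0 = x" using x by (intro eq_vecI) auto
    thus "mat p 1 (\<lambda>(i, j). (A *\<^sub>v x) $ i) $$ (i, j) = (A * mat q 1 (\<lambda>(i, j). x $ i)) $$ (i, j)"
      using ij A x by simp
  qed (use A in auto)
  thus ?thesis unfolding column_fmat_def d using fm_mult[OF A, of "mat q 1 (\<lambda>(i, j). x $ i)" 1] by simp
qed

text \<open>Column \<open>i\<close> of \<open>U\<close> is a unit eigenvector for
  \<open>l i\<close>. The bound translates the norm condition on the parameter into the bound on
  \<open>v\<close> under which all estimates are made.\<close>

lemma abs_eigenvalue_le_op_norm:
  assumes A: "A \<in> carrier_mat p p" and U: "spectral_decomposition p A U l" and i: "i < p"
  shows "\<bar>l i\<bar> \<le> op_norm A"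
proof -
  note U' = U[unfolded spectral_decomposition_def]
  define x where "x = vec p (\<lambda>k. ent U k i)"
  have x: "x \<in> carrier_vec p" by (simp add: x_def)
  have "ent (adj U * U) i i = (\<Sum>k<p. cnj (ent U k i) * ent U k i)"
    using ent_mult_eq[OF car_adj, of p p U U i i] U' by simp
  hence "(\<Sum>k<p. cnj (ent U k i) * ent U k i) = 1" using U' i by simp
  moreover have "(\<Sum>k<p. cnj (ent U k i) * ent U k i) = complex_of_real (\<Sum>k<p. (cmod (ent U k i))\<^sup>2)"
    unfolding of_real_sum by (intro sum.cong refl, subst complex_norm_square, rule mult.commute)
  ultimately have s1: "(\<Sum>k<p. (cmod (ent U k i))\<^sup>2) = 1" using of_real_eq_1_iff by metis
  have n1: "vec_norm2 x = 1" unfolding vec_norm2_def using s1 by (simp add: x_def)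
  have "fm A * U = U * dg p (\<lambda>i. complex_of_real (l i)) * (adj U * U)" using U' by (simp add: mult.assoc)
  also have "\<dots> = U * dg p (\<lambda>i. complex_of_real (l i))"
    using U' by (simp add: mult.assoc dg_mult_dg)
  finally have AU: "fm A * U = U * dg p (\<lambda>i. complex_of_real (l i))" .
  have ev: "(A *\<^sub>v x) $ k = complex_of_real (l i) * ent U k i" if k: "k < p" for k
  proof -
    have "(A *\<^sub>v x) $ k = (\<Sum>j<p. ent (fm A) k j * ent U j i)"
      using A k by (simp add: x_def scalar_prod_def lessThan_atLeast0)
    also have "\<dots> = ent (fm A * U) k i" using ent_mult_eq[OF car_fm[OF A]] by simp
    also have "\<dots> = (\<Sum>j<p. ent U k j * ent (dg p (\<lambda>i. complex_of_real (l i))) j i)"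
      unfolding AU using U' by (intro ent_mult_eq) auto
    also have "\<dots> = (\<Sum>j<p. if j = i then ent U k i * complex_of_real (l i) else 0)"
      by (intro sum.cong) auto
    finally show ?thesis using i by (simp add: mult.commute)
  qed
  have "vec_norm2 (A *\<^sub>v x) = sqrt (\<Sum>k<p. (l i)\<^sup>2 * (cmod (ent U k i))\<^sup>2)"
  proof -
    have d: "dim_vec (A *\<^sub>v x) = p" using A by simp
    show ?thesis unfolding vec_norm2_def d
      by (intro arg_cong[where f=sqrt] sum.cong refl)
         (simp add: ev norm_mult power_mult_distrib del: index_mult_mat_vec)
  qed
  also have "\<dots> = \<bar>l i\<bar>" by (simp flip: sum_distrib_left add: s1)
  finally have n2: "vec_norm2 (A *\<^sub>v x) = \<bar>l i\<bar>" .
  have "vec_norm2 (A *\<^sub>v x) \<le> op_norm A" unfolding op_norm_def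
  proof (rule cSup_upper)
    show "vec_norm2 (A *\<^sub>v x) \<in> {vec_norm2 (A *\<^sub>v x) |x. x \<in> carrier_vec (dim_col A) \<and> vec_norm2 x \<le> 1}"
      using A x n1 by auto
    \<comment> \<open>\<open>Sup\<close> dominates the elements of the set only if it is bounded
      above; the Hilbert-Schmidt norm provides a bound.\<close>
    show "bdd_above {vec_norm2 (A *\<^sub>v x) |x. x \<in> carrier_vec (dim_col A) \<and> vec_norm2 x \<le> 1}"
    proof (rule bdd_aboveI)
      fix s assume "s \<in> {vec_norm2 (A *\<^sub>v x) |x. x \<in> carrier_vec (dim_col A) \<and> vec_norm2 x \<le> 1}"
      then obtain y where y: "s = vec_norm2 (A *\<^sub>v y)" "y \<in> carrier_vec p" "vec_norm2 y \<le> 1" using A by auto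
      have "s \<le> norm (fm A) * norm (column_fmat y)"
        unfolding y(1) vec_norm2_eq column_fmat_mult_mat_vec[OF A y(2)] by (rule norm_mult_ineq)
      also have "\<dots> \<le> norm (fm A) * 1" using y(3) unfolding vec_norm2_eq by (intro mult_left_mono) auto
      finally show "s \<le> norm (fm A)" by simp
    qed
  qed
  thus ?thesis unfolding n2 .
qed

subsection \<open>The limit measures\<close>

definition Rcal_mset :: "nat \<Rightarrow> real multiset \<Rightarrow> complex \<Rightarrow> complex" where
  "Rcal_mset d E b = (1 / of_nat d) * (\<Sum>v\<in>#E. complex_of_real v / (1 - complex_of_real v * b))"

text \<open>The fixed point equation is phrased through the multiset of eigenvalues, so that the choice
  depends on the matrix only through its characteristic polynomial.\<close>

definition mu_CW :: "nat \<times> complex mat \<Rightarrow> real measure" where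
  "mu_CW \<theta> = (SOME \<mu>. real_distribution \<mu> \<and> compactly_supported_prob \<mu> \<and> (\<forall>z. 0 < Im z \<longrightarrow>
     inverse (z - Rcal_mset (fst \<theta>) (image_mset Re (proots (char_poly (snd \<theta>)))) (cauchy_transform \<mu> z)) = cauchy_transform \<mu> z))"

lemma Rcal_mset_spectral:
  assumes "A \<in> carrier_mat p p" "spectral_decomposition p A U l"
  shows "inverse (z - Rcal_mset d (image_mset Re (proots (char_poly A))) b) = Gcal d p z l b"
proof -
  have "image_mset Re (proots (char_poly A)) = image_mset l (mset_set {..<p})"
    using spectral_proots(1)[OF assms(1), of U l] assms(2)
    unfolding spectral_decomposition_def by (simp add: multiset.map_comp o_def)
  thus ?thesis by (simp add: Gcal_def Rcal_def Rcal_mset_def multiset.map_comp o_def sum_unfold_sum_mset)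
qed

lemma compactly_supported_of_AE_bounded:
  assumes "real_distribution \<mu>" "AE t in \<mu>. \<bar>t\<bar> \<le> L"
  shows "compactly_supported_prob \<mu>"
proof -
  interpret real_distribution \<mu> by fact
  have "emeasure \<mu> {- L..L} = 1"
  proof (rule emeasure_eq_1_AE)
    show "AE t in \<mu>. t \<in> {- L..L}" using assms(2) by eventually_elim (auto simp: abs_le_iff)
  qed auto
  thus ?thesis unfolding compactly_supported_prob_def
    using prob_space_axioms events_eq_borel compact_Icc by blast
qed

lemma mu_CW:
  assumes p: "1 \<le> p" and d: "1 \<le> d" and A: "A \<in> carrier_mat p p" "mat_adjoint A = A"
  shows "real_distribution (mu_CW (d, A))" "compactly_supported_prob (mu_CW (d, A))"
    and "\<And>U l z. spectral_decomposition p A U l \<Longrightarrow> 0 < Im z \<Longrightarrow>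
      Gcal d p z l (cauchy_transform (mu_CW (d, A)) z) = cauchy_transform (mu_CW (d, A)) z"
proof -
  obtain U l where U: "spectral_decomposition p A U l" using spectral_decomposition_exists[OF A] by blast
  obtain \<mu> where \<mu>: "real_distribution \<mu>" "\<And>z. 0 < Im z \<Longrightarrow> Gcal d p z l (cauchy_transform \<mu> z) = cauchy_transform \<mu> z"
    using limit_measure_exists[OF p d, of l] by blast
  define V where "V = 1 + (\<Sum>i<p. \<bar>l i\<bar>)"
  have V: "0 < V" unfolding V_def by (intro add_pos_nonneg sum_nonneg) auto
  have lV: "\<bar>l i\<bar> \<le> V" if "i < p" for i
    using member_le_sum[of i "{..<p}" "\<lambda>i. \<bar>l i\<bar>"] that by (simp add: V_def)
  have "compactly_supported_prob \<mu>"
    by (rule compactly_supported_of_AE_bounded[OF \<mu>(1) real_distribution.AE_bounded_of_fixpoint[OF \<mu> lV V order_refl]])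
  hence "\<exists>\<mu>. real_distribution \<mu> \<and> compactly_supported_prob \<mu> \<and> (\<forall>z. 0 < Im z \<longrightarrow>
     inverse (z - Rcal_mset (fst (d, A)) (image_mset Re (proots (char_poly (snd (d, A))))) (cauchy_transform \<mu> z)) = cauchy_transform \<mu> z)"
    unfolding fst_conv snd_conv Rcal_mset_spectral[OF A(1) U] using \<mu> by blast
  from someI_ex[OF this]
  have *: "real_distribution (mu_CW (d, A)) \<and> compactly_supported_prob (mu_CW (d, A)) \<and> (\<forall>z. 0 < Im z \<longrightarrow>
     inverse (z - Rcal_mset d (image_mset Re (proots (char_poly A))) (cauchy_transform (mu_CW (d, A)) z)) = cauchy_transform (mu_CW (d, A)) z)"
    unfolding mu_CW_def fst_conv snd_conv .
  thus "real_distribution (mu_CW (d, A))" "compactly_supported_prob (mu_CW (d, A))" by blast+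
  show "Gcal d p z l (cauchy_transform (mu_CW (d, A)) z) = cauchy_transform (mu_CW (d, A)) z"
    if "spectral_decomposition p A U l" "0 < Im z" for U l z
    using * that(2) unfolding Rcal_mset_spectral[OF A(1) that(1)] by blast
qed

text \<open>Similar matrices have the same characteristic polynomial, so both sides choose from
  literally the same predicate. Equality of measures follows without any uniqueness theorem for
  Cauchy transforms.\<close>

lemma mu_CW_unitary_conj:
  assumes A: "A \<in> carrier_mat p p" and U: "unitary_mat p U"
  shows "mu_CW (d, A) = mu_CW (d, mat_adjoint U * A * U)"
proof -
  have c: "U \<in> carrier_mat p p" "mat_adjoint U \<in> carrier_mat p p" and u: "mat_adjoint U * U = 1\<^sub>m p"
    using U mat_adjoint_carrier[of U p p] by (auto simp: unitary_mat_def)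
  have u': "U * mat_adjoint U = 1\<^sub>m p" by (rule mat_mult_left_right_inverse[OF c(2,1) u])
  have "similar_mat (mat_adjoint U * A * U) A"
    unfolding similar_mat_def similar_mat_wit_def Let_def
    by (rule exI[of _ "mat_adjoint U"], rule exI[of _ U]) (use A c u u' in auto)
  from char_poly_similar[OF this] show ?thesis unfolding mu_CW_def by simp
qed

text \<open>The radius depends on \<open>C\<close> and \<open>Mb\<close> only. It is common to all
  sizes with \<open>p / d \<le> C\<close> and to all parameters, which makes the bound on the loss
  functions uniform.\<close>

lemma mu_CW_AE_bounded:
  assumes p: "1 \<le> p" and d: "1 \<le> d" and \<theta>: "\<theta> \<in> Theta_CW_bdd p d Mb" and Mb: "0 < Mb" and C: "real p / real d \<le> C"
  shows "real_distribution (mu_CW \<theta>)" "AE t in mu_CW \<theta>. \<bar>t\<bar> \<le> (4 + 6 * C) * Mb"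
proof -
  obtain A where A: "\<theta> = (d, A)" "A \<in> carrier_mat p p" "mat_adjoint A = A" "op_norm A \<le> Mb"
    using \<theta> by (auto simp: Theta_CW_bdd_def Theta_CW_def)
  obtain U l where U: "spectral_decomposition p A U l" using spectral_decomposition_exists[OF A(2,3)] by blast
  show r: "real_distribution (mu_CW \<theta>)" unfolding A(1) by (rule mu_CW(1)[OF p d A(2,3)])
  have "\<bar>l i\<bar> \<le> Mb" if "i < p" for i using abs_eigenvalue_le_op_norm[OF A(2) U that] A(4) by linarith
  thus "AE t in mu_CW \<theta>. \<bar>t\<bar> \<le> (4 + 6 * C) * Mb"
    using mu_CW(3)[OF p d A(2,3) U] unfolding A(1)[symmetric]
    by (intro real_distribution.AE_bounded_of_fixpoint[OF r _ _ Mb C, where v=l]) auto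
qed

lemma first_moment_of_AE_bounded:
  assumes "real_distribution \<mu>" "AE t in \<mu>. \<bar>t\<bar> \<le> L"
  shows "integrable \<mu> (\<lambda>t. \<bar>t\<bar>)" "(\<integral>t. \<bar>t\<bar> \<partial>\<mu>) \<le> L"
proof -
  interpret real_distribution \<mu> by fact
  show i: "integrable \<mu> (\<lambda>t. \<bar>t\<bar>)" by (rule integrable_const_bound[where B=L]) (use assms(2) in auto)
  show "(\<integral>t. \<bar>t\<bar> \<partial>\<mu>) \<le> L" by (rule integral_le_const[OF i assms(2)])
qed

subsection \<open>Uniform convergence of the cross entropies\<close>

lemma cross_entropy_uniform_tendsto:
  fixes \<phi> :: "nat \<Rightarrow> nat \<times> complex mat"
  assumes Pr: "prob_space Pr" and Mb: "0 < Mb" and \<gamma>: "0 < \<gamma>" and pd: "\<And>d. 1 \<le> d \<Longrightarrow> d \<le> pd d"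
    and C: "\<And>d. 1 \<le> d \<Longrightarrow> real (pd d) / real d \<le> C" and \<phi>: "\<And>d. 1 \<le> d \<Longrightarrow> \<phi> d \<in> Theta_CW_bdd (pd d) d Mb"
    and Z: "\<And>d. 1 \<le> d \<Longrightarrow> ginibre Pr K (pd d) d (Z d)"
  shows "AE \<omega> in Pr. (\<lambda>d. SUP \<theta>\<in>Theta_CW_bdd (pd d) d Mb.
      ereal \<bar>cauchy_cross_entropy \<gamma> (spectral_distribution (W_CW (Z d \<omega>) (snd (\<phi> d)))) (mu_CW \<theta>)
         - cauchy_cross_entropy \<gamma> (mu_CW (\<phi> d)) (mu_CW \<theta>)\<bar>) \<longlonglongrightarrow> 0"
proof -
  \<comment> \<open>The index is shifted by one because nothing is assumed at size 0; the shift is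
    undone by \<open>filterlim_sequentially_Suc\<close> at the end.\<close>
  define A where "A n = snd (\<phi> (Suc n))" for n
  have A: "A n \<in> carrier_mat (pd (Suc n)) (pd (Suc n))" "mat_adjoint (A n) = A n" "op_norm (A n) \<le> Mb"
    and \<phi>A: "\<phi> (Suc n) = (Suc n, A n)" for n
    using \<phi>[of "Suc n"] by (auto simp: Theta_CW_bdd_def Theta_CW_def A_def)
  have "\<forall>n. \<exists>U l. spectral_decomposition (pd (Suc n)) (A n) U l" using spectral_decomposition_exists[OF A(1,2)] by blast
  then obtain U v where U: "\<And>n. spectral_decomposition (pd (Suc n)) (A n) (U n) (v n)" by metis
  have vM: "\<bar>v n i\<bar> \<le> Mb" if "i < pd (Suc n)" for n i
    using abs_eigenvalue_le_op_norm[OF A(1) U that] A(3)[of n] by linarith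
  have pd1: "1 \<le> pd (Suc n)" for n using pd[of "Suc n"] by simp
  have C0: "0 \<le> C" using order_trans[OF _ C[of 1], of 0] by simp
  have CS: "real (pd (Suc n)) / real (Suc n) \<le> C" for n using C[of "Suc n"] by simp
  have CS': "real (pd (Suc n)) \<le> C * real (Suc n)" for n using CS[of n] by (simp add: divide_le_eq)
  have est: "matrix_estimates Pr (pd (Suc n)) (Suc n) (v n) Mb C (\<lambda>\<omega>. W_CW (Z (Suc n) \<omega>) (A n))" for n
    by (rule matrix_estimates_ginibre[OF Pr Z pd1 _ Mb vM CS' A(1,2)]) (use U in \<open>auto simp: spectral_decomposition_def\<close>)
  define \<mu> where "\<mu> n = mu_CW (\<phi> (Suc n))" for n
  define L where "L = (4 + 6 * C) * Mb"
  have L0: "0 \<le> L" using C0 Mb by (simp add: L_def)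
  have \<mu>: "real_distribution (\<mu> n)" "AE t in \<mu> n. \<bar>t\<bar> \<le> L" for n
    unfolding \<mu>_def L_def using mu_CW_AE_bounded[OF pd1 _ \<phi> Mb CS, of n] by auto
  note mom = first_moment_of_AE_bounded[OF \<mu>]
  have fp: "0 < Im z \<Longrightarrow> Gcal (Suc n) (pd (Suc n)) z (v n) (cauchy_transform (\<mu> n) z) = cauchy_transform (\<mu> n) z" for n z
    unfolding \<mu>_def \<phi>A by (rule mu_CW(3)[OF pd1 _ A(1,2) U]) auto
  \<comment> \<open>\<open>C1\<close> depends on \<open>\<gamma>\<close> and the common radius
    \<open>L\<close> only, so one constant serves every \<open>\<theta>\<close> and every
    size.\<close>
  obtain C1 where C1: "\<And>\<mu> x. real_distribution \<mu> \<Longrightarrow> (AE t in \<mu>. \<bar>t\<bar> \<le> L) \<Longrightarrow> \<bar>cauchy_loss \<gamma> x \<mu>\<bar> \<le> C1 * sqrt (sqrt (1 + \<bar>x\<bar>))"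
    using cauchy_loss_bound[OF \<gamma> L0] by blast
  have "AE \<omega> in Pr. (\<forall>z. 0 < Im z \<longrightarrow> (\<lambda>n. cauchy_transform (esd (W_CW (Z (Suc n) \<omega>) (A n))) z - cauchy_transform (\<mu> n) z) \<longlonglongrightarrow> 0) \<and>
     (\<exists>m. \<forall>n. integrable (esd (W_CW (Z (Suc n) \<omega>) (A n))) (\<lambda>t. \<bar>t\<bar>) \<and> (\<integral>t. \<bar>t\<bar> \<partial>esd (W_CW (Z (Suc n) \<omega>) (A n))) \<le> m)"
    by (rule matrix_estimates_AE[OF Pr est Mb vM CS \<mu>(1) fp])
  thus ?thesis
  proof eventually_elim
    fix \<omega> assume "(\<forall>z. 0 < Im z \<longrightarrow> (\<lambda>n. cauchy_transform (esd (W_CW (Z (Suc n) \<omega>) (A n))) z - cauchy_transform (\<mu> n) z) \<longlonglongrightarrow> 0) \<and>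
     (\<exists>m. \<forall>n. integrable (esd (W_CW (Z (Suc n) \<omega>) (A n))) (\<lambda>t. \<bar>t\<bar>) \<and> (\<integral>t. \<bar>t\<bar> \<partial>esd (W_CW (Z (Suc n) \<omega>) (A n))) \<le> m)"
    then obtain m where lim: "\<And>z. 0 < Im z \<Longrightarrow> (\<lambda>n. cauchy_transform (esd (W_CW (Z (Suc n) \<omega>) (A n))) z - cauchy_transform (\<mu> n) z) \<longlonglongrightarrow> 0"
      and m: "\<And>n. integrable (esd (W_CW (Z (Suc n) \<omega>) (A n))) (\<lambda>t. \<bar>t\<bar>)" "\<And>n. (\<integral>t. \<bar>t\<bar> \<partial>esd (W_CW (Z (Suc n) \<omega>) (A n))) \<le> m" by blast
    define D where "D n = (\<integral>x. sqrt (sqrt (1 + \<bar>x\<bar>)) * \<bar>poisson_conv \<gamma> (esd (W_CW (Z (Suc n) \<omega>) (A n))) x - poisson_conv \<gamma> (\<mu> n) x\<bar> \<partial>lborel)" for n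
    have "D \<longlonglongrightarrow> 0" unfolding D_def
      by (rule weighted_poisson_difference_tendsto[OF \<gamma> esd_real_distribution m(1) _ \<mu>(1) mom(1) _ lim, where m="max m L"])
         (auto intro: le_max_iff_disj[THEN iffD2] m(2) mom(2))
    hence "(\<lambda>n. C1 * D n) \<longlonglongrightarrow> C1 * 0" by (intro tendsto_intros)
    hence lim0: "(\<lambda>n. ereal (C1 * D n)) \<longlonglongrightarrow> 0" by (simp add: zero_ereal_def)
    define S where "S d = (SUP \<theta>\<in>Theta_CW_bdd (pd d) d Mb.
      ereal \<bar>cauchy_cross_entropy \<gamma> (spectral_distribution (W_CW (Z d \<omega>) (snd (\<phi> d)))) (mu_CW \<theta>)
         - cauchy_cross_entropy \<gamma> (mu_CW (\<phi> d)) (mu_CW \<theta>)\<bar>)" for d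
    have "S (Suc n) \<le> ereal (C1 * D n)" for n unfolding S_def
    proof (rule SUP_least)
      fix \<theta> assume "\<theta> \<in> Theta_CW_bdd (pd (Suc n)) (Suc n) Mb"
      note \<theta> = mu_CW_AE_bounded[OF pd1 _ this Mb CS, folded L_def]
      have "\<bar>cauchy_cross_entropy \<gamma> (esd (W_CW (Z (Suc n) \<omega>) (A n))) (mu_CW \<theta>) - cauchy_cross_entropy \<gamma> (\<mu> n) (mu_CW \<theta>)\<bar> \<le> C1 * D n"
        unfolding D_def by (rule cross_entropy_difference_bound[OF \<gamma> esd_real_distribution m(1) \<mu>(1) mom(1)]) (use \<theta> C1 in auto)
      thus "ereal \<bar>cauchy_cross_entropy \<gamma> (spectral_distribution (W_CW (Z (Suc n) \<omega>) (snd (\<phi> (Suc n))))) (mu_CW \<theta>)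
         - cauchy_cross_entropy \<gamma> (mu_CW (\<phi> (Suc n))) (mu_CW \<theta>)\<bar> \<le> ereal (C1 * D n)"
        by (simp add: cross_entropy_esd \<mu>_def A_def)
    qed
    \<comment> \<open>The parameter set contains \<open>\<phi> (Suc n)\<close>; over an empty set
      the supremum in \<open>ereal\<close> would be minus infinity.\<close>
    moreover have "0 \<le> S (Suc n)" for n unfolding S_def by (rule SUP_upper2[OF \<phi>]) auto
    ultimately have "(\<lambda>n. S (Suc n)) \<longlonglongrightarrow> 0"
      by (intro tendsto_sandwich[OF _ _ tendsto_const lim0]) auto
    hence "S \<longlonglongrightarrow> 0" by (simp only: filterlim_sequentially_Suc)
    thus "(\<lambda>d. SUP \<theta>\<in>Theta_CW_bdd (pd d) d Mb.
      ereal \<bar>cauchy_cross_entropy \<gamma> (spectral_distribution (W_CW (Z d \<omega>) (snd (\<phi> d)))) (mu_CW \<theta>)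
         - cauchy_cross_entropy \<gamma> (mu_CW (\<phi> d)) (mu_CW \<theta>)\<bar>) \<longlonglongrightarrow> 0" unfolding S_def[abs_def] .
  qed
qed

lemma mu_CW_smooth:
  assumes p: "1 \<le> p" and d: "1 \<le> d" and z: "0 < Im z"
  shows "smooth_coords N (\<lambda>x. cauchy_transform (mu_CW (d, herm_of p x)) z)"
proof -
  note m = mu_CW[OF p d herm_of_carrier herm_of_adjoint]
  interpret implicit_family p d z "\<lambda>x. cauchy_transform (mu_CW (d, herm_of p x)) z"
    using d z real_distribution.Im_cauchy_neg[OF m(1) z] m(3)[OF _ z]
    by unfold_locales (auto simp: spectral_decomposition_def)
  show ?thesis by (rule smooth)
qed

lemma mu_CW_diag_real:
  fixes v :: "nat \<Rightarrow> real"
  assumes "1 \<le> p" "1 \<le> d" "0 < Im z"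
  defines "g \<equiv> cauchy_transform (mu_CW (d, diag_real p v)) z"
  shows "Im g < 0" "Gcal d p z v g = g"
  unfolding g_def
  using mu_CW(3)[OF assms(1,2) diag_real_carrier diag_real_adjoint spectral_decomposition_diag_real assms(3)]
    real_distribution.Im_cauchy_neg[OF mu_CW(1)[OF assms(1,2) diag_real_carrier diag_real_adjoint] assms(3)] by blast+

text \<open>One family of measures serves both fields and every probability space, as
  \<open>mu_CW\<close> refers to neither. That its Cauchy transform is a fixed point in the lower
  half plane is the common source of the convergence of the iterates, the smoothness and the
  invertibility.\<close>

theorem mainTheorem1:
  fixes K :: scalar_field
  shows "\<exists>\<mu> :: nat \<times> complex mat \<Rightarrow> real measure.
    (\<forall>p d \<theta>. 1 \<le> p \<and> 1 \<le> d \<and> \<theta> \<in> Theta_CW p d \<longrightarrow> compactly_supported_prob (\<mu> \<theta>)) \<and>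
    (\<forall>(Pr :: 'a measure) Mb \<gamma> (pd :: nat \<Rightarrow> nat) (\<phi> :: nat \<Rightarrow> nat \<times> complex mat)
        (Z :: nat \<Rightarrow> 'a \<Rightarrow> complex mat).
       prob_space Pr \<and> 0 < Mb \<and> 0 < \<gamma> \<and>
       (\<forall>d\<ge>1. d \<le> pd d) \<and> (\<exists>C. \<forall>d\<ge>1. real (pd d) / real d \<le> C) \<and>
       (\<forall>d\<ge>1. \<phi> d \<in> Theta_CW_bdd (pd d) d Mb) \<and>
       (\<forall>d\<ge>1. ginibre Pr K (pd d) d (Z d))
       \<longrightarrow> (AE \<omega> in Pr.
             (\<lambda>d. SUP \<theta>\<in>Theta_CW_bdd (pd d) d Mb.
                ereal \<bar>cauchy_cross_entropy \<gamma> (spectral_distribution (W_CW (Z d \<omega>) (snd (\<phi> d)))) (\<mu> \<theta>)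
                       - cauchy_cross_entropy \<gamma> (\<mu> (\<phi> d)) (\<mu> \<theta>)\<bar>)
             \<longlonglongrightarrow> 0)) \<and>
    (\<forall>p d z v b0. 1 \<le> p \<and> 1 \<le> d \<and> 0 < Im z \<and> (\<forall>k<p. \<bar>v k\<bar> < Im z) \<and> Im b0 < 0
       \<longrightarrow> (\<lambda>n. (Gcal d p z v ^^ n) b0) \<longlonglongrightarrow> cauchy_transform (\<mu> (d, diag_real p v)) z) \<and>
    (\<forall>p d A U. 1 \<le> p \<and> 1 \<le> d \<and> (d, A) \<in> Theta_CW p d \<and> unitary_mat p U
       \<longrightarrow> \<mu> (d, A) = \<mu> (d, mat_adjoint U * A * U)) \<and>
    (\<forall>p d z. 1 \<le> p \<and> 1 \<le> d \<and> 0 < Im z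
       \<longrightarrow> smooth_coords (p * p) (\<lambda>x. cauchy_transform (\<mu> (d, herm_of p x)) z)) \<and>
    (\<forall>p d z v. 1 \<le> p \<and> 1 \<le> d \<and> 0 < Im z
       \<longrightarrow> (\<exists>D. (Gcal d p z v has_derivative D) (at (cauchy_transform (\<mu> (d, diag_real p v)) z))
               \<and> bij (\<lambda>h. h - D h)))"
proof (rule exI[of _ mu_CW], intro conjI allI impI; (elim conjE exE)?)
  fix p d :: nat and \<theta> assume "1 \<le> p" "1 \<le> d" "\<theta> \<in> Theta_CW p d"
  thus "compactly_supported_prob (mu_CW \<theta>)" using mu_CW(2) by (auto simp: Theta_CW_def)
next
  fix Pr :: "'a measure" and Mb \<gamma> C :: real and pd \<phi> Z
  assume "prob_space Pr" "0 < Mb" "0 < \<gamma>" "\<forall>d\<ge>1. d \<le> pd d" "\<forall>d\<ge>1. real (pd d) / real d \<le> C"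
    "\<forall>d\<ge>1. \<phi> d \<in> Theta_CW_bdd (pd d) d Mb" "\<forall>d\<ge>1. ginibre Pr K (pd d) d (Z d)"
  thus "AE \<omega> in Pr.
             (\<lambda>d. SUP \<theta>\<in>Theta_CW_bdd (pd d) d Mb.
                ereal \<bar>cauchy_cross_entropy \<gamma> (spectral_distribution (W_CW (Z d \<omega>) (snd (\<phi> d)))) (mu_CW \<theta>)
                       - cauchy_cross_entropy \<gamma> (mu_CW (\<phi> d)) (mu_CW \<theta>)\<bar>)
             \<longlonglongrightarrow> 0"
    by (intro cross_entropy_uniform_tendsto[where C=C and K=K]) auto
next
  fix p d :: nat and z b0 :: complex and v :: "nat \<Rightarrow> real" assume "1 \<le> p" "1 \<le> d" "0 < Im z" "\<forall>k<p. \<bar>v k\<bar> < Im z" "Im b0 < 0"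
  thus "(\<lambda>n. (Gcal d p z v ^^ n) b0) \<longlonglongrightarrow> cauchy_transform (mu_CW (d, diag_real p v)) z"
    by (intro Gcal_iterates_tendsto mu_CW_diag_real) auto
next
  fix p d :: nat and A U :: "complex mat" assume "1 \<le> p" "1 \<le> d" "(d, A) \<in> Theta_CW p d" "unitary_mat p U"
  thus "mu_CW (d, A) = mu_CW (d, mat_adjoint U * A * U)" by (intro mu_CW_unitary_conj) (auto simp: Theta_CW_def)
next
  fix p d :: nat and z :: complex assume "1 \<le> p" "1 \<le> d" "0 < Im z"
  thus "smooth_coords (p * p) (\<lambda>x. cauchy_transform (mu_CW (d, herm_of p x)) z)" by (rule mu_CW_smooth)
next
  fix p d :: nat and z :: complex and v :: "nat \<Rightarrow> real" assume "1 \<le> p" "1 \<le> d" "0 < Im z"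
  thus "\<exists>D. (Gcal d p z v has_derivative D) (at (cauchy_transform (mu_CW (d, diag_real p v)) z)) \<and> bij (\<lambda>h. h - D h)"
    by (intro bij_id_minus_Gcal_deriv mu_CW_diag_real)
qed

end
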